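(* Let $p$ be a prime, $n=2$, and let $\tilde R$, $s$, $\theta$, $\tilde P_2(X)$, $A$, $B$, $\langle p\rangle$, $\langle p^2\rangle$ be as in the context. Put $q_0=1$, $q_1=-T(A)$, $q_2=pT(B)+p(p^2+1)\langle p\rangle$, $q_3=-p^3\langle p\rangle T(A)$, $q_4=p^6\langle p^2\rangle$ (elements of $R$) and $g(X)=1-p^2\langle p\rangle X^2\in R[X]$. Then, with $Y=p^2X$, \[ g^s(Y)=\tilde P_2^{\theta^4}(X)+q_1^sY\,\tilde P_2^{\theta^3}(X)+q_2^sY^2\,\tilde P_2^{\theta^2}(X)+q_3^sY^3\,\tilde P_2^{\theta}(X)+q_4^sY^4\,\tilde P_2(X) \] in $\tilde R[[X]]$ (where $Y$ commutes with everything).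
   Context: Fix a prime $p$ and $n\ge1$ (here $n=2$). Let $J=\begin{pmatrix}0&E_n\\-E_n&0\end{pmatrix}$, $G=GSp_{2n}(\mathbb Q_p)=\{g\in GL_{2n}(\mathbb Q_p): {}^tgJg=\mu(g)J\}$ with multiplier $\mu(g)\in\mathbb Q_p^\times$, $\Delta=G\cap M_{2n}(\mathbb Z_p)$, $\Gamma=G\cap GL_{2n}(\mathbb Z_p)$. For a group $H$, a submonoid $D$ and a subgroup $K\subset D$ such that every double coset $KxK$ ($x\in D$) is a finite union of left and of right $K$-cosets, the Hecke ring $R(K,D)$ is the free abelian group on $K\backslash D/K$ with product $(KaK)(KbK)=\sum_{KcK} m_c\,(KcK)$, $m_c=\#\{K\beta\in K\backslash KbK: c\beta^{-1}\in KaK\}$. Let $R=R(\Gamma,\Delta)$, $T(A)=\Gamma A\Gamma$. Let $\mathcal M=\mathbb Z_p^{2n}$ (column vectors); let $\tilde\Delta=\Delta\times\mathcal M$ with product $(A,\mathbf a)(B,\mathbf b)=(AB,A\mathbf b+\mu(B)\mathbf a)$ and $\tilde\Gamma=\Gamma\times\mathcal M$ (a subgroup); $\tilde R=R(\tilde\Gamma,\tilde\Delta)$ (this pair is double finite; $\tilde R$ is the local Hecke ring of the Heisenberg Lie algebra of dimension $2n+1$ over $\mathbb Z_p$), $\tilde T(A,\mathbf a)=\tilde\Gamma(A,\mathbf a)\tilde\Gamma$. $T(p^k)$ is the sum of all $\Gamma C\Gamma$ with $v_p(\mu(C))=k$, $\tilde T(p^k)$ the sum of all $\tilde\Gamma(C,\mathbf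 c)\tilde\Gamma$ with $v_p(\mu(C))=k$; $\tilde P_n(X)=\sum_{k\ge0}\tilde T(p^k)X^k\in\tilde R[[X]]$. $s:R\to\tilde R$ is the (injective ring) homomorphism $T(C)\mapsto\tilde T(C,\mathbf 0)$; $\xi^s=s(\xi)$, and $g^s$ means applying $s$ to the coefficients. For $C\in\Delta$ let $\Gamma^C=\Gamma\cap C\Gamma C^{-1}$, acting on $\mathcal M/C\mathcal M$ by $X*(\mathbf a+C\mathcal M)=\mu(X)^{-1}X\mathbf a+C\mathcal M$. $\theta:\tilde R\to\tilde R$ is the $\mathbb Z$-linear ring endomorphism with $\tilde T(C,\mathbf a)^\theta=\frac{|\Gamma^C*(\mathbf a\bmod C\mathcal M)|}{|\Gamma^C*(p\mathbf a\bmod C\mathcal M)|}\tilde T(C,p\mathbf a)$; equivalently $\xi\,\tilde T(pE,\mathbf 0)=\tilde T(pE,\mathbf 0)\,\xi^\theta$ for all $\xi\in\tilde R$. For a power series, $\tilde P^{\theta^j}(X)$ means applying $\theta^j$ to each coefficient. $\langle p\rangle=T(pE)$, $\langle p^2\rangle=T(p^2E)$, $A=\mathrm{diag}(1,1,p,p)$, $B=\mathrm{diag}(1,p,p^2,p)$. *)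

theory Defs
  imports
    "HOL-Analysis.Analysis"
    "HOL-Algebra.Coset"
    "HOL-Algebra.UnivPoly"
    "HOL-Library.Poly_Mapping"
    "HOL-Computational_Algebra.Polynomial_Factorial"
    "Berlekamp_Zassenhaus.Finite_Field"
begin

text \<open>
  The prime \<open>p\<close> is the cardinality of a type \<open>'p\<close> of class \<open>prime_card\<close>. The ring \<open>\<int>\<^sub>p\<close> is the
  inverse limit of the rings \<open>\<int>/p\<^sup>k\<int>\<close>; the residue of level \<open>k\<close> is represented by an integer, and
  the compatibility condition puts this integer into \<open>{0..<p\<^sup>k}\<close>.
\<close>

typedef (overloaded) 'p padic_int =
  "{x :: nat \<Rightarrow> int. \<forall>k. x (Suc k) mod int CARD('p::prime_card) ^ k = x k}"
  by (rule exI[of _ "\<lambda>_. 0"]) simp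

setup_lifting type_definition_padic_int

lemma mod_power_Suc: "(x mod (b::int) ^ Suc k) mod b ^ k = x mod b ^ k"
  by (rule mod_mod_cancel) simp

instantiation padic_int :: (prime_card) comm_ring_1
begin

lift_definition zero_padic_int :: "'a padic_int" is "\<lambda>_. 0"
  by simp

lift_definition one_padic_int :: "'a padic_int" is "\<lambda>k. 1 mod int CARD('a) ^ k"
  by (simp only: mod_power_Suc simp_thms)

lift_definition plus_padic_int :: "'a padic_int \<Rightarrow> 'a padic_int \<Rightarrow> 'a padic_int"
  is "\<lambda>x y k. (x k + y k) mod int CARD('a) ^ k"
  by (metis mod_power_Suc mod_add_eq)

lift_definition minus_padic_int :: "'a padic_int \<Rightarrow> 'a padic_int \<Rightarrow> 'a padic_int"
  is "\<lambda>x y k. (x k - y k) mod int CARD('a) ^ k"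
  by (metis mod_power_Suc mod_diff_eq)

lift_definition uminus_padic_int :: "'a padic_int \<Rightarrow> 'a padic_int"
  is "\<lambda>x k. (- x k) mod int CARD('a) ^ k"
  by (metis mod_power_Suc mod_minus_eq)

lift_definition times_padic_int :: "'a padic_int \<Rightarrow> 'a padic_int \<Rightarrow> 'a padic_int"
  is "\<lambda>x y k. (x k * y k) mod int CARD('a) ^ k"
  by (metis mod_power_Suc mod_mult_eq)

lemma padic_int_residue_mod:
  assumes "\<forall>k. x (Suc k) mod int CARD('a::prime_card) ^ k = x k"
  shows "x k mod int CARD('a) ^ k = x k"
  by (metis assms mod_mod_trivial)

instance
proof
  fix a b c :: "'a padic_int"
  show "a * b * c = a * (b * c)"
    by transfer (simp add: mod_mult_left_eq mod_mult_right_eq mult.assoc fun_eq_iff)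
  show "a * b = b * a"
    by transfer (simp add: mult.commute)
  show "1 * a = a"
    by transfer (simp add: mod_mult_left_eq padic_int_residue_mod fun_eq_iff)
  show "a + b + c = a + (b + c)"
    by transfer (simp add: mod_add_left_eq mod_add_right_eq add.assoc fun_eq_iff)
  show "a + b = b + a"
    by transfer (simp add: add.commute)
  show "0 + a = a"
    by transfer (simp add: padic_int_residue_mod fun_eq_iff)
  show "- a + a = 0"
    by transfer (simp add: mod_add_left_eq fun_eq_iff)
  show "a - b = a + - b"
    by transfer (simp add: mod_add_right_eq fun_eq_iff)
  show "(a + b) * c = a * c + b * c"
    by transfer (simp add: mod_mult_left_eq mod_add_eq distrib_right fun_eq_iff)
  have "(1::int) mod int CARD('a) ^ 1 \<noteq> 0"
    using prime_card[where 'a='a] prime_gt_1_nat by fastforce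
  then show "(0::'a padic_int) \<noteq> 1"
    by transfer metis
qed

end

lemma padic_int_residue_le:
  assumes "\<forall>k. x (Suc k) mod int CARD('a::prime_card) ^ k = x k"
  shows "x (k + m) mod int CARD('a) ^ k = x k"
proof (induction m)
  case 0
  show ?case using padic_int_residue_mod[OF assms] by simp
next
  case (Suc m)
  have "x (k + Suc m) mod int CARD('a) ^ k
      = (x (Suc (k + m)) mod int CARD('a) ^ (k + m)) mod int CARD('a) ^ k"
    by (simp add: mod_mod_cancel le_imp_power_dvd)
  also have "\<dots> = x k"
    using assms Suc by simp
  finally show ?case .
qed

instance padic_int :: (prime_card) idom
proof
  fix a b :: "'a padic_int"
  assume "a \<noteq> 0" "b \<noteq> 0"
  then show "a * b \<noteq> 0"
  proof transfer
    fix x y :: "nat \<Rightarrow> int"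
    let ?p = "int CARD('a)"
    assume x: "\<forall>k. x (Suc k) mod ?p ^ k = x k" and y: "\<forall>k. y (Suc k) mod ?p ^ k = y k"
      and "x \<noteq> (\<lambda>_. 0)" "y \<noteq> (\<lambda>_. 0)"
    then obtain k l where kl: "x k \<noteq> 0" "y l \<noteq> 0"
      unfolding fun_eq_iff by blast
    have p: "prime ?p" by (rule prime_card_int)
    have nx: "\<not> ?p ^ k dvd x (k + l)"
      using padic_int_residue_le[OF x, of k l] kl by (auto simp: dvd_eq_mod_eq_0)
    have ny: "\<not> ?p ^ l dvd y (k + l)"
      using padic_int_residue_le[OF y, of l k] kl by (auto simp: dvd_eq_mod_eq_0 add.commute)
    have "\<not> ?p ^ (k + l) dvd x (k + l) * y (k + l)"
    proof
      assume d: "?p ^ (k + l) dvd x (k + l) * y (k + l)"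
      have nz: "x (k + l) \<noteq> 0" "y (k + l) \<noteq> 0" using nx ny by auto
      have "multiplicity ?p (x (k + l)) < k" "multiplicity ?p (y (k + l)) < l"
        using nx ny multiplicity_dvd' not_less by blast+
      moreover have "k + l \<le> multiplicity ?p (x (k + l)) + multiplicity ?p (y (k + l))"
        using d nz p prime_elem_multiplicity_mult_distrib[of ?p "x (k + l)" "y (k + l)"]
        by (metis mult_eq_0_iff multiplicity_geI not_prime_unit prime_imp_prime_elem)
      ultimately show False by simp
    qed
    then show "(\<lambda>k. (x k * y k) mod ?p ^ k) \<noteq> (\<lambda>_. 0)"
      by (metis dvd_eq_mod_eq_0)
  qed
qed

type_synonym 'p padic = "'p padic_int fract"

definition padic_integers :: "'p::prime_card padic set" where
  "padic_integers = range to_fract"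

definition padic_val :: "'p::prime_card padic \<Rightarrow> int" where
  "padic_val x = (THE k. \<exists>u :: 'p padic_int. u dvd 1 \<and> x = to_fract u * of_nat CARD('p) powi k)"

text \<open>
  The Hecke ring \<open>R(K, D)\<close> inside a group \<open>G\<close>. The definitions presuppose that \<open>K\<close> is a subgroup
  contained in the submonoid \<open>D\<close> of \<open>G\<close>, and that every double coset \<open>K x K\<close> with \<open>x \<in> D\<close> is a
  finite union of left and of right cosets of \<open>K\<close>. The structure constant
  \<open>hecke_coeff\<close> depends on \<open>c\<close> only through the double coset of \<open>c\<close>, hence the choice of a
  representative in \<open>hecke_prod\<close>. Free abelian groups are those of \<^theory>\<open>HOL-Library.Poly_Mapping\<close>.
\<close>

definition double_coset :: "('g, 'm) monoid_scheme \<Rightarrow> 'g set \<Rightarrow> 'g \<Rightarrow> 'g set" where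
  "double_coset G K x = (K #>\<^bsub>G\<^esub> x) <#>\<^bsub>G\<^esub> K"

definition double_cosets :: "('g, 'm) monoid_scheme \<Rightarrow> 'g set \<Rightarrow> 'g set \<Rightarrow> 'g set set" where
  "double_cosets G K D = double_coset G K ` D"

definition hecke_coeff ::
    "('g, 'm) monoid_scheme \<Rightarrow> 'g set \<Rightarrow> 'g set \<Rightarrow> 'g set \<Rightarrow> 'g \<Rightarrow> nat" where
  "hecke_coeff G K U V c = card {K #>\<^bsub>G\<^esub> b | b. b \<in> V \<and> c \<otimes>\<^bsub>G\<^esub> inv\<^bsub>G\<^esub> b \<in> U}"

definition hecke_prod ::
    "('g, 'm) monoid_scheme \<Rightarrow> 'g set \<Rightarrow> 'g set \<Rightarrow> 'g set \<Rightarrow> 'g set \<Rightarrow> ('g set \<Rightarrow>\<^sub>0 int)" where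
  "hecke_prod G K D U V =
     (let m = (\<lambda>W. hecke_coeff G K U V (SOME c. c \<in> W))
      in \<Sum>W \<in> {W \<in> double_cosets G K D. m W \<noteq> 0}. frag_cmul (int (m W)) (frag_of W))"

definition hecke_ring ::
    "('g, 'm) monoid_scheme \<Rightarrow> 'g set \<Rightarrow> 'g set \<Rightarrow> ('g set \<Rightarrow>\<^sub>0 int) ring" where
  "hecke_ring G K D = \<lparr>
     carrier = {\<xi>. Poly_Mapping.keys \<xi> \<subseteq> double_cosets G K D},
     mult = (\<lambda>\<xi> \<eta>. frag_extend (\<lambda>U. frag_extend (hecke_prod G K D U) \<eta>) \<xi>),
     one = frag_of (double_coset G K \<one>\<^bsub>G\<^esub>),
     zero = 0,
     add = (+)\<rparr>"

text \<open>
  Formal power series are coefficient sequences. The class-based type \<open>fps\<close> does not apply to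
  coefficients in a ring given by a carrier.
\<close>

definition ps_ring :: "('a, 'm) ring_scheme \<Rightarrow> (nat \<Rightarrow> 'a) ring" where
  "ps_ring R = \<lparr>
     carrier = UNIV \<rightarrow> carrier R,
     mult = (\<lambda>f g n. \<Oplus>\<^bsub>R\<^esub>i \<in> {..n}. f i \<otimes>\<^bsub>R\<^esub> g (n - i)),
     one = (\<lambda>n. if n = 0 then \<one>\<^bsub>R\<^esub> else \<zero>\<^bsub>R\<^esub>),
     zero = (\<lambda>_. \<zero>\<^bsub>R\<^esub>),
     add = (\<lambda>f g n. f n \<oplus>\<^bsub>R\<^esub> g n)\<rparr>"

definition ps_const :: "('a, 'm) ring_scheme \<Rightarrow> 'a \<Rightarrow> nat \<Rightarrow> 'a" where
  "ps_const R a = (\<lambda>n. if n = 0 then a else \<zero>\<^bsub>R\<^esub>)"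

definition ps_X :: "('a, 'm) ring_scheme \<Rightarrow> nat \<Rightarrow> 'a" where
  "ps_X R = (\<lambda>n. if n = 1 then \<one>\<^bsub>R\<^esub> else \<zero>\<^bsub>R\<^esub>)"

text \<open>The index set \<open>{1..2n}\<close> is rendered as \<open>'n + 'n\<close> with \<open>n = CARD('n)\<close>.\<close>

type_synonym ('p, 'n) sp_vec = "'p padic ^ ('n + 'n)"
type_synonym ('p, 'n) sp_mat = "'p padic ^ ('n + 'n) ^ ('n + 'n)"

definition sp_J :: "('p::prime_card, 'n::finite) sp_mat" where
  "sp_J = (\<chi> i j. case (i, j) of
     (Inl a, Inr b) \<Rightarrow> if a = b then 1 else 0
   | (Inr a, Inl b) \<Rightarrow> if a = b then -1 else 0
   | _ \<Rightarrow> 0)"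

definition block_diag :: "'p::prime_card padic ^ 'n \<Rightarrow> 'p padic ^ 'n \<Rightarrow> ('p, 'n::finite) sp_mat" where
  "block_diag d e = (\<chi> i j. if i = j then (case i of Inl a \<Rightarrow> d $ a | Inr a \<Rightarrow> e $ a) else 0)"

definition GSp :: "('p::prime_card, 'n::finite) sp_mat monoid" where
  "GSp = \<lparr>
     carrier = {g. invertible g \<and> (\<exists>\<mu>. \<mu> \<noteq> 0 \<and> transpose g ** sp_J ** g = mat \<mu> ** sp_J)},
     mult = (**),
     one = mat 1\<rparr>"

definition multiplier :: "('p::prime_card, 'n::finite) sp_mat \<Rightarrow> 'p padic" where
  "multiplier g = (THE \<mu>. transpose g ** sp_J ** g = mat \<mu> ** sp_J)"

definition integral_mats :: "('p::prime_card, 'n::finite) sp_mat set" where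
  "integral_mats = {g. \<forall>i j. g $ i $ j \<in> padic_integers}"

definition integral_vecs :: "('p::prime_card, 'n::finite) sp_vec set" where
  "integral_vecs = {a. \<forall>i. a $ i \<in> padic_integers}"

definition GSp_Delta :: "('p::prime_card, 'n::finite) sp_mat set" where
  "GSp_Delta = carrier GSp \<inter> integral_mats"

definition GSp_Gamma :: "('p::prime_card, 'n::finite) sp_mat set" where
  "GSp_Gamma = carrier GSp \<inter>
     {g \<in> integral_mats. \<exists>h \<in> integral_mats. g ** h = mat 1 \<and> h ** g = mat 1}"

definition GSp_hecke :: "(('p::prime_card, 'n::finite) sp_mat set \<Rightarrow>\<^sub>0 int) ring" where
  "GSp_hecke = hecke_ring GSp GSp_Gamma GSp_Delta"

definition GSp_T :: "('p::prime_card, 'n::finite) sp_mat \<Rightarrow> (('p, 'n) sp_mat set \<Rightarrow>\<^sub>0 int)" where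
  "GSp_T C = frag_of (double_coset GSp GSp_Gamma C)"

text \<open>
  The ambient group in which quotients are formed is \<open>GSp\<^sub>2\<^sub>n(\<rat>\<^sub>p) \<times> \<rat>\<^sub>p\<^sup>2\<^sup>n\<close>, with the product that
  extends the one given on \<open>\<Delta> \<times> \<int>\<^sub>p\<^sup>2\<^sup>n\<close>.
\<close>

type_synonym ('p, 'n) heis = "('p, 'n) sp_mat \<times> ('p, 'n) sp_vec"

definition Heis :: "('p::prime_card, 'n::finite) heis monoid" where
  "Heis = \<lparr>
     carrier = carrier GSp \<times> UNIV,
     mult = (\<lambda>(A, a) (B, b). (A ** B, A *v b + multiplier B *s a)),
     one = (mat 1, 0)\<rparr>"

definition Heis_Delta :: "('p::prime_card, 'n::finite) heis set" where
  "Heis_Delta = GSp_Delta \<times> integral_vecs"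

definition Heis_Gamma :: "('p::prime_card, 'n::finite) heis set" where
  "Heis_Gamma = GSp_Gamma \<times> integral_vecs"

definition Heis_hecke :: "(('p::prime_card, 'n::finite) heis set \<Rightarrow>\<^sub>0 int) ring" where
  "Heis_hecke = hecke_ring Heis Heis_Gamma Heis_Delta"

definition Heis_T :: "('p::prime_card, 'n::finite) heis \<Rightarrow> (('p, 'n) heis set \<Rightarrow>\<^sub>0 int)" where
  "Heis_T x = frag_of (double_coset Heis Heis_Gamma x)"

text \<open>
  The series with coefficients \<open>T(p\<^sup>k)\<close>. Only finitely many double cosets have a given multiplier
  valuation, so the sum is not degenerate.
\<close>

definition Heis_P :: "nat \<Rightarrow> (('p::prime_card, 'n::finite) heis set \<Rightarrow>\<^sub>0 int)" where
  "Heis_P k = (\<Sum>U \<in> {double_coset Heis Heis_Gamma (C, c) | C c.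
     (C, c) \<in> Heis_Delta \<and> padic_val (multiplier C) = int k}. frag_of U)"

text \<open>
  The maps \<open>s\<close> and \<open>\<theta>\<close> are the linear extensions of their values on double cosets, which do not
  depend on the representatives chosen below.
\<close>

definition hecke_s ::
    "(('p::prime_card, 'n::finite) sp_mat set \<Rightarrow>\<^sub>0 int) \<Rightarrow> (('p, 'n) heis set \<Rightarrow>\<^sub>0 int)" where
  "hecke_s = frag_extend (\<lambda>U. Heis_T (SOME C. C \<in> U, 0))"

definition Gamma_conj :: "('p::prime_card, 'n::finite) sp_mat \<Rightarrow> ('p, 'n) sp_mat set" where
  "Gamma_conj C = GSp_Gamma \<inter> ((C <#\<^bsub>GSp\<^esub> GSp_Gamma) #>\<^bsub>GSp\<^esub> inv\<^bsub>GSp\<^esub> C)"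

text \<open>The orbit of \<open>a + C\<M>\<close> in \<open>\<M>/C\<M>\<close>, the elements of the quotient being subsets of \<open>\<M>\<close>.\<close>

definition Gamma_orbit ::
    "('p::prime_card, 'n::finite) sp_mat \<Rightarrow> ('p, 'n) sp_vec \<Rightarrow> ('p, 'n) sp_vec set set" where
  "Gamma_orbit C a =
     {{inverse (multiplier X) *s (X *v a) + C *v m | m. m \<in> integral_vecs} | X. X \<in> Gamma_conj C}"

text \<open>
  The division is exact, because multiplication by \<open>p\<close> maps the orbit of \<open>a\<close> equivariantly onto
  the orbit of \<open>pa\<close>.
\<close>

definition hecke_theta ::
    "(('p::prime_card, 'n::finite) heis set \<Rightarrow>\<^sub>0 int) \<Rightarrow> (('p, 'n) heis set \<Rightarrow>\<^sub>0 int)" where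
  "hecke_theta = frag_extend (\<lambda>U.
     let (C, a) = (SOME x. x \<in> U); pa = of_nat CARD('p) *s a
     in frag_cmul (int (card (Gamma_orbit C a) div card (Gamma_orbit C pa))) (Heis_T (C, pa)))"

end

theory Submission
  imports Defs
begin

text \<open>
  Elements of the Hecke rings are functions on double cosets, and the identity is checked at each double
  coset \<open>\<Gamma>~(C, a)\<Gamma>~\<close>. The coefficient of \<open>\<theta>\<^sup>j(T~(p\<^sup>k))\<close> there is, up to a power of \<open>p\<close>, the number of
  solutions \<open>x\<close> of \<open>p\<^sup>j x \<equiv> a\<close> modulo the lattice \<open>C\<M>\<close>, and multiplying by \<open>s(T(\<alpha>))\<close> sums such numbers over
  the lattices \<open>N = \<gamma>\<alpha>\<M>\<close>, \<open>\<gamma> \<in> \<Gamma>\<close>. A finite Fourier transform with respect to the symplectic form \<open>\<omega>\<close>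
  turns the term with index \<open>j\<close> into a sum over \<open>w\<close> modulo \<open>p\<^sup>k\<close> of the number of those \<open>N\<close> that contain
  \<open>L\<^sub>w = C\<M> + \<int>\<^sub>p p\<^bsup>4-k\<^esup>Cw\<close>, the lattice \<open>L\<^sub>w\<close> and the normalising powers of \<open>p\<close> being the same for all
  \<open>j\<close>. Everything therefore follows from the evaluation of the alternating sum, with weights \<open>q\<^sub>0, \<dots>, q\<^sub>4\<close>,
  over the lattices \<open>N\<close> containing a lattice \<open>L\<close> on which \<open>\<omega>\<close> is divisible by \<open>p\<^sup>3\<close> or which is one of
  the \<open>C\<M>\<close>: it is \<open>1\<close> for \<open>L = \<M>\<close>, \<open>-p\<^sup>2\<close> for \<open>L = p\<M>\<close> and \<open>0\<close> otherwise. This is a count of isotropic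
  subspaces modulo \<open>p\<close>, carried out by double counting primitive vectors.
\<close>

text \<open>The exponent 4 - j of \<theta> is complementary to the level j of \<alpha>. Dualising
  the congruence modulo C'M, where C' = \<alpha>^(-1)C has level k - j, selects the w with p^(4-j)
  C'w in p^(k-j) M. This says that p^(4-k) Cw lies in \<alpha>M, so j survives only through
  \<alpha>. The only other trace of j is the factor p^(2j), the index of \<alpha>M in M, and
  evaluating at Y = p^2 X supplies exactly this factor. The bound p^3 has two sources. For k > 4 the
  form pairs CM with p^(4-k) Cw inside p^4, so enlarging the lattice keeps enough divisibility. In
  the count, a lattice L = pL' uses up p^2 of the divisibility, and one further p makes L' isotropic
  modulo p. The lattices CM with k < 3 escape this argument and are treated by their self-duality.
  On the way back the sum over w of the characters is p^(4k) or 0 according to whether a lies in CM.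
  After normalisation, the value -p^2 at pM (where k = 2) becomes -p^6, the coefficient of X^2 in 1
  - p^2<p>Y^2.\<close>

lemma lookup_sum_int: "Poly_Mapping.lookup (sum f A) x = (\<Sum>a\<in>A. Poly_Mapping.lookup (f a) x)"
  by (induction A rule: infinite_finite_induct) (auto simp: lookup_add)

lemma lookup_frag_extend:
  "Poly_Mapping.lookup (frag_extend b x) y =
     (\<Sum>i\<in>Poly_Mapping.keys x. Poly_Mapping.lookup x i * Poly_Mapping.lookup (b i) y)"
  by (simp add: frag_extend_def lookup_sum_int)

subsection \<open>Hecke rings\<close>

lemma double_coset_eq:
  "double_coset G K x = {h \<otimes>\<^bsub>G\<^esub> x \<otimes>\<^bsub>G\<^esub> k | h k. h \<in> K \<and> k \<in> K}"
  unfolding double_coset_def r_coset_def set_mult_def by blast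

lemma hecke_ring_simps:
  "carrier (hecke_ring G K D) = {\<xi>. Poly_Mapping.keys \<xi> \<subseteq> double_cosets G K D}"
  "\<zero>\<^bsub>hecke_ring G K D\<^esub> = 0"
  "\<one>\<^bsub>hecke_ring G K D\<^esub> = frag_of (double_coset G K \<one>\<^bsub>G\<^esub>)"
  "\<xi> \<oplus>\<^bsub>hecke_ring G K D\<^esub> \<eta> = \<xi> + \<eta>"
  "\<xi> \<otimes>\<^bsub>hecke_ring G K D\<^esub> \<eta> = frag_extend (\<lambda>U. frag_extend (hecke_prod G K D U) \<eta>) \<xi>"
  by (simp_all add: hecke_ring_def)

text \<open>The additive structure is what \<open>finsum\<close>, the additive inverse and integer
  multiples refer to. Products are computed through their coefficients instead.\<close>

lemma hecke_ring_abelian_group: "abelian_group (hecke_ring G K D)"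
proof (rule abelian_groupI)
  fix x y
  assume "x \<in> carrier (hecke_ring G K D)" "y \<in> carrier (hecke_ring G K D)"
  then show "x \<oplus>\<^bsub>hecke_ring G K D\<^esub> y \<in> carrier (hecke_ring G K D)"
    using keys_add[of x y] by (auto simp: hecke_ring_simps)
next
  fix x
  assume "x \<in> carrier (hecke_ring G K D)"
  then show "\<exists>y\<in>carrier (hecke_ring G K D). y \<oplus>\<^bsub>hecke_ring G K D\<^esub> x = \<zero>\<^bsub>hecke_ring G K D\<^esub>"
    by (intro bexI[of _ "- x"]) (auto simp: hecke_ring_simps)
qed (auto simp: hecke_ring_simps)

lemma hecke_ring_a_inv:
  assumes "\<xi> \<in> carrier (hecke_ring G K D)"
  shows "\<ominus>\<^bsub>hecke_ring G K D\<^esub> \<xi> = - \<xi>"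
  using assms
  by (intro abelian_group.minus_equality[OF hecke_ring_abelian_group])
    (auto simp: hecke_ring_simps)

lemma hecke_ring_add_pow: "[(n::nat)] \<cdot>\<^bsub>hecke_ring G K D\<^esub> \<xi> = frag_cmul (int n) \<xi>"
proof (induction n)
  case 0
  then show ?case by (simp add: add_pow_def hecke_ring_simps)
next
  case (Suc n)
  then show ?case
    by (simp add: add_pow_def hecke_ring_simps frag_cmul_distrib add.commute)
qed

lemma hecke_ring_finsum:
  assumes "finite A" "\<And>a. a \<in> A \<Longrightarrow> f a \<in> carrier (hecke_ring G K D)"
  shows "finsum (hecke_ring G K D) f A = sum f A"
proof -
  interpret abelian_group "hecke_ring G K D" by (rule hecke_ring_abelian_group)
  show ?thesis
    using assms
  proof (induction A rule: finite_induct)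
    case (insert a A)
    then show ?case
      by (subst finsum_insert) (auto simp: hecke_ring_simps(4))
  qed (simp add: hecke_ring_simps)
qed

lemma hecke_mult_add_left:
  "(\<xi> + \<xi>') \<otimes>\<^bsub>hecke_ring G K D\<^esub> \<eta> = \<xi> \<otimes>\<^bsub>hecke_ring G K D\<^esub> \<eta> + \<xi>' \<otimes>\<^bsub>hecke_ring G K D\<^esub> \<eta>"
  by (simp add: hecke_ring_simps frag_extend_add)

lemma hecke_mult_cmul_left:
  "frag_cmul c \<xi> \<otimes>\<^bsub>hecke_ring G K D\<^esub> \<eta> = frag_cmul c (\<xi> \<otimes>\<^bsub>hecke_ring G K D\<^esub> \<eta>)"
  by (simp add: hecke_ring_simps frag_extend_cmul)

lemma hecke_mult_minus_left:
  "(- \<xi>) \<otimes>\<^bsub>hecke_ring G K D\<^esub> \<eta> = - (\<xi> \<otimes>\<^bsub>hecke_ring G K D\<^esub> \<eta>)"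
  by (simp add: hecke_ring_simps frag_extend_minus)

lemma hecke_mult_cmul_right:
  "\<xi> \<otimes>\<^bsub>hecke_ring G K D\<^esub> frag_cmul c \<eta> = frag_cmul c (\<xi> \<otimes>\<^bsub>hecke_ring G K D\<^esub> \<eta>)"
proof -
  have "frag_extend (\<lambda>U. frag_cmul c (f U)) \<xi> = frag_cmul c (frag_extend f \<xi>)"
    for f :: "'a set \<Rightarrow> ('a set \<Rightarrow>\<^sub>0 int)"
    by (simp add: frag_extend_def frag_cmul_sum mult.commute)
  then show ?thesis by (simp only: hecke_ring_simps frag_extend_cmul)
qed

lemma hecke_mult_0:
  "0 \<otimes>\<^bsub>hecke_ring G K D\<^esub> \<eta> = 0" "\<xi> \<otimes>\<^bsub>hecke_ring G K D\<^esub> 0 = 0"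
  by (simp_all add: hecke_ring_simps frag_extend_eq_0)

lemma keys_hecke_prod: "Poly_Mapping.keys (hecke_prod G K D U V) \<subseteq> double_cosets G K D"
proof (cases "finite {W \<in> double_cosets G K D. hecke_coeff G K U V (SOME c. c \<in> W) \<noteq> 0}")
  case True
  then show ?thesis
    unfolding hecke_prod_def Let_def
    by (intro order.trans[OF keys_sum]) (auto split: if_splits)
next
  case False
  then show ?thesis unfolding hecke_prod_def Let_def by simp
qed

lemma hecke_mult_closed:
  "\<xi> \<otimes>\<^bsub>hecke_ring G K D\<^esub> \<eta> \<in> carrier (hecke_ring G K D)"
proof -
  have "Poly_Mapping.keys (frag_extend (hecke_prod G K D U) \<eta>) \<subseteq> double_cosets G K D" for U
    using keys_frag_extend[of "hecke_prod G K D U" \<eta>] keys_hecke_prod by blast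
  then show ?thesis
    unfolding hecke_ring_simps(1,5) mem_Collect_eq
    using keys_frag_extend[of "\<lambda>U. frag_extend (hecke_prod G K D U) \<eta>" \<xi>] by blast
qed

text \<open>Left cosets are the ones that later become lattices: \<open>g\<Gamma>\<close>
  corresponds to \<open>g\<M>\<close>, since \<Gamma> is the stabiliser of \<M>.\<close>

definition left_cosets_in :: "('g, 'm) monoid_scheme \<Rightarrow> 'g set \<Rightarrow> 'g set \<Rightarrow> 'g set set" where
  "left_cosets_in G K U = {a <#\<^bsub>G\<^esub> K | a. a \<in> U}"

locale hecke_pair = group G for G (structure) +
  fixes K D :: "'a set"
  assumes K_subgroup: "subgroup K G"
    and K_sub_D: "K \<subseteq> D" and D_sub: "D \<subseteq> carrier G"
    and D_mult: "\<lbrakk>x \<in> D; y \<in> D\<rbrakk> \<Longrightarrow> x \<otimes> y \<in> D"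
    and finite_left_cosets: "x \<in> D \<Longrightarrow> finite (left_cosets_in G K (double_coset G K x))"
begin

abbreviation "dc \<equiv> double_coset G K"

lemma K_closed [simp]:
  "k \<in> K \<Longrightarrow> k \<in> carrier G" "\<one> \<in> K" "k \<in> K \<Longrightarrow> inv k \<in> K"
  "h \<in> K \<Longrightarrow> k \<in> K \<Longrightarrow> h \<otimes> k \<in> K"
  using K_subgroup by (auto simp: subgroup.mem_carrier subgroup.one_closed
      subgroup.m_inv_closed subgroup.m_closed)

lemma dc_self: "x \<in> carrier G \<Longrightarrow> x \<in> dc x"
  unfolding double_coset_eq by simp (metis K_closed(2) l_one r_one)

lemma dc_carrier: "x \<in> carrier G \<Longrightarrow> y \<in> dc x \<Longrightarrow> y \<in> carrier G"
  unfolding double_coset_eq by auto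

lemma dc_sub_D: "x \<in> D \<Longrightarrow> dc x \<subseteq> D"
  unfolding double_coset_eq using D_mult K_sub_D by blast

lemma dc_mult:
  assumes "x \<in> carrier G" "y \<in> dc x" "h \<in> K" "k \<in> K"
  shows "h \<otimes> y \<otimes> k \<in> dc x"
proof -
  obtain h' k' where y: "h' \<in> K" "k' \<in> K" "y = h' \<otimes> x \<otimes> k'"
    using assms unfolding double_coset_eq by auto
  have "h \<otimes> y \<otimes> k = (h \<otimes> h') \<otimes> x \<otimes> (k' \<otimes> k)"
    using y assms by (simp add: m_assoc)
  then show ?thesis using y(1,2) assms(3,4) K_closed(4) unfolding double_coset_eq by blast
qed

lemma dc_mult_left: "x \<in> carrier G \<Longrightarrow> y \<in> dc x \<Longrightarrow> h \<in> K \<Longrightarrow> h \<otimes> y \<in> dc x"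
  using dc_mult[of x y h \<one>] dc_carrier by simp

lemma dc_mult_right: "x \<in> carrier G \<Longrightarrow> y \<in> dc x \<Longrightarrow> k \<in> K \<Longrightarrow> y \<otimes> k \<in> dc x"
  using dc_mult[of x y \<one> k] dc_carrier by simp

lemma dc_sym:
  assumes "x \<in> carrier G" "y \<in> dc x" shows "x \<in> dc y"
proof -
  obtain h k where y: "h \<in> K" "k \<in> K" "y = h \<otimes> x \<otimes> k"
    using assms unfolding double_coset_eq by auto
  have "x = inv h \<otimes> y \<otimes> inv k"
    using y assms by (simp add: m_assoc inv_solve_left)
  then show ?thesis using y(1,2) K_closed(3) unfolding double_coset_eq by blast
qed

lemma dc_eq:
  assumes "x \<in> carrier G" "y \<in> dc x" shows "dc y = dc x"
proof -
  have sub: "dc b \<subseteq> dc a" if "a \<in> carrier G" "b \<in> dc a" for a b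
    using dc_mult[OF that] unfolding double_coset_eq[of G K b] by auto
  show ?thesis using sub[OF assms] sub[OF dc_carrier[OF assms] dc_sym[OF assms]] by auto
qed

lemma dc_eq_iff: "x \<in> carrier G \<Longrightarrow> y \<in> carrier G \<Longrightarrow> dc y = dc x \<longleftrightarrow> y \<in> dc x"
  using dc_eq dc_self by metis

lemma dc_mult_eq: "x \<in> carrier G \<Longrightarrow> h \<in> K \<Longrightarrow> k \<in> K \<Longrightarrow> dc (h \<otimes> x \<otimes> k) = dc x"
  by (intro dc_eq dc_mult dc_self)

lemma dc_mem_double_cosets_iff:
  "x \<in> carrier G \<Longrightarrow> dc x \<in> double_cosets G K D \<longleftrightarrow> x \<in> D"
  unfolding double_cosets_def using dc_sub_D dc_self D_sub by (metis image_iff subsetD)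

lemma some_dc:
  assumes "x \<in> carrier G"
  shows "(SOME c. c \<in> dc x) \<in> dc x" "(SOME c. c \<in> dc x) \<in> carrier G" "dc (SOME c. c \<in> dc x) = dc x"
proof -
  show 1: "(SOME c. c \<in> dc x) \<in> dc x" by (rule someI[of "\<lambda>c. c \<in> dc x"]) (rule dc_self[OF assms])
  show "(SOME c. c \<in> dc x) \<in> carrier G" "dc (SOME c. c \<in> dc x) = dc x"
    using dc_carrier[OF assms 1] dc_eq[OF assms 1] by auto
qed

lemma l_coset_some:
  assumes "a \<in> carrier G"
  shows "(SOME x. x \<in> a <# K) \<in> a <# K" "(SOME x. x \<in> a <# K) \<in> carrier G"
    "(SOME x. x \<in> a <# K) <# K = a <# K"
proof -
  have "a \<in> a <# K" using assms K_closed(2) r_one unfolding l_coset_def by force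
  then show 1: "(SOME x. x \<in> a <# K) \<in> a <# K" by (rule someI)
  show 2: "(SOME x. x \<in> a <# K) \<in> carrier G"
    using l_coset_carrier[OF 1 assms K_subgroup] .
  show "(SOME x. x \<in> a <# K) <# K = a <# K"
    by (rule l_repr_independence[OF 1 assms K_subgroup, symmetric])
qed

lemma l_coset_mem: "a \<in> carrier G \<Longrightarrow> k \<in> K \<Longrightarrow> (a \<otimes> k) <# K = a <# K"
  by (rule l_repr_independence[OF _ _ K_subgroup, symmetric]) (auto simp: l_coset_def)

lemma l_coset_eqD:
  assumes "a \<in> carrier G" "b \<in> carrier G" "a <# K = b <# K"
  obtains k where "k \<in> K" "a = b \<otimes> k"
proof -
  have "a \<in> a <# K" using assms K_closed(2) r_one unfolding l_coset_def by force
  then have "a \<in> b <# K" using assms by simp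
  then show ?thesis using that unfolding l_coset_def by auto
qed

text \<open>The map \<open>Kb \<mapsto> cb\<^sup>-\<^sup>1K\<close> turns the count of right cosets in \<open>hecke_coeff\<close> into one of left cosets.\<close>

lemma hecke_coeff_left_cosets:
  assumes u: "u \<in> carrier G" and v: "v \<in> carrier G" and c: "c \<in> carrier G"
  shows "hecke_coeff G K (dc u) (dc v) c = card {a <# K | a. a \<in> dc u \<and> inv a \<otimes> c \<in> dc v}"
proof -
  let ?S = "{K #> b | b. b \<in> dc v \<and> c \<otimes> inv b \<in> dc u}"
  let ?f = "\<lambda>X. (\<lambda>x. c \<otimes> inv x) ` X"
  have f: "?f (K #> b) = (c \<otimes> inv b) <# K" if "b \<in> carrier G" for b
  proof -
    have "?f (K #> b) = (\<lambda>k. (c \<otimes> inv b) \<otimes> inv k) ` K"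
      unfolding r_coset_def using that c by (auto simp: image_iff inv_mult_group m_assoc)
    also have "\<dots> = (\<lambda>k. (c \<otimes> inv b) \<otimes> k) ` (m_inv G ` K)"
      by (simp add: image_image)
    also have "m_inv G ` K = K"
      using K_closed(1,3) inv_inv by (metis (no_types, lifting) image_eqI image_subsetI subsetI subset_antisym)
    finally show ?thesis unfolding l_coset_def by auto
  qed
  have "inj_on ?f ?S"
  proof (rule inj_on_subset[OF inj_on_image_Pow[of "\<lambda>x. c \<otimes> inv x" "carrier G"]])
    show "inj_on (\<lambda>x. c \<otimes> inv x) (carrier G)"
      using c by (auto intro!: inj_onI)
    show "?S \<subseteq> Pow (carrier G)"
      using dc_carrier[OF v] r_coset_subset_G[of K] K_closed(1) by blast
  qed
  moreover have "?f ` ?S = {a <# K | a. a \<in> dc u \<and> inv a \<otimes> c \<in> dc v}"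
  proof safe
    fix b assume b: "b \<in> dc v" "c \<otimes> inv b \<in> dc u"
    then have "b \<in> carrier G" using dc_carrier[OF v] by auto
    then have "inv (c \<otimes> inv b) \<otimes> c = b" using c by (simp add: inv_mult_group m_assoc)
    then show "\<exists>a. ?f (K #> b) = a <# K \<and> a \<in> dc u \<and> inv a \<otimes> c \<in> dc v"
      using b f[OF \<open>b \<in> carrier G\<close>] by auto
  next
    fix a assume a: "a \<in> dc u" "inv a \<otimes> c \<in> dc v"
    then have ac: "a \<in> carrier G" using dc_carrier[OF u] by auto
    have "c \<otimes> inv (inv a \<otimes> c) = a" using ac c by (simp add: inv_mult_group m_assoc[symmetric])
    then show "a <# K \<in> ?f ` ?S"
      using a f[of "inv a \<otimes> c"] ac c by (intro image_eqI[of _ _ "K #> (inv a \<otimes> c)"]) auto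
  qed
  ultimately show ?thesis
    unfolding hecke_coeff_def using card_image by fastforce
qed

text \<open>For \<open>d = hck\<close>, left multiplication by \<open>h\<close> carries the left
  cosets counted for \<open>c\<close> to those counted for \<open>d\<close>. Hence the
  representative picked by \<open>SOME\<close> in \<open>hecke_prod\<close> is harmless.\<close>

lemma hecke_coeff_cong:
  assumes u: "u \<in> carrier G" and v: "v \<in> carrier G" and c: "c \<in> carrier G" and d: "d \<in> dc c"
  shows "hecke_coeff G K (dc u) (dc v) d = hecke_coeff G K (dc u) (dc v) c"
proof -
  obtain h k where hk: "h \<in> K" "k \<in> K" "d = h \<otimes> c \<otimes> k"
    using d unfolding double_coset_eq by auto
  let ?A = "\<lambda>c. {a <# K | a. a \<in> dc u \<and> inv a \<otimes> c \<in> dc v}"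
  let ?f = "\<lambda>X. (\<lambda>x. h \<otimes> x) ` X"
  have f: "?f (a <# K) = (h \<otimes> a) <# K" if "a \<in> carrier G" for a
    unfolding l_coset_def using that hk by (auto simp: m_assoc image_iff)
  have "inj_on ?f (?A c)"
  proof (rule inj_on_subset[OF inj_on_image_Pow[of "\<lambda>x. h \<otimes> x" "carrier G"]])
    show "inj_on (\<lambda>x. h \<otimes> x) (carrier G)" using hk by (auto intro!: inj_onI)
    show "?A c \<subseteq> Pow (carrier G)"
      using dc_carrier[OF u] l_coset_subset_G[of K] K_closed(1) by blast
  qed
  moreover have "?f ` ?A c = ?A d"
  proof safe
    fix a assume a: "a \<in> dc u" "inv a \<otimes> c \<in> dc v"
    have ac: "a \<in> carrier G" using a dc_carrier[OF u] by auto
    have "inv (h \<otimes> a) \<otimes> d = inv a \<otimes> c \<otimes> k"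
      using hk ac c by (simp add: inv_mult_group m_assoc[symmetric]) (simp add: m_assoc)
    then show "\<exists>a'. ?f (a <# K) = a' <# K \<and> a' \<in> dc u \<and> inv a' \<otimes> d \<in> dc v"
      using dc_mult_right[OF v a(2) hk(2)] dc_mult_left[OF u a(1) hk(1)] f[OF ac] by auto
  next
    fix a assume a: "a \<in> dc u" "inv a \<otimes> d \<in> dc v"
    have ac: "a \<in> carrier G" using a dc_carrier[OF u] by auto
    have "inv (inv h \<otimes> a) \<otimes> c = inv a \<otimes> d \<otimes> inv k"
      using hk ac c by (simp add: inv_mult_group m_assoc)
    then have "inv (inv h \<otimes> a) \<otimes> c \<in> dc v"
      using dc_mult_right[OF v a(2), of "inv k"] hk by simp
    moreover have "inv h \<otimes> a \<in> dc u" using dc_mult_left[OF u a(1)] hk by simp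
    moreover have "?f ((inv h \<otimes> a) <# K) = a <# K"
      using f[of "inv h \<otimes> a"] hk ac by (simp add: m_assoc[symmetric])
    ultimately show "a <# K \<in> ?f ` ?A c" by (intro image_eqI[of _ _ "(inv h \<otimes> a) <# K"]) auto
  qed
  ultimately have "card (?A c) = card (?A d)" using card_image by fastforce
  moreover have "d \<in> carrier G" using hk c by simp
  ultimately show ?thesis using hecke_coeff_left_cosets[OF u v] c by simp
qed

text \<open>A nonzero coefficient at \<open>c\<close> puts \<open>c\<close> into
  \<open>KuKvK\<close>. Modulo \<open>K\<close> on the right it is then a product of chosen
  representatives of left cosets in \<open>KuK\<close> and \<open>KvK\<close>, of which there are
  finitely many. Without this the sum in \<open>hecke_prod\<close> would take the default value 0 of
  an infinite sum.\<close>

lemma finite_hecke_support: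
  assumes u: "u \<in> D" and v: "v \<in> D"
  shows "finite {W \<in> double_cosets G K D. hecke_coeff G K (dc u) (dc v) (SOME c. c \<in> W) \<noteq> 0}"
proof (rule finite_subset)
  let ?r = "\<lambda>A::'a set. SOME a. a \<in> A"
  let ?I = "left_cosets_in G K (dc u) \<times> left_cosets_in G K (dc v)"
  show "finite ((\<lambda>(A, B). dc (?r A \<otimes> ?r B)) ` ?I)"
    using finite_left_cosets u v by blast
  have uc: "u \<in> carrier G" and vc: "v \<in> carrier G" using u v D_sub by auto
  show "{W \<in> double_cosets G K D. hecke_coeff G K (dc u) (dc v) (SOME c. c \<in> W) \<noteq> 0}
      \<subseteq> (\<lambda>(A, B). dc (?r A \<otimes> ?r B)) ` ?I"
  proof clarify
    fix W assume W: "W \<in> double_cosets G K D" "hecke_coeff G K (dc u) (dc v) (SOME c. c \<in> W) > 0"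
    then obtain w where w: "w \<in> D" "W = dc w" unfolding double_cosets_def by auto
    have wc: "w \<in> carrier G" using w D_sub by auto
    define c where "c = (SOME c. c \<in> W)"
    have c: "c \<in> carrier G" "dc c = W" using some_dc[OF wc] unfolding c_def w by auto
    have "{a <# K | a. a \<in> dc u \<and> inv a \<otimes> c \<in> dc v} \<noteq> {}"
      using W hecke_coeff_left_cosets[OF uc vc c(1)] unfolding c_def[symmetric]
      by (metis card.empty less_numeral_extra(3))
    then obtain a where a: "a \<in> dc u" "inv a \<otimes> c \<in> dc v" by auto
    have ac: "a \<in> carrier G" using a dc_carrier[OF uc] by auto
    let ?a = "?r (a <# K)"
    obtain k where k: "k \<in> K" "a = ?a \<otimes> k"
      using l_coset_eqD[OF ac l_coset_some(2)[OF ac]] l_coset_some(3)[OF ac] by metis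
    \<comment> \<open>Replacing \<open>a\<close> by the chosen representative of its coset costs a
      factor \<open>k\<close> from \<open>K\<close>, which moves into the second factor, so that
      \<open>c\<close> is still the product.\<close>
    define b where "b = k \<otimes> (inv a \<otimes> c)"
    have b: "b \<in> dc v" "b \<in> carrier G"
      using dc_mult_left[OF vc a(2) k(1)] k ac c unfolding b_def by auto
    let ?b = "?r (b <# K)"
    obtain k' where k': "k' \<in> K" "b = ?b \<otimes> k'"
      using l_coset_eqD[OF b(2) l_coset_some(2)[OF b(2)]] l_coset_some(3)[OF b(2)] by metis
    note ca = l_coset_some(2)[OF ac] and cb = l_coset_some(2)[OF b(2)]
    have "c = a \<otimes> (inv a \<otimes> c)" using ac c by (simp add: m_assoc[symmetric])
    also have "\<dots> = ?a \<otimes> b" unfolding b_def using k ca ac c by (metis K_closed(1) m_assoc inv_closed m_closed)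
    also have "\<dots> = \<one> \<otimes> (?a \<otimes> ?b) \<otimes> k'" using k' ca cb by (metis K_closed(1) m_assoc l_one m_closed)
    finally have "W = dc (?a \<otimes> ?b)"
      using c dc_mult_eq[of "?a \<otimes> ?b" \<one> k'] k' ca cb by simp
    then show "W \<in> (\<lambda>(A, B). dc (?r A \<otimes> ?r B)) ` ?I"
      using a b unfolding left_cosets_in_def by (intro image_eqI[of _ _ "(a <# K, b <# K)"]) auto
  qed
qed

lemma lookup_hecke_prod:
  assumes u: "u \<in> D" and v: "v \<in> D" and c: "c \<in> D"
  shows "Poly_Mapping.lookup (hecke_prod G K D (dc u) (dc v)) (dc c)
    = int (hecke_coeff G K (dc u) (dc v) c)"
proof -
  let ?m = "\<lambda>W. hecke_coeff G K (dc u) (dc v) (SOME c. c \<in> W)"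
  have cc: "c \<in> carrier G" and uc: "u \<in> carrier G" and vc: "v \<in> carrier G" using c u v D_sub by auto
  have "Poly_Mapping.lookup (hecke_prod G K D (dc u) (dc v)) (dc c)
     = (\<Sum>W | W \<in> double_cosets G K D \<and> ?m W \<noteq> 0. if W = dc c then int (?m W) else 0)"
    unfolding hecke_prod_def Let_def lookup_sum_int
    by (intro sum.cong) (auto simp: when_def)
  also have "\<dots> = int (?m (dc c))"
    using finite_hecke_support[OF u v] c by (auto simp: sum.delta' double_cosets_def)
  also have "?m (dc c) = hecke_coeff G K (dc u) (dc v) c"
    by (rule hecke_coeff_cong[OF uc vc cc some_dc(1)[OF cc]])
  finally show ?thesis .
qed

lemma dc_inv_some:
  assumes a: "a \<in> carrier G" and c: "c \<in> carrier G"
  shows "dc (inv (SOME x. x \<in> a <# K) \<otimes> c) = dc (inv a \<otimes> c)"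
proof -
  let ?a = "SOME x. x \<in> a <# K"
  have sc: "?a \<in> carrier G" by (rule l_coset_some(2)[OF a])
  obtain k where k: "k \<in> K" "a = ?a \<otimes> k"
    using l_coset_eqD[OF a sc] l_coset_some(3)[OF a] by metis
  have "inv a \<otimes> c = inv k \<otimes> (inv ?a \<otimes> c)"
    using k sc c by (metis inv_mult_group K_closed(1) m_assoc inv_closed)
  then show ?thesis
    using dc_mult_eq[of "inv ?a \<otimes> c" "inv k" \<one>] k sc c by simp
qed

text \<open>Multiplication by a double coset from the left is a convolution operator: it sums the
  translates by \<open>a\<inverse>\<close> of the function \<eta>, with \<open>a\<close> running
  over the left cosets in \<open>KuK\<close>. All products below are evaluated by this
  formula.\<close>

lemma lookup_hecke_mult:
  assumes u: "u \<in> D" and \<eta>: "\<eta> \<in> carrier (hecke_ring G K D)" and c: "c \<in> D"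
  shows "Poly_Mapping.lookup (frag_of (dc u) \<otimes>\<^bsub>hecke_ring G K D\<^esub> \<eta>) (dc c)
    = (\<Sum>A\<in>left_cosets_in G K (dc u). Poly_Mapping.lookup \<eta> (dc (inv (SOME a. a \<in> A) \<otimes> c)))"
proof -
  let ?L = "left_cosets_in G K (dc u)"
  have cc: "c \<in> carrier G" and uc: "u \<in> carrier G" using c u D_sub by auto
  let ?g = "\<lambda>A. inv (SOME a. a \<in> A) \<otimes> c"
  have "int (hecke_coeff G K (dc u) V c) = (\<Sum>A\<in>?L. if dc (?g A) = V then 1 else 0)"
    if V: "V \<in> Poly_Mapping.keys \<eta>" for V
  proof -
    obtain v where v: "v \<in> D" "V = dc v"
      using V \<eta> unfolding hecke_ring_simps double_cosets_def by auto
    have vc: "v \<in> carrier G" using v D_sub by auto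
    have "{a <# K | a. a \<in> dc u \<and> inv a \<otimes> c \<in> dc v} = {A \<in> ?L. dc (?g A) = V}"
    proof -
      have "inv a \<otimes> c \<in> dc v \<longleftrightarrow> dc (?g (a <# K)) = V" if a: "a \<in> dc u" for a
      proof -
        have ac: "a \<in> carrier G" using a dc_carrier[OF uc] by auto
        have "dc (?g (a <# K)) = dc (inv a \<otimes> c)" by (rule dc_inv_some[OF ac cc])
        then show ?thesis using v vc ac cc dc_eq_iff[of v "inv a \<otimes> c"] by auto
      qed
      then show ?thesis unfolding left_cosets_in_def by auto
    qed
    then have "hecke_coeff G K (dc u) V c = card {A \<in> ?L. dc (?g A) = V}"
      using hecke_coeff_left_cosets[OF uc vc cc] v by simp
    then show ?thesis
      using finite_left_cosets[OF u] by (simp add: sum.If_cases Int_def)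
  qed
  moreover have "Poly_Mapping.lookup (hecke_prod G K D (dc u) V) (dc c) = int (hecke_coeff G K (dc u) V c)"
    if V: "V \<in> Poly_Mapping.keys \<eta>" for V
    using V \<eta> lookup_hecke_prod[OF u _ c] unfolding hecke_ring_simps double_cosets_def by blast
  ultimately have "Poly_Mapping.lookup (frag_of (dc u) \<otimes>\<^bsub>hecke_ring G K D\<^esub> \<eta>) (dc c)
    = (\<Sum>V\<in>Poly_Mapping.keys \<eta>. Poly_Mapping.lookup \<eta> V * (\<Sum>A\<in>?L. if dc (?g A) = V then 1 else 0))"
    unfolding hecke_ring_simps frag_extend_of lookup_frag_extend by (intro sum.cong) auto
  also have "\<dots> = (\<Sum>A\<in>?L. \<Sum>V\<in>Poly_Mapping.keys \<eta>. if dc (?g A) = V then Poly_Mapping.lookup \<eta> V else 0)"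
    by (subst sum.swap) (simp add: sum_distrib_left if_distrib cong: if_cong)
  also have "\<dots> = (\<Sum>A\<in>?L. Poly_Mapping.lookup \<eta> (dc (?g A)))"
    by (intro sum.cong refl) (auto simp: in_keys_iff)
  finally show ?thesis .
qed

text \<open>The coefficients of the powers of Y are multiples of the unit and stand on the right of
  the coefficients \<open>q\<^sub>j\<close>, so the right unit law is what collapses these
  products.\<close>

lemma hecke_mult_one_right:
  assumes \<xi>: "\<xi> \<in> carrier (hecke_ring G K D)"
  shows "\<xi> \<otimes>\<^bsub>hecke_ring G K D\<^esub> \<one>\<^bsub>hecke_ring G K D\<^esub> = \<xi>"
proof -
  have "hecke_prod G K D U (dc \<one>) = frag_of U" if U: "U \<in> Poly_Mapping.keys \<xi>" for U
  proof -
    obtain u where u: "u \<in> D" "U = dc u"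
      using U \<xi> unfolding hecke_ring_simps double_cosets_def by auto
    have uc: "u \<in> carrier G" using u D_sub by auto
    have one: "\<one> \<in> D" "dc \<one> = K"
    proof -
      show "\<one> \<in> D" using K_sub_D by auto
      have "k = \<one> \<otimes> \<one> \<otimes> k" if "k \<in> K" for k using that by simp
      then show "dc \<one> = K" unfolding double_coset_eq using K_closed(2,4) by fastforce
    qed
    show ?thesis
    proof (rule poly_mapping_eqI)
      fix W
      show "Poly_Mapping.lookup (hecke_prod G K D U (dc \<one>)) W = Poly_Mapping.lookup (frag_of U) W"
      proof (cases "W \<in> double_cosets G K D")
        case True
        then obtain c where c: "c \<in> D" "W = dc c" unfolding double_cosets_def by auto
        have cc: "c \<in> carrier G" using c D_sub by auto
        have "{K #> b | b. b \<in> K \<and> c \<otimes> inv b \<in> U} = (if W = U then {K} else {})"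
        proof -
          have 1: "K #> b = K" if "b \<in> K" for b
            using that K_subgroup by (simp add: coset_join2)
          have 2: "c \<otimes> inv b \<in> U \<longleftrightarrow> W = U" if b: "b \<in> K" for b
          proof -
            have "dc (c \<otimes> inv b) = dc c" using dc_mult_eq[of c \<one> "inv b"] b cc by simp
            then show ?thesis using u c uc cc b dc_eq_iff[of u "c \<otimes> inv b"] by auto
          qed
          show ?thesis using 1 2 2[OF K_closed(2)] K_closed(2) by (auto split: if_splits intro!: exI[of _ \<one>])
        qed
        then have "hecke_coeff G K U K c = (if W = U then 1 else 0)"
          unfolding hecke_coeff_def by auto
        then show ?thesis
          using lookup_hecke_prod[OF u(1) one(1) c(1)] one(2) u c by simp
      next
        case False
        then show ?thesis
          using keys_hecke_prod[of G K D U "dc \<one>"] u unfolding double_cosets_def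
          by (auto simp: in_keys_iff)
      qed
    qed
  qed
  then have "\<xi> \<otimes>\<^bsub>hecke_ring G K D\<^esub> \<one>\<^bsub>hecke_ring G K D\<^esub> = frag_extend frag_of \<xi>"
    unfolding hecke_ring_simps frag_extend_of by (intro frag_extend_eq) auto
  then show ?thesis using frag_expansion by metis
qed

end

subsection \<open>p-adic integers\<close>

abbreviation res :: "'p::prime_card padic_int \<Rightarrow> nat \<Rightarrow> int" where "res \<equiv> Rep_padic_int"

lemma res_Suc: "res (x :: 'p::prime_card padic_int) (Suc k) mod int CARD('p) ^ k = res x k"
  using Rep_padic_int[of x] by auto

lemma res_add_level: "res (x :: 'p::prime_card padic_int) (k + m) mod int CARD('p) ^ k = res x k"
  using padic_int_residue_le Rep_padic_int[of x] by auto

lemma res_mod: "res (x :: 'p::prime_card padic_int) k mod int CARD('p) ^ k = res x k"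
  using res_add_level[of x k 0] by simp

lemma CARD_gt_1: "CARD('p::prime_card) > 1"
  using prime_card[where 'a='p] prime_gt_1_nat by auto

lemma res_bounds: "0 \<le> res (x :: 'p::prime_card padic_int) k" "res x k < int CARD('p) ^ k"
proof -
  have "int CARD('p) ^ k > 0" using CARD_gt_1[where 'p='p] by simp
  then show "0 \<le> res x k" "res x k < int CARD('p) ^ k" by (metis res_mod pos_mod_sign, metis res_mod pos_mod_bound)
qed

lemma res_simps:
  fixes x y :: "'p::prime_card padic_int"
  shows "res (x + y) k = (res x k + res y k) mod int CARD('p) ^ k"
    "res (x - y) k = (res x k - res y k) mod int CARD('p) ^ k"
    "res (x * y) k = (res x k * res y k) mod int CARD('p) ^ k"
    "res 0 k = 0" "res (1 :: 'p padic_int) k = 1 mod int CARD('p) ^ k"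
  by (transfer; simp)+

lemma res_of_nat: "res (of_nat n :: 'p::prime_card padic_int) k = int n mod int CARD('p) ^ k"
  by (induction n) (simp_all add: res_simps mod_add_eq)

lemma padic_int_eqI: "(\<And>k. res x k = res y k) \<Longrightarrow> x = (y :: 'p::prime_card padic_int)"
  using Rep_padic_int_inject by blast

lemma Ex_res:
  "(\<And>k. f (Suc k) mod int CARD('p) ^ k = f k) \<Longrightarrow> \<exists>x :: 'p::prime_card padic_int. \<forall>k. res x k = f k"
  using Abs_padic_int_inverse[of f, where 'p='p] by (intro exI[of _ "Abs_padic_int f"]) auto

text \<open>For the converse, the residues of \<open>x\<close> are divided by \<open>p^k\<close>,
  and the quotients are the residues of the cofactor.\<close>

lemma p_power_dvd_iff:
  "of_nat CARD('p) ^ k dvd (x :: 'p::prime_card padic_int) \<longleftrightarrow> res x k = 0"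
proof
  have pk: "res (of_nat CARD('p) ^ k :: 'p padic_int) m = int CARD('p) ^ k mod int CARD('p) ^ m" for m
    using res_of_nat[of "CARD('p) ^ k", where 'p='p] by simp
  {
    assume "of_nat CARD('p) ^ k dvd x"
    then show "res x k = 0" by (auto simp: res_simps pk)
  }
  assume x: "res x k = 0"
  let ?p = "int CARD('p)"
  have p0: "?p > 0" using CARD_gt_1[where 'p='p] by simp
  have d: "?p ^ k dvd res x (k + m)" for m
    using res_add_level[of x k m] x by (simp add: dvd_eq_mod_eq_0)
  \<comment> \<open>Dividing by \<open>p^k\<close> loses \<open>k\<close> levels of precision, so
    the residue of level \<open>m\<close> of the quotient is read off from level
    \<open>k + m\<close>.\<close>
  define f where "f m = res x (k + m) div ?p ^ k" for m
  have f: "res x (k + m) = ?p ^ k * f m" for m using d unfolding f_def by simp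
  have "f (Suc m) mod ?p ^ m = f m" for m
  proof -
    have "?p ^ k * (f (Suc m) mod ?p ^ m) = (?p ^ k * f (Suc m)) mod ?p ^ (k + m)"
      by (simp only: mult_mod_right power_add)
    also have "\<dots> = res x (Suc (k + m)) mod ?p ^ (k + m)" using f[of "Suc m"] by simp
    also have "\<dots> = ?p ^ k * f m" by (simp only: res_Suc f)
    finally have "?p ^ k * (f (Suc m) mod ?p ^ m) = ?p ^ k * f m" .
    then show ?thesis using p0 by simp
  qed
  then obtain y :: "'p padic_int" where y: "\<And>m. res y m = f m"
    using Ex_res[of f, where 'p='p] by auto
  have "x = of_nat CARD('p) ^ k * y"
  proof (rule padic_int_eqI)
    fix m
    have "res x m = res x (m + k) mod ?p ^ m" by (simp add: res_add_level)
    also have "\<dots> = (?p ^ k * f m) mod ?p ^ m" using f[of m] by (simp add: add.commute)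
    also have "\<dots> = res (of_nat CARD('p) ^ k * y) m"
      by (simp add: res_simps pk y mod_mult_left_eq)
    finally show "res x m = res (of_nat CARD('p) ^ k * y) m" .
  qed
  then show "of_nat CARD('p) ^ k dvd x" by simp
qed

text \<open>If the residue modulo \<open>p\<close> is nonzero, every residue of \<open>x\<close> is
  invertible modulo \<open>p^k\<close> by Bezout. Inverses modulo \<open>p^k\<close> are unique, so
  the chosen ones form a compatible sequence.\<close>

lemma padic_int_unit_iff: "(x :: 'p::prime_card padic_int) dvd 1 \<longleftrightarrow> res x 1 \<noteq> 0"
proof
  let ?p = "int CARD('p)"
  have p1: "?p > 1" using CARD_gt_1[where 'p='p] by simp
  {
    assume "x dvd 1"
    then obtain y where "1 = x * y" by (auto simp: dvd_def)
    then have "res x 1 * res y 1 mod ?p = 1"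
      using p1 res_simps(3)[of x y 1] res_simps(5)[of 1, where 'p='p] by simp
    then show "res x 1 \<noteq> 0" by auto
  }
  assume x: "res x 1 \<noteq> 0"
  have p: "prime ?p" by (rule prime_card_int)
  have cop: "coprime (res x k) (?p ^ k)" for k
  proof (cases k)
    case (Suc j)
    have "res x (Suc j) mod ?p = res x 1" using res_add_level[of x 1 j] by simp
    then have "\<not> ?p dvd res x k" using x Suc by (auto simp: dvd_eq_mod_eq_0)
    then have "coprime ?p (res x k)" using p by (rule prime_imp_coprime[rotated])
    then show ?thesis by (simp add: coprime_commute)
  qed simp
  define f where "f k = fst (bezout_coefficients (res x k) (?p ^ k)) mod ?p ^ k" for k
  have f: "(res x k * f k) mod ?p ^ k = 1 mod ?p ^ k" for k
  proof -
    have "fst (bezout_coefficients (res x k) (?p ^ k)) * res x k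
        + snd (bezout_coefficients (res x k) (?p ^ k)) * ?p ^ k = 1"
      using bezout_coefficients_fst_snd[of "res x k" "?p ^ k"] cop[of k] by simp
    then have "(fst (bezout_coefficients (res x k) (?p ^ k)) * res x k) mod ?p ^ k = 1 mod ?p ^ k"
      by (metis mod_mult_self1)
    then show ?thesis unfolding f_def by (metis mult.commute mod_mult_left_eq)
  qed
  have "f (Suc k) mod ?p ^ k = f k" for k
  proof -
    have "(res x (Suc k) * f (Suc k)) mod ?p ^ k = 1 mod ?p ^ k"
      using f[of "Suc k"] by (metis mod_power_Suc)
    then have "(res x k * f (Suc k)) mod ?p ^ k = 1 mod ?p ^ k"
      by (metis mod_mult_left_eq res_Suc)
    then have "?p ^ k dvd res x k * f (Suc k) - res x k * f k"
      using f[of k] by (metis mod_eq_dvd_iff)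
    then have "?p ^ k dvd res x k * (f (Suc k) - f k)" by (simp add: algebra_simps)
    then have "?p ^ k dvd f (Suc k) - f k" using cop[of k] by (simp add: coprime_commute coprime_dvd_mult_right_iff)
    then have "f (Suc k) mod ?p ^ k = f k mod ?p ^ k" by (simp add: mod_eq_dvd_iff)
    then show ?thesis unfolding f_def by simp
  qed
  then obtain y :: "'p padic_int" where y: "\<And>m. res y m = f m"
    using Ex_res[of f, where 'p='p] by auto
  have "x * y = 1" by (rule padic_int_eqI) (simp add: res_simps y f)
  then show "x dvd 1" by (metis dvd_triv_left)
qed

text \<open>The least level with nonzero residue is at least 1, since level 0 only has the residue
  0. It is one more than the exponent.\<close>

lemma padic_int_factor:
  fixes x :: "'p::prime_card padic_int"
  assumes "x \<noteq> 0"
  obtains n u where "u dvd 1" "x = u * of_nat CARD('p) ^ n"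
proof -
  have "\<exists>k. res x k \<noteq> 0" using assms padic_int_eqI[of x 0] by (auto simp: res_simps)
  define k where "k = (LEAST k. res x k \<noteq> 0)"
  have k: "res x k \<noteq> 0" unfolding k_def using \<open>\<exists>k. _\<close> by (rule LeastI_ex)
  moreover have "res x 0 = 0" using res_bounds[of x 0] by simp
  ultimately obtain n where n: "k = Suc n" by (cases k) auto
  then have "res x n = 0" using not_less_Least[of n "\<lambda>k. res x k \<noteq> 0"] unfolding k_def by auto
  then obtain u where u: "x = of_nat CARD('p) ^ n * u"
    using p_power_dvd_iff[of n x] by (auto simp: dvd_def)
  have "res u 1 \<noteq> 0"
  proof
    assume "res u 1 = 0"
    then have "of_nat CARD('p) ^ 1 dvd u" using p_power_dvd_iff[of 1 u] by simp
    then have "of_nat CARD('p) ^ Suc n dvd x" unfolding u by (auto simp: mult.commute intro: mult_dvd_mono)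
    then show False using k n p_power_dvd_iff[of "Suc n" x] by simp
  qed
  then show ?thesis using that[of u n] u padic_int_unit_iff[of u] by (simp add: mult.commute)
qed

subsection \<open>The field of fractions\<close>

abbreviation unif :: "'p::prime_card padic" ("\<pi>") where "\<pi> \<equiv> of_nat CARD('p)"
abbreviation intg :: "'p::prime_card padic set" ("\<O>") where "\<O> \<equiv> padic_integers"

text \<open>The condition \<open>x \<noteq> 0\<close> is explicit because
  \<open>inverse 0 = 0\<close> is integral as well.\<close>

definition unit_p :: "'p::prime_card padic \<Rightarrow> bool" where
  "unit_p x \<longleftrightarrow> x \<in> \<O> \<and> inverse x \<in> \<O> \<and> x \<noteq> 0"

lemma to_fract_of_nat: "to_fract (of_nat n) = of_nat n"
  by (induction n) auto

lemma to_fract_power: "to_fract (x ^ n) = to_fract x ^ n"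
  by (induction n) auto

lemma unif_nonzero [simp]: "(\<pi> :: 'p::prime_card padic) \<noteq> 0"
proof -
  have "(of_nat CARD('p) :: 'p padic_int) \<noteq> 0"
  proof
    assume "(of_nat CARD('p) :: 'p padic_int) = 0"
    then have "int CARD('p) mod int CARD('p) ^ 2 = 0"
      using res_of_nat[of "CARD('p)" 2, where 'p='p] by (simp add: res_simps)
    then have "CARD('p) ^ 2 dvd CARD('p)" by (metis int_dvd_int_iff mod_0_imp_dvd of_nat_power)
    then show False using CARD_gt_1[where 'p='p] by (auto dest!: dvd_imp_le simp: power2_eq_square)
  qed
  then show ?thesis by (metis to_fract_of_nat to_fract_eq_0_iff)
qed

lemma intg_simps [simp, intro]:
  "0 \<in> \<O>" "1 \<in> \<O>" "x \<in> \<O> \<Longrightarrow> y \<in> \<O> \<Longrightarrow> x + y \<in> \<O>"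
  "x \<in> \<O> \<Longrightarrow> y \<in> \<O> \<Longrightarrow> x - y \<in> \<O>" "x \<in> \<O> \<Longrightarrow> y \<in> \<O> \<Longrightarrow> x * y \<in> \<O>"
  "x \<in> \<O> \<Longrightarrow> - x \<in> \<O>" "x \<in> \<O> \<Longrightarrow> x ^ n \<in> \<O>" "of_nat m \<in> \<O>"
  unfolding padic_integers_def
proof -
  show "0 \<in> range to_fract" "1 \<in> range to_fract"
    by (metis rangeI to_fract_0, metis rangeI to_fract_1)
  show "x \<in> range to_fract \<Longrightarrow> y \<in> range to_fract \<Longrightarrow> x + y \<in> range to_fract"
    "x \<in> range to_fract \<Longrightarrow> y \<in> range to_fract \<Longrightarrow> x - y \<in> range to_fract"
    "x \<in> range to_fract \<Longrightarrow> y \<in> range to_fract \<Longrightarrow> x * y \<in> range to_fract"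
    "x \<in> range to_fract \<Longrightarrow> - x \<in> range to_fract"
    "x \<in> range to_fract \<Longrightarrow> x ^ n \<in> range to_fract"
    by (auto simp flip: to_fract_add to_fract_diff to_fract_mult to_fract_uminus to_fract_power)
  show "of_nat m \<in> range to_fract"
    by (metis rangeI to_fract_of_nat)
qed

lemma intg_sum: "(\<And>i. i \<in> I \<Longrightarrow> f i \<in> \<O>) \<Longrightarrow> sum f I \<in> \<O>"
  by (induction I rule: infinite_finite_induct) auto

lemma intgE: assumes "x \<in> \<O>" obtains y where "x = to_fract y"
  using assms unfolding padic_integers_def by auto

lemma to_fract_intg [simp]: "to_fract x \<in> \<O>"
  unfolding padic_integers_def by auto

lemma unit_p_to_fract: "unit_p (to_fract u) \<longleftrightarrow> u dvd 1"
proof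
  assume "unit_p (to_fract u)"
  then obtain v where v: "inverse (to_fract u) = to_fract v" "to_fract u \<noteq> 0"
    unfolding unit_p_def by (metis intgE)
  then have "to_fract (u * v) = to_fract 1" by (metis right_inverse to_fract_1 to_fract_mult)
  then show "u dvd 1" by (metis dvd_triv_left to_fract_eq_iff)
next
  assume "u dvd 1"
  then obtain v where "1 = u * v" by (auto simp: dvd_def)
  then have uv: "to_fract u * to_fract v = 1" by (metis to_fract_1 to_fract_mult)
  then have "inverse (to_fract u) = to_fract v" by (rule inverse_unique)
  then show "unit_p (to_fract u)" using uv unfolding unit_p_def by auto
qed

lemma unit_p_simps:
  "unit_p 1" "unit_p x \<Longrightarrow> unit_p y \<Longrightarrow> unit_p (x * y)" "unit_p x \<Longrightarrow> unit_p (inverse x)"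
  "unit_p x \<Longrightarrow> unit_p (- x)"
  unfolding unit_p_def by auto

lemma unit_p_intg: "unit_p x \<Longrightarrow> x \<in> \<O>" "unit_p x \<Longrightarrow> inverse x \<in> \<O>" "unit_p x \<Longrightarrow> x \<noteq> 0"
  unfolding unit_p_def by auto

lemma inverse_unif_notin: "inverse (\<pi> :: 'p::prime_card padic) \<notin> \<O>"
proof
  assume "inverse (\<pi> :: 'p padic) \<in> \<O>"
  then have "unit_p (to_fract (of_nat CARD('p) :: 'p padic_int))"
    unfolding unit_p_def to_fract_of_nat by auto
  then show False
    using padic_int_unit_iff[of "of_nat CARD('p) :: 'p padic_int"] unit_p_to_fract
      res_of_nat[of "CARD('p)" 1, where 'p='p] by auto
qed

lemma padic_factor_intg:
  fixes x :: "'p::prime_card padic"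
  assumes "x \<in> \<O>" "x \<noteq> 0" obtains n u where "unit_p u" "x = u * \<pi> ^ n"
proof -
  obtain y where y: "x = to_fract y" using assms intgE by blast
  then have "y \<noteq> 0" using assms by auto
  then obtain u n where u: "u dvd 1" "y = u * of_nat CARD('p) ^ n" by (rule padic_int_factor)
  then show ?thesis
    using that[of "to_fract u" n] y by (simp add: unit_p_to_fract to_fract_power to_fract_of_nat)
qed

lemma padic_factor:
  fixes x :: "'p::prime_card padic"
  assumes "x \<noteq> 0" obtains k u where "unit_p u" "x = u * \<pi> powi k"
proof -
  obtain a b where ab: "x = to_fract a / to_fract b" "b \<noteq> 0"
    by (cases x rule: Fract_cases) (auto simp: Fract_conv_to_fract)
  then have ne: "to_fract a \<noteq> 0" "to_fract b \<noteq> 0" using assms by auto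
  obtain n u where u: "unit_p u" "to_fract a = u * \<pi> ^ n"
    using padic_factor_intg[OF to_fract_intg ne(1)] by metis
  obtain m v where v: "unit_p v" "to_fract b = v * \<pi> ^ m"
    using padic_factor_intg[OF to_fract_intg ne(2)] by metis
  have "x = (u * inverse v) * \<pi> powi (int n - int m)"
    using u v unfolding ab by (simp add: power_int_diff divide_simps unit_p_def)
  then show ?thesis using that u v unit_p_simps by blast
qed

lemma powi_intg_iff: "(\<pi> :: 'p::prime_card padic) powi k \<in> \<O> \<longleftrightarrow> k \<ge> 0"
proof
  assume *: "(\<pi> :: 'p padic) powi k \<in> \<O>"
  show "k \<ge> 0"
  proof (rule ccontr)
    assume "\<not> k \<ge> 0"
    then obtain n where n: "- k = int (Suc n)" by (metis not_le neg_0_less_iff_less zero_less_imp_eq_int gr0_conv_Suc)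
    have "inverse \<pi> = \<pi> powi k * (\<pi> :: 'p padic) ^ n"
    proof -
      have "\<pi> powi k = inverse ((\<pi> :: 'p padic) ^ Suc n)"
        using n by (metis minus_minus power_int_minus power_int_of_nat)
      then show ?thesis by (simp add: field_simps)
    qed
    then show False using inverse_unif_notin[where 'p='p] * by (metis intg_simps(5,7,8))
  qed
qed (auto simp: power_int_def)

lemma unit_mult_intg_iff: "unit_p u \<Longrightarrow> u * x \<in> \<O> \<longleftrightarrow> x \<in> \<O>"
proof
  assume u: "unit_p u" and "u * x \<in> \<O>"
  then have "inverse u * (u * x) \<in> \<O>" unfolding unit_p_def by blast
  then show "x \<in> \<O>" using u unfolding unit_p_def by (simp add: mult.assoc[symmetric])
qed (auto simp: unit_p_def)

lemma padic_factor_unique: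
  fixes u v :: "'p::prime_card padic"
  assumes "unit_p u" "unit_p v" "u * \<pi> powi k = v * \<pi> powi l"
  shows "k = l"
proof -
  have *: "k \<le> l" if "unit_p u" "unit_p v" "u * \<pi> powi k = v * (\<pi> :: 'p padic) powi l" for u v k l
  proof -
    have "\<pi> powi (l - k) = u * inverse v"
      using that by (simp add: power_int_diff field_simps unit_p_def)
    then show ?thesis using powi_intg_iff[of "l - k", where 'p='p] that unit_p_simps(2,3) unit_p_intg(1)
      by (metis diff_ge_0_iff_ge)
  qed
  show ?thesis using *[OF assms] *[OF assms(2,1) assms(3)[symmetric]] by simp
qed

lemma padic_val_eq:
  fixes u :: "'p::prime_card padic"
  assumes "unit_p u" shows "padic_val (u * \<pi> powi k) = k"
  unfolding padic_val_def
proof (rule the_equality)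
  obtain v where "u = to_fract v" using assms unit_p_intg(1) intgE by blast
  then show "\<exists>v. v dvd 1 \<and> u * \<pi> powi k = to_fract v * \<pi> powi k"
    using assms unit_p_to_fract by auto
next
  fix l assume "\<exists>v. v dvd 1 \<and> u * \<pi> powi k = to_fract v * \<pi> powi l"
  then show "l = k" using padic_factor_unique[OF assms] unit_p_to_fract by metis
qed

lemma padic_val_iff:
  fixes x :: "'p::prime_card padic"
  assumes "x \<noteq> 0" shows "padic_val x = int k \<longleftrightarrow> (\<exists>u. unit_p u \<and> x = u * \<pi> ^ k)"
proof -
  obtain u l where u: "unit_p u" "x = u * \<pi> powi l" using padic_factor[OF assms] by blast
  show ?thesis
  proof
    assume "padic_val x = int k"
    then show "\<exists>u. unit_p u \<and> x = u * \<pi> ^ k" using u padic_val_eq by (metis power_int_of_nat)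
  next
    assume "\<exists>u. unit_p u \<and> x = u * \<pi> ^ k"
    then show "padic_val x = int k" using padic_val_eq by (metis power_int_of_nat)
  qed
qed

text \<open>Divisibility by \<open>p^k\<close> is expressed inside the fraction field. It entails
  integrality, and \<open>dvdp 0\<close> is integrality itself.\<close>

definition dvdp :: "nat \<Rightarrow> 'p::prime_card padic \<Rightarrow> bool" where
  "dvdp k x \<longleftrightarrow> x / \<pi> ^ k \<in> \<O>"

lemma dvdpE:
  fixes x :: "'p::prime_card padic"
  assumes "dvdp k x" obtains y where "y \<in> \<O>" "x = \<pi> ^ k * y"
  using assms that[of "x / \<pi> ^ k"] unfolding dvdp_def by simp

lemma dvdp_simps:
  fixes x y :: "'p::prime_card padic"
  shows
  "dvdp 0 x \<longleftrightarrow> x \<in> \<O>" "dvdp k 0" "dvdp k x \<Longrightarrow> dvdp k y \<Longrightarrow> dvdp k (x + y)"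
  "dvdp k x \<Longrightarrow> dvdp k y \<Longrightarrow> dvdp k (x - y)" "dvdp k x \<Longrightarrow> dvdp k (- x)"
  "dvdp k x \<Longrightarrow> y \<in> \<O> \<Longrightarrow> dvdp k (x * y)" "dvdp k x \<Longrightarrow> y \<in> \<O> \<Longrightarrow> dvdp k (y * x)"
  "dvdp k (\<pi> ^ k * x) \<longleftrightarrow> x \<in> \<O>" "dvdp k x \<Longrightarrow> dvdp l y \<Longrightarrow> dvdp (k + l) (x * y)"
proof -
  show 1: "dvdp k (x * y)" if "dvdp k x" "y \<in> \<O>" for k and x y :: "'p padic"
    using intg_simps(5)[of "x / \<pi> ^ k" y] that unfolding dvdp_def by simp
  show "dvdp k x \<Longrightarrow> y \<in> \<O> \<Longrightarrow> dvdp k (y * x)"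
    using 1[of k x y] by (simp add: mult.commute)
  have "x * y / \<pi> ^ (k + l) = (x / \<pi> ^ k) * (y / \<pi> ^ l)"
    by (simp add: power_add)
  then show "dvdp k x \<Longrightarrow> dvdp l y \<Longrightarrow> dvdp (k + l) (x * y)"
    unfolding dvdp_def by (metis intg_simps(5))
qed (auto simp: dvdp_def add_divide_distrib diff_divide_distrib)

lemma dvdp_intg: "dvdp k x \<Longrightarrow> x \<in> \<O>"
  by (erule dvdpE) auto

lemma dvdp_le: "dvdp k x \<Longrightarrow> l \<le> k \<Longrightarrow> dvdp l x"
  unfolding dvdp_def
proof -
  assume a: "x / \<pi> ^ k \<in> \<O>" "l \<le> k"
  then have "x / \<pi> ^ l = x / \<pi> ^ k * \<pi> ^ (k - l)" by (simp add: power_diff field_simps)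
  then show "x / \<pi> ^ l \<in> \<O>" using a by (metis intg_simps(5,7,8))
qed

lemma not_dvdp_1_iff: "x \<in> \<O> \<Longrightarrow> \<not> dvdp 1 x \<longleftrightarrow> unit_p (x :: 'p::prime_card padic)"
proof
  assume x: "x \<in> \<O>" "\<not> dvdp 1 x"
  then have "x \<noteq> 0" using dvdp_simps(2) by auto
  then obtain n u where u: "unit_p u" "x = u * \<pi> ^ n" using padic_factor_intg x by blast
  have "n = 0"
  proof (rule ccontr)
    assume "n \<noteq> 0"
    then obtain m where "n = Suc m" by (cases n) auto
    then have "x = \<pi> ^ 1 * (u * \<pi> ^ m)" using u by simp
    then show False using x u unit_p_intg dvdp_simps(8) by (metis intg_simps(5,7,8))
  qed
  then show "unit_p x" using u by simp
next
  assume "unit_p x"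
  then show "\<not> dvdp 1 x"
    unfolding dvdp_def using inverse_unif_notin[where 'p='p] unit_mult_intg_iff[of x "inverse \<pi>"]
    by (simp add: divide_inverse)
qed

lemma unit_dvdp_iff: "unit_p u \<Longrightarrow> dvdp k (u * x) \<longleftrightarrow> dvdp k x"
  unfolding dvdp_def using unit_mult_intg_iff[of u "x / \<pi> ^ k"] by simp

text \<open>The residue is meant for integral elements only; these have a unique preimage under
  \<open>to_fract\<close>.\<close>

definition resf :: "nat \<Rightarrow> 'p::prime_card padic \<Rightarrow> int" where
  "resf k x = res (THE y. x = to_fract y) k"

lemma resf_to_fract: "resf k (to_fract y) = res y k"
  unfolding resf_def by simp

lemma resf_bounds: "x \<in> \<O> \<Longrightarrow> 0 \<le> resf k x" "x \<in> \<O> \<Longrightarrow> resf k (x :: 'p::prime_card padic) < int CARD('p) ^ k"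
  by (auto elim!: intgE simp: resf_to_fract res_bounds)

lemma resf_add:
  "x \<in> \<O> \<Longrightarrow> y \<in> \<O> \<Longrightarrow> resf k (x + y) = (resf k x + resf k (y :: 'p::prime_card padic)) mod int CARD('p) ^ k"
  by (auto elim!: intgE simp: resf_to_fract res_simps simp flip: to_fract_add)

lemma dvdp_to_fract: "dvdp k (to_fract y) \<longleftrightarrow> of_nat CARD('p) ^ k dvd (y :: 'p::prime_card padic_int)"
proof
  assume "dvdp k (to_fract y)"
  then obtain z where z: "z \<in> \<O>" "to_fract y = \<pi> ^ k * z" by (rule dvdpE)
  then obtain w where "z = to_fract w" by (metis intgE)
  then have "to_fract y = to_fract (of_nat CARD('p) ^ k * w)"
    using z by (simp add: to_fract_power to_fract_of_nat)
  then show "of_nat CARD('p) ^ k dvd y" by (metis dvd_triv_left to_fract_eq_iff)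
qed (auto simp: dvd_def to_fract_power to_fract_of_nat dvdp_simps)

lemma resf_eq_0_iff: "x \<in> \<O> \<Longrightarrow> resf k (x :: 'p::prime_card padic) = 0 \<longleftrightarrow> dvdp k x"
  by (auto elim!: intgE simp: resf_to_fract p_power_dvd_iff dvdp_to_fract)

lemma resf_of_nat: "resf k (of_nat n :: 'p::prime_card padic) = int n mod int CARD('p) ^ k"
  by (metis resf_to_fract res_of_nat to_fract_of_nat)

lemma resf_eq_iff:
  fixes x :: "'p::prime_card padic"
  assumes "x \<in> \<O>" "y \<in> \<O>"
  shows "resf k x = resf k y \<longleftrightarrow> dvdp k (x - y)"
proof -
  have m: "resf k x mod int CARD('p) ^ k = resf k x" "resf k y mod int CARD('p) ^ k = resf k y"
    using assms by (auto simp: resf_bounds)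
  have eq: "resf k x = (resf k (x - y) + resf k y) mod int CARD('p) ^ k"
    using resf_add[of "x - y" y k] assms by simp
  have "dvdp k (x - y) \<longleftrightarrow> resf k (x - y) = 0" using resf_eq_0_iff[of "x - y" k] assms by simp
  also have "\<dots> \<longleftrightarrow> resf k x = resf k y"
  proof
    assume "resf k x = resf k y"
    then have "(resf k (x - y) + resf k y) mod int CARD('p) ^ k = resf k y mod int CARD('p) ^ k"
      using eq m by simp
    then have "int CARD('p) ^ k dvd resf k (x - y)" by (metis add_diff_cancel_right' mod_eq_dvd_iff)
    then show "resf k (x - y) = 0"
      using resf_bounds[of "x - y" k] assms zdvd_not_zless[of "resf k (x - y)" "int CARD('p) ^ k"]
      by (metis intg_simps(4) order_le_less)
  qed (use eq m in simp)
  finally show ?thesis by simp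
qed

subsection \<open>The symplectic form and the similitude group\<close>

definition om :: "('p::prime_card, 'n::finite) sp_vec \<Rightarrow> ('p, 'n) sp_vec \<Rightarrow> 'p padic" where
  "om x y = (\<Sum>i\<in>UNIV. x $ Inl i * y $ Inr i - x $ Inr i * y $ Inl i)"

lemma om_linear:
  "om (x + y) z = om x z + om y z" "om (x - y) z = om x z - om y z" "om (c *s x) z = c * om x z"
  "om z (x + y) = om z x + om z y" "om z (x - y) = om z x - om z y" "om z (c *s x) = c * om z x"
  "om 0 z = 0" "om z 0 = 0"
  unfolding om_def by (auto simp: sum_distrib_left algebra_simps sum.distrib sum_subtractf)

lemma om_swap: "om y x = - om x y"
  unfolding om_def by (simp add: sum_negf[symmetric] algebra_simps)

lemma om_self [simp]: "om x x = 0"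
  unfolding om_def by (simp add: algebra_simps)

lemma sum_plus_UNIV:
  fixes f :: "'m::finite + 'n::finite \<Rightarrow> 'a::comm_monoid_add"
  shows "(\<Sum>k\<in>UNIV. f k) = (\<Sum>i\<in>UNIV. f (Inl i)) + (\<Sum>i\<in>UNIV. f (Inr i))"
  using sum.Plus[of "UNIV :: 'm set" "UNIV :: 'n set" f] by (simp add: UNIV_Plus_UNIV comp_def)

lemma sp_J_component:
  "(sp_J *v y) $ Inl i = y $ Inr i" "(sp_J *v y) $ Inr i = - y $ Inl (i :: 'n::finite)"
  unfolding matrix_vector_mult_def sp_J_def
  by (simp_all add: sum_plus_UNIV if_distrib if_distribR cong: if_cong)

lemma om_eq_sp_J: "om x y = (\<Sum>k\<in>UNIV. x $ k * (sp_J *v y) $ k)"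
  by (simp add: sum_plus_UNIV sp_J_component om_def sum_subtractf sum_negf)

lemma sum_transpose_mult:
  fixes A :: "'a::comm_ring_1 ^ 'n::finite ^ 'm::finite"
  shows "(\<Sum>k\<in>UNIV. x $ k * (transpose A *v y) $ k) = (\<Sum>k\<in>UNIV. (A *v x) $ k * y $ k)"
  unfolding matrix_vector_mult_def transpose_def
  by (simp add: sum_distrib_left sum_distrib_right) (subst sum.swap, simp add: mult_ac)

lemma vec_eq_iff_dot:
  fixes u v :: "'a::comm_ring_1 ^ 'n::finite"
  shows "u = v \<longleftrightarrow> (\<forall>x. (\<Sum>k\<in>UNIV. x $ k * u $ k) = (\<Sum>k\<in>UNIV. x $ k * v $ k))"
proof
  assume *: "\<forall>x. (\<Sum>k\<in>UNIV. x $ k * u $ k) = (\<Sum>k\<in>UNIV. x $ k * v $ k)"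
  have "(\<Sum>k\<in>UNIV. axis i 1 $ k * w $ k) = w $ i" for i and w :: "'a ^ 'n"
    by (simp add: axis_def if_distrib if_distribR cong: if_cong)
  then show "u = v" using * by (metis vec_eq_iff)
qed auto

lemma mat_mult_vec: "mat c *v x = c *s (x :: 'a::comm_ring_1 ^ 'n::finite)"
  by (simp add: vec_eq_iff matrix_vector_mult_def mat_def if_distrib if_distribR cong: if_cong)

lemma similitude_iff:
  fixes g :: "('p::prime_card, 'n::finite) sp_mat"
  shows "transpose g ** sp_J ** g = mat \<mu> ** sp_J \<longleftrightarrow> (\<forall>x y. om (g *v x) (g *v y) = \<mu> * om x y)"
proof -
  have "transpose g ** sp_J ** g = mat \<mu> ** sp_J
    \<longleftrightarrow> (\<forall>y. transpose g *v (sp_J *v (g *v y)) = \<mu> *s (sp_J *v y))"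
    by (simp add: matrix_eq matrix_vector_mul_assoc[symmetric] mat_mult_vec del: transpose_matrix_vector)
  also have "\<dots> \<longleftrightarrow> (\<forall>y x. om (g *v x) (g *v y) = \<mu> * om x y)"
    unfolding vec_eq_iff_dot
    by (simp add: sum_transpose_mult om_eq_sp_J sum_distrib_left mult_ac del: transpose_matrix_vector)
  finally show ?thesis by blast
qed

lemma om_axis:
  "om (axis (Inl i) 1) y = y $ Inr i" "om (axis (Inr i) 1) y = - y $ Inl i"
  unfolding om_def axis_def by (simp_all add: if_distrib if_distribR sum_negf cong: if_cong)

lemma om_nondegenerate: "(\<And>y. om x y = 0) \<Longrightarrow> x = 0"
proof -
  assume *: "\<And>y. om x y = 0"
  have "om y x = 0" for y using *[of y] om_swap[of y x] by simp
  then have "x $ Inl i = 0" "x $ Inr i = 0" for i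
    using om_axis(2)[of i x] om_axis(1)[of i x] by simp_all
  then have "x $ k = 0" for k by (cases k) auto
  then show "x = 0" by (simp add: vec_eq_iff)
qed

lemma multiplierI:
  fixes g :: "('p::prime_card, 'n::finite) sp_mat"
  assumes "\<And>x y. om (g *v x) (g *v y) = \<mu> * om x y" shows "multiplier g = \<mu>"
  unfolding multiplier_def similitude_iff
proof (rule the_equality)
  fix \<nu> assume *: "\<forall>x y. om (g *v x) (g *v y) = \<nu> * om x y"
  have "\<nu> * om x y = \<mu> * om x y" for x y :: "('p, 'n) sp_vec"
    using trans[OF sym[OF spec[OF spec[OF *, of x], of y]] assms[of x y]] .
  from this[of "axis (Inl undefined) 1" "axis (Inr undefined) 1"] show "\<nu> = \<mu>"
    by (simp add: om_axis)
qed (use assms in auto)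

text \<open>Invertibility comes for free: the form is nondegenerate, so a map that scales it by a
  nonzero factor has trivial kernel.\<close>

lemma GSpI:
  fixes g :: "('p::prime_card, 'n::finite) sp_mat"
  assumes "\<And>x y. om (g *v x) (g *v y) = \<mu> * om x y" "\<mu> \<noteq> 0"
  shows "g \<in> carrier GSp" "multiplier g = \<mu>"
proof -
  have "x = 0" if "g *v x = 0" for x
  proof (rule om_nondegenerate)
    fix y show "om x y = 0" using assms(1)[of x y] assms(2) that by (simp add: om_linear)
  qed
  then have "invertible g" by (simp add: invertible_left_inverse matrix_left_invertible_ker)
  then show "g \<in> carrier GSp" using assms similitude_iff[of g \<mu>] unfolding GSp_def by auto
  show "multiplier g = \<mu>" using assms multiplierI by blast
qed

lemma GSpD:
  fixes g :: "('p::prime_card, 'n::finite) sp_mat"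
  assumes "g \<in> carrier GSp"
  shows "om (g *v x) (g *v y) = multiplier g * om x y" "multiplier g \<noteq> 0" "invertible g"
proof -
  obtain \<mu> where \<mu>: "\<mu> \<noteq> 0" "transpose g ** sp_J ** g = mat \<mu> ** sp_J"
    using assms unfolding GSp_def by auto
  then have "\<forall>x y. om (g *v x) (g *v y) = \<mu> * om x y" by (simp add: similitude_iff)
  then show "om (g *v x) (g *v y) = multiplier g * om x y" "multiplier g \<noteq> 0"
    using multiplierI \<mu>(1) by metis+
  show "invertible g" using assms unfolding GSp_def by auto
qed

lemma GSp_simps [simp]: "x \<otimes>\<^bsub>GSp\<^esub> y = x ** y" "\<one>\<^bsub>GSp\<^esub> = mat 1"
  unfolding GSp_def by auto

lemma GSp_one: "mat 1 \<in> carrier GSp" "multiplier (mat 1) = 1"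
  using GSpI[of "mat 1" 1] by auto

lemma GSp_mult:
  assumes "g \<in> carrier GSp" "h \<in> carrier GSp"
  shows "g ** h \<in> carrier GSp" "multiplier (g ** h) = multiplier g * multiplier h"
  using GSpI[of "g ** h" "multiplier g * multiplier h"] assms
  by (simp_all add: matrix_vector_mul_assoc[symmetric] GSpD)

lemma GSp_scalar:
  assumes "c \<noteq> 0" shows "mat c \<in> carrier GSp" "multiplier (mat c) = c ^ 2"
  using GSpI[of "mat c" "c ^ 2"] assms by (auto simp: mat_mult_vec om_linear power2_eq_square mult.assoc)

lemma GSp_group: "group GSp"
proof (rule groupI)
  fix g :: "('p::prime_card, 'n::finite) sp_mat" assume g: "g \<in> carrier GSp"
  then obtain h where h: "g ** h = mat 1" "h ** g = mat 1" using GSpD(3) invertible_def by blast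
  have "om (h *v x) (h *v y) = inverse (multiplier g) * om x y" for x y
  proof -
    have "om x y = om (g *v (h *v x)) (g *v (h *v y))" using h by (simp add: matrix_vector_mul_assoc)
    then show ?thesis using g GSpD(2) by (simp add: GSpD)
  qed
  then have "h \<in> carrier GSp" using GSpI GSpD(2)[OF g] by (metis nonzero_imp_inverse_nonzero)
  then show "\<exists>h\<in>carrier GSp. h \<otimes>\<^bsub>GSp\<^esub> g = \<one>\<^bsub>GSp\<^esub>" using h by auto
qed (auto simp: GSp_one GSp_mult matrix_mul_assoc)

interpretation GSp: group "GSp :: ('p::prime_card, 'n::finite) sp_mat monoid" by (rule GSp_group)

abbreviation ginv :: "('p::prime_card, 'n::finite) sp_mat \<Rightarrow> ('p, 'n) sp_mat" where
  "ginv g \<equiv> inv\<^bsub>GSp\<^esub> g"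

lemma ginv:
  assumes "g \<in> carrier GSp"
  shows "g ** ginv g = mat 1" "ginv g ** g = mat 1" "g *v (ginv g *v x) = x" "ginv g *v (g *v x) = x"
    "ginv g \<in> carrier GSp" "multiplier (ginv g) = inverse (multiplier g)"
proof -
  show 1: "g ** ginv g = mat 1" "ginv g ** g = mat 1"
    using GSp.r_inv[OF assms] GSp.l_inv[OF assms] by auto
  then show "g *v (ginv g *v x) = x" "ginv g *v (g *v x) = x"
    by (simp_all add: matrix_vector_mul_assoc)
  show 2: "ginv g \<in> carrier GSp" using assms by simp
  have "multiplier g * multiplier (ginv g) = 1"
    using GSp_mult(2)[OF assms 2] 1 GSp_one(2) by metis
  then show "multiplier (ginv g) = inverse (multiplier g)" by (metis inverse_unique)
qed

subsection \<open>Integral vectors and lattices\<close>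

abbreviation \<M> :: "('p::prime_card, 'n::finite) sp_vec set" where "\<M> \<equiv> integral_vecs"

lemma M_simps [simp, intro]:
  "0 \<in> \<M>" "x \<in> \<M> \<Longrightarrow> y \<in> \<M> \<Longrightarrow> x + y \<in> \<M>" "x \<in> \<M> \<Longrightarrow> y \<in> \<M> \<Longrightarrow> x - y \<in> \<M>"
  "x \<in> \<M> \<Longrightarrow> - x \<in> \<M>" "c \<in> \<O> \<Longrightarrow> x \<in> \<M> \<Longrightarrow> c *s x \<in> \<M>" "axis i 1 \<in> \<M>"
  unfolding integral_vecs_def by (auto simp: axis_def)

lemma om_intg: "x \<in> \<M> \<Longrightarrow> y \<in> \<M> \<Longrightarrow> om x y \<in> \<O>"
  unfolding om_def integral_vecs_def by (auto intro!: intg_sum)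

definition pM :: "nat \<Rightarrow> ('p::prime_card, 'n::finite) sp_vec set" where
  "pM k = {x. \<forall>i. dvdp k (x $ i)}"

lemma pM_simps:
  "0 \<in> pM k" "x \<in> pM k \<Longrightarrow> y \<in> pM k \<Longrightarrow> x + y \<in> pM k" "x \<in> pM k \<Longrightarrow> y \<in> pM k \<Longrightarrow> x - y \<in> pM k"
  "x \<in> pM k \<Longrightarrow> - x \<in> pM k" "c \<in> \<O> \<Longrightarrow> x \<in> pM k \<Longrightarrow> c *s x \<in> pM k" "pM 0 = \<M>"
  "\<pi> ^ k *s x \<in> pM k \<longleftrightarrow> x \<in> \<M>"
  unfolding pM_def integral_vecs_def by (auto simp: dvdp_simps)

lemma pM_sub_M: "pM k \<subseteq> \<M>"
  unfolding pM_def integral_vecs_def by (auto intro: dvdp_intg)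

lemma pM_mono: "l \<le> k \<Longrightarrow> pM k \<subseteq> pM l"
  unfolding pM_def by (auto intro: dvdp_le)

lemma pME:
  assumes "x \<in> pM k" obtains y where "y \<in> \<M>" "x = \<pi> ^ k *s y"
proof -
  have "x = \<pi> ^ k *s (inverse (\<pi> ^ k) *s x)" by (simp add: vector_smult_assoc)
  then show ?thesis using that assms by (metis pM_simps(7))
qed

lemma om_pM: "x \<in> pM k \<Longrightarrow> y \<in> \<M> \<Longrightarrow> dvdp k (om x y)" "x \<in> \<M> \<Longrightarrow> y \<in> pM k \<Longrightarrow> dvdp k (om x y)"
  by (auto elim!: pME simp: om_linear dvdp_simps om_intg)

text \<open>The form is unimodular on \<M>: pairing with the standard basis vectors returns the
  coordinates up to sign.\<close>

lemma pM_iff_om: "x \<in> pM k \<longleftrightarrow> (\<forall>y\<in>\<M>. dvdp k (om y x))"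
proof
  assume *: "\<forall>y\<in>\<M>. dvdp k (om y x)"
  have "dvdp k (x $ i)" for i
  proof (cases i)
    case (Inl a)
    then show ?thesis using *[rule_format, of "axis (Inr a) 1"] dvdp_simps(5)[of k "- x $ i"]
      by (simp add: om_axis)
  next
    case (Inr a)
    then show ?thesis using *[rule_format, of "axis (Inl a) 1"] by (simp add: om_axis)
  qed
  then show "x \<in> pM k" unfolding pM_def by auto
qed (auto intro: om_pM)

lemma M_iff_om: "x \<in> \<M> \<longleftrightarrow> (\<forall>y\<in>\<M>. om y x \<in> \<O>)"
  using pM_iff_om[of x 0] by (simp add: dvdp_simps pM_simps)

lemma unit_smult_M: "unit_p u \<Longrightarrow> u *s x \<in> \<M> \<longleftrightarrow> x \<in> \<M>"
  unfolding integral_vecs_def by (simp add: unit_mult_intg_iff)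

lemma unit_smult_pM: "unit_p u \<Longrightarrow> u *s x \<in> pM k \<longleftrightarrow> x \<in> pM k"
  unfolding pM_def by (simp add: unit_dvdp_iff)

lemma integral_mats_iff: "g \<in> integral_mats \<longleftrightarrow> (\<forall>x\<in>\<M>. g *v x \<in> \<M>)"
proof
  assume "g \<in> integral_mats"
  then show "\<forall>x\<in>\<M>. g *v x \<in> \<M>"
    unfolding integral_mats_def integral_vecs_def matrix_vector_mult_def by (auto intro!: intg_sum)
next
  assume *: "\<forall>x\<in>\<M>. g *v x \<in> \<M>"
  have "(g *v axis j 1) $ i = g $ i $ j" for i j
    by (simp add: matrix_vector_mult_def axis_def if_distrib if_distribR cong: if_cong)
  moreover have "(g *v axis j 1) $ i \<in> \<O>" for i j
    using * M_simps(6)[of j] unfolding integral_vecs_def by blast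
  ultimately show "g \<in> integral_mats" unfolding integral_mats_def by simp
qed

lemma Delta_iff: "g \<in> GSp_Delta \<longleftrightarrow> g \<in> carrier GSp \<and> (\<forall>x\<in>\<M>. g *v x \<in> \<M>)"
  unfolding GSp_Delta_def by (auto simp: integral_mats_iff)

lemma Gamma_iff: "g \<in> GSp_Gamma \<longleftrightarrow> g \<in> carrier GSp \<and> (\<forall>x. g *v x \<in> \<M> \<longleftrightarrow> x \<in> \<M>)"
proof
  assume g: "g \<in> GSp_Gamma"
  then obtain h where h: "h \<in> integral_mats" "h ** g = mat 1" "g \<in> integral_mats" "g \<in> carrier GSp"
    unfolding GSp_Gamma_def by auto
  have "x = h *v (g *v x)" for x using h(2) by (simp add: matrix_vector_mul_assoc)
  then show "g \<in> carrier GSp \<and> (\<forall>x. g *v x \<in> \<M> \<longleftrightarrow> x \<in> \<M>)"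
    using h unfolding integral_mats_iff by metis
next
  assume g: "g \<in> carrier GSp \<and> (\<forall>x. g *v x \<in> \<M> \<longleftrightarrow> x \<in> \<M>)"
  then have "g \<in> integral_mats" "ginv g \<in> integral_mats"
    using ginv[of g] unfolding integral_mats_iff by metis+
  then show "g \<in> GSp_Gamma" using g ginv[of g] unfolding GSp_Gamma_def by blast
qed

lemma Gamma_Delta: "g \<in> GSp_Gamma \<Longrightarrow> g \<in> GSp_Delta"
  unfolding Gamma_iff Delta_iff by auto

lemma Delta_GSp: "g \<in> GSp_Delta \<Longrightarrow> g \<in> carrier GSp"
  unfolding Delta_iff by auto

lemma Gamma_GSp: "g \<in> GSp_Gamma \<Longrightarrow> g \<in> carrier GSp"
  unfolding Gamma_iff by auto

lemma multiplier_intg: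
  fixes g :: "('p::prime_card, 'n::finite) sp_mat"
  assumes "g \<in> GSp_Delta" shows "multiplier g \<in> \<O>"
proof -
  let ?e = "axis (Inl undefined) 1 :: ('p, 'n) sp_vec" and ?f = "axis (Inr undefined) 1 :: ('p, 'n) sp_vec"
  have "om (g *v ?e) (g *v ?f) = multiplier g"
    using GSpD(1)[OF Delta_GSp[OF assms]] by (simp add: om_axis)
  then show ?thesis using assms om_intg Delta_iff M_simps(6) by metis
qed

text \<open>An integral similitude with unit multiplier has an integral inverse because \<M> is
  self-dual: \<open>x\<close> is tested by \<open>om y x\<close>, which agrees with
  \<open>om (g *v y) (g *v x)\<close> up to a unit. Determinants do not enter.\<close>

lemma Gamma_iff_unit: "g \<in> GSp_Gamma \<longleftrightarrow> g \<in> GSp_Delta \<and> unit_p (multiplier g)"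
proof
  assume g: "g \<in> GSp_Gamma"
  then have "ginv g \<in> GSp_Delta" using ginv[of g] unfolding Gamma_iff Delta_iff by metis
  then show "g \<in> GSp_Delta \<and> unit_p (multiplier g)"
    using g multiplier_intg[of g] multiplier_intg[of "ginv g"] Gamma_Delta Gamma_GSp ginv(6) GSpD(2)
    unfolding unit_p_def by metis
next
  assume g: "g \<in> GSp_Delta \<and> unit_p (multiplier g)"
  have "x \<in> \<M>" if "g *v x \<in> \<M>" for x
    unfolding M_iff_om
  proof
    fix y :: "('a, 'b) sp_vec" assume "y \<in> \<M>"
    then have "om (g *v y) (g *v x) \<in> \<O>" using g that om_intg Delta_iff by blast
    then show "om y x \<in> \<O>" using g by (simp add: GSpD Delta_GSp unit_mult_intg_iff)
  qed
  then show "g \<in> GSp_Gamma" using g unfolding Gamma_iff Delta_iff by blast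
qed

lemma Gamma_subgroup: "subgroup GSp_Gamma GSp"
proof (rule GSp.subgroupI)
  show "GSp_Gamma \<subseteq> carrier GSp" using Gamma_GSp by auto
  show "GSp_Gamma \<noteq> {}" using GSp_one(1) Gamma_iff[of "mat 1"] by auto
  show "g \<otimes>\<^bsub>GSp\<^esub> h \<in> GSp_Gamma" if "g \<in> GSp_Gamma" "h \<in> GSp_Gamma" for g h
    using that by (simp add: Gamma_iff GSp_mult matrix_vector_mul_assoc[symmetric])
  show "ginv g \<in> GSp_Gamma" if g: "g \<in> GSp_Gamma" for g
  proof -
    note gg = Gamma_GSp[OF g]
    have "ginv g *v x \<in> \<M> \<longleftrightarrow> x \<in> \<M>" for x
      using g ginv(3)[OF gg, of x] Gamma_iff[of g] by metis
    then show ?thesis using ginv(5)[OF gg] Gamma_iff by blast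
  qed
qed

lemma Gamma_closed:
  "mat 1 \<in> GSp_Gamma" "g \<in> GSp_Gamma \<Longrightarrow> h \<in> GSp_Gamma \<Longrightarrow> g ** h \<in> GSp_Gamma"
  "g \<in> GSp_Gamma \<Longrightarrow> ginv g \<in> GSp_Gamma"
  using Gamma_subgroup subgroup.one_closed subgroup.m_closed subgroup.m_inv_closed by (metis GSp_simps)+

lemma Delta_mult: "g \<in> GSp_Delta \<Longrightarrow> h \<in> GSp_Delta \<Longrightarrow> g ** h \<in> GSp_Delta"
  unfolding Delta_iff by (auto simp: GSp_mult matrix_vector_mul_assoc[symmetric])

text \<open>This is the valuation of the multiplier as a natural number. It is stated as a relation,
  so that nothing is asserted about similitudes whose multiplier is not integral.\<close>

definition level :: "('p::prime_card, 'n::finite) sp_mat \<Rightarrow> nat \<Rightarrow> bool" where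
  "level g k \<longleftrightarrow> (\<exists>u. unit_p u \<and> multiplier g = u * \<pi> ^ k)"

lemma level_iff_val: "g \<in> carrier GSp \<Longrightarrow> level g k \<longleftrightarrow> padic_val (multiplier g) = int k"
  unfolding level_def using padic_val_iff GSpD(2) by blast

lemma level_exists: "g \<in> GSp_Delta \<Longrightarrow> \<exists>k. level g k"
  unfolding level_def using padic_factor_intg multiplier_intg GSpD(2) Delta_GSp by metis

lemma level_unique: "level g k \<Longrightarrow> level g l \<Longrightarrow> k = l"
  unfolding level_def using padic_factor_unique by (metis of_nat_eq_iff power_int_of_nat)

lemma level_mult:
  "g \<in> carrier GSp \<Longrightarrow> h \<in> carrier GSp \<Longrightarrow> level g k \<Longrightarrow> level h l \<Longrightarrow> level (g ** h) (k + l)"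
  unfolding level_def
proof (elim exE conjE)
  fix u v assume *: "g \<in> carrier GSp" "h \<in> carrier GSp" "unit_p u" "multiplier g = u * \<pi> ^ k" "unit_p v" "multiplier h = v * \<pi> ^ l"
  then show "\<exists>w. unit_p w \<and> multiplier (g ** h) = w * \<pi> ^ (k + l)"
    using unit_p_simps(2)[of u v] by (intro exI[of _ "u * v"]) (simp add: GSp_mult power_add)
qed

lemma level_0_iff: "g \<in> GSp_Delta \<Longrightarrow> level g 0 \<longleftrightarrow> g \<in> GSp_Gamma"
  unfolding level_def Gamma_iff_unit by auto

lemma dvdp_multiplier: "level g k \<Longrightarrow> dvdp k (multiplier g * x) \<longleftrightarrow> x \<in> \<O>"
  unfolding level_def by (auto simp: mult.assoc unit_dvdp_iff dvdp_simps)

definition lat :: "('p::prime_card, 'n::finite) sp_mat \<Rightarrow> ('p, 'n) sp_vec set" where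
  "lat g = (*v) g ` \<M>"

lemma lat_iff: "g \<in> carrier GSp \<Longrightarrow> x \<in> lat g \<longleftrightarrow> ginv g *v x \<in> \<M>"
  unfolding lat_def using ginv by (metis (no_types, lifting) image_iff)

text \<open>The lattice \<open>g\<M>\<close> is its own dual with respect to the form divided by
  \<open>p^k\<close>, because \<M> is self-dual and \<open>g\<close> scales the form by a unit times
  \<open>p^k\<close>. This property replaces elementary divisors throughout.\<close>

lemma lat_iff_om:
  assumes "g \<in> carrier GSp" "level g k"
  shows "x \<in> lat g \<longleftrightarrow> (\<forall>y\<in>lat g. dvdp k (om y x))"
proof -
  have "om (g *v y) x = multiplier g * om y (ginv g *v x)" for y
    using GSpD(1)[OF assms(1), of y "ginv g *v x"] ginv(3)[OF assms(1)] by simp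
  then have "dvdp k (om (g *v y) x) \<longleftrightarrow> om y (ginv g *v x) \<in> \<O>" for y
    using dvdp_multiplier[OF assms(2)] by simp
  then show ?thesis using lat_iff[OF assms(1)] M_iff_om[of "ginv g *v x"] unfolding lat_def by auto
qed

lemma lat_closed:
  "0 \<in> lat g" "x \<in> lat g \<Longrightarrow> y \<in> lat g \<Longrightarrow> x + y \<in> lat g" "x \<in> lat g \<Longrightarrow> y \<in> lat g \<Longrightarrow> x - y \<in> lat g"
  "c \<in> \<O> \<Longrightarrow> x \<in> lat g \<Longrightarrow> c *s x \<in> lat g" "x \<in> lat g \<Longrightarrow> - x \<in> lat g"
proof -
  show 1: "0 \<in> lat g" unfolding lat_def by (force intro: image_eqI[of _ _ 0])
  show "x \<in> lat g \<Longrightarrow> y \<in> lat g \<Longrightarrow> x + y \<in> lat g" "c \<in> \<O> \<Longrightarrow> x \<in> lat g \<Longrightarrow> c *s x \<in> lat g"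
    unfolding lat_def
    by (auto simp: matrix_vector_right_distrib[symmetric] vector_scalar_commute[symmetric])
  show 2: "x - y \<in> lat g" if "x \<in> lat g" "y \<in> lat g" for x y
    using that unfolding lat_def by (auto simp: matrix_vector_mult_diff_distrib[symmetric])
  show "x \<in> lat g \<Longrightarrow> - x \<in> lat g" using 2[OF 1, of x] by simp
qed

lemma lat_sub_M: "g \<in> GSp_Delta \<Longrightarrow> lat g \<subseteq> \<M>"
  unfolding lat_def Delta_iff by auto

lemma pM_sub_lat: "g \<in> GSp_Delta \<Longrightarrow> level g k \<Longrightarrow> pM k \<subseteq> lat g"
  using lat_iff_om[OF Delta_GSp, of g k] lat_sub_M om_pM(2) by blast

lemma lat_mult_Gamma: "h \<in> GSp_Gamma \<Longrightarrow> lat (g ** h) = lat g"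
proof -
  assume h: "h \<in> GSp_Gamma"
  have "x \<in> (*v) h ` \<M>" if "x \<in> \<M>" for x
  proof (rule image_eqI)
    show "x = h *v (ginv h *v x)" using ginv(3)[OF Gamma_GSp[OF h], of x] by simp
    then show "ginv h *v x \<in> \<M>" using h that Gamma_iff[of h] by metis
  qed
  then have "(*v) h ` \<M> = \<M>" using h Gamma_iff[of h] by auto
  then have "(*v) g ` ((*v) h ` \<M>) = lat g" unfolding lat_def by simp
  then show ?thesis unfolding lat_def by (simp add: image_image matrix_vector_mul_assoc)
qed

text \<open>Together with \<open>lat_mult_Gamma\<close> this identifies left cosets of \<Gamma> with
  lattices.\<close>

lemma lat_eq_imp:
  assumes "g \<in> carrier GSp" "h \<in> carrier GSp" "lat g = lat h"
  shows "ginv g ** h \<in> GSp_Gamma"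
proof -
  have "(ginv g ** h) *v x \<in> \<M> \<longleftrightarrow> x \<in> \<M>" for x
  proof -
    have "(ginv g ** h) *v x \<in> \<M> \<longleftrightarrow> h *v x \<in> lat g"
      using lat_iff[OF assms(1)] by (simp add: matrix_vector_mul_assoc[symmetric])
    also have "\<dots> \<longleftrightarrow> x \<in> \<M>" using assms lat_iff ginv by metis
    finally show ?thesis .
  qed
  then show ?thesis using assms unfolding Gamma_iff by (simp add: GSp_mult)
qed

lemma lat_subset_iff:
  assumes "g \<in> carrier GSp" "h \<in> carrier GSp"
  shows "ginv g ** h \<in> GSp_Delta \<longleftrightarrow> lat h \<subseteq> lat g"
  using assms lat_iff[OF assms(1)] unfolding Delta_iff
  by (auto simp: lat_def GSp_mult matrix_vector_mul_assoc[symmetric])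

lemma lat_eq_M_iff: "g \<in> carrier GSp \<Longrightarrow> lat g = \<M> \<longleftrightarrow> g \<in> GSp_Gamma"
proof -
  assume g: "g \<in> carrier GSp"
  have 1: "lat (mat 1) = \<M>" unfolding lat_def by simp
  have "lat g = \<M> \<Longrightarrow> g \<in> GSp_Gamma"
    using lat_eq_imp[OF GSp_one(1) g] 1 ginv(2)[OF GSp_one(1)] by (metis matrix_mul_lid matrix_mul_rid)
  then show ?thesis using lat_mult_Gamma[of g "mat 1"] 1 by auto
qed

subsection \<open>Residue vectors and characters\<close>

text \<open>A fixed box of representatives of \<M> modulo \<open>p^k\<close>, so that counting
  residue classes becomes counting a finite set of vectors. The box is not closed under addition;
  translations are followed by \<open>red\<close>.\<close>

definition Rk :: "nat \<Rightarrow> ('p::prime_card, 'n::finite) sp_vec set" where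
  "Rk k = {v. \<forall>i. v $ i \<in> of_nat ` {..<CARD('p) ^ k}}"

definition red :: "nat \<Rightarrow> ('p::prime_card, 'n::finite) sp_vec \<Rightarrow> ('p, 'n) sp_vec" where
  "red k x = (\<chi> i. of_nat (nat (resf k (x $ i))))"

lemma card_vec_prod:
  fixes S :: "'i::finite \<Rightarrow> 'a set"
  assumes "\<And>i. finite (S i)"
  shows "finite {v :: 'a ^ 'i. \<forall>i. v $ i \<in> S i}" "card {v :: 'a ^ 'i. \<forall>i. v $ i \<in> S i} = (\<Prod>i\<in>UNIV. card (S i))"
proof -
  have b: "bij_betw vec_nth {v :: 'a ^ 'i. \<forall>i. v $ i \<in> S i} (PiE UNIV S)"
    by (rule bij_betw_byWitness[where f' = vec_lambda]) (auto simp: vec_lambda_inverse)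
  show "card {v :: 'a ^ 'i. \<forall>i. v $ i \<in> S i} = (\<Prod>i\<in>UNIV. card (S i))"
    using bij_betw_same_card[OF b] by (simp add: card_PiE)
  show "finite {v :: 'a ^ 'i. \<forall>i. v $ i \<in> S i}"
    using bij_betw_finite[OF b] assms by (simp add: finite_PiE)
qed

lemma of_nat_eq_level:
  assumes "m < CARD('p) ^ k" "n < CARD('p) ^ k" "dvdp k (of_nat m - of_nat n :: 'p::prime_card padic)"
  shows "m = n"
proof -
  have "resf k (of_nat m :: 'p padic) = resf k (of_nat n :: 'p padic)"
    using resf_eq_iff[OF intg_simps(8) intg_simps(8)] assms(3) by blast
  then have "int m = int n" using assms(1,2) by (simp add: resf_of_nat flip: of_nat_power)
  then show ?thesis by simp
qed

lemma inj_of_nat_level: "inj_on (of_nat :: nat \<Rightarrow> 'p::prime_card padic) {..<CARD('p) ^ k}"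
  by (rule inj_onI) (auto intro!: of_nat_eq_level[where k=k] simp: dvdp_simps)

lemma card_Rk:
  "finite (Rk k :: ('p::prime_card, 'n::finite) sp_vec set)"
  "card (Rk k :: ('p::prime_card, 'n::finite) sp_vec set) = (CARD('p) ^ k) ^ (2 * CARD('n))"
  unfolding Rk_def using card_vec_prod[of "\<lambda>_ :: 'n + 'n. of_nat ` {..<CARD('p) ^ k} :: 'p padic set"]
  by (simp_all add: card_image[OF inj_of_nat_level] mult_2)

lemma Rk_sub_M: "Rk k \<subseteq> \<M>"
  unfolding Rk_def integral_vecs_def by (auto, metis imageE intg_simps(8))

lemma red_Rk: "x \<in> \<M> \<Longrightarrow> red k x \<in> Rk k"
  unfolding Rk_def red_def integral_vecs_def
  by (auto intro!: imageI simp: nat_less_iff resf_bounds simp del: of_nat_nat)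

lemma red_cong: "x \<in> \<M> \<Longrightarrow> x - red k x \<in> pM k"
proof -
  assume x: "x \<in> \<M>"
  have "dvdp k (y - of_nat (nat (resf k y)))" if y: "y \<in> \<O>" for y :: "'a padic"
  proof -
    have "resf k (of_nat (nat (resf k y)) :: 'a padic) = resf k y"
      using resf_bounds[OF y, of k] unfolding resf_of_nat by simp
    then show ?thesis using y resf_eq_iff[of y "of_nat (nat (resf k y))" k] by simp
  qed
  then show ?thesis using x unfolding pM_def red_def integral_vecs_def by simp
qed

lemma Rk_eqI:
  fixes x :: "('p::prime_card, 'n::finite) sp_vec"
  assumes "x \<in> Rk k" "y \<in> Rk k" "x - y \<in> pM k" shows "x = y"
proof -
  have "x $ i = y $ i" for i
  proof -
    obtain m n where "x $ i = of_nat m" "y $ i = of_nat n" "m < CARD('p) ^ k" "n < CARD('p) ^ k"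
      using assms unfolding Rk_def by blast
    moreover have "dvdp k (x $ i - y $ i)" using assms(3) unfolding pM_def by simp
    ultimately show ?thesis using of_nat_eq_level[of m k n, where 'p='p] by auto
  qed
  then show ?thesis by (simp add: vec_eq_iff)
qed

text \<open>A map that is injective modulo \<open>p^k\<close> becomes, after reduction by
  \<open>red\<close>, an injective self-map of the finite set \<open>Rk k\<close>, hence a
  permutation.\<close>

lemma sum_Rk_reindex:
  fixes f :: "('p::prime_card, 'n::finite) sp_vec \<Rightarrow> 'a::comm_monoid_add"
    and h :: "('p, 'n) sp_vec \<Rightarrow> ('p, 'n) sp_vec"
  assumes h: "\<And>x. x \<in> \<M> \<Longrightarrow> h x \<in> \<M>" "\<And>x y. x \<in> \<M> \<Longrightarrow> y \<in> \<M> \<Longrightarrow> h x - h y \<in> pM k \<Longrightarrow> x - y \<in> pM k"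
    and f: "\<And>x y. x \<in> \<M> \<Longrightarrow> y \<in> \<M> \<Longrightarrow> x - y \<in> pM k \<Longrightarrow> f x = f y"
  shows "(\<Sum>x\<in>Rk k. f (h x)) = (\<Sum>x\<in>Rk k. f x)"
proof -
  let ?g = "\<lambda>x. red k (h x)"
  have inj: "inj_on ?g (Rk k)"
  proof (rule inj_onI)
    fix x y :: "('p, 'n) sp_vec" assume xy: "x \<in> Rk k" "y \<in> Rk k" "?g x = ?g y"
    have hx: "h x \<in> \<M>" "h y \<in> \<M>" using xy h(1) Rk_sub_M by blast+
    have "h x - h y = (h x - ?g x) - (h y - ?g y)" using xy(3) by simp
    then have "h x - h y \<in> pM k" using red_cong[OF hx(1), of k] red_cong[OF hx(2), of k] pM_simps(3) by metis
    then show "x = y" using h(2)[of x y] Rk_eqI[OF xy(1,2)] xy(1,2) Rk_sub_M by blast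
  qed
  moreover have "?g ` Rk k \<subseteq> Rk k" using red_Rk h(1) Rk_sub_M by blast
  ultimately have "?g ` Rk k = Rk k" using endo_inj_surj[OF card_Rk(1)] by blast
  then have "(\<Sum>x\<in>Rk k. f x) = (\<Sum>x\<in>Rk k. f (?g x))" using sum.reindex[OF inj, of f] by (simp add: comp_def)
  also have "\<dots> = (\<Sum>x\<in>Rk k. f (h x))"
  proof (rule sum.cong[OF refl])
    fix x :: "('p, 'n) sp_vec" assume "x \<in> Rk k"
    then have "h x \<in> \<M>" using h(1) Rk_sub_M by blast
    then show "f (?g x) = f (h x)" using f[of "h x" "?g x"] red_cong[of "h x" k] red_Rk[of "h x" k] Rk_sub_M by (metis subsetD)
  qed
  finally show ?thesis by simp
qed

lemma sum_Rk_shift: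
  fixes f :: "('p::prime_card, 'n::finite) sp_vec \<Rightarrow> 'a::comm_monoid_add"
  assumes "v \<in> \<M>" "\<And>x y. x \<in> \<M> \<Longrightarrow> y \<in> \<M> \<Longrightarrow> x - y \<in> pM k \<Longrightarrow> f x = f y"
  shows "(\<Sum>x\<in>Rk k. f (x + v)) = (\<Sum>x\<in>Rk k. f x)"
  using assms by (intro sum_Rk_reindex) auto

lemma card_Rk_reindex:
  fixes h :: "('p::prime_card, 'n::finite) sp_vec \<Rightarrow> ('p, 'n) sp_vec"
  assumes h: "\<And>x. x \<in> \<M> \<Longrightarrow> h x \<in> \<M>" "\<And>x y. x \<in> \<M> \<Longrightarrow> y \<in> \<M> \<Longrightarrow> h x - h y \<in> pM k \<Longrightarrow> x - y \<in> pM k"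
    and P: "\<And>x y. x \<in> \<M> \<Longrightarrow> y \<in> \<M> \<Longrightarrow> x - y \<in> pM k \<Longrightarrow> P x = P y"
  shows "card {x \<in> Rk k. P (h x)} = card {x \<in> Rk k. P x}"
proof -
  have "(\<Sum>x\<in>Rk k. if P (h x) then 1 else 0 :: nat) = (\<Sum>x\<in>Rk k. if P x then 1 else 0)"
    using P by (intro sum_Rk_reindex[OF h]) auto
  then show ?thesis by (simp add: sum.If_cases[OF card_Rk(1)] Int_def)
qed

lemma card_Rk_shift:
  fixes v :: "('p::prime_card, 'n::finite) sp_vec"
  assumes "v \<in> \<M>" "\<And>x y. x \<in> \<M> \<Longrightarrow> y \<in> \<M> \<Longrightarrow> x - y \<in> pM k \<Longrightarrow> P x = P y"
  shows "card {x \<in> Rk k. P (x + v)} = card {x \<in> Rk k. P x}"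
  using assms by (intro card_Rk_reindex) auto

text \<open>The faithful additive character of the integers modulo \<open>p^k\<close>, namely
  \<open>exp (2 pi i z / p^k)\<close>.\<close>

definition psi :: "nat \<Rightarrow> 'p::prime_card padic \<Rightarrow> complex" where
  "psi k z = cis (2 * pi * (of_int (resf k z) / of_nat (CARD('p) ^ k)))"

lemma cis_2pi_frac_mod:
  assumes "n > 0" shows "cis (2 * pi * (of_int (a mod int n) / of_nat n)) = cis (2 * pi * (of_int a / of_nat n))"
proof -
  have "real_of_int a = of_int (a mod int n) + of_nat n * of_int (a div int n)"
    by (metis add.commute mult_div_mod_eq of_int_add of_int_mult of_int_of_nat_eq)
  then have "2 * pi * (of_int a / of_nat n) = 2 * pi * (of_int (a mod int n) / of_nat n) + 2 * pi * of_int (a div int n)"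
    using assms by (simp add: field_simps)
  then show ?thesis by (simp add: cis_mult[symmetric] cis_multiple_2pi)
qed

lemma psi_add: "x \<in> \<O> \<Longrightarrow> y \<in> \<O> \<Longrightarrow> psi k (x + y) = psi k x * psi k (y :: 'p::prime_card padic)"
proof -
  assume xy: "x \<in> \<O>" "y \<in> \<O>"
  have "psi k (x + y) = cis (2 * pi * (of_int (resf k x + resf k y) / of_nat (CARD('p) ^ k)))"
    unfolding psi_def resf_add[OF xy] using cis_2pi_frac_mod[of "CARD('p) ^ k" "resf k x + resf k y"] by simp
  then show ?thesis unfolding psi_def by (simp add: cis_mult add_divide_distrib distrib_left)
qed

lemma psi_eq_1_iff: "x \<in> \<O> \<Longrightarrow> psi k x = 1 \<longleftrightarrow> dvdp k (x :: 'p::prime_card padic)"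
proof
  assume x: "x \<in> \<O>" and "psi k x = 1"
  let ?t = "2 * pi * (of_int (resf k x) / of_nat (CARD('p) ^ k))"
  have "cos ?t = 1" using \<open>psi k x = 1\<close> unfolding psi_def by (simp add: complex_eq_iff)
  then obtain n :: int where "?t = real_of_int n * 2 * pi" by (auto simp: cos_one_2pi_int)
  then have "real_of_int (resf k x) = of_int (n * int CARD('p) ^ k)"
    using CARD_gt_1[where 'p='p] by (simp add: field_simps)
  then have "resf k x = n * int CARD('p) ^ k" by (simp only: of_int_eq_iff)
  then have "resf k x = 0"
    using resf_bounds[OF x, of k] by (metis dvd_triv_right mod_0_imp_dvd mod_pos_pos_trivial dvd_imp_mod_0)
  then show "dvdp k x" using x resf_eq_0_iff by blast
next
  assume "x \<in> \<O>" "dvdp k x"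
  then show "psi k x = 1" using resf_eq_0_iff[of x k] unfolding psi_def by simp
qed

text \<open>Orthogonality of characters: a shift by a vector \<open>v\<close> with
  \<open>ch v \<noteq> 1\<close> multiplies the sum by \<open>ch v\<close> and also leaves it
  unchanged.\<close>

lemma sum_character:
  fixes ch :: "('p::prime_card, 'n::finite) sp_vec \<Rightarrow> complex"
  assumes add: "\<And>x y. x \<in> \<M> \<Longrightarrow> y \<in> \<M> \<Longrightarrow> ch (x + y) = ch x * ch y"
    and triv: "\<And>x. x \<in> pM k \<Longrightarrow> ch x = 1"
  shows "(\<Sum>x\<in>Rk k. ch x) = (if \<forall>x\<in>\<M>. ch x = 1 then of_nat (card (Rk k :: ('p, 'n) sp_vec set)) else 0)"
proof (cases "\<forall>x\<in>\<M>. ch x = 1")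
  case True
  then have "(\<Sum>x\<in>Rk k. ch x) = (\<Sum>x\<in>(Rk k :: ('p, 'n) sp_vec set). 1)"
    using Rk_sub_M by (intro sum.cong) auto
  then show ?thesis using True by simp
next
  case False
  then obtain v where v: "v \<in> \<M>" "ch v \<noteq> 1" by auto
  have "ch x = ch y" if "x \<in> \<M>" "y \<in> \<M>" "x - y \<in> pM k" for x y
    using add[of "x - y" y] triv[OF that(3)] that by simp
  then have "(\<Sum>x\<in>Rk k. ch x) = (\<Sum>x\<in>Rk k. ch (x + v))"
    using v by (intro sum_Rk_shift[symmetric])
  also have "\<dots> = (\<Sum>x\<in>Rk k. ch x) * ch v"
    using add v Rk_sub_M unfolding sum_distrib_right by (intro sum.cong) auto
  finally have "(\<Sum>x\<in>Rk k. ch x) = 0" using v(2) by simp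
  then show ?thesis using False by (simp only: if_False)
qed

lemma sum_psi:
  fixes \<phi> :: "('p::prime_card, 'n::finite) sp_vec \<Rightarrow> 'p padic"
  assumes "\<And>x y. \<phi> (x + y) = \<phi> x + \<phi> y" "\<And>x. x \<in> \<M> \<Longrightarrow> \<phi> x \<in> \<O>" "\<And>x. x \<in> pM k \<Longrightarrow> dvdp k (\<phi> x)"
  shows "(\<Sum>x\<in>Rk k. psi k (\<phi> x)) =
    (if \<forall>x\<in>\<M>. dvdp k (\<phi> x) then of_nat (card (Rk k :: ('p, 'n) sp_vec set)) else 0)"
proof -
  have "(\<Sum>x\<in>Rk k. psi k (\<phi> x)) =
    (if \<forall>x\<in>\<M>. psi k (\<phi> x) = 1 then of_nat (card (Rk k :: ('p, 'n) sp_vec set)) else 0)"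
  proof (rule sum_character)
    show "psi k (\<phi> (x + y)) = psi k (\<phi> x) * psi k (\<phi> y)" if "x \<in> \<M>" "y \<in> \<M>" for x y
      using that by (simp add: assms(1,2) psi_add)
    show "psi k (\<phi> x) = 1" if "x \<in> pM k" for x
      using assms(3)[OF that] psi_eq_1_iff dvdp_intg by blast
  qed
  moreover have "(\<forall>x\<in>\<M>. psi k (\<phi> x) = 1) \<longleftrightarrow> (\<forall>x\<in>\<M>. dvdp k (\<phi> x))"
    using assms(2) psi_eq_1_iff by blast
  ultimately show ?thesis by simp
qed

lemma sum_psi_om:
  fixes z :: "('p::prime_card, 'n::finite) sp_vec"
  assumes "z \<in> \<M>"
  shows "(\<Sum>w\<in>Rk k. psi k (om w z)) = (if z \<in> pM k then of_nat (card (Rk k :: ('p, 'n) sp_vec set)) else 0)"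
  unfolding pM_iff_om[of z k]
  using assms by (intro sum_psi) (auto simp: om_linear om_intg om_pM)

subsection \<open>Indices of lattices\<close>

text \<open>By translation, every class modulo \<open>p^m\<close> has the same number of
  representatives in \<open>Rk k\<close>. The comparison is cross-multiplied to avoid
  division.\<close>

lemma card_fibres:
  fixes P :: "('p::prime_card, 'n::finite) sp_vec \<Rightarrow> bool"
  assumes mk: "m \<le> k" and P: "\<And>x y. x \<in> \<M> \<Longrightarrow> y \<in> \<M> \<Longrightarrow> x - y \<in> pM m \<Longrightarrow> P x = P y"
  shows "card {x \<in> Rk k. P x} * card (Rk m :: ('p, 'n) sp_vec set)
    = card {x \<in> Rk m. P x} * card (Rk k :: ('p, 'n) sp_vec set)"
proof -
  let ?t = "card {x \<in> Rk k :: ('p, 'n) sp_vec set. x \<in> pM m}"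
  have fib: "card {x \<in> Rk k. P x} = card {x \<in> Rk m. P x} * ?t"
    if P: "\<And>x y. x \<in> \<M> \<Longrightarrow> y \<in> \<M> \<Longrightarrow> x - y \<in> pM m \<Longrightarrow> P x = P y" for P :: "('p, 'n) sp_vec \<Rightarrow> bool"
  proof -
    have "{x \<in> Rk k. P x} = (\<Union>r\<in>{x \<in> Rk m. P x}. {x \<in> Rk k. x - r \<in> pM m})"
    proof safe
      fix x :: "('p, 'n) sp_vec" assume x: "x \<in> Rk k" "P x"
      then have "x \<in> \<M>" using Rk_sub_M by auto
      then have "red m x \<in> Rk m" "x - red m x \<in> pM m" using red_Rk red_cong by auto
      then show "x \<in> (\<Union>r\<in>{x \<in> Rk m. P x}. {x \<in> Rk k. x - r \<in> pM m})"
        using x P[of x "red m x"] \<open>x \<in> \<M>\<close> Rk_sub_M by blast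
    next
      fix x r :: "('p, 'n) sp_vec" assume "x \<in> Rk k" "r \<in> Rk m" "P r" "x - r \<in> pM m"
      then show "P x" using P[of x r] Rk_sub_M by blast
    qed
    also have "card \<dots> = (\<Sum>r\<in>{x \<in> Rk m. P x}. card {x \<in> Rk k. x - r \<in> pM m})"
    proof (rule card_UN_disjoint)
      show "\<forall>r\<in>{x \<in> Rk m. P x}. \<forall>s\<in>{x \<in> Rk m. P x}. r \<noteq> s \<longrightarrow>
          {x \<in> Rk k. x - r \<in> pM m} \<inter> {x \<in> Rk k. x - s \<in> pM m} = {}"
      proof (safe, goal_cases)
        case (1 r s x)
        have "s - r = (x - r) - (x - s)" by simp
        then have "s - r \<in> pM m" using 1 pM_simps(3) by metis
        then show ?case using 1 Rk_eqI by metis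
      qed
    qed (auto simp: card_Rk(1))
    also have "\<dots> = (\<Sum>r\<in>{x \<in> Rk m. P x}. ?t)"
    proof (rule sum.cong[OF refl])
      fix r assume "r \<in> {x \<in> Rk m. P x}"
      then have "- r \<in> \<M>" using Rk_sub_M by blast
      moreover have "x \<in> pM m \<longleftrightarrow> y \<in> pM m" if "x - y \<in> pM k" for x y :: "('p, 'n) sp_vec"
      proof -
        have "x - y \<in> pM m" using that pM_mono[OF mk] by auto
        then show ?thesis using pM_simps(2)[of "x - y" m y] pM_simps(3)[of x m "x - y"] by auto
      qed
      ultimately show "card {x \<in> Rk k. x - r \<in> pM m} = ?t"
        using card_Rk_shift[of "- r" k "\<lambda>x. x \<in> pM m"] by simp
    qed
    finally show ?thesis by simp
  qed
  have "card (Rk k :: ('p, 'n) sp_vec set) = card (Rk m :: ('p, 'n) sp_vec set) * ?t"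
    using fib[of "\<lambda>_. True"] by simp
  then show ?thesis using fib[OF P] by simp
qed

text \<open>Counting the pairs \<open>(x, y)\<close> with weight \<open>\<psi>(\<omega>(y, p\<^sup>k D\<^sup>-\<^sup>1 x))\<close> in both orders.\<close>

lemma card_lat_dual:
  fixes D :: "('p::prime_card, 'n::finite) sp_mat"
  assumes D: "D \<in> GSp_Delta" "level D m" "m \<le> k"
  shows "card {x \<in> Rk k. x \<in> lat D} = card {y \<in> Rk k. D *v y \<in> pM m}"
proof -
  let ?R = "Rk k :: ('p, 'n) sp_vec set"
  note DG = Delta_GSp[OF D(1)]
  obtain u where u: "unit_p u" "multiplier D = u * \<pi> ^ m" using D(2) unfolding level_def by auto
  define E where "E x = \<pi> ^ k *s (ginv D *v x)" for x
  have E_add: "E (x + y) = E x + E y" for x y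
    unfolding E_def by (simp add: matrix_vector_right_distrib vector_add_ldistrib)
  have om_E: "om y (E x) = inverse u * (\<pi> ^ (k - m) * om (D *v y) x)" for x y
  proof -
    have "om (D *v y) x = (u * \<pi> ^ m) * om y (ginv D *v x)"
      using GSpD(1)[OF DG, of y "ginv D *v x"] ginv(3)[OF DG] u by simp
    moreover have "\<pi> ^ k = \<pi> ^ (k - m) * (\<pi> ^ m :: 'p padic)" using D(3) by (simp add: power_add[symmetric])
    ultimately show ?thesis unfolding E_def using u unit_p_intg(3)[OF u(1)] by (simp add: om_linear)
  qed
  have om_intg': "om y (E x) \<in> \<O>" if "x \<in> \<M>" "y \<in> \<M>" for x y
  proof -
    have "D *v y \<in> \<M>" using D that Delta_iff by auto
    then show ?thesis unfolding om_E using that u om_intg unit_p_intg(2) by auto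
  qed
  have E_M: "E x \<in> \<M>" if "x \<in> \<M>" for x unfolding M_iff_om using that om_intg' by auto
  have lat_E: "x \<in> lat D \<longleftrightarrow> E x \<in> pM k" for x
    unfolding E_def lat_iff[OF DG] by (simp add: pM_simps)
  have "(\<Sum>x\<in>?R. \<Sum>y\<in>?R. psi k (om y (E x)))
      = (\<Sum>x\<in>?R. if x \<in> lat D then of_nat (card ?R) else 0)"
    unfolding lat_E using E_M Rk_sub_M by (intro sum.cong refl sum_psi_om) auto
  moreover have "(\<Sum>x\<in>?R. \<Sum>y\<in>?R. psi k (om y (E x)))
      = (\<Sum>y\<in>?R. if D *v y \<in> pM m then of_nat (card ?R) else 0)"
  proof (subst sum.swap, rule sum.cong[OF refl])
    fix y assume "y \<in> ?R"
    then have y: "y \<in> \<M>" using Rk_sub_M by auto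
    have Dy: "D *v y \<in> \<M>" using D y Delta_iff by auto
    have 1: "dvdp k (om y (E x))" if "x \<in> pM k" for x
      unfolding om_E using that Dy u om_pM(2) unit_p_intg(2) by (intro dvdp_simps(7)) auto
    have "dvdp k (om y (E x)) \<longleftrightarrow> dvdp m (om (D *v y) x)" for x
    proof -
      have "dvdp k (om y (E x)) \<longleftrightarrow> dvdp k (\<pi> ^ (k - m) * om (D *v y) x)"
        unfolding om_E using unit_dvdp_iff unit_p_simps(3)[OF u(1)] by blast
      also have "\<dots> \<longleftrightarrow> dvdp m (om (D *v y) x)"
        unfolding dvdp_def using D(3) by (simp add: power_diff)
      finally show ?thesis .
    qed
    moreover have "(\<forall>x\<in>\<M>. dvdp m (om (D *v y) x)) \<longleftrightarrow> D *v y \<in> pM m"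
      unfolding pM_iff_om[of "D *v y"] om_swap[of "D *v y"] by (metis dvdp_simps(5) minus_minus)
    ultimately show "(\<Sum>x\<in>?R. psi k (om y (E x))) = (if D *v y \<in> pM m then of_nat (card ?R) else 0)"
      using sum_psi[of "\<lambda>x. om y (E x)" k] E_add 1 om_intg'[OF _ y] by (simp add: om_linear)
  qed
  ultimately have "(\<Sum>x\<in>?R. if x \<in> lat D then of_nat (card ?R) else (0::complex))
      = (\<Sum>y\<in>?R. if D *v y \<in> pM m then of_nat (card ?R) else 0)" by simp
  then have "of_nat (card {x \<in> ?R. x \<in> lat D} * card ?R) = (of_nat (card {y \<in> ?R. D *v y \<in> pM m} * card ?R) :: complex)"
    by (simp add: sum.If_cases card_Rk(1) Int_def)
  then have "card {x \<in> ?R. x \<in> lat D} * card ?R = card {y \<in> ?R. D *v y \<in> pM m} * card ?R"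
    by (simp only: of_nat_eq_iff)
  moreover have "card ?R \<noteq> 0" unfolding card_Rk(2) by simp
  ultimately show ?thesis by simp
qed

text \<open>The index of \<open>D\<M>\<close> is found without determinants. Multiplication by
  \<open>D\<close> on \<M> modulo \<open>p^m\<close> has an image and a kernel, and
  \<open>card_lat_dual\<close> shows that they have equal size. The product of the two sizes is the
  number of residues, so each is its square root.\<close>

lemma card_lat:
  fixes D :: "('p::prime_card, 'n::finite) sp_mat"
  assumes D: "D \<in> GSp_Delta" "level D m" "m \<le> k"
  shows "card {x \<in> Rk k. x \<in> lat D} * (CARD('p) ^ m) ^ CARD('n) = (CARD('p) ^ k) ^ (2 * CARD('n))"
proof -
  let ?q = "CARD('p) ^ m" and ?n = "CARD('n)"
  let ?R = "Rk m :: ('p, 'n) sp_vec set"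
  let ?c = "card {x \<in> ?R. x \<in> lat D}"
  have per: "x \<in> lat D \<longleftrightarrow> y \<in> lat D" if "x - y \<in> pM m" for x y
  proof -
    have "x - y \<in> lat D" using that pM_sub_lat[OF D(1,2)] by auto
    then show ?thesis using lat_closed(2)[of "x - y" D y] lat_closed(3)[of x D "x - y"] by auto
  qed
  have perD: "D *v x \<in> pM m \<longleftrightarrow> D *v y \<in> pM m" if xy: "x - y \<in> pM m" for x y
  proof -
    obtain z where z: "z \<in> \<M>" "x - y = \<pi> ^ m *s z" using xy by (rule pME)
    have "D *v z \<in> \<M>" using z D(1) Delta_iff by blast
    then have "D *v (x - y) \<in> pM m" using z by (simp add: vector_scalar_commute pM_simps)
    then show ?thesis
      using pM_simps(2)[of "D *v (x - y)" m "D *v y"] pM_simps(3)[of "D *v x" m "D *v (x - y)"]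
      by (auto simp: matrix_vector_mult_diff_distrib)
  qed
  have "card ?R = ?c * card {y \<in> ?R. D *v y \<in> pM m}"
  proof -
    have "?R = (\<Union>z\<in>{x \<in> ?R. x \<in> lat D}. {x \<in> ?R. D *v x - z \<in> pM m})"
    proof safe
      fix x assume x: "x \<in> ?R"
      then have Dx: "D *v x \<in> lat D" "D *v x \<in> \<M>" using Rk_sub_M D Delta_iff unfolding lat_def by blast+
      then show "x \<in> (\<Union>z\<in>{x \<in> ?R. x \<in> lat D}. {x \<in> ?R. D *v x - z \<in> pM m})"
        using red_Rk[of "D *v x" m] red_cong[of "D *v x" m] per[of "D *v x" "red m (D *v x)"] x by blast
    qed
    then have "card ?R = card (\<Union>z\<in>{x \<in> ?R. x \<in> lat D}. {x \<in> ?R. D *v x - z \<in> pM m})" by simp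
    also have "\<dots> = (\<Sum>z\<in>{x \<in> ?R. x \<in> lat D}. card {x \<in> ?R. D *v x - z \<in> pM m})"
    proof (rule card_UN_disjoint)
      show "\<forall>r\<in>{x \<in> ?R. x \<in> lat D}. \<forall>s\<in>{x \<in> ?R. x \<in> lat D}. r \<noteq> s \<longrightarrow>
          {x \<in> ?R. D *v x - r \<in> pM m} \<inter> {x \<in> ?R. D *v x - s \<in> pM m} = {}"
      proof (safe, goal_cases)
        case (1 r s x)
        have "s - r = (D *v x - r) - (D *v x - s)" by simp
        then have "s - r \<in> pM m" using 1 pM_simps(3) by metis
        then show ?case using 1 Rk_eqI by metis
      qed
    qed (auto simp: card_Rk(1))
    also have "\<dots> = (\<Sum>z\<in>{x \<in> ?R. x \<in> lat D}. card {y \<in> ?R. D *v y \<in> pM m})"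
    proof (rule sum.cong[OF refl])
      fix z assume "z \<in> {x \<in> ?R. x \<in> lat D}"
      then obtain x0 where x0: "x0 \<in> \<M>" "z = D *v x0" unfolding lat_def by auto
      have "card {x \<in> ?R. D *v (x + - x0) \<in> pM m} = card {y \<in> ?R. D *v y \<in> pM m}"
        using x0 perD by (intro card_Rk_shift) auto
      then show "card {x \<in> ?R. D *v x - z \<in> pM m} = card {y \<in> ?R. D *v y \<in> pM m}"
        using x0 by (simp add: matrix_vector_mult_diff_distrib)
    qed
    finally show ?thesis by simp
  qed
  \<comment> \<open>Image times kernel, with the kernel replaced by the image through the duality at
    level \<open>m\<close>.\<close>
  then have "?c ^ 2 = (?q ^ ?n) ^ 2"
    using card_lat_dual[OF D(1,2), of m] card_Rk(2)[of m, where 'p='p and 'n='n]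
    by (simp add: power2_eq_square power_add[symmetric] mult_2)
  then have c: "?c = ?q ^ ?n" by (rule power_eq_imp_eq_base) simp_all
  have "card {x \<in> Rk k. x \<in> lat D} * card ?R = ?c * card (Rk k :: ('p, 'n) sp_vec set)"
    using per by (intro card_fibres[OF D(3)]) auto
  moreover have "card ?R = ?q ^ ?n * ?q ^ ?n"
    unfolding card_Rk(2) by (simp add: mult_2 power_add)
  ultimately have "?q ^ ?n * (card {x \<in> Rk k. x \<in> lat D} * ?q ^ ?n) = ?q ^ ?n * card (Rk k :: ('p, 'n) sp_vec set)"
    unfolding c by (simp only: mult_ac)
  then show ?thesis unfolding card_Rk(2) by simp
qed

text \<open>Orthogonality is used twice. The sum over \<open>w\<close> detects membership in
  \<open>lat D\<close>; after exchanging the sums, the sum over \<open>x\<close> keeps only those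
  \<open>w\<close> whose character of \<open>x\<close> is trivial. The vector \<open>b\<close> may
  fail to be integral: it will be \<open>\<alpha>\<inverse>a\<close>, for which only the scaled
  vector in the last assumption is known to be integral.\<close>

lemma count_fourier:
  fixes D :: "('p::prime_card, 'n::finite) sp_mat"
  assumes D: "D \<in> GSp_Delta" "level D m" "m \<le> k"
    and b: "\<pi> ^ k *s (ginv D *v b) \<in> \<M>"
  shows "of_nat (card {x \<in> Rk k. \<pi> ^ i *s x - b \<in> lat D})
    = (\<Sum>w\<in>Rk k. if \<pi> ^ i *s (D *v w) \<in> pM m then psi k (- om w (\<pi> ^ k *s (ginv D *v b))) else 0)"
proof -
  let ?R = "Rk k :: ('p, 'n) sp_vec set"
  note DG = Delta_GSp[OF D(1)]
  define E where "E x = \<pi> ^ k *s (ginv D *v x)" for x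
  have E_lin: "E (x + y) = E x + E y" "E (x - y) = E x - E y" "E (c *s x) = c *s E x" for x y c
    unfolding E_def by (simp_all add: matrix_vector_right_distrib matrix_vector_mult_diff_distrib
        vector_add_ldistrib vector_ssub_ldistrib vector_scalar_commute vector_smult_assoc mult.commute)
  have om_E: "multiplier D * om w (E x) = \<pi> ^ k * om (D *v w) x" for x w
    using GSpD(1)[OF DG, of w "ginv D *v x"] ginv(3)[OF DG] unfolding E_def by (simp add: om_linear)
  have E_M: "E x \<in> \<M>" if "x \<in> \<M>" for x
    unfolding M_iff_om
  proof
    fix y :: "('p, 'n) sp_vec" assume y: "y \<in> \<M>"
    have "D *v y \<in> \<M>" using D y Delta_iff by auto
    then have "dvdp k (multiplier D * om y (E x))" unfolding om_E using that om_intg by (simp add: dvdp_simps)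
    then have "dvdp m (multiplier D * om y (E x))" using dvdp_le D(3) by blast
    then show "om y (E x) \<in> \<O>" using dvdp_multiplier[OF D(2)] by blast
  qed
  have Eb: "E b \<in> \<M>" using b unfolding E_def .
  have lat_E: "x \<in> lat D \<longleftrightarrow> E x \<in> pM k" for x
    unfolding E_def lat_iff[OF DG] by (simp add: pM_simps)
  let ?N = "of_nat (card ?R) :: complex"
  let ?f = "\<lambda>w x. psi k (om w (E (\<pi> ^ i *s x - b)))"
  have "(\<Sum>x\<in>?R. \<Sum>w\<in>?R. ?f w x) = (\<Sum>x\<in>?R. if \<pi> ^ i *s x - b \<in> lat D then ?N else 0)"
  proof (rule sum.cong[OF refl])
    fix x assume "x \<in> ?R"
    then have "\<pi> ^ i *s x \<in> \<M>" using Rk_sub_M by auto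
    then have "E (\<pi> ^ i *s x - b) \<in> \<M>" unfolding E_lin(2) using E_M Eb by blast
    then show "(\<Sum>w\<in>?R. ?f w x) = (if \<pi> ^ i *s x - b \<in> lat D then ?N else 0)"
      by (simp add: sum_psi_om lat_E)
  qed
  moreover have "(\<Sum>x\<in>?R. \<Sum>w\<in>?R. ?f w x)
    = (\<Sum>w\<in>?R. if \<pi> ^ i *s (D *v w) \<in> pM m then ?N * psi k (- om w (E b)) else 0)"
  proof (subst sum.swap, rule sum.cong[OF refl])
    fix w assume "w \<in> ?R"
    then have w: "w \<in> \<M>" using Rk_sub_M by auto
    have om_iE: "om w (E (\<pi> ^ i *s x)) = \<pi> ^ i * om w (E x)" for x by (simp add: E_lin om_linear)
    have 1: "\<pi> ^ i * om w (E x) \<in> \<O>" if "x \<in> \<M>" for x using that E_M om_intg w by auto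
    have "?f w x = psi k (\<pi> ^ i * om w (E x)) * psi k (- om w (E b))" if "x \<in> ?R" for x
    proof -
      have x: "x \<in> \<M>" using that Rk_sub_M by auto
      have "om w (E (\<pi> ^ i *s x - b)) = \<pi> ^ i * om w (E x) + - om w (E b)"
        by (simp add: E_lin om_linear)
      then show ?thesis using psi_add[OF 1[OF x], of "- om w (E b)" k] om_intg[OF w Eb] by simp
    qed
    then have "(\<Sum>x\<in>?R. ?f w x) = (\<Sum>x\<in>?R. psi k (\<pi> ^ i * om w (E x))) * psi k (- om w (E b))"
      by (simp add: sum_distrib_right)
    also have "(\<Sum>x\<in>?R. psi k (\<pi> ^ i * om w (E x))) = (if \<forall>x\<in>\<M>. dvdp k (\<pi> ^ i * om w (E x)) then ?N else 0)"
    proof (rule sum_psi)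
      show "\<pi> ^ i * om w (E (x + y)) = \<pi> ^ i * om w (E x) + \<pi> ^ i * om w (E y)" for x y
        by (simp add: E_lin om_linear distrib_left)
      fix x :: "('p, 'n) sp_vec" assume "x \<in> pM k"
      then obtain z where z: "z \<in> \<M>" "x = \<pi> ^ k *s z" by (rule pME)
      have "\<pi> ^ i * om w (E x) = \<pi> ^ k * (\<pi> ^ i * om w (E z))" using z by (simp add: E_lin om_linear)
      then show "dvdp k (\<pi> ^ i * om w (E x))" using 1[OF z(1)] by (simp only: dvdp_simps)
    qed (use 1 in auto)
    also have "(\<forall>x\<in>\<M>. dvdp k (\<pi> ^ i * om w (E x))) \<longleftrightarrow> \<pi> ^ i *s (D *v w) \<in> pM m"
    proof -
      have "dvdp k (\<pi> ^ i * om w (E x)) \<longleftrightarrow> dvdp m (om x (\<pi> ^ i *s (D *v w)))" for x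
      proof -
        have eq: "multiplier D * (\<pi> ^ i * om w (E x)) = \<pi> ^ k * (\<pi> ^ i * om (D *v w) x)"
          using om_E[of w x] by (simp add: algebra_simps)
        have ne: "multiplier D \<noteq> 0" using GSpD(2)[OF DG] .
        have "dvdp k (\<pi> ^ i * om w (E x)) \<longleftrightarrow> \<pi> ^ i * om w (E x) / \<pi> ^ k \<in> \<O>" by (simp add: dvdp_def)
        also have "\<dots> \<longleftrightarrow> dvdp m (multiplier D * (\<pi> ^ i * om w (E x) / \<pi> ^ k))"
          using dvdp_multiplier[OF D(2)] by blast
        also have "multiplier D * (\<pi> ^ i * om w (E x) / \<pi> ^ k) = \<pi> ^ i * om (D *v w) x"
          using eq by (simp add: field_simps)
        also have "\<dots> = - om x (\<pi> ^ i *s (D *v w))" by (simp add: om_linear om_swap[of "D *v w"])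
        finally show ?thesis using dvdp_simps(5)[of m "om x (\<pi> ^ i *s (D *v w))"]
            dvdp_simps(5)[of m "- om x (\<pi> ^ i *s (D *v w))"] by auto
      qed
      then show ?thesis unfolding pM_iff_om by blast
    qed
    finally show "(\<Sum>x\<in>?R. ?f w x) = (if \<pi> ^ i *s (D *v w) \<in> pM m then ?N * psi k (- om w (E b)) else 0)"
      by simp
  qed
  ultimately have "of_nat (card {x \<in> ?R. \<pi> ^ i *s x - b \<in> lat D}) * ?N
    = (\<Sum>w\<in>?R. if \<pi> ^ i *s (D *v w) \<in> pM m then psi k (- om w (E b)) else 0) * ?N"
    by (simp add: sum.If_cases card_Rk(1) Int_def sum_distrib_left mult.commute)
  moreover have "?N \<noteq> 0" unfolding card_Rk(2) by simp
  ultimately show ?thesis unfolding E_def by simp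
qed

text \<open>This keeps the level 1 in \<open>pM 1\<close>, \<open>dvdp 1\<close> and
  \<open>\<pi> ^ 1\<close> in the form in which the lemmas about a general level apply.\<close>

declare One_nat_def [simp del]

subsection \<open>Families of lattices\<close>

text \<open>These are the lattices \<open>a\<M>\<close> attached to the left cosets
  \<open>a\<Gamma>\<close> in \<open>\<Gamma>g\<Gamma>\<close>; a right factor from \<Gamma> does
  not change the lattice.\<close>

definition lats :: "('p::prime_card, 'n::finite) sp_mat \<Rightarrow> ('p, 'n) sp_vec set set" where
  "lats g = {lat (\<gamma> ** g) | \<gamma>. \<gamma> \<in> GSp_Gamma}"

lemma level_Gamma_mult:
  assumes "\<gamma> \<in> GSp_Gamma" "g \<in> GSp_Delta" "level g m"
  shows "\<gamma> ** g \<in> GSp_Delta" "level (\<gamma> ** g) m"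
proof -
  show "\<gamma> ** g \<in> GSp_Delta" using assms Gamma_Delta Delta_mult by auto
  have "level \<gamma> 0" using assms(1) Gamma_Delta level_0_iff by blast
  then show "level (\<gamma> ** g) m" using level_mult[of \<gamma> g 0 m] assms Gamma_GSp Delta_GSp by auto
qed

lemma lat_translate:
  assumes "\<gamma> \<in> carrier GSp"
  shows "\<gamma> *v x \<in> lat (\<gamma> ** g) \<longleftrightarrow> x \<in> lat g" "x \<in> lat (\<gamma> ** g) \<longleftrightarrow> ginv \<gamma> *v x \<in> lat g"
proof -
  show 1: "\<gamma> *v x \<in> lat (\<gamma> ** g) \<longleftrightarrow> x \<in> lat g" for x
  proof -
    have "\<gamma> *v x = \<gamma> *v (g *v y) \<longleftrightarrow> x = g *v y" for y
      using ginv(4)[OF assms] by metis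
    then show ?thesis unfolding lat_def by (auto simp: matrix_vector_mul_assoc[symmetric])
  qed
  show "x \<in> lat (\<gamma> ** g) \<longleftrightarrow> ginv \<gamma> *v x \<in> lat g"
    using 1[of "ginv \<gamma> *v x"] ginv(3)[OF assms] by simp
qed

lemma lat_translate_eq_iff:
  assumes "\<gamma> \<in> carrier GSp"
  shows "lat (\<gamma> ** g) = lat (\<gamma> ** h) \<longleftrightarrow> lat g = lat h"
  using lat_translate[OF assms] by blast

lemma lats_cases:
  assumes "N \<in> lats g" "g \<in> GSp_Delta" "level g m"
  obtains h where "N = lat h" "h \<in> GSp_Delta" "level h m"
  using assms level_Gamma_mult unfolding lats_def by blast

lemma lats_props:
  fixes N :: "('p::prime_card, 'n::finite) sp_vec set"
  assumes "N \<in> lats g" "g \<in> GSp_Delta" "level g m"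
  shows "N \<subseteq> \<M>" "pM m \<subseteq> N" "x \<in> N \<Longrightarrow> y \<in> N \<Longrightarrow> dvdp m (om x y)"
    "(\<And>y. y \<in> N \<Longrightarrow> dvdp m (om y x)) \<Longrightarrow> x \<in> N"
    "x \<in> N \<Longrightarrow> y \<in> N \<Longrightarrow> x + y \<in> N" "x \<in> N \<Longrightarrow> y \<in> N \<Longrightarrow> x - y \<in> N"
    "c \<in> \<O> \<Longrightarrow> x \<in> N \<Longrightarrow> c *s x \<in> N" "0 \<in> N"
    "m \<le> k \<Longrightarrow> card {x \<in> Rk k. x \<in> N} * (CARD('p) ^ m) ^ CARD('n) = (CARD('p) ^ k) ^ (2 * CARD('n))"
proof -
  obtain h where h: "N = lat h" "h \<in> GSp_Delta" "level h m" using lats_cases[OF assms] by blast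
  note hG = Delta_GSp[OF h(2)]
  show "N \<subseteq> \<M>" "pM m \<subseteq> N" using h lat_sub_M[of h] pM_sub_lat[of h m] by auto
  show "x \<in> N \<Longrightarrow> y \<in> N \<Longrightarrow> dvdp m (om x y)" "(\<And>y. y \<in> N \<Longrightarrow> dvdp m (om y x)) \<Longrightarrow> x \<in> N"
    using lat_iff_om[OF hG h(3)] unfolding h(1) by blast+
  show "x \<in> N \<Longrightarrow> y \<in> N \<Longrightarrow> x + y \<in> N" "x \<in> N \<Longrightarrow> y \<in> N \<Longrightarrow> x - y \<in> N"
    "c \<in> \<O> \<Longrightarrow> x \<in> N \<Longrightarrow> c *s x \<in> N" "0 \<in> N"
    using lat_closed h(1) by auto
  show "m \<le> k \<Longrightarrow> card {x \<in> Rk k. x \<in> N} * (CARD('p) ^ m) ^ CARD('n) = (CARD('p) ^ k) ^ (2 * CARD('n))"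
    using card_lat[OF h(2,3)] h(1) by simp
qed

text \<open>A lattice of level \<open>k\<close> contains \<open>p^k \<M>\<close>, so it is
  determined by the representatives in \<open>Rk k\<close> that it contains.\<close>

lemma finite_lattices:
  "finite {lat g | g :: ('p::prime_card, 'n::finite) sp_mat. g \<in> GSp_Delta \<and> level g k}" (is "finite ?L")
proof (rule inj_on_finite[of "\<lambda>N. N \<inter> Rk k" _ "Pow (Rk k)"])
  show "inj_on (\<lambda>N. N \<inter> Rk k) ?L"
  proof (rule inj_onI)
    fix N N' :: "('p, 'n) sp_vec set" assume N: "N \<in> ?L" "N' \<in> ?L" "N \<inter> Rk k = N' \<inter> Rk k"
    have *: "N \<subseteq> N'" if N: "N \<in> ?L" "N' \<in> ?L" "N \<inter> Rk k = N' \<inter> Rk k" for N N' :: "('p, 'n) sp_vec set"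
    proof
      fix x assume x: "x \<in> N"
      obtain g h where g: "N = lat g" "g \<in> GSp_Delta" "level g k" "N' = lat h" "h \<in> GSp_Delta" "level h k"
        using N by auto
      have xM: "x \<in> \<M>" using x g lat_sub_M by auto
      have c: "x - red k x \<in> pM k" using red_cong[OF xM] .
      then have "x - (x - red k x) \<in> N" using lat_closed(3)[of x g] g x pM_sub_lat by blast
      then have "red k x \<in> N'" using N(3) red_Rk[OF xM] by auto
      then have "red k x + (x - red k x) \<in> N'" using lat_closed(2) g c pM_sub_lat by blast
      then show "x \<in> N'" by simp
    qed
    show "N = N'" using *[OF N] *[OF N(2,1) N(3)[symmetric]] by auto
  qed
qed (auto simp: card_Rk(1))

lemma finite_lats: "g \<in> GSp_Delta \<Longrightarrow> finite (lats g)"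
proof -
  assume g: "g \<in> GSp_Delta"
  then obtain k where "level g k" using level_exists by blast
  then have "lats g \<subseteq> {lat g | g. g \<in> GSp_Delta \<and> level g k}"
    using level_Gamma_mult[OF _ g] unfolding lats_def by blast
  then show ?thesis using finite_lattices finite_subset by blast
qed

section \<open>Scalar matrices, box counts and explicit elements of \<Gamma>\<close>

lemma mat_comm:
  fixes A :: "'a::field ^ 'n::finite ^ 'n"
  shows "mat c ** A = A ** mat c"
  by (simp add: matrix_eq matrix_vector_mul_assoc[symmetric] mat_mult_vec vector_scalar_commute)

lemma lat_scalar: "lat (mat (\<pi> ^ k)) = pM k"
  unfolding lat_def by (auto simp: mat_mult_vec pM_simps image_iff elim!: pME)

lemma lat_scalar_mult: "x \<in> lat (mat (\<pi> ^ k) ** g) \<longleftrightarrow> (\<exists>y\<in>lat g. x = \<pi> ^ k *s y)"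
  unfolding lat_def by (auto simp: matrix_vector_mul_assoc[symmetric] mat_mult_vec)

lemma lats_scalar: "lats (mat (\<pi> ^ k)) = {pM k}"
proof -
  have "lat (\<gamma> ** mat (\<pi> ^ k)) = pM k" if "\<gamma> \<in> GSp_Gamma" for \<gamma> :: "('a, 'b) sp_mat"
    using lat_mult_Gamma[OF that] lat_scalar by (metis mat_comm)
  then show ?thesis unfolding lats_def using Gamma_closed(1) by auto
qed

lemma scalar_Delta:
  fixes k :: nat
  defines "c \<equiv> mat (\<pi> ^ k) :: ('p::prime_card, 'n::finite) sp_mat"
  shows "c \<in> GSp_Delta" "level c (2 * k)"
proof -
  have *: "c \<in> carrier GSp" "multiplier c = (\<pi> ^ k) ^ 2"
    unfolding c_def using GSp_scalar[of "\<pi> ^ k"] by simp_all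
  show "c \<in> GSp_Delta" using * by (simp add: Delta_iff c_def mat_mult_vec)
  show "level c (2 * k)"
    unfolding level_def *(2) by (intro exI[of _ 1]) (simp add: unit_p_simps power_mult mult.commute)
qed

lemma lats_scalar_mult: "lats (mat (\<pi> ^ k) ** g) = (\<lambda>N. (*s) (\<pi> ^ k) ` N) ` lats g"
proof -
  have "lat (\<gamma> ** (mat (\<pi> ^ k) ** g)) = (*s) (\<pi> ^ k) ` lat (\<gamma> ** g)" for \<gamma>
  proof -
    have "\<gamma> ** (mat (\<pi> ^ k) ** g) = mat (\<pi> ^ k) ** (\<gamma> ** g)"
      by (metis mat_comm matrix_mul_assoc)
    then show ?thesis using lat_scalar_mult by auto
  qed
  then show ?thesis unfolding lats_def by auto
qed

lemma card_Rk_dvdp: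
  fixes t :: "'n::finite + 'n \<Rightarrow> nat"
  assumes "\<And>i. t i \<le> k"
  shows "card {x \<in> Rk k :: ('p::prime_card, 'n) sp_vec set. \<forall>i. dvdp (t i) (x $ i)} = (\<Prod>i\<in>UNIV. CARD('p) ^ (k - t i))"
proof -
  let ?p = "CARD('p)"
  have p0: "?p > 0" by simp
  define S where "S i = (of_nat :: nat \<Rightarrow> 'p padic) ` {n. n < ?p ^ k \<and> ?p ^ t i dvd n}" for i
  have dv: "dvdp j (of_nat n :: 'p padic) \<longleftrightarrow> ?p ^ j dvd n" for j n
    using resf_eq_0_iff[of "of_nat n :: 'p padic" j] resf_of_nat[of j n, where 'p='p]
    by (simp add: dvd_eq_mod_eq_0 flip: of_nat_power of_nat_mod)
  have "y \<in> S i \<longleftrightarrow> y \<in> of_nat ` {..<?p ^ k} \<and> dvdp (t i) y" for y i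
    unfolding S_def using dv[of "t i"] by auto
  then have "{x \<in> Rk k :: ('p, 'n) sp_vec set. \<forall>i. dvdp (t i) (x $ i)} = {x. \<forall>i. x $ i \<in> S i}"
    unfolding Rk_def by blast
  moreover have "card (S i) = ?p ^ (k - t i)" for i
  proof -
    have "card (S i) = card {n. n < ?p ^ k \<and> ?p ^ t i dvd n}"
      unfolding S_def by (rule card_image, rule inj_on_subset[OF inj_of_nat_level[of k, where 'p='p]]) auto
    also have "{n. n < ?p ^ k \<and> ?p ^ t i dvd n} = (\<lambda>m. ?p ^ t i * m) ` {..<?p ^ (k - t i)}"
    proof -
      have "?p ^ k = ?p ^ t i * ?p ^ (k - t i)" using assms[of i] by (simp flip: power_add)
      then show ?thesis by (auto simp: image_iff elim!: dvdE)
    qed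
    also have "card \<dots> = ?p ^ (k - t i)" using p0 by (subst card_image) (auto intro!: inj_onI)
    finally show ?thesis .
  qed
  moreover have "finite (S i)" for i unfolding S_def by auto
  ultimately show ?thesis using card_vec_prod(2)[of S] by simp
qed

text \<open>An integral linear isometry has multiplier 1, so \<open>Gamma_iff_unit\<close> makes its
  inverse integral as well.\<close>

lemma Gamma_of_linear:
  fixes f :: "('p::prime_card, 'n::finite) sp_vec \<Rightarrow> ('p, 'n) sp_vec"
  assumes add: "\<And>x y. f (x + y) = f x + f y" and smult: "\<And>c x. f (c *s x) = c *s f x"
    and om: "\<And>x y. om (f x) (f y) = om x y" and M: "\<And>x. x \<in> \<M> \<Longrightarrow> f x \<in> \<M>"
  obtains \<gamma> where "\<gamma> \<in> GSp_Gamma" "\<And>x. \<gamma> *v x = f x"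
proof -
  have "Vector_Spaces.linear (*s) (*s) f" by unfold_locales (use add smult in auto)
  then have *: "matrix f *v x = f x" for x by (rule matrix_works)
  then have "matrix f \<in> carrier GSp" "multiplier (matrix f) = 1"
    using GSpI[of "matrix f" 1] om by auto
  then have "matrix f \<in> GSp_Gamma"
    unfolding Gamma_iff_unit Delta_iff using * M by (simp add: unit_p_simps)
  then show ?thesis using that * by blast
qed

text \<open>The map is the symplectic transvection along \<open>u = y - x\<close>. Since
  \<open>om x u = om x y\<close>, the factor \<open>c = 1 / om x y\<close> makes it send
  \<open>x\<close> to \<open>x + u\<close>; \<open>c\<close> is integral because the pairing is a
  unit.\<close>

lemma transvection:
  fixes x y :: "('p::prime_card, 'n::finite) sp_vec"
  assumes "x \<in> \<M>" "y \<in> \<M>" "unit_p (om x y)"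
  obtains \<gamma> where "\<gamma> \<in> GSp_Gamma" "\<gamma> *v x = y"
proof -
  define u c where "u = y - x" and "c = inverse (om x y)"
  have c: "c \<in> \<O>" unfolding c_def using assms unit_p_intg by auto
  have u: "u \<in> \<M>" unfolding u_def using assms by auto
  define f where "f z = z + (c * om z u) *s u" for z
  have "\<exists>\<gamma>\<in>GSp_Gamma. \<forall>z. \<gamma> *v z = f z"
  proof (rule Gamma_of_linear[of f])
    show "om (f a) (f b) = om a b" for a b
      unfolding f_def using om_swap[of u b] by (simp add: om_linear algebra_simps)
    show "f a \<in> \<M>" if "a \<in> \<M>" for a unfolding f_def
      by (rule M_simps(2)[OF that M_simps(5)[OF intg_simps(5)[OF c om_intg[OF that u]] u]])
  qed (auto simp: f_def om_linear algebra_simps vector_add_ldistrib vector_sadd_rdistrib vector_smult_assoc)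
  moreover have "f x = y"
    unfolding f_def u_def c_def using unit_p_intg(3)[OF assms(3)] by (simp add: om_linear)
  ultimately show ?thesis using that by metis
qed

subsection \<open>Genus two\<close>

abbreviation "i1 \<equiv> Inl 1 :: 2 + 2"
abbreviation "i2 \<equiv> Inl 2 :: 2 + 2"
abbreviation "i3 \<equiv> Inr 1 :: 2 + 2"
abbreviation "i4 \<equiv> Inr 2 :: 2 + 2"

lemma all_4: "(\<forall>i :: 2 + 2. P i) \<longleftrightarrow> P i1 \<and> P i2 \<and> P i3 \<and> P i4"
proof safe
  fix i assume "P i1" "P i2" "P i3" "P i4"
  then show "P i" by (cases i) (use exhaust_2 in metis)+
qed blast+

lemma two_neq_one_2 [simp]: "(2 :: 2) \<noteq> 1"
  by simp_all

lemma om_4: "om x y = x $ i1 * y $ i3 - x $ i3 * y $ i1 + (x $ i2 * y $ i4 - x $ i4 * y $ i2)"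
  unfolding om_def by (simp add: sum_2)

lemma prod_4: "(\<Prod>i\<in>UNIV. f i) = f i1 * f i2 * f i3 * (f i4 :: 'a::comm_monoid_mult)"
proof -
  have "(UNIV :: (2 + 2) set) = {i1, i2, i3, i4}"
    using all_4[of "\<lambda>i. i \<in> {i1, i2, i3, i4}"] by auto
  then have "(\<Prod>i\<in>UNIV. f i) = (\<Prod>i\<in>{i1, i2, i3, i4}. f i)" by (simp only:)
  then show ?thesis by (simp add: mult.assoc)
qed

definition vec4 :: "'a \<Rightarrow> 'a \<Rightarrow> 'a \<Rightarrow> 'a \<Rightarrow> 'a ^ (2 + 2)" where
  "vec4 a b c d = (\<chi> i. case i of Inl j \<Rightarrow> if j = 1 then a else b | Inr j \<Rightarrow> if j = 1 then c else d)"

lemma vec4_simps [simp]: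
  "vec4 a b c d $ i1 = a" "vec4 a b c d $ i2 = b" "vec4 a b c d $ i3 = c" "vec4 a b c d $ i4 = d"
  unfolding vec4_def by simp_all

lemma vec_eq_4: "x = y \<longleftrightarrow> x $ i1 = y $ i1 \<and> x $ i2 = y $ i2 \<and> x $ i3 = y $ i3 \<and> x $ i4 = y $ i4"
  by (simp add: vec_eq_iff all_4)

lemma M_4: "x \<in> \<M> \<longleftrightarrow> x $ i1 \<in> \<O> \<and> x $ i2 \<in> \<O> \<and> x $ i3 \<in> \<O> \<and> x $ i4 \<in> \<O>"
  unfolding integral_vecs_def by (simp add: all_4)

lemma pM_4: "x \<in> pM k \<longleftrightarrow> dvdp k (x $ i1) \<and> dvdp k (x $ i2) \<and> dvdp k (x $ i3) \<and> dvdp k (x $ i4)"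
  unfolding pM_def by (simp add: all_4)

abbreviation e1 :: "('p::prime_card, 2) sp_vec" where "e1 \<equiv> vec4 1 0 0 0"
abbreviation e2 :: "('p::prime_card, 2) sp_vec" where "e2 \<equiv> vec4 0 1 0 0"

definition primv :: "('p::prime_card, 2) sp_vec \<Rightarrow> bool" where "primv v \<longleftrightarrow> v \<in> \<M> \<and> v \<notin> pM 1"

lemma unit_p_add: "dvdp 1 x \<Longrightarrow> unit_p y \<Longrightarrow> unit_p (x + y)"
proof -
  assume x: "dvdp 1 x" and y: "unit_p y"
  have "\<not> dvdp 1 (x + y)"
  proof
    assume "dvdp 1 (x + y)"
    then have "dvdp 1 (x + y - x)" using x dvdp_simps(4) by blast
    then show False using y not_dvdp_1_iff[OF unit_p_intg(1)[OF y]] by simp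
  qed
  then show ?thesis using not_dvdp_1_iff[of "x + y"] x y dvdp_intg unit_p_intg(1) by blast
qed

text \<open>One transvection suffices when \<open>om e1 v\<close> is a unit, that is, when the third
  coordinate of \<open>v\<close> is one. Otherwise two transvections are composed through an
  intermediate vector.\<close>

lemma primitive_transitive:
  fixes v :: "('p::prime_card, 2) sp_vec"
  assumes "primv v" obtains \<gamma> where "\<gamma> \<in> GSp_Gamma" "\<gamma> *v e1 = v"
proof -
  have vM: "v \<in> \<M>" using assms unfolding primv_def by auto
  note goal = that
  \<comment> \<open>The intermediate \<open>w\<close> must pair to a unit with \<open>e1\<close> and
    with \<open>v\<close>. The choices below have third coordinate 1 for the first condition, and a
    coordinate 1 opposite to a unit coordinate of \<open>v\<close> for the second.\<close>
  have two: thesis if w: "w \<in> \<M>" "unit_p (om e1 w)" "unit_p (om w v)" for w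
  proof -
    have "e1 \<in> (\<M> :: ('p, 2) sp_vec set)" by (simp add: M_4)
    then obtain g where g: "g \<in> GSp_Gamma" "g *v e1 = w" using transvection w by blast
    obtain h where h: "h \<in> GSp_Gamma" "h *v w = v" using transvection w vM by blast
    show thesis
      using goal[of "h ** g"] g h Gamma_closed(2)[OF h(1) g(1)] by (simp add: matrix_vector_mul_assoc[symmetric])
  qed
  have *: "dvdp 1 (v $ i) \<or> unit_p (v $ i)" for i
    using vM not_dvdp_1_iff[of "v $ i"] unfolding integral_vecs_def by auto
  consider "unit_p (v $ i3)" | "unit_p (v $ i1)" | "dvdp 1 (v $ i1)" "unit_p (v $ i2)"
    | "dvdp 1 (v $ i1)" "unit_p (v $ i4)"
    using assms * unfolding primv_def pM_4 by blast
  then show thesis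
  proof cases
    case 1
    have e: "e1 \<in> (\<M> :: ('p, 2) sp_vec set)" by (simp add: M_4)
    have "unit_p (om e1 v)" using 1 by (simp add: om_4)
    then obtain \<gamma> where "\<gamma> \<in> GSp_Gamma" "\<gamma> *v e1 = v" using transvection[OF e vM] by blast
    then show thesis by (rule goal)
  next
    case 2
    then show thesis
      by (intro two[of "vec4 0 0 1 0"]) (auto simp: om_4 M_4 unit_p_simps)
  next
    case 3
    have "unit_p (- (v $ i1 + v $ i2))" using 3 unit_p_add unit_p_simps(4) by blast
    then show thesis
      by (intro two[of "vec4 0 0 1 1"]) (auto simp: om_4 M_4 unit_p_simps algebra_simps)
  next
    case 4
    have "unit_p (- v $ i1 + v $ i4)" using 4 unit_p_add dvdp_simps(5) by blast
    then show thesis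
      by (intro two[of "vec4 0 1 1 0"]) (auto simp: om_4 M_4 unit_p_simps algebra_simps)
  qed
qed

text \<open>The line spanned by \<open>v\<close> is taken modulo \<open>p\<close> and includes the
  zero class.\<close>

definition in_line :: "('p::prime_card, 2) sp_vec \<Rightarrow> ('p, 2) sp_vec \<Rightarrow> bool" where
  "in_line v u \<longleftrightarrow> (\<exists>c\<in>\<O>. u - c *s v \<in> pM 1)"

lemma Gamma_pM: "\<gamma> \<in> GSp_Gamma \<Longrightarrow> \<gamma> *v x \<in> pM k \<longleftrightarrow> x \<in> pM k"
proof -
  assume g: "\<gamma> \<in> GSp_Gamma"
  have 1: "y \<in> pM k \<longleftrightarrow> inverse (\<pi> ^ k) *s y \<in> \<M>" for y
    using pM_simps(7)[of k "inverse (\<pi> ^ k) *s y"] by (simp add: vector_smult_assoc)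
  have "\<gamma> *v x \<in> pM k \<longleftrightarrow> \<gamma> *v (inverse (\<pi> ^ k) *s x) \<in> \<M>"
    unfolding 1[of "\<gamma> *v x"] by (simp add: vector_scalar_commute)
  then show ?thesis using g 1[of x] by (simp add: Gamma_iff)
qed

lemma Gamma_dvdp_om: "\<gamma> \<in> GSp_Gamma \<Longrightarrow> dvdp k (om (\<gamma> *v x) (\<gamma> *v y)) \<longleftrightarrow> dvdp k (om x y)"
  using GSpD(1)[OF Gamma_GSp] Gamma_iff_unit unit_dvdp_iff by metis

lemma Gamma_in_line:
  assumes "\<gamma> \<in> GSp_Gamma" shows "in_line (\<gamma> *v v) (\<gamma> *v u) \<longleftrightarrow> in_line v u"
proof -
  have "\<gamma> *v u - c *s (\<gamma> *v v) = \<gamma> *v (u - c *s v)" for c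
    by (simp add: matrix_vector_mult_diff_distrib vector_scalar_commute)
  then show ?thesis unfolding in_line_def using Gamma_pM[OF assms] by simp
qed

lemma in_line_e1: "u \<in> \<M> \<Longrightarrow> in_line e1 u \<longleftrightarrow> dvdp 1 (u $ i2) \<and> dvdp 1 (u $ i3) \<and> dvdp 1 (u $ i4)"
proof
  assume "u \<in> \<M>" "dvdp 1 (u $ i2) \<and> dvdp 1 (u $ i3) \<and> dvdp 1 (u $ i4)"
  then show "in_line e1 u" unfolding in_line_def
    by (intro bexI[of _ "u $ i1"]) (auto simp: pM_4 M_4 dvdp_simps)
qed (auto simp: in_line_def pM_4)

text \<open>Modulo \<open>p\<close>, a pair of independent orthogonal vectors can be moved to
  \<open>e1, e2\<close>, up to a multiple of the first. After \<open>v\<close> has become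
  \<open>e1\<close>, orthogonality kills the third coordinate of \<open>u\<close>, and the plane of
  the second and fourth coordinates is moved by a matrix of determinant 1.\<close>

lemma isotropic_normal_form:
  fixes v u :: "('p::prime_card, 2) sp_vec"
  assumes v: "primv v" and u: "u \<in> \<M>" "\<not> in_line v u" "dvdp 1 (om v u)"
  obtains \<gamma> c where "\<gamma> \<in> GSp_Gamma" "\<gamma> *v e1 = v" "c \<in> \<O>" "u - \<gamma> *v e2 - c *s v \<in> pM 1"
proof -
  obtain g where g: "g \<in> GSp_Gamma" "g *v e1 = v" using primitive_transitive[OF v] by blast
  define w where "w = ginv g *v u"
  have gw: "g *v w = u" unfolding w_def by (rule ginv(3)[OF Gamma_GSp[OF g(1)]])
  have w: "w \<in> \<M>" using g u gw Gamma_iff by blast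
  have "dvdp 1 (om e1 w)" using Gamma_dvdp_om[OF g(1), of 1 e1 w] g gw u by simp
  then have w3: "dvdp 1 (w $ i3)" by (simp add: om_4)
  have "\<not> in_line e1 w" using Gamma_in_line[OF g(1), of e1 w] g gw u by simp
  then have "\<not> dvdp 1 (w $ i2) \<or> \<not> dvdp 1 (w $ i4)" using in_line_e1[OF w] w3 by auto
  then have "unit_p (w $ i2) \<or> unit_p (w $ i4)" using w not_dvdp_1_iff unfolding M_4 by blast
  \<comment> \<open>One of the coordinates 2 and 4 of \<open>w\<close> is a unit, so the column that
    they form extends to a matrix of determinant 1 with second column \<open>(a, b)\<close>.\<close>
  then have "\<exists>a\<in>\<O>. \<exists>b\<in>\<O>. w $ i2 * b - w $ i4 * a = 1"
  proof
    assume "unit_p (w $ i2)"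
    then show ?thesis by (intro bexI[of _ 0] bexI[of _ "inverse (w $ i2)"]) (auto simp: unit_p_def)
  next
    assume "unit_p (w $ i4)"
    then show ?thesis by (intro bexI[of _ "- inverse (w $ i4)"] bexI[of _ 0]) (auto simp: unit_p_def)
  qed
  then obtain a b where ab: "a \<in> \<O>" "b \<in> \<O>" "w $ i2 * b - w $ i4 * a = 1" by blast
  define f where "f x = vec4 (x $ i1) (x $ i2 * w $ i2 + x $ i4 * a) (x $ i3) (x $ i2 * w $ i4 + x $ i4 * b)" for x
  obtain h where h: "h \<in> GSp_Gamma" "\<And>x. h *v x = f x"
  proof (rule Gamma_of_linear[of f])
    show "om (f x) (f y) = om x y" for x y
    proof -
      have "om (f x) (f y) = x $ i1 * y $ i3 - x $ i3 * y $ i1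
          + (w $ i2 * b - w $ i4 * a) * (x $ i2 * y $ i4 - x $ i4 * y $ i2)"
        unfolding f_def by (simp add: om_4 algebra_simps)
      then show ?thesis using ab by (simp add: om_4)
    qed
    show "f x \<in> \<M>" if "x \<in> \<M>" for x using that ab w unfolding f_def M_4 by auto
  qed (auto simp: f_def vec_eq_4 algebra_simps)
  have 1: "h *v e1 = e1" unfolding h f_def by (simp add: vec_eq_4)
  have 2: "h *v e2 = vec4 0 (w $ i2) 0 (w $ i4)" unfolding h f_def by (simp add: vec_eq_4)
  have "w - h *v e2 - w $ i1 *s e1 \<in> pM 1" unfolding 2 using w3 by (simp add: pM_4 dvdp_simps)
  then have "g *v (w - h *v e2 - w $ i1 *s e1) \<in> pM 1" using Gamma_pM[OF g(1)] by blast
  then have "u - (g ** h) *v e2 - w $ i1 *s v \<in> pM 1"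
    by (simp add: matrix_vector_mult_diff_distrib vector_scalar_commute gw g matrix_vector_mul_assoc)
  moreover have "(g ** h) *v e1 = v" using 1 g by (simp add: matrix_vector_mul_assoc[symmetric])
  ultimately show ?thesis using that[of "g ** h" "w $ i1"] Gamma_closed(2)[OF g(1) h(1)] w unfolding M_4 by blast
qed

section \<open>The lattices of diag(1,1,p,p) and diag(1,p,p^2,p)\<close>

lemma block_diag_component:
  "(block_diag d e *v x) $ Inl i = d $ i * x $ Inl i" "(block_diag d e *v x) $ Inr i = e $ i * x $ Inr i"
  unfolding block_diag_def matrix_vector_mult_def
  by (simp_all add: if_distrib if_distribR cong: if_cong)

definition matA :: "('p::prime_card, 2) sp_mat" where
  "matA = block_diag (vector [1, 1]) (vector [\<pi>, \<pi>])"

definition matB :: "('p::prime_card, 2) sp_mat" where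
  "matB = block_diag (vector [1, \<pi>]) (vector [\<pi> ^ 2, \<pi>])"

lemma matA_mult: "matA *v x = vec4 (x $ i1) (x $ i2) (\<pi> * x $ i3) (\<pi> * x $ i4)"
  unfolding matA_def by (simp add: vec_eq_4 block_diag_component vector_2)

lemma matB_mult: "matB *v x = vec4 (x $ i1) (\<pi> * x $ i2) (\<pi> ^ 2 * x $ i3) (\<pi> * x $ i4)"
  unfolding matB_def by (simp add: vec_eq_4 block_diag_component vector_2)

lemma matA_Delta: "matA \<in> GSp_Delta" "level matA 1"
proof -
  have *: "matA \<in> carrier GSp" "multiplier matA = \<pi>"
    using GSpI[of matA \<pi>] by (simp_all add: matA_mult om_4 algebra_simps)
  show "matA \<in> GSp_Delta" using * by (simp add: Delta_iff matA_mult M_4)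
  show "level matA 1" unfolding level_def *(2) by (intro exI[of _ 1]) (simp add: unit_p_simps)
qed

lemma matB_Delta: "matB \<in> GSp_Delta" "level matB 2"
proof -
  have *: "matB \<in> carrier GSp" "multiplier matB = \<pi> ^ 2"
    using GSpI[of matB "\<pi> ^ 2"] by (simp_all add: matB_mult om_4 algebra_simps power2_eq_square)
  show "matB \<in> GSp_Delta" using * by (simp add: Delta_iff matB_mult M_4)
  show "level matB 2" unfolding level_def *(2) by (intro exI[of _ 1]) (simp add: unit_p_simps)
qed

lemma lat_matA: "x \<in> lat matA \<longleftrightarrow> x $ i1 \<in> \<O> \<and> x $ i2 \<in> \<O> \<and> dvdp 1 (x $ i3) \<and> dvdp 1 (x $ i4)"
proof
  assume "x $ i1 \<in> \<O> \<and> x $ i2 \<in> \<O> \<and> dvdp 1 (x $ i3) \<and> dvdp 1 (x $ i4)"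
  then show "x \<in> lat matA"
    unfolding lat_def dvdp_def
    by (intro image_eqI[of _ _ "vec4 (x $ i1) (x $ i2) (x $ i3 / \<pi>) (x $ i4 / \<pi>)"])
      (auto simp: matA_mult M_4 vec_eq_4)
qed (auto simp: lat_def matA_mult M_4 dvdp_simps dvdp_def)

lemma lat_matB:
  "x \<in> lat matB \<longleftrightarrow> x $ i1 \<in> \<O> \<and> dvdp 1 (x $ i2) \<and> dvdp 2 (x $ i3) \<and> dvdp 1 (x $ i4)"
proof
  assume "x $ i1 \<in> \<O> \<and> dvdp 1 (x $ i2) \<and> dvdp 2 (x $ i3) \<and> dvdp 1 (x $ i4)"
  then show "x \<in> lat matB"
    unfolding lat_def dvdp_def
    by (intro image_eqI[of _ _ "vec4 (x $ i1) (x $ i2 / \<pi>) (x $ i3 / \<pi> ^ 2) (x $ i4 / \<pi>)"])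
      (auto simp: matB_mult M_4 vec_eq_4)
qed (auto simp: lat_def matB_mult M_4 dvdp_simps dvdp_def)

declare dvdp_simps(2) [simp]

lemma dvdp_unif:
  "dvdp 1 (\<pi> * x) \<longleftrightarrow> x \<in> \<O>" "dvdp 2 (\<pi> * x) \<longleftrightarrow> dvdp 1 x" "dvdp 1 (\<pi> ^ 2 * x) \<longleftrightarrow> \<pi> * x \<in> \<O>"
  unfolding dvdp_def by (simp_all add: power2_eq_square)

subsection \<open>Counting lattices\<close>

text \<open>Double counting of the related pairs. It is the common form of nearly all lattice counts
  below, with vectors on one side and lattices on the other.\<close>

lemma sum_card_swap:
  assumes "finite S" "finite T" "\<And>i. i \<in> S \<Longrightarrow> card {j \<in> T. R i j} = a" "\<And>j. j \<in> T \<Longrightarrow> card {i \<in> S. R i j} = b"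
  shows "card S * a = card T * (b :: nat)"
proof -
  have "(\<Sum>i\<in>S. card {j \<in> T. R i j}) = b * card T"
    using assms(4) by (intro sum_multicount[OF assms(1,2)]) auto
  then show ?thesis using assms(3) by (simp add: mult.commute)
qed

lemma Rk_transport:
  fixes P :: "('p::prime_card, 'n::finite) sp_vec \<Rightarrow> bool"
  assumes "\<gamma> \<in> GSp_Gamma" "\<And>x y. x \<in> \<M> \<Longrightarrow> y \<in> \<M> \<Longrightarrow> x - y \<in> pM k \<Longrightarrow> P x = P y"
  shows "card {x \<in> Rk k. P (\<gamma> *v x)} = card {x \<in> Rk k. P x}"
proof (rule card_Rk_reindex)
  show "\<gamma> *v x \<in> \<M>" if "x \<in> \<M>" for x using that assms(1) Gamma_iff by blast
  show "x - y \<in> pM k" if "\<gamma> *v x - \<gamma> *v y \<in> pM k" for x y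
    using that Gamma_pM[OF assms(1)] by (simp flip: matrix_vector_mult_diff_distrib)
qed (use assms in auto)

text \<open>For \<open>N\<close> in \<open>\<A>\<close> the quotient of \<open>N\<close> by
  \<open>p\<M>\<close> is a Lagrangian plane of the symplectic space of dimension 4 over the field
  with \<open>p\<close> elements.\<close>

definition \<A> :: "('p::prime_card, 2) sp_vec set set" where "\<A> = lats matA"
definition \<B> :: "('p::prime_card, 2) sp_vec set set" where "\<B> = lats matB"

lemma A_props:
  fixes N :: "('p::prime_card, 2) sp_vec set"
  assumes "N \<in> \<A>"
  shows "N \<subseteq> \<M>" "pM 1 \<subseteq> N" "x \<in> N \<Longrightarrow> y \<in> N \<Longrightarrow> dvdp 1 (om x y)"
    "(\<And>y. y \<in> N \<Longrightarrow> dvdp 1 (om y x)) \<Longrightarrow> x \<in> N"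
    "x \<in> N \<Longrightarrow> y \<in> N \<Longrightarrow> x + y \<in> N" "x \<in> N \<Longrightarrow> y \<in> N \<Longrightarrow> x - y \<in> N"
    "c \<in> \<O> \<Longrightarrow> x \<in> N \<Longrightarrow> c *s x \<in> N"
    "card {x \<in> Rk 1. x \<in> N} = CARD('p) ^ 2" "card {x \<in> Rk 2. x \<in> N} = CARD('p) ^ 6"
proof -
  note * = lats_props[OF assms[unfolded \<A>_def] matA_Delta]
  show "N \<subseteq> \<M>" "pM 1 \<subseteq> N" "x \<in> N \<Longrightarrow> y \<in> N \<Longrightarrow> dvdp 1 (om x y)"
    "(\<And>y. y \<in> N \<Longrightarrow> dvdp 1 (om y x)) \<Longrightarrow> x \<in> N"
    "x \<in> N \<Longrightarrow> y \<in> N \<Longrightarrow> x + y \<in> N" "x \<in> N \<Longrightarrow> y \<in> N \<Longrightarrow> x - y \<in> N"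
    "c \<in> \<O> \<Longrightarrow> x \<in> N \<Longrightarrow> c *s x \<in> N"
    by (fact *)+
  let ?p = "CARD('p)"
  have "card {x \<in> Rk 1. x \<in> N} * ?p ^ 2 = ?p ^ 2 * ?p ^ 2"
    using *(9)[of 1] by (simp flip: power_add)
  then show "card {x \<in> Rk 1. x \<in> N} = ?p ^ 2" by (rule mult_right_cancel[THEN iffD1, rotated]) simp
  have "card {x \<in> Rk 2. x \<in> N} * ?p ^ 2 = ?p ^ 6 * ?p ^ 2"
    using *(9)[of 2] by (simp flip: power_add power_mult)
  then show "card {x \<in> Rk 2. x \<in> N} = ?p ^ 6" by (rule mult_right_cancel[THEN iffD1, rotated]) simp
qed

lemma B_props:
  fixes N :: "('p::prime_card, 2) sp_vec set"
  assumes "N \<in> \<B>"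
  shows "N \<subseteq> \<M>" "pM 2 \<subseteq> N" "x \<in> N \<Longrightarrow> y \<in> N \<Longrightarrow> dvdp 2 (om x y)"
    "(\<And>y. y \<in> N \<Longrightarrow> dvdp 2 (om y x)) \<Longrightarrow> x \<in> N"
  by (fact lats_props[OF assms[unfolded \<B>_def] matB_Delta])+

lemma finite_AB: "finite \<A>" "finite \<B>"
  unfolding \<A>_def \<B>_def by (simp_all add: finite_lats matA_Delta matB_Delta)

lemma primv_cong: "x \<in> \<M> \<Longrightarrow> y \<in> \<M> \<Longrightarrow> x - y \<in> pM k \<Longrightarrow> k \<ge> 1 \<Longrightarrow> primv x = primv y"
proof -
  assume xy: "x \<in> \<M>" "y \<in> \<M>" "x - y \<in> pM k" "k \<ge> 1"
  then have c: "x - y \<in> pM 1" using pM_mono[of 1 k] by auto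
  have "x \<in> pM 1 \<longleftrightarrow> y \<in> pM 1"
    using pM_simps(2)[OF c, of y] pM_simps(3)[of x 1, OF _ c] by auto
  then show ?thesis unfolding primv_def using xy by auto
qed

lemma om_cong: "x - y \<in> pM k \<Longrightarrow> v \<in> \<M> \<Longrightarrow> j \<le> k \<Longrightarrow> dvdp j (om v x) = dvdp j (om v y)"
proof -
  assume xy: "x - y \<in> pM k" "v \<in> \<M>" "j \<le> k"
  have d: "dvdp j (om v x - om v y)" using om_pM(2)[OF xy(2,1)] dvdp_le xy(3) by (simp add: om_linear) blast
  show ?thesis using dvdp_simps(3)[OF d, of "om v y"] dvdp_simps(4)[OF _ d, of "om v x"] by auto
qed

lemma in_line_cong: "x - y \<in> pM 1 \<Longrightarrow> in_line v x = in_line v y"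
proof -
  assume xy: "x - y \<in> pM 1"
  have *: "in_line v a" if b: "in_line v b" "b - a \<in> pM 1" for a b
  proof -
    obtain c where c: "c \<in> \<O>" "b - c *s v \<in> pM 1" using b(1) unfolding in_line_def by auto
    have "a - c *s v = (b - c *s v) - (b - a)" by simp
    then have "a - c *s v \<in> pM 1" using c b(2) pM_simps(3) by metis
    then show ?thesis using c unfolding in_line_def by auto
  qed
  have "y - x \<in> pM 1" using pM_simps(4)[OF xy] by simp
  then show ?thesis using * xy by blast
qed

lemma primv_Gamma: "\<gamma> \<in> GSp_Gamma \<Longrightarrow> primv (\<gamma> *v x) \<longleftrightarrow> primv x"
  unfolding primv_def using Gamma_pM Gamma_iff by blast

lemma primv_e1: "primv (e1 :: ('p::prime_card, 2) sp_vec)"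
  using not_dvdp_1_iff[of 1] unfolding primv_def M_4 pM_4 by (simp add: unit_p_simps)

lemma in_A_if_line: "N \<in> \<A> \<Longrightarrow> v \<in> N \<Longrightarrow> in_line v u \<Longrightarrow> u \<in> N"
proof -
  assume N: "N \<in> \<A>" "v \<in> N" "in_line v u"
  then obtain c where c: "c \<in> \<O>" "u - c *s v \<in> pM 1" unfolding in_line_def by auto
  then have "(u - c *s v) + c *s v \<in> N" using A_props(2,5,7)[OF N(1)] N(2) by blast
  then show "u \<in> N" by simp
qed

text \<open>Two independent orthogonal vectors span a Lagrangian plane modulo \<open>p\<close>, and
  such a plane is its own orthogonal complement. The equivalence therefore contains both existence
  and uniqueness of the lattice through \<open>v\<close> and \<open>u\<close>.\<close>

lemma A_two_vectors:
  fixes v u :: "('p::prime_card, 2) sp_vec"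
  assumes v: "primv v" and u: "u \<in> \<M>" "\<not> in_line v u" "dvdp 1 (om v u)"
  shows "N \<in> \<A> \<and> v \<in> N \<and> u \<in> N \<longleftrightarrow> N = {x \<in> \<M>. dvdp 1 (om v x) \<and> dvdp 1 (om u x)}"
proof -
  obtain \<gamma> c where g: "\<gamma> \<in> GSp_Gamma" "\<gamma> *v e1 = v" and c: "c \<in> \<O>" "u - \<gamma> *v e2 - c *s v \<in> pM 1"
    by (rule isotropic_normal_form[OF assms])
  note gG = Gamma_GSp[OF g(1)]
  let ?N = "lat (\<gamma> ** matA)" and ?P = "{x \<in> \<M>. dvdp 1 (om v x) \<and> dvdp 1 (om u x)}"
  have N0: "?N \<in> \<A>" unfolding \<A>_def lats_def using g by auto
  have 1: "\<gamma> *v e1 \<in> ?N" "\<gamma> *v e2 \<in> ?N" using lat_translate(1)[OF gG] by (auto simp: lat_matA)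
  have "(u - \<gamma> *v e2 - c *s v) + (\<gamma> *v e2 + c *s v) \<in> ?N"
    using A_props(5)[OF N0 subsetD[OF A_props(2)[OF N0] c(2)]]
      A_props(5)[OF N0 1(2) A_props(7)[OF N0 c(1) 1(1)]] unfolding g(2) by blast
  then have 2: "v \<in> ?N" "u \<in> ?N" using 1 g by auto
  have P_sub: "?P \<subseteq> ?N"
  proof
    fix x assume x: "x \<in> ?P"
    define y where "y = ginv \<gamma> *v x"
    have gy: "\<gamma> *v y = x" unfolding y_def by (rule ginv(3)[OF gG])
    have y: "y \<in> \<M>" using g x gy Gamma_iff by blast
    have "om (\<gamma> *v e2) x = om u x - om (u - \<gamma> *v e2 - c *s v) x - c * om v x" by (simp add: om_linear)
    moreover have "dvdp 1 (om (u - \<gamma> *v e2 - c *s v) x)" using om_pM(1)[OF c(2)] x by blast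
    ultimately have "dvdp 1 (om (\<gamma> *v e2) x)" using x c(1) dvdp_simps(4,7) by (metis (lifting) mem_Collect_eq)
    then have "dvdp 1 (om e2 y)" using Gamma_dvdp_om[OF g(1), of 1 e2 y] gy by simp
    moreover have "dvdp 1 (om e1 y)" using Gamma_dvdp_om[OF g(1), of 1 e1 y] gy g x by simp
    ultimately have "y \<in> lat matA" using y by (simp add: lat_matA om_4 M_4)
    then show "x \<in> ?N" using lat_translate(1)[OF gG, of y matA] gy by simp
  qed
  have sub_P: "N \<subseteq> ?P" if "N \<in> \<A>" "v \<in> N" "u \<in> N" for N
    using A_props(1,3)[OF that(1)] that by blast
  \<comment> \<open>The images of \<open>e1\<close> and \<open>e2\<close> under \<gamma> generate
    \<open>?N\<close> together with \<open>p\<M>\<close>, and \<open>N\<close> contains all of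
    these.\<close>
  have N_sub: "?N \<subseteq> N" if N: "N \<in> \<A>" "v \<in> N" "u \<in> N" for N
  proof
    fix x assume "x \<in> ?N"
    then obtain y where y: "y \<in> \<M>" "x = \<gamma> *v (matA *v y)"
      unfolding lat_def by (auto simp: matrix_vector_mul_assoc)
    have "u - c *s v - (u - \<gamma> *v e2 - c *s v) \<in> N"
      using A_props(6)[OF N(1) A_props(6)[OF N(1,3) A_props(7)[OF N(1) c(1) N(2)]]
          subsetD[OF A_props(2)[OF N(1)] c(2)]] .
    then have e2N: "\<gamma> *v e2 \<in> N" by simp
    have "vec4 0 0 (\<pi> * y $ i3) (\<pi> * y $ i4) \<in> pM 1"
      using y(1) by (simp add: pM_4 M_4 dvdp_unif)
    then have "\<gamma> *v vec4 0 0 (\<pi> * y $ i3) (\<pi> * y $ i4) \<in> N"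
      using Gamma_pM[OF g(1)] A_props(2)[OF N(1)] by blast
    moreover have "y $ i1 *s v \<in> N" "y $ i2 *s (\<gamma> *v e2) \<in> N"
      using A_props(7)[OF N(1)] N(2) e2N y(1) unfolding M_4 by blast+
    moreover have "matA *v y = y $ i1 *s e1 + y $ i2 *s e2 + vec4 0 0 (\<pi> * y $ i3) (\<pi> * y $ i4)"
      unfolding matA_mult by (simp add: vec_eq_4)
    then have "x = y $ i1 *s v + y $ i2 *s (\<gamma> *v e2) + \<gamma> *v vec4 0 0 (\<pi> * y $ i3) (\<pi> * y $ i4)"
      unfolding y(2) by (simp add: matrix_vector_right_distrib vector_scalar_commute g)
    ultimately show "x \<in> N" using A_props(5)[OF N(1)] by simp
  qed
  have NP: "?N = ?P" using P_sub sub_P[OF N0 2] by blast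
  show ?thesis
  proof
    assume "N \<in> \<A> \<and> v \<in> N \<and> u \<in> N"
    then show "N = ?P" using N_sub sub_P NP by blast
  next
    assume "N = ?P"
    then show "N \<in> \<A> \<and> v \<in> N \<and> u \<in> N" using NP N0 2 by simp
  qed
qed

text \<open>By transitivity of \<Gamma> on primitive vectors it suffices to take
  \<open>v = e1\<close>, where all three conditions become divisibility conditions on coordinates.
  In the third count the vectors in \<open>p\<M>\<close> are subtracted.\<close>

lemma card_Rk_orth:
  fixes v :: "('p::prime_card, 2) sp_vec"
  assumes "primv v"
  shows "card {u \<in> Rk 1. dvdp 1 (om v u)} = CARD('p) ^ 3" "card {u \<in> Rk 1. in_line v u} = CARD('p)"
    "card {u \<in> Rk 2. primv u \<and> dvdp 1 (om v u)} = CARD('p) ^ 7 - CARD('p) ^ 4"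
proof -
  let ?p = "CARD('p)"
  obtain \<gamma> where g: "\<gamma> \<in> GSp_Gamma" "\<gamma> *v e1 = v" using primitive_transitive[OF assms] by blast
  have vM: "v \<in> \<M>" using assms unfolding primv_def by auto
  define t :: "2 + 2 \<Rightarrow> nat" where "t i = (if i = i3 then 1 else 0)" for i
  have t: "(\<forall>i. dvdp (t i) (x $ i)) \<longleftrightarrow> dvdp 1 (om e1 x)" if "x \<in> \<M>" for x
    using that unfolding t_def by (simp add: all_4 om_4 M_4 dvdp_simps)
  have t': "card {x \<in> Rk k :: ('p, 2) sp_vec set. dvdp 1 (om e1 x)} = (?p ^ k) ^ 3 * ?p ^ (k - 1)" if "k \<ge> 1" for k
  proof -
    have "{x \<in> Rk k :: ('p, 2) sp_vec set. dvdp 1 (om e1 x)} = {x \<in> Rk k. \<forall>i. dvdp (t i) (x $ i)}"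
      using t Rk_sub_M by blast
    then show ?thesis
      using card_Rk_dvdp[of t k, where 'p='p] that unfolding prod_4
      by (simp add: t_def power3_eq_cube)
  qed
  have "card {u \<in> Rk 1. dvdp 1 (om v u)} = card {x \<in> Rk 1 :: ('p, 2) sp_vec set. dvdp 1 (om v (\<gamma> *v x))}"
    using vM om_cong[of _ _ 1 v 1] by (intro Rk_transport[OF g(1), symmetric]) auto
  also have "\<dots> = card {x \<in> Rk 1 :: ('p, 2) sp_vec set. dvdp 1 (om e1 x)}"
    using Gamma_dvdp_om[OF g(1), of 1 e1] g(2) by simp
  finally show "card {u \<in> Rk 1. dvdp 1 (om v u)} = ?p ^ 3" using t'[of 1] by simp
  have "card {u \<in> Rk 1. in_line v u} = card {x \<in> Rk 1 :: ('p, 2) sp_vec set. in_line v (\<gamma> *v x)}"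
    using in_line_cong by (intro Rk_transport[OF g(1), symmetric]) auto
  also have "\<dots> = card {x \<in> Rk 1 :: ('p, 2) sp_vec set. in_line e1 x}"
    using Gamma_in_line[OF g(1), of e1] g(2) by simp
  also have "{x \<in> Rk 1 :: ('p, 2) sp_vec set. in_line e1 x}
      = {x \<in> Rk 1. \<forall>i. dvdp (if i = i1 then 0 else 1) (x $ i)}"
  proof -
    have "in_line e1 x \<longleftrightarrow> (\<forall>i. dvdp (if i = i1 then 0 else 1) (x $ i))" if "x \<in> \<M>" for x :: "('p, 2) sp_vec"
      using in_line_e1[OF that] that by (simp add: all_4 dvdp_simps M_4)
    then show ?thesis using Rk_sub_M by blast
  qed
  also have "card \<dots> = ?p"
    using card_Rk_dvdp[of "\<lambda>i. if i = i1 then 0 else 1" 1, where 'p='p] unfolding prod_4 by simp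
  finally show "card {u \<in> Rk 1. in_line v u} = ?p" .
  have "card {u \<in> Rk 2. primv u \<and> dvdp 1 (om v u)}
      = card {x \<in> Rk 2 :: ('p, 2) sp_vec set. primv (\<gamma> *v x) \<and> dvdp 1 (om v (\<gamma> *v x))}"
    using vM om_cong[of _ _ 2 v 1] primv_cong[of _ _ 2] by (intro Rk_transport[OF g(1), symmetric]) auto
  also have "\<dots> = card {x \<in> Rk 2 :: ('p, 2) sp_vec set. primv x \<and> dvdp 1 (om e1 x)}"
    using Gamma_dvdp_om[OF g(1), of 1 e1] g(2) primv_Gamma[OF g(1)] by simp
  also have "\<dots> = card ({x \<in> Rk 2 :: ('p, 2) sp_vec set. dvdp 1 (om e1 x)} - {x \<in> Rk 2. \<forall>i. dvdp 1 (x $ i)})"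
    using Rk_sub_M unfolding primv_def pM_def by (intro arg_cong[of _ _ card]) auto
  also have "\<dots> = card {x \<in> Rk 2 :: ('p, 2) sp_vec set. dvdp 1 (om e1 x)}
      - card {x \<in> Rk 2 :: ('p, 2) sp_vec set. \<forall>i. dvdp 1 (x $ i)}"
    by (intro card_Diff_subset) (auto simp: card_Rk(1) om_4 dvdp_simps)
  also have "\<dots> = ?p ^ 7 - ?p ^ 4"
  proof -
    have "(?p ^ 2) ^ 3 * ?p ^ (2 - 1) = ?p ^ 7" by (simp flip: power_mult power_Suc2)
    moreover have "?p ^ (2 - 1) * ?p ^ (2 - 1) * ?p ^ (2 - 1) * ?p ^ (2 - 1) = ?p ^ 4"
      by (simp add: power4_eq_xxxx)
    ultimately show ?thesis
      using t'[of 2] card_Rk_dvdp[of "\<lambda>_ :: 2 + 2. 1" 2, where 'p='p] unfolding prod_4 by simp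
  qed
  finally show "card {u \<in> Rk 2. primv u \<and> dvdp 1 (om v u)} = ?p ^ 7 - ?p ^ 4" .
qed

lemma card_primv:
  "card {u \<in> Rk 1 :: ('p::prime_card, 2) sp_vec set. primv u} = CARD('p) ^ 4 - 1"
  "card {u \<in> Rk 2 :: ('p::prime_card, 2) sp_vec set. primv u} = CARD('p) ^ 8 - CARD('p) ^ 4"
proof -
  have *: "card {u \<in> Rk k :: ('p, 2) sp_vec set. primv u} = (CARD('p) ^ k) ^ 4 - (CARD('p) ^ (k - 1)) ^ 4" if "k \<ge> 1" for k
  proof -
    have "{u \<in> Rk k :: ('p, 2) sp_vec set. primv u} = Rk k - {x \<in> Rk k. \<forall>i. dvdp 1 (x $ i)}"
      using Rk_sub_M unfolding primv_def pM_def by auto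
    also have "card \<dots> = card (Rk k :: ('p, 2) sp_vec set) - card {x \<in> Rk k :: ('p, 2) sp_vec set. \<forall>i. dvdp 1 (x $ i)}"
      by (intro card_Diff_subset) (auto simp: card_Rk(1))
    finally show ?thesis
      using card_Rk(2)[of k, where 'p='p and 'n=2] card_Rk_dvdp[of "\<lambda>_ :: 2 + 2. 1" k, where 'p='p] that
      unfolding prod_4 by (simp add: power4_eq_xxxx)
  qed
  show "card {u \<in> Rk 1 :: ('p::prime_card, 2) sp_vec set. primv u} = CARD('p) ^ 4 - 1"
    "card {u \<in> Rk 2 :: ('p::prime_card, 2) sp_vec set. primv u} = CARD('p) ^ 8 - CARD('p) ^ 4"
    using *[of 1] *[of 2] by (simp_all flip: power_mult)
qed

text \<open>Modulo \<open>p\<close>, the vectors orthogonal to \<open>v\<close> outside its line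
  number \<open>p^3 - p\<close>. Each spans with \<open>v\<close> exactly one Lagrangian plane, and
  each plane through \<open>v\<close> contains \<open>p^2 - p\<close> of them.\<close>

lemma card_A_through:
  fixes v :: "('p::prime_card, 2) sp_vec"
  assumes v: "primv v"
  shows "card {N \<in> \<A>. v \<in> N} = CARD('p) + 1"
proof -
  let ?p = "CARD('p)"
  let ?S = "{u \<in> Rk 1. dvdp 1 (om v u) \<and> \<not> in_line v u}" and ?T = "{N \<in> \<A>. v \<in> N}"
  have p: "?p > 1" by (rule CARD_gt_1)
  have vM: "v \<in> \<M>" using v unfolding primv_def by auto
  have line_orth: "dvdp 1 (om v u)" if l: "in_line v u" for u
  proof -
    obtain c where c: "c \<in> \<O>" "u - c *s v \<in> pM 1" using l unfolding in_line_def by auto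
    have "om v u = om v (u - c *s v)" by (simp add: om_linear)
    then show ?thesis using om_pM(2)[OF vM c(2)] by simp
  qed
  have "?S = {u \<in> Rk 1. dvdp 1 (om v u)} - {u \<in> Rk 1. in_line v u}" by auto
  then have cS: "card ?S = ?p ^ 3 - ?p"
    using card_Rk_orth(1,2)[OF v] line_orth
    by (simp add: card_Diff_subset card_Rk(1) Collect_mono_iff subset_iff)
  have "card ?S * 1 = card ?T * (?p ^ 2 - ?p)"
  proof (rule sum_card_swap)
    fix u assume u: "u \<in> ?S"
    then have "{N \<in> ?T. u \<in> N} = {{x \<in> \<M>. dvdp 1 (om v x) \<and> dvdp 1 (om u x)}}"
      using A_two_vectors[OF v, of u] Rk_sub_M by blast
    then show "card {N \<in> ?T. u \<in> N} = 1" by simp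
  next
    fix N assume N: "N \<in> ?T"
    then have "{u \<in> ?S. u \<in> N} = {u \<in> Rk 1. u \<in> N} - {u \<in> Rk 1. in_line v u}"
      using A_props(3)[of N v] by blast
    moreover have "{u \<in> Rk 1. in_line v u} \<subseteq> {u \<in> Rk 1. u \<in> N}" using N in_A_if_line by blast
    ultimately show "card {u \<in> ?S. u \<in> N} = ?p ^ 2 - ?p"
      using A_props(8)[of N] N card_Rk_orth(2)[OF v] by (simp add: card_Diff_subset card_Rk(1))
  qed (auto simp: finite_AB card_Rk(1))
  then have "int (card ?T) * (int ?p ^ 2 - int ?p) = int ?p ^ 3 - int ?p"
  proof -
    assume "card ?S * 1 = card ?T * (?p ^ 2 - ?p)"
    then have "int (?p ^ 3 - ?p) = int (card ?T) * int (?p ^ 2 - ?p)"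
      unfolding cS by (simp flip: of_nat_mult)
    moreover have "?p \<le> ?p ^ 3" "?p \<le> ?p ^ 2" using p by (simp_all add: self_le_power)
    ultimately show ?thesis by (simp add: of_nat_diff)
  qed
  moreover have "int ?p ^ 3 - int ?p = (int ?p + 1) * (int ?p ^ 2 - int ?p)"
    by (simp add: power3_eq_cube power2_eq_square algebra_simps)
  moreover have "int ?p ^ 2 - int ?p \<noteq> 0" using p by (simp add: power2_eq_square)
  ultimately have "int (card ?T) = int ?p + 1" by simp
  then show ?thesis by simp
qed

text \<open>Pairs of a nonzero vector and a Lagrangian plane through it are counted twice, which
  gives \<open>(p^4 - 1)(p + 1) = card \<A> * (p^2 - 1)\<close>.\<close>

lemma card_A:
  "int (card (\<A> :: ('p::prime_card, 2) sp_vec set set)) = (int CARD('p) + 1) * (int CARD('p) ^ 2 + 1)"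
proof -
  let ?p = "CARD('p)"
  let ?S = "{u \<in> Rk 1 :: ('p, 2) sp_vec set. primv u}" and ?T = "\<A> :: ('p, 2) sp_vec set set"
  have p: "?p > 1" by (rule CARD_gt_1)
  have z: "{x \<in> Rk 1. x \<in> pM 1} = {0 :: ('p, 2) sp_vec}"
  proof -
    have "(0 :: ('p, 2) sp_vec) \<in> Rk 1" unfolding Rk_def by (auto intro!: image_eqI[of _ _ 0])
    then show ?thesis using Rk_eqI[of _ 1 0] pM_simps(1) by auto
  qed
  have "card ?S * (?p + 1) = card ?T * (?p ^ 2 - 1)"
  proof (rule sum_card_swap)
    fix N assume N: "N \<in> ?T"
    have "{u \<in> ?S. u \<in> N} = {u \<in> Rk 1. u \<in> N} - {x \<in> Rk 1. x \<in> pM 1}"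
      using Rk_sub_M unfolding primv_def by auto
    moreover have "{x \<in> Rk 1. x \<in> pM 1} \<subseteq> {u \<in> Rk 1. u \<in> N}" using A_props(2)[OF N] by blast
    ultimately show "card {u \<in> ?S. u \<in> N} = ?p ^ 2 - 1"
      using A_props(8)[OF N] by (simp add: card_Diff_subset z)
  qed (auto simp: finite_AB card_Rk(1) card_A_through)
  then have "(?p ^ 4 - 1) * (?p + 1) = card ?T * (?p ^ 2 - 1)" by (simp add: card_primv)
  then have "(int ?p ^ 4 - 1) * (int ?p + 1) = int (card ?T) * (int ?p ^ 2 - 1)"
  proof -
    assume "(?p ^ 4 - 1) * (?p + 1) = card ?T * (?p ^ 2 - 1)"
    then have "int (?p ^ 4 - 1) * (int ?p + 1) = int (card ?T) * int (?p ^ 2 - 1)"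
      by (metis of_nat_1 of_nat_add of_nat_mult)
    moreover have "1 \<le> ?p ^ 4" "1 \<le> ?p ^ 2" using p by simp_all
    ultimately show ?thesis by (simp add: of_nat_diff)
  qed
  moreover have "(int ?p ^ 4 - 1) * (int ?p + 1) = (int ?p + 1) * (int ?p ^ 2 + 1) * (int ?p ^ 2 - 1)"
    by (simp add: power4_eq_xxxx power2_eq_square algebra_simps)
  moreover have "int ?p ^ 2 - 1 \<noteq> 0" using p by (simp add: power2_eq_1_iff)
  ultimately show ?thesis by simp
qed

text \<open>Modulo \<open>p\<close> the lattice is the line of \<open>\<delta> *v e1\<close>. If it
  contains \<open>e1\<close>, this is the line of \<open>e1\<close>, and divisibility by
  \<open>p^2\<close> of the pairings with \<open>e1\<close> then forces the inclusion in
  \<open>lat matB\<close>.\<close>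

lemma B_through_e1:
  fixes \<delta> :: "('p::prime_card, 2) sp_mat"
  assumes d: "\<delta> \<in> GSp_Gamma" and e: "e1 \<in> lat (\<delta> ** matB)"
  shows "lat (\<delta> ** matB) = lat matB"
proof -
  have N: "lat (\<delta> ** matB) \<in> \<B>" unfolding \<B>_def lats_def using d by auto
  have BB: "lat matB \<in> \<B>" unfolding \<B>_def lats_def using Gamma_closed(1) by (metis (mono_tags, lifting) matrix_mul_lid mem_Collect_eq)
  have rank1: "\<exists>c\<in>\<O>. x - c *s (\<delta> *v e1) \<in> pM 1" if x: "x \<in> lat (\<delta> ** matB)" for x
  proof -
    obtain y where y: "y \<in> \<M>" "x = \<delta> *v (matB *v y)"
      using x unfolding lat_def by (auto simp: matrix_vector_mul_assoc)
    have "matB *v y - y $ i1 *s e1 \<in> pM 1"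
      using y(1) unfolding matB_mult by (simp add: pM_4 M_4 dvdp_unif)
    then have "\<delta> *v (matB *v y - y $ i1 *s e1) \<in> pM 1" using Gamma_pM[OF d] by blast
    then have "x - y $ i1 *s (\<delta> *v e1) \<in> pM 1"
      by (simp add: y(2) matrix_vector_mult_diff_distrib vector_scalar_commute)
    then show ?thesis using y(1) M_4 by blast
  qed
  obtain a where a: "a \<in> \<O>" "e1 - a *s (\<delta> *v e1) \<in> pM 1" using rank1[OF e] by blast
  have de: "\<delta> *v e1 \<in> \<M>" using d Gamma_iff M_4[of e1] by auto
  \<comment> \<open>If \<open>a\<close> were divisible by \<open>p\<close>, the vector
    \<open>e1\<close> would lie in \<open>p\<M>\<close>, against its primitivity.\<close>
  have ua: "unit_p a"
  proof (rule ccontr)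
    assume "\<not> unit_p a"
    then have "dvdp 1 a" using not_dvdp_1_iff a by blast
    then have "a *s (\<delta> *v e1) \<in> pM 1"
      using de unfolding pM_def integral_vecs_def by (simp add: dvdp_simps)
    then have "(e1 - a *s (\<delta> *v e1)) + a *s (\<delta> *v e1) \<in> pM 1" using a pM_simps(2) by blast
    then show False using primv_e1[where 'p='p] unfolding primv_def by simp
  qed
  have sub: "lat (\<delta> ** matB) \<subseteq> lat matB"
  proof
    fix x assume x: "x \<in> lat (\<delta> ** matB)"
    then have xM: "x \<in> \<M>" using B_props(1)[OF N] by auto
    obtain c where c: "c \<in> \<O>" "x - c *s (\<delta> *v e1) \<in> pM 1" using rank1[OF x] by blast
    have ca: "c * inverse a \<in> \<O>" using c ua unit_p_intg by blast
    have "x - (c * inverse a) *s e1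
        = (x - c *s (\<delta> *v e1)) - (c * inverse a) *s (e1 - a *s (\<delta> *v e1))"
      using unit_p_intg(3)[OF ua] by (simp add: vector_ssub_ldistrib vector_smult_assoc)
    moreover have "(x - c *s (\<delta> *v e1)) - (c * inverse a) *s (e1 - a *s (\<delta> *v e1)) \<in> pM 1"
      using pM_simps(3)[OF c(2) pM_simps(5)[OF ca a(2)]] .
    ultimately have "in_line e1 x" unfolding in_line_def using ca by metis
    then have "dvdp 1 (x $ i2)" "dvdp 1 (x $ i4)" using in_line_e1[OF xM] by auto
    moreover have "dvdp 2 (om e1 x)" using B_props(3)[OF N e x] .
    ultimately show "x \<in> lat matB" using xM by (simp add: lat_matB M_4 om_4)
  qed
  \<comment> \<open>An inclusion between lattices of the same level is an equality, because both are
    self-dual for the form divided by \<open>p^2\<close>.\<close>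
  moreover have "lat matB \<subseteq> lat (\<delta> ** matB)"
    using B_props(4)[OF N] B_props(3)[OF BB] sub by blast
  ultimately show ?thesis by blast
qed

text \<open>The case of \<open>e1\<close> is transported by \<gamma>. Together with transitivity
  this says that each primitive vector lies in exactly one lattice of \<open>\<B>\<close>.\<close>

lemma B_through:
  fixes \<gamma> :: "('p::prime_card, 2) sp_mat"
  assumes g: "\<gamma> \<in> GSp_Gamma"
  shows "N \<in> \<B> \<and> \<gamma> *v e1 \<in> N \<longleftrightarrow> N = lat (\<gamma> ** matB)"
proof
  note gG = Gamma_GSp[OF g]
  {
    assume N: "N \<in> \<B> \<and> \<gamma> *v e1 \<in> N"
    then obtain \<delta> where d: "\<delta> \<in> GSp_Gamma" "N = lat (\<delta> ** matB)" unfolding \<B>_def lats_def by auto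
    define \<eta> where "\<eta> = ginv \<gamma> ** \<delta>"
    have eta: "\<eta> \<in> GSp_Gamma" "\<gamma> ** \<eta> = \<delta>"
      unfolding \<eta>_def using Gamma_closed g d ginv(1)[OF gG] by (auto simp: matrix_mul_assoc)
    have N': "N = lat (\<gamma> ** (\<eta> ** matB))" using d eta by (simp add: matrix_mul_assoc)
    then have "e1 \<in> lat (\<eta> ** matB)" using N lat_translate(1)[OF gG, of e1] by simp
    then have "lat (\<eta> ** matB) = lat matB" using B_through_e1[OF eta(1)] by blast
    then show "N = lat (\<gamma> ** matB)" unfolding N' lat_translate_eq_iff[OF gG] .
  }
  assume N: "N = lat (\<gamma> ** matB)"
  have "\<gamma> *v e1 \<in> N" unfolding N lat_translate(1)[OF gG] by (simp add: lat_matB dvdp_simps)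
  then show "N \<in> \<B> \<and> \<gamma> *v e1 \<in> N" unfolding \<B>_def lats_def using g N by auto
qed

text \<open>In other words, \<open>N\<close> is the lattice spanned by \<open>v\<close>, \<open>p v\<^sup>\<bottom>\<close> and \<open>p\<^sup>2\<M>\<close>.\<close>

lemma B_mem:
  fixes v :: "('p::prime_card, 2) sp_vec"
  assumes N: "N \<in> \<B>" "v \<in> N" "primv v" and x: "x \<in> \<M>"
  shows "\<pi> *s x \<in> N \<longleftrightarrow> dvdp 1 (om v x)" "in_line v x \<Longrightarrow> dvdp 2 (om v x) \<Longrightarrow> x \<in> N"
    "x \<in> N \<Longrightarrow> in_line v x"
proof -
  obtain \<gamma> where g: "\<gamma> \<in> GSp_Gamma" "\<gamma> *v e1 = v" using primitive_transitive[OF N(3)] by blast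
  note gG = Gamma_GSp[OF g(1)]
  have N': "N = lat (\<gamma> ** matB)" using B_through[OF g(1)] N g by auto
  define y where "y = ginv \<gamma> *v x"
  have gy: "\<gamma> *v y = x" unfolding y_def by (rule ginv(3)[OF gG])
  have y: "y \<in> \<M>" using g x gy Gamma_iff by blast
  have "\<pi> *s x \<in> N \<longleftrightarrow> \<pi> *s y \<in> lat matB"
    unfolding N' gy[symmetric] vector_scalar_commute[symmetric] by (rule lat_translate(1)[OF gG])
  also have "\<dots> \<longleftrightarrow> dvdp 1 (y $ i3)" using y by (simp add: lat_matB M_4 dvdp_unif)
  also have "\<dots> \<longleftrightarrow> dvdp 1 (om v x)" using Gamma_dvdp_om[OF g(1), of 1 e1 y] g(2) gy by (simp add: om_4)
  finally show "\<pi> *s x \<in> N \<longleftrightarrow> dvdp 1 (om v x)" .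
  have xN: "x \<in> N \<longleftrightarrow> y \<in> lat matB"
    unfolding N' gy[symmetric] by (rule lat_translate(1)[OF gG])
  have line: "in_line v x \<longleftrightarrow> in_line e1 y" using Gamma_in_line[OF g(1), of e1 y] g gy by simp
  have o: "dvdp 2 (om v x) \<longleftrightarrow> dvdp 2 (y $ i3)" using Gamma_dvdp_om[OF g(1), of 2 e1 y] g(2) gy by (simp add: om_4)
  show "x \<in> N" if "in_line v x" "dvdp 2 (om v x)"
    using that y in_line_e1[OF y] unfolding xN line o lat_matB M_4 by blast
  show "in_line v x" if "x \<in> N"
    using that dvdp_le[of 2 "y $ i3" 1] unfolding xN line lat_matB in_line_e1[OF y] by auto
qed

lemma B_unique: "primv v \<Longrightarrow> \<exists>!N. N \<in> \<B> \<and> v \<in> N"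
  using primitive_transitive[of v] B_through by metis

text \<open>After transport to \<open>lat matB\<close>, a vector is primitive exactly when its first
  coordinate is a unit. There are \<open>p^4\<close> residues modulo \<open>p^2\<close> in the
  lattice, and \<open>p^3\<close> of them have first coordinate divisible by
  \<open>p\<close>.\<close>

lemma card_B_prim:
  fixes N :: "('p::prime_card, 2) sp_vec set"
  assumes "N \<in> \<B>"
  shows "card {u \<in> Rk 2. primv u \<and> u \<in> N} = CARD('p) ^ 4 - CARD('p) ^ 3"
proof -
  let ?p = "CARD('p)"
  obtain \<gamma> where g: "\<gamma> \<in> GSp_Gamma" "N = lat (\<gamma> ** matB)" using assms unfolding \<B>_def lats_def by auto
  note gG = Gamma_GSp[OF g(1)]
  note props = lats_props[OF assms[unfolded \<B>_def] matB_Delta]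
  have per: "x \<in> N \<longleftrightarrow> y \<in> N" if "x - y \<in> pM 2" for x y
  proof -
    have d: "x - y \<in> N" using that props(2) by auto
    show ?thesis using props(5)[OF d, of y] props(6)[OF _ d, of x] by auto
  qed
  have "card {u \<in> Rk 2. primv u \<and> u \<in> N} = card {x \<in> Rk 2. primv (\<gamma> *v x) \<and> \<gamma> *v x \<in> N}"
    using per primv_cong[of _ _ 2] by (intro Rk_transport[OF g(1), symmetric]) auto
  also have "\<dots> = card {x \<in> Rk 2 :: ('p, 2) sp_vec set. primv x \<and> x \<in> lat matB}"
    unfolding g(2) lat_translate(1)[OF gG] primv_Gamma[OF g(1)] ..
  also have "{x \<in> Rk 2 :: ('p, 2) sp_vec set. primv x \<and> x \<in> lat matB} =
     {x \<in> Rk 2. \<forall>i. dvdp (if i = i1 then 0 else if i = i3 then 2 else 1) (x $ i)}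
     - {x \<in> Rk 2 :: ('p, 2) sp_vec set. \<forall>i. dvdp (if i = i3 then 2 else 1) (x $ i)}" (is "_ = ?S - ?T")
    using Rk_sub_M dvdp_le[of 2 _ 1]
    by (auto simp: all_4 dvdp_simps M_4 subset_iff primv_def pM_4 lat_matB)
  also have "card (?S - ?T) = card ?S - card ?T"
    by (intro card_Diff_subset) (auto simp: card_Rk(1) all_4 dvdp_simps dvdp_intg)
  also have "\<dots> = ?p ^ (2 - 0) * ?p ^ (2 - 1) * ?p ^ (2 - 2) * ?p ^ (2 - 1)
      - ?p ^ (2 - 1) * ?p ^ (2 - 1) * ?p ^ (2 - 2) * ?p ^ (2 - 1)"
    using card_Rk_dvdp[of "\<lambda>i. if i = i1 then 0 else if i = i3 then 2 else 1" 2, where 'p='p]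
      card_Rk_dvdp[of "\<lambda>i. if i = i3 then 2 else 1" 2, where 'p='p] unfolding prod_4
    by simp
  also have "\<dots> = ?p ^ 4 - ?p ^ 3" by (simp add: power4_eq_xxxx power3_eq_cube power2_eq_square)
  finally show ?thesis .
qed

text \<open>The lattices of \<open>\<B>\<close> are counted by their primitive vectors
  \<open>u\<close> modulo \<open>p^2\<close>. Each \<open>u\<close> lies in a single
  \<open>N\<close>, for this \<open>N\<close> the inclusion of \<open>pL\<close> means that
  \<open>u\<close> is orthogonal to \<open>L\<close> modulo \<open>p\<close>, and each
  \<open>N\<close> has \<open>p^4 - p^3\<close> such vectors.\<close>

lemma card_B_scaled:
  fixes L :: "('p::prime_card, 2) sp_vec set"
  assumes "L \<subseteq> \<M>"
  shows "card {N \<in> \<B>. \<forall>x\<in>L. \<pi> *s x \<in> N} * (CARD('p) ^ 4 - CARD('p) ^ 3)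
    = card {u \<in> Rk 2. primv u \<and> (\<forall>x\<in>L. dvdp 1 (om u x))}"
proof -
  let ?T = "{N \<in> \<B>. \<forall>x\<in>L. \<pi> *s x \<in> N}" and ?S = "{u \<in> Rk 2. primv u \<and> (\<forall>x\<in>L. dvdp 1 (om u x))}"
  have "card ?S * 1 = card ?T * (CARD('p) ^ 4 - CARD('p) ^ 3)"
  proof (rule sum_card_swap)
    fix u assume u: "u \<in> ?S"
    then obtain N where N: "N \<in> \<B>" "u \<in> N" "\<And>N'. N' \<in> \<B> \<Longrightarrow> u \<in> N' \<Longrightarrow> N' = N"
      using B_unique[of u] by blast
    have "\<pi> *s x \<in> N" if "x \<in> L" for x
      using B_mem(1)[OF N(1,2), of x] u assms that by auto
    then have "{N \<in> ?T. u \<in> N} = {N}" using N(1,2) by (auto dest: N(3))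
    then show "card {N \<in> ?T. u \<in> N} = 1" by simp
  next
    fix N assume N: "N \<in> ?T"
    have "dvdp 1 (om u x)" if "x \<in> L" "primv u" "u \<in> N" for x u
      using B_mem(1)[of N u x] N assms that by auto
    then have "{u \<in> ?S. u \<in> N} = {u \<in> Rk 2. primv u \<and> u \<in> N}" by auto
    then show "card {u \<in> ?S. u \<in> N} = CARD('p) ^ 4 - CARD('p) ^ 3" using card_B_prim[of N] N by simp
  qed (auto simp: finite_AB card_Rk(1))
  then show ?thesis by simp
qed

subsection \<open>The alternating sum over overlattices\<close>

definition cnt :: "('p::prime_card, 'n::finite) sp_mat \<Rightarrow> ('p, 'n) sp_vec set \<Rightarrow> nat" where
  "cnt g L = card {N \<in> lats g. L \<subseteq> N}"

text \<open>The signed integer weights of \<open>q\<^sub>0, \<dots>, q\<^sub>4\<close>, applied to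
  numbers of overlattices. The element \<open>q\<^sub>2\<close> contributes two terms, and
  \<open>\<langle>p\<rangle>T(A)\<close> is counted through the single double coset of
  \<open>pA\<close> (see \<open>GSp_T_scalar_mult\<close>). Scalars are kept as
  \<open>\<pi> ^ k\<close> so that \<open>cnt_scalar\<close> covers all of them.\<close>

definition hecke_sum :: "('p::prime_card, 2) sp_vec set \<Rightarrow> int" where
  "hecke_sum L = int (cnt (mat (\<pi> ^ 0)) L) - int (cnt matA L) + int CARD('p) * int (cnt matB L)
    + int CARD('p) * (int CARD('p) ^ 2 + 1) * int (cnt (mat (\<pi> ^ 1)) L)
    - int CARD('p) ^ 3 * int (cnt (mat (\<pi> ^ 1) ** matA) L) + int CARD('p) ^ 6 * int (cnt (mat (\<pi> ^ 2)) L)"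

lemma cnt_scalar: "cnt (mat (\<pi> ^ k)) L = (if L \<subseteq> pM k then 1 else 0)"
proof -
  have "{N. N = pM k \<and> L \<subseteq> N} = (if L \<subseteq> pM k then {pM k} else {})" by auto
  then show ?thesis unfolding cnt_def lats_scalar by simp
qed

lemma cnt_AB: "cnt matA L = card {N \<in> \<A>. L \<subseteq> N}" "cnt matB L = card {N \<in> \<B>. L \<subseteq> N}"
  unfolding cnt_def \<A>_def \<B>_def by simp_all

lemma smult_M_sub: "N \<subseteq> \<M> \<Longrightarrow> (*s) (\<pi> ^ k) ` N \<subseteq> pM k"
  by (auto simp: pM_simps subset_iff)

lemma cnt_pA_zero:
  assumes "\<not> L \<subseteq> pM 1" shows "cnt (mat (\<pi> ^ 1) ** matA) L = 0"
proof -
  have "\<not> L \<subseteq> N" if "N \<in> lats (mat (\<pi> ^ 1) ** matA)" for N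
    using that assms smult_M_sub[of _ 1] A_props(1) unfolding lats_scalar_mult \<A>_def[symmetric] by blast
  then have "{N \<in> lats (mat (\<pi> ^ 1) ** matA). L \<subseteq> N} = {}" by blast
  then show ?thesis unfolding cnt_def by (simp only: card.empty)
qed

text \<open>Both sides of an inclusion inside \<open>p\<M>\<close> are divided by \<open>p\<close>,
  which turns lattices of type \<open>pA\<close> into lattices of \<open>\<A>\<close>.\<close>

lemma cnt_pA:
  fixes L :: "('p::prime_card, 2) sp_vec set"
  assumes "L \<subseteq> pM 1"
  shows "cnt (mat (\<pi> ^ 1) ** matA) L = card {N \<in> \<A>. {x. \<pi> *s x \<in> L} \<subseteq> N}"
proof -
  have inj: "inj ((*s) (\<pi> :: 'p padic) :: ('p, 2) sp_vec \<Rightarrow> _)"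
    by (rule injI) simp
  have "{N \<in> lats (mat (\<pi> ^ 1) ** matA). L \<subseteq> N} = (`) ((*s) \<pi>) ` {N \<in> \<A>. {x. \<pi> *s x \<in> L} \<subseteq> N}"
  proof -
    have "L \<subseteq> (*s) \<pi> ` N \<longleftrightarrow> {x. \<pi> *s x \<in> L} \<subseteq> N" for N
    proof
      assume "L \<subseteq> (*s) \<pi> ` N"
      then show "{x. \<pi> *s x \<in> L} \<subseteq> N" using inj by (auto dest: injD)
    next
      assume *: "{x. \<pi> *s x \<in> L} \<subseteq> N"
      show "L \<subseteq> (*s) \<pi> ` N"
      proof
        fix x assume x: "x \<in> L"
        then obtain y where "y \<in> \<M>" "x = \<pi> ^ 1 *s y" using assms pME by blast
        then show "x \<in> (*s) \<pi> ` N" using x * by auto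
      qed
    qed
    then show ?thesis unfolding lats_scalar_mult \<A>_def by auto
  qed
  moreover have "inj_on ((`) ((*s) \<pi>)) {N \<in> \<A>. {x. \<pi> *s x \<in> L} \<subseteq> N}"
    using inj_image_eq_iff[OF inj] by (auto intro!: inj_onI)
  ultimately show ?thesis unfolding cnt_def by (simp add: card_image)
qed

text \<open>The terms for \<open>pE\<close>, \<open>pA\<close> and \<open>p\<^sup>2E\<close> count
  lattices inside \<open>p\<M>\<close>, and none of these contains a primitive vector.\<close>

lemma hecke_sum_prim:
  fixes L :: "('p::prime_card, 2) sp_vec set"
  assumes "L \<subseteq> \<M>" "v \<in> L" "primv v"
  shows "hecke_sum L = 1 - int (card {N \<in> \<A>. L \<subseteq> N}) + int CARD('p) * int (card {N \<in> \<B>. L \<subseteq> N})"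
proof -
  have n: "\<not> L \<subseteq> pM 1" using assms unfolding primv_def by auto
  then have "\<not> L \<subseteq> pM 2" using pM_mono[of 1 2] by auto
  then show ?thesis
    unfolding hecke_sum_def cnt_scalar cnt_AB cnt_pA_zero[OF n] pM_simps using n assms(1) by simp
qed

text \<open>Here \<open>L\<close> spans a Lagrangian plane modulo \<open>p\<close>. Exactly one
  lattice of \<open>\<A>\<close> contains it, and none of \<open>\<B>\<close> does, because those
  have rank 1 modulo \<open>p\<close>: the sum is 1 - 1 + 0.\<close>

lemma hecke_sum_rank2:
  fixes L :: "('p::prime_card, 2) sp_vec set"
  assumes L: "L \<subseteq> \<M>" "\<And>x y. x \<in> L \<Longrightarrow> y \<in> L \<Longrightarrow> dvdp 1 (om x y)"
    and v: "v \<in> L" "primv v" and u: "u \<in> L" "\<not> in_line v u"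
  shows "hecke_sum L = 0"
proof -
  let ?P = "{x \<in> \<M>. dvdp 1 (om v x) \<and> dvdp 1 (om u x)}"
  note A2 = A_two_vectors[OF v(2) subsetD[OF L(1) u(1)] u(2) L(2)[OF v(1) u(1)]]
  have P: "?P \<in> \<A>" "v \<in> ?P" "u \<in> ?P" using A2[of ?P] by blast+
  have "L \<subseteq> ?P" using L v(1) u(1) by blast
  then have A: "{N \<in> \<A>. L \<subseteq> N} = {?P}" using P A2 v(1) u(1) by blast
  have B: "{N \<in> \<B>. L \<subseteq> N} = {}"
    using B_mem(3)[OF _ _ v(2), of _ u] u v(1) L(1) by blast
  show ?thesis unfolding hecke_sum_prim[OF L(1) v] A B by simp
qed

text \<open>Here \<open>L\<close> is a line modulo \<open>p\<close>. It lies in \<open>p + 1\<close>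
  lattices of \<open>\<A>\<close>, and the lattice of \<open>\<B>\<close> through \<open>v\<close>
  contains it because the pairings with \<open>v\<close> are divisible by \<open>p^2\<close>: the
  sum is 1 - (p + 1) + p.\<close>

lemma hecke_sum_rank1:
  fixes L :: "('p::prime_card, 2) sp_vec set"
  assumes L: "L \<subseteq> \<M>" and v: "v \<in> L" "primv v"
    and u: "\<And>u. u \<in> L \<Longrightarrow> in_line v u" "\<And>u. u \<in> L \<Longrightarrow> dvdp 2 (om v u)"
  shows "hecke_sum L = 0"
proof -
  have "{N \<in> \<A>. L \<subseteq> N} = {N \<in> \<A>. v \<in> N}" using in_A_if_line u(1) v(1) by blast
  then have A: "card {N \<in> \<A>. L \<subseteq> N} = CARD('p) + 1" using card_A_through[OF v(2)] by simp
  obtain N where N: "N \<in> \<B>" "v \<in> N" "\<And>N'. N' \<in> \<B> \<Longrightarrow> v \<in> N' \<Longrightarrow> N' = N"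
    using B_unique[OF v(2)] by blast
  have "L \<subseteq> N" using B_mem(2)[OF N(1,2) v(2)] u L by blast
  then have "{N \<in> \<B>. L \<subseteq> N} = {N}" using N v(1) by blast
  then show ?thesis using hecke_sum_prim[OF L(1) v] A by simp
qed

text \<open>When \<open>L\<close> lies in \<open>p\<M>\<close>, every lattice of \<open>\<A>\<close>
  contains it and the other conditions pass to \<open>L' = L/p\<close>. The number \<open>b\<close>
  of lattices of \<open>\<B>\<close> above \<open>L\<close> is given by an equation, since
  \<open>card_B_scaled\<close> determines it only after multiplication by
  \<open>p^4 - p^3\<close>.\<close>

lemma hecke_sum_scaled:
  fixes L :: "('p::prime_card, 2) sp_vec set"
  assumes L: "L \<subseteq> pM 1" and L': "L' = {x. \<pi> *s x \<in> L}"
  obtains b where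
    "hecke_sum L = 1 - (int CARD('p) + 1) * (int CARD('p) ^ 2 + 1) + int CARD('p) * b
      + int CARD('p) * (int CARD('p) ^ 2 + 1) - int CARD('p) ^ 3 * int (card {N \<in> \<A>. L' \<subseteq> N})
      + int CARD('p) ^ 6 * (if L' \<subseteq> pM 1 then 1 else 0)"
    "b * (int CARD('p) ^ 4 - int CARD('p) ^ 3)
      = int (card {u \<in> Rk 2. primv u \<and> (\<forall>x\<in>L'. dvdp 1 (om u x))})"
proof -
  let ?p = "CARD('p)"
  have p: "?p > 1" by (rule CARD_gt_1)
  have LL': "x \<in> L \<longleftrightarrow> (\<exists>y\<in>L'. x = \<pi> *s y)" for x
  proof
    assume x: "x \<in> L"
    then obtain y where "y \<in> \<M>" "x = \<pi> ^ 1 *s y" using L pME by blast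
    then show "\<exists>y\<in>L'. x = \<pi> *s y" using x L' by auto
  qed (use L' in auto)
  have L'M: "L' \<subseteq> \<M>"
  proof
    fix x assume "x \<in> L'"
    then have "\<pi> ^ 1 *s x \<in> pM 1" using L L' by auto
    then show "x \<in> \<M>" by (simp only: pM_simps)
  qed
  have "pM 1 \<subseteq> N" if "N \<in> \<A>" for N :: "('p, 2) sp_vec set" using A_props(2)[OF that] .
  then have "{N \<in> \<A>. L \<subseteq> N} = \<A>" using L by blast
  then have 1: "int (card {N \<in> \<A>. L \<subseteq> N}) = (int ?p + 1) * (int ?p ^ 2 + 1)" using card_A[where 'p='p] by simp
  have 2: "{N \<in> \<B>. L \<subseteq> N} = {N \<in> \<B>. \<forall>x\<in>L'. \<pi> *s x \<in> N}" using LL' by auto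
  have 3: "L \<subseteq> pM 2 \<longleftrightarrow> L' \<subseteq> pM 1"
  proof -
    have "\<pi> *s y \<in> pM 2 \<longleftrightarrow> y \<in> pM 1" for y :: "('p, 2) sp_vec"
      unfolding pM_4 by (simp add: dvdp_unif)
    moreover have "L = (*s) \<pi> ` L'" using LL' by auto
    ultimately show ?thesis by (simp add: image_subset_iff subset_eq)
  qed
  have M: "L \<subseteq> \<M>" using L pM_sub_M by blast
  show ?thesis
  proof (rule that)
    show "hecke_sum L = 1 - (int ?p + 1) * (int ?p ^ 2 + 1) + int ?p * int (card {N \<in> \<B>. L \<subseteq> N})
      + int ?p * (int ?p ^ 2 + 1) - int ?p ^ 3 * int (card {N \<in> \<A>. L' \<subseteq> N})
      + int ?p ^ 6 * (if L' \<subseteq> pM 1 then 1 else 0)"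
      unfolding hecke_sum_def cnt_scalar cnt_AB cnt_pA[OF L] pM_simps(6) 1 3 using L M by (simp add: L')
    have "?p ^ 3 \<le> ?p ^ 4" using p by (simp add: power_increasing)
    then have e: "int (?p ^ 4 - ?p ^ 3) = int ?p ^ 4 - int ?p ^ 3" by (simp add: of_nat_diff)
    show "int (card {N \<in> \<B>. L \<subseteq> N}) * (int ?p ^ 4 - int ?p ^ 3)
      = int (card {u \<in> Rk 2. primv u \<and> (\<forall>x\<in>L'. dvdp 1 (om u x))})"
      using arg_cong[OF card_B_scaled[OF L'M], of int] unfolding 2 of_nat_mult e .
  qed
qed

lemma power_expand:
  fixes x :: "'a::comm_ring_1"
  shows "x ^ 2 = x * x" "x ^ 3 = x * x * x" "x ^ 4 = x * x * x * x" "x ^ 6 = x * x * x * x * x * x"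
    "x ^ 7 = x * x * x * x * x * x * x" "x ^ 8 = x * x * x * x * x * x * x * x"
  by (simp_all add: numeral_eq_Suc mult.assoc One_nat_def)

lemma cancel_B:
  fixes b q :: int
  assumes "q > 1" "b * (q ^ 4 - q ^ 3) = c * (q ^ 4 - q ^ 3)" shows "b = c"
proof -
  have "q ^ 4 - q ^ 3 = q ^ 3 * (q - 1)" by (simp add: power_expand algebra_simps)
  then have "q ^ 4 - q ^ 3 \<noteq> 0" using assms(1) by simp
  then show ?thesis using assms(2) by simp
qed

text \<open>The cases are the rank of \<open>L\<close> modulo \<open>p\<close> and, if it is 0, the
  rank of \<open>L' = L/p\<close>. For rank 2, 1, 0 of \<open>L'\<close> the number of lattices of
  \<open>\<A>\<close> above \<open>L'\<close> is \<open>1\<close>, \<open>p + 1\<close>,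
  \<open>(p + 1)(p^2 + 1)\<close>, and \<open>b\<close> is \<open>p^2 + p\<close>,
  \<open>p^3 + p^2 + p\<close>, \<open>p^4 + p^3 + p^2 + p\<close>. Only in the last case does the
  term with \<open>p^6\<close> contribute, and each time everything cancels.\<close>

lemma hecke_sum_isotropic:
  fixes L :: "('p::prime_card, 2) sp_vec set"
  assumes M: "L \<subseteq> \<M>" and L: "\<And>x y. x \<in> L \<Longrightarrow> y \<in> L \<Longrightarrow> dvdp 3 (om x y)"
  shows "hecke_sum L = 0"
proof -
  let ?q = "int CARD('p)"
  have q: "?q > 1" using CARD_gt_1[where 'p='p] by simp
  have L1: "dvdp 1 (om x y)" "dvdp 2 (om x y)" if "x \<in> L" "y \<in> L" for x y
    using L[OF that] dvdp_le[of 3 "om x y" 1] dvdp_le[of 3 "om x y" 2] by simp_all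
  consider v u where "v \<in> L" "primv v" "u \<in> L" "\<not> in_line v u"
    | v where "v \<in> L" "primv v" "\<And>u. u \<in> L \<Longrightarrow> in_line v u"
    | "L \<subseteq> pM 1"
    using M unfolding primv_def by blast
  then show ?thesis
  proof cases
    case 1
    then show ?thesis using hecke_sum_rank2[OF M L1(1)] by blast
  next
    case 2
    then show ?thesis using hecke_sum_rank1[OF M] L1(2) by blast
  next
    case 3
    define L' where "L' = {x. \<pi> *s x \<in> L}"
    obtain b where F: "hecke_sum L = 1 - (?q + 1) * (?q ^ 2 + 1) + ?q * b
        + ?q * (?q ^ 2 + 1) - ?q ^ 3 * int (card {N \<in> \<A>. L' \<subseteq> N})
        + ?q ^ 6 * (if L' \<subseteq> pM 1 then 1 else 0)"
      and b: "b * (?q ^ 4 - ?q ^ 3) = int (card {u \<in> Rk 2. primv u \<and> (\<forall>x\<in>L'. dvdp 1 (om u x))})"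
      using hecke_sum_scaled[OF 3 L'_def] by blast
    have M': "L' \<subseteq> \<M>"
    proof
      fix x assume "x \<in> L'"
      then have "\<pi> ^ 1 *s x \<in> pM 1" using 3 unfolding L'_def by auto
      then show "x \<in> \<M>" by (simp only: pM_simps)
    qed
    \<comment> \<open>This is where \<open>p^3\<close> is required: dividing both arguments by
      \<open>p\<close> uses up \<open>p^2\<close>, and one factor \<open>p\<close> must
      remain.\<close>
    have iso: "dvdp 1 (om x y)" if "x \<in> L'" "y \<in> L'" for x y
    proof -
      have "dvdp 3 (om (\<pi> *s x) (\<pi> *s y))" using L that unfolding L'_def by blast
      then show ?thesis unfolding dvdp_def om_linear by (simp add: power3_eq_cube)
    qed
    have pw: "CARD('p) ^ 4 \<le> CARD('p) ^ k" if "k \<ge> 4" for k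
      using CARD_gt_1[where 'p='p] that by (simp add: power_increasing)
    consider v u where "v \<in> L'" "primv v" "u \<in> L'" "\<not> in_line v u"
      | v where "v \<in> L'" "primv v" "\<And>u. u \<in> L' \<Longrightarrow> in_line v u"
      | "L' \<subseteq> pM 1"
      using M' unfolding primv_def by blast
    then show ?thesis
    proof cases
      case 1
      let ?P = "{x \<in> \<M>. dvdp 1 (om v x) \<and> dvdp 1 (om u x)}"
      note A2 = A_two_vectors[OF 1(2) subsetD[OF M' 1(3)] 1(4) iso[OF 1(1,3)]]
      have P: "?P \<in> \<A>" "v \<in> ?P" "u \<in> ?P" using A2[of ?P] by blast+
      have L'P: "L' \<subseteq> ?P" using M' iso 1(1,3) by blast
      have "N = ?P" if "N \<in> \<A>" "L' \<subseteq> N" for N using A2[of N] that 1(1,3) by blast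
      then have "{N \<in> \<A>. L' \<subseteq> N} = {?P}" using P(1) L'P by blast
      then have A: "card {N \<in> \<A>. L' \<subseteq> N} = 1" by simp
      \<comment> \<open>The plane \<open>?P\<close> is its own orthogonal complement, so the vectors
        orthogonal to \<open>L'\<close> modulo \<open>p\<close> are those of \<open>?P\<close>. This
        reduces \<open>b\<close> to the index of a lattice of \<open>\<A>\<close>.\<close>
      have "u' \<in> ?P \<longleftrightarrow> (\<forall>x\<in>L'. dvdp 1 (om u' x))" if u': "u' \<in> \<M>" for u'
      proof
        assume "u' \<in> ?P"
        then show "\<forall>x\<in>L'. dvdp 1 (om u' x)" using A_props(3)[OF P(1), of u'] L'P by blast
      next
        assume *: "\<forall>x\<in>L'. dvdp 1 (om u' x)"
        have "dvdp 1 (om x u')" if "x \<in> L'" for x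
          using * that dvdp_simps(5)[of 1 "om u' x"] om_swap[of x u'] by simp
        then show "u' \<in> ?P" using u' 1(1,3) by blast
      qed
      then have "{u' \<in> Rk 2. primv u' \<and> (\<forall>x\<in>L'. dvdp 1 (om u' x))}
          = {u' \<in> Rk 2. u' \<in> ?P} - {x \<in> Rk 2. \<forall>i. dvdp 1 (x $ i)}"
        using Rk_sub_M unfolding primv_def pM_def by blast
      moreover have "{x \<in> Rk 2. \<forall>i. dvdp 1 (x $ i)} \<subseteq> {u' \<in> Rk 2. u' \<in> ?P}"
        using A_props(2)[OF P(1)] unfolding pM_def by blast
      moreover have "card {x \<in> Rk 2 :: ('p, 2) sp_vec set. \<forall>i. dvdp 1 (x $ i)} = CARD('p) ^ 4"
        using card_Rk_dvdp[of "\<lambda>_ :: 2 + 2. 1" 2, where 'p='p] unfolding prod_4 by (simp add: power4_eq_xxxx)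
      moreover have "finite {x \<in> Rk 2 :: ('p, 2) sp_vec set. \<forall>i. dvdp 1 (x $ i)}" by (simp add: card_Rk(1))
      ultimately have "card {u' \<in> Rk 2. primv u' \<and> (\<forall>x\<in>L'. dvdp 1 (om u' x))} = CARD('p) ^ 6 - CARD('p) ^ 4"
        using A_props(9)[OF P(1)] by (simp only: card_Diff_subset)
      then have "b * (?q ^ 4 - ?q ^ 3) = ?q ^ 6 - ?q ^ 4"
        using b pw[of 6] by (simp add: of_nat_diff)
      also have "\<dots> = (?q ^ 2 + ?q) * (?q ^ 4 - ?q ^ 3)" by (simp add: power_expand algebra_simps)
      finally have "b = ?q ^ 2 + ?q" using cancel_B[OF q] by blast
      moreover have "\<not> L' \<subseteq> pM 1" using 1(1,2) unfolding primv_def by auto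
      ultimately show ?thesis using F A by (simp add: power_expand algebra_simps)
    next
      case 2
      have vM: "v \<in> \<M>" using 2 unfolding primv_def by auto
      have "{N \<in> \<A>. L' \<subseteq> N} = {N \<in> \<A>. v \<in> N}" using in_A_if_line 2(1,3) by blast
      then have A: "card {N \<in> \<A>. L' \<subseteq> N} = CARD('p) + 1" using card_A_through[OF 2(2)] by simp
      have "(\<forall>x\<in>L'. dvdp 1 (om u x)) \<longleftrightarrow> dvdp 1 (om v u)" if u: "u \<in> \<M>" for u
      proof
        assume "\<forall>x\<in>L'. dvdp 1 (om u x)"
        then show "dvdp 1 (om v u)" using 2(1) dvdp_simps(5)[of 1 "om u v"] om_swap[of v u] by simp
      next
        assume *: "dvdp 1 (om v u)"
        show "\<forall>x\<in>L'. dvdp 1 (om u x)"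
        proof
          fix x assume "x \<in> L'"
          then obtain c where c: "c \<in> \<O>" "x - c *s v \<in> pM 1" using 2(3) unfolding in_line_def by blast
          have "om u x = om u (x - c *s v) + c * - om v u" by (simp add: om_linear om_swap[of v u])
          moreover have "dvdp 1 (c * - om v u)" using dvdp_simps(7)[OF dvdp_simps(5)[OF *] c(1)] .
          ultimately show "dvdp 1 (om u x)" using om_pM(2)[OF u c(2)] dvdp_simps(3) by metis
        qed
      qed
      then have "{u \<in> Rk 2. primv u \<and> (\<forall>x\<in>L'. dvdp 1 (om u x))} = {u \<in> Rk 2. primv u \<and> dvdp 1 (om v u)}"
        unfolding primv_def by blast
      then have "b * (?q ^ 4 - ?q ^ 3) = ?q ^ 7 - ?q ^ 4"
        using b pw[of 7] card_Rk_orth(3)[OF 2(2)] by (simp add: of_nat_diff)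
      also have "\<dots> = (?q ^ 3 + ?q ^ 2 + ?q) * (?q ^ 4 - ?q ^ 3)" by (simp add: power_expand algebra_simps)
      finally have "b = ?q ^ 3 + ?q ^ 2 + ?q" using cancel_B[OF q] by blast
      moreover have "\<not> L' \<subseteq> pM 1" using 2(1,2) unfolding primv_def by auto
      ultimately show ?thesis using F A by (simp add: power_expand algebra_simps)
    next
      case 3
      have "{N \<in> \<A>. L' \<subseteq> N} = \<A>" using A_props(2) 3 by blast
      then have A: "int (card {N \<in> \<A>. L' \<subseteq> N}) = (?q + 1) * (?q ^ 2 + 1)" using card_A[where 'p='p] by simp
      have "\<forall>x\<in>L'. dvdp 1 (om u x)" if u: "u \<in> \<M>" for u using om_pM(2)[OF u] 3 by blast
      then have "{u \<in> Rk 2. primv u \<and> (\<forall>x\<in>L'. dvdp 1 (om u x))} = {u \<in> Rk 2. primv u}"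
        unfolding primv_def by blast
      then have "b * (?q ^ 4 - ?q ^ 3) = ?q ^ 8 - ?q ^ 4"
        using b pw[of 8] card_primv(2)[where 'p='p] by (simp add: of_nat_diff)
      also have "\<dots> = (?q ^ 4 + ?q ^ 3 + ?q ^ 2 + ?q) * (?q ^ 4 - ?q ^ 3)" by (simp add: power_expand algebra_simps)
      finally have "b = ?q ^ 4 + ?q ^ 3 + ?q ^ 2 + ?q" using cancel_B[OF q] by blast
      then show ?thesis using F A 3 by (simp add: power_expand algebra_simps)
    qed
  qed
qed

section \<open>Values of the alternating sum at the lattices C\<M> and their enlargements\<close>

lemma e1_M [simp]: "e1 \<in> \<M>" "e2 \<in> \<M>" "vec4 0 0 1 0 \<in> \<M>"
  by (simp_all add: M_4)

lemma unit_not_dvdp: "\<not> dvdp 1 (1 :: 'p::prime_card padic)"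
  using not_dvdp_1_iff[of "1 :: 'p padic"] by (simp add: unit_p_simps)

lemma hecke_sum_M: "hecke_sum (\<M> :: ('p::prime_card, 2) sp_vec set) = 1"
proof -
  have e: "(e1 :: ('p, 2) sp_vec) \<in> \<M>" "(vec4 0 0 1 0 :: ('p, 2) sp_vec) \<in> \<M>" by simp_all
  have om: "om e1 (vec4 0 0 1 0 :: ('p, 2) sp_vec) = 1" by (simp add: om_4)
  have "\<not> \<M> \<subseteq> N" if "N \<in> \<A>" for N :: "('p, 2) sp_vec set"
    using A_props(3)[OF that, of e1 "vec4 0 0 1 0"] e om unit_not_dvdp by (metis subsetD)
  moreover have "\<not> \<M> \<subseteq> N" if "N \<in> \<B>" for N :: "('p, 2) sp_vec set"
    using B_props(3)[OF that, of e1 "vec4 0 0 1 0"] e om unit_not_dvdp dvdp_le[of 2 1 1] by (metis subsetD one_le_numeral)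
  ultimately have AB: "{N \<in> \<A>. (\<M> :: ('p, 2) sp_vec set) \<subseteq> N} = {}" "{N \<in> \<B>. (\<M> :: ('p, 2) sp_vec set) \<subseteq> N} = {}"
    by blast+
  show ?thesis unfolding hecke_sum_prim[OF subset_refl e(1) primv_e1] AB by simp
qed

text \<open>With \<open>L' = \<M>\<close> only the terms for \<open>E\<close>, \<open>A\<close> and
  \<open>pE\<close> remain, and 1 - (p + 1)(p^2 + 1) + p(p^2 + 1) equals -p^2.\<close>

lemma hecke_sum_pM: "hecke_sum (pM 1 :: ('p::prime_card, 2) sp_vec set) = - (int CARD('p) ^ 2)"
proof -
  let ?q = "int CARD('p)" and ?M = "\<M> :: ('p, 2) sp_vec set"
  have "\<pi> ^ 1 *s x \<in> pM 1 \<longleftrightarrow> x \<in> \<M>" for x :: "('p, 2) sp_vec" by (rule pM_simps(7))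
  then have L': "?M = {x. \<pi> *s x \<in> pM 1}" by simp
  obtain b where F: "hecke_sum (pM 1 :: ('p, 2) sp_vec set) = 1 - (?q + 1) * (?q ^ 2 + 1) + ?q * b
        + ?q * (?q ^ 2 + 1) - ?q ^ 3 * int (card {N \<in> \<A>. ?M \<subseteq> N})
        + ?q ^ 6 * (if ?M \<subseteq> pM 1 then 1 else 0)"
      and b: "b * (?q ^ 4 - ?q ^ 3) = int (card {u \<in> Rk 2. primv u \<and> (\<forall>x\<in>?M. dvdp 1 (om u x))})"
    using hecke_sum_scaled[OF subset_refl L'] by blast
  have e: "(e1 :: ('p, 2) sp_vec) \<in> \<M>" "(vec4 0 0 1 0 :: ('p, 2) sp_vec) \<in> \<M>" by simp_all
  have om: "om e1 (vec4 0 0 1 0 :: ('p, 2) sp_vec) = 1" by (simp add: om_4)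
  have "\<not> \<M> \<subseteq> N" if "N \<in> \<A>" for N :: "('p, 2) sp_vec set"
    using A_props(3)[OF that, of e1 "vec4 0 0 1 0"] e om unit_not_dvdp by (metis subsetD)
  then have A: "{N \<in> \<A>. ?M \<subseteq> N} = {}" by blast
  \<comment> \<open>A vector orthogonal to all of \<M> modulo \<open>p\<close> is not primitive, so
    no lattice of \<open>\<B>\<close> contains \<open>p\<M>\<close>.\<close>
  have "u \<in> pM 1" if "\<forall>x\<in>?M. dvdp 1 (om u x)" for u
    unfolding pM_iff_om using that dvdp_simps(5) om_swap[of _ u] by metis
  then have E: "{u \<in> Rk 2. primv u \<and> (\<forall>x\<in>?M. dvdp 1 (om u x))} = {}" unfolding primv_def by blast
  have "b * (?q ^ 4 - ?q ^ 3) = 0 * (?q ^ 4 - ?q ^ 3)" unfolding b E by simp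
  then have "b = 0" using cancel_B[of ?q b 0] CARD_gt_1[where 'p='p] by simp
  moreover have "\<not> ?M \<subseteq> pM 1" using e primv_e1[where 'p='p] unfolding primv_def by blast
  ultimately show ?thesis unfolding F A by (simp add: power_expand algebra_simps)
qed

text \<open>For levels 0, 1 and 2 the form is not divisible by \<open>p^3\<close> on
  \<open>C\<M>\<close>, and self-duality of the lattice takes over. It forces rank 2 modulo
  \<open>p\<close> at level 1, and it leaves \<open>p\<M>\<close> as the only lattice of rank 0 at
  level 2. From level 3 on \<open>hecke_sum_isotropic\<close> applies.\<close>

lemma hecke_sum_lat:
  fixes C :: "('p::prime_card, 2) sp_mat"
  assumes C: "C \<in> GSp_Delta" "level C k"
  shows "hecke_sum (lat C) = (if k = 0 then 1 else if lat C = pM 1 then - (int CARD('p) ^ 2) else 0)"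
proof -
  note CG = Delta_GSp[OF C(1)]
  have iso: "dvdp k (om x y)" if "x \<in> lat C" "y \<in> lat C" for x y
    using that lat_iff_om[OF CG C(2)] by blast
  have iso': "dvdp j (om x y)" if "x \<in> lat C" "y \<in> lat C" "j \<le> k" for x y j
    using dvdp_le[OF iso[OF that(1,2)] that(3)] .
  have dual: "x \<in> lat C" if "\<And>y. y \<in> lat C \<Longrightarrow> dvdp k (om y x)" for x
    using that lat_iff_om[OF CG C(2)] by blast
  have M: "lat C \<subseteq> \<M>" by (rule lat_sub_M[OF C(1)])
  consider "k = 0" | "k = 1" | "k = 2" | "k \<ge> 3" by linarith
  then show ?thesis
  proof cases
    case 1
    then have "C \<in> GSp_Gamma" using C level_0_iff by blast
    then show ?thesis using 1 lat_eq_M_iff[OF CG] hecke_sum_M by simp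
  next
    case 2
    \<comment> \<open>A lattice inside \<open>p\<M>\<close> is orthogonal modulo \<open>p\<close> to
      every integral vector, so at level 1 self-duality would put \<open>e1\<close> into it.\<close>
    have ne: "\<not> lat C \<subseteq> pM 1"
    proof
      assume *: "lat C \<subseteq> pM 1"
      have "e1 \<in> lat C" using dual om_pM(1) * 2 e1_M(1) by blast
      then show False using * primv_e1 unfolding primv_def by blast
    qed
    then obtain v where v: "v \<in> lat C" "primv v" using M unfolding primv_def by blast
    obtain \<gamma> where g: "\<gamma> \<in> GSp_Gamma" "\<gamma> *v e1 = v" using primitive_transitive[OF v(2)] by blast
    \<comment> \<open>If the lattice were only the line of \<open>v\<close> modulo \<open>p\<close>,
      the vector \<open>\<gamma> *v e2\<close>, which is orthogonal to \<open>v\<close> and off this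
      line, would belong to it by self-duality.\<close>
    have "\<exists>u\<in>lat C. \<not> in_line v u"
    proof (rule ccontr)
      assume "\<not> (\<exists>u\<in>lat C. \<not> in_line v u)"
      then have line: "in_line v u" if "u \<in> lat C" for u using that by blast
      have gM: "\<gamma> *v e2 \<in> \<M>" using g Gamma_iff e1_M(2) by blast
      have "\<gamma> *v e2 \<in> lat C"
      proof (rule dual)
        fix y assume "y \<in> lat C"
        then obtain c where c: "c \<in> \<O>" "y - c *s v \<in> pM 1" using line unfolding in_line_def by blast
        have "om v (\<gamma> *v e2) = 0"
          using GSpD(1)[OF Gamma_GSp[OF g(1)], of e1 e2] g(2) by (simp add: om_4)
        then have "om y (\<gamma> *v e2) = om (y - c *s v) (\<gamma> *v e2)" by (simp add: om_linear)
        then show "dvdp k (om y (\<gamma> *v e2))" using om_pM(1)[OF c(2) gM] 2 by simp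
      qed
      then have "in_line e1 (e2 :: ('p, 2) sp_vec)" using line Gamma_in_line[OF g(1), of e1 e2] g(2) by simp
      then show False using in_line_e1[of "e2 :: ('p, 2) sp_vec"] unit_not_dvdp[where 'p='p] by simp
    qed
    then obtain u where "u \<in> lat C" "\<not> in_line v u" by blast
    then have "hecke_sum (lat C) = 0" using hecke_sum_rank2[OF M _ v] iso 2 by blast
    then show ?thesis using ne 2 by auto
  next
    case 3
    consider v u where "v \<in> lat C" "primv v" "u \<in> lat C" "\<not> in_line v u"
      | v where "v \<in> lat C" "primv v" "\<And>u. u \<in> lat C \<Longrightarrow> in_line v u"
      | "lat C \<subseteq> pM 1"
      using M unfolding primv_def by blast
    then show ?thesis
    proof cases
      case 1
      have "hecke_sum (lat C) = 0"
        using \<open>k = 2\<close> iso' by (intro hecke_sum_rank2[OF M _ 1]) auto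
      then show ?thesis using 1 \<open>k = 2\<close> unfolding primv_def by auto
    next
      case 2
      have "hecke_sum (lat C) = 0"
        using hecke_sum_rank1[OF M 2] iso 2(1) \<open>k = 2\<close> by simp
      then show ?thesis using 2 \<open>k = 2\<close> unfolding primv_def by auto
    next
      case 3
      have "pM 1 \<subseteq> lat C"
      proof
        fix x :: "('p, 2) sp_vec" assume "x \<in> pM 1"
        then obtain z where z: "z \<in> \<M>" "x = \<pi> ^ 1 *s z" by (rule pME)
        show "x \<in> lat C"
        proof (rule dual)
          fix y assume "y \<in> lat C"
          then have "y \<in> pM 1" using 3 by blast
          then have "dvdp 1 (om y z)" using om_pM(1) z(1) by blast
          then show "dvdp k (om y x)" unfolding z(2) \<open>k = 2\<close> om_linear by (simp add: dvdp_unif)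
        qed
      qed
      then have "lat C = pM 1" using 3 by blast
      then show ?thesis using hecke_sum_pM[where 'p='p] \<open>k = 2\<close> by simp
    qed
  next
    case 4
    have "lat C \<noteq> pM 1"
    proof
      assume *: "lat C = pM 1"
      have "\<pi> ^ 1 *s e1 \<in> lat C" "\<pi> ^ 1 *s vec4 0 0 1 0 \<in> lat C"
        unfolding * pM_simps(7) by simp_all
      then have "dvdp k (om (\<pi> ^ 1 *s e1) (\<pi> ^ 1 *s vec4 0 0 1 0 :: ('p, 2) sp_vec))" by (rule iso)
      then have "dvdp 3 (\<pi> * \<pi> :: 'p padic)" using dvdp_le[OF _ 4] by (simp add: om_4)
      moreover have "\<pi> * \<pi> / \<pi> ^ 3 = (inverse \<pi> :: 'p padic)"
        by (simp add: power3_eq_cube field_simps)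
      ultimately show False using inverse_unif_notin[where 'p='p] unfolding dvdp_def by simp
    qed
    moreover have "hecke_sum (lat C) = 0"
      using hecke_sum_isotropic[OF M] iso dvdp_le[OF _ 4] by blast
    ultimately show ?thesis using 4 by simp
  qed
qed

text \<open>When \<open>z \<notin> lat C\<close> the symplectic form is divisible by \<open>p\<^sup>3\<close> on the enlarged lattice,
  so that the alternating sum vanishes.\<close>

lemma hecke_sum_adjoin:
  fixes C :: "('p::prime_card, 2) sp_mat"
  assumes C: "C \<in> GSp_Delta" "level C k" and w: "w \<in> \<M>"
    and z: "z = (\<pi> ^ 4 / \<pi> ^ k) *s (C *v w)"
  shows "hecke_sum (insert z (lat C)) = (if k = 0 then 1 else if lat C = pM 1 then - (int CARD('p) ^ 2) else 0)"
proof (cases "k \<le> 4")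
  case True
  have "z = \<pi> ^ (4 - k) *s (C *v w)" unfolding z using True by (simp add: power_diff)
  moreover have "C *v w \<in> lat C" using w unfolding lat_def by blast
  ultimately have "z \<in> lat C" using lat_closed(4)[of "\<pi> ^ (4 - k)" "C *v w" C] by simp
  then show ?thesis using hecke_sum_lat[OF C] by (simp add: insert_absorb)
next
  case False
  note CG = Delta_GSp[OF C(1)]
  have zero: "hecke_sum (insert z (lat C)) = 0"
  proof (cases "z \<in> \<M>")
    case True
    show ?thesis
    proof (rule hecke_sum_isotropic)
      show "insert z (lat C) \<subseteq> \<M>" using True lat_sub_M[OF C(1)] by blast
      have iso: "dvdp k (om x y)" if "x \<in> lat C" "y \<in> lat C" for x y
        using that lat_iff_om[OF CG C(2)] by blast
      have 1: "dvdp 3 (om x y)" if "x \<in> lat C" "y \<in> lat C" for x y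
        using dvdp_le[OF iso[OF that], of 3] \<open>\<not> k \<le> 4\<close> by simp
      have 2: "dvdp 3 (om x z)" if "x \<in> lat C" for x
      proof -
        have "dvdp k (om x (C *v w))" using that w lat_iff_om[OF CG C(2), of "C *v w"] unfolding lat_def by blast
        then obtain t where t: "t \<in> \<O>" "om x (C *v w) = \<pi> ^ k * t" by (rule dvdpE)
        \<comment> \<open>The pairing with \<open>Cw\<close> is divisible by \<open>p^k\<close>, and
          the scaling by \<open>p^(4-k)\<close> leaves \<open>p^4\<close>, one power more than
          needed.\<close>
        have "om x z = \<pi> ^ 3 * (\<pi> * t)" unfolding z om_linear t(2) by (simp add: power_expand)
        then show ?thesis using t(1) by (simp only: dvdp_simps) simp
      qed
      have 3: "dvdp 3 (om z x)" if "x \<in> lat C" for x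
        using dvdp_simps(5)[OF 2[OF that]] om_swap[of z x] by simp
      show "dvdp 3 (om x y)" if "x \<in> insert z (lat C)" "y \<in> insert z (lat C)" for x y
        using that 1 2 3 by auto
    qed
  next
    case False
    \<comment> \<open>All lattices that are counted lie in \<M>, so a non-integral \<open>z\<close>
      makes the sum vanish term by term.\<close>
    have sub: "cnt g (insert z (lat C)) = 0" if g: "g \<in> GSp_Delta" for g
    proof -
      obtain m where m: "level g m" using level_exists[OF g] by blast
      have "{N \<in> lats g. insert z (lat C) \<subseteq> N} = {}"
        using lats_props(1)[OF _ g m] False by blast
      then show ?thesis unfolding cnt_def by (simp only: card.empty)
    qed
    show ?thesis unfolding hecke_sum_def
      by (simp add: sub scalar_Delta(1) matA_Delta(1) matB_Delta(1) Delta_mult[OF scalar_Delta(1) matA_Delta(1)] del: power_one_right power_0)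
  qed
  \<comment> \<open>At level above 4 the sum at \<open>lat C\<close> vanishes by
    \<open>hecke_sum_isotropic\<close>, whereas its value at \<open>p\<M>\<close> is
    \<open>-p^2\<close>.\<close>
  moreover have "lat C \<noteq> pM 1"
  proof
    assume *: "lat C = pM 1"
    have iso: "dvdp k (om x y)" if "x \<in> lat C" "y \<in> lat C" for x y
      using that lat_iff_om[OF CG C(2)] by blast
    have "dvdp 3 (om x y)" if "x \<in> lat C" "y \<in> lat C" for x y
      using dvdp_le[OF iso[OF that], of 3] False by simp
    then have "hecke_sum (lat C) = 0" using hecke_sum_isotropic[OF lat_sub_M[OF C(1)]] by blast
    then show False unfolding * hecke_sum_pM by simp
  qed
  ultimately show ?thesis using False by simp
qed

subsection \<open>The two Hecke pairs\<close>

lemma Heis_simps [simp]: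
  "carrier Heis = carrier GSp \<times> UNIV" "\<one>\<^bsub>Heis\<^esub> = (mat 1, 0)"
  "(A, a) \<otimes>\<^bsub>Heis\<^esub> (B, b) = (A ** B, A *v b + multiplier B *s a)"
  unfolding Heis_def by simp_all

lemma Heis_group: "group Heis"
proof (rule groupI)
  fix x y z :: "('p::prime_card, 'n::finite) heis"
  assume xyz: "x \<in> carrier Heis" "y \<in> carrier Heis" "z \<in> carrier Heis"
  obtain A a B b C c where e: "x = (A, a)" "y = (B, b)" "z = (C, c)" by (cases x, cases y, cases z)
  show "x \<otimes>\<^bsub>Heis\<^esub> y \<otimes>\<^bsub>Heis\<^esub> z = x \<otimes>\<^bsub>Heis\<^esub> (y \<otimes>\<^bsub>Heis\<^esub> z)"
    using xyz unfolding e
    by (simp add: GSp_mult matrix_mul_assoc matrix_vector_right_distrib matrix_vector_mul_assoc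
        vector_scalar_commute vector_add_ldistrib vector_smult_assoc mult.commute add.assoc)
next
  fix x :: "('p::prime_card, 'n::finite) heis" assume x: "x \<in> carrier Heis"
  obtain A a where e: "x = (A, a)" by (cases x)
  have A: "A \<in> carrier GSp" using x e by simp
  show "\<exists>y\<in>carrier Heis. y \<otimes>\<^bsub>Heis\<^esub> x = \<one>\<^bsub>Heis\<^esub>"
    using ginv[OF A] GSpD(2)[OF A] unfolding e
    by (intro bexI[of _ "(ginv A, - (inverse (multiplier A) *s (ginv A *v a)))"])
      (simp_all add: vector_smult_assoc vector_smult_rneg)
qed (auto simp: GSp_one GSp_mult)

interpretation Heis: group "Heis :: ('p::prime_card, 'n::finite) heis monoid" by (rule Heis_group)

lemma Heis_inv_0: "\<alpha> \<in> carrier GSp \<Longrightarrow> inv\<^bsub>Heis\<^esub> (\<alpha>, 0) = (ginv \<alpha>, 0)"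
  by (rule Heis.inv_equality) (simp_all add: ginv)

lemma Heis_Gamma_subgroup: "subgroup Heis_Gamma Heis"
proof (rule Heis.subgroupI)
  show "Heis_Gamma \<subseteq> carrier Heis" unfolding Heis_Gamma_def using Gamma_GSp by auto
  show "Heis_Gamma \<noteq> {}" unfolding Heis_Gamma_def using Gamma_closed(1) M_simps(1) by blast
  fix x :: "('a, 'b) heis" assume x: "x \<in> Heis_Gamma"
  obtain A a where e: "x = (A, a)" by (cases x)
  have A: "A \<in> GSp_Gamma" "a \<in> \<M>" using x unfolding e Heis_Gamma_def by auto
  have AG: "A \<in> carrier GSp" using A Gamma_GSp by auto
  have "inv\<^bsub>Heis\<^esub> x = (ginv A, - (inverse (multiplier A) *s (ginv A *v a)))"
    unfolding e using ginv[OF AG] GSpD(2)[OF AG]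
    by (intro Heis.inv_equality) (simp_all add: vector_smult_assoc vector_smult_rneg AG)
  moreover have "ginv A *v a \<in> \<M>" using Gamma_closed(3)[OF A(1)] A(2) Gamma_iff by blast
  moreover have "inverse (multiplier A) \<in> \<O>" using A(1) Gamma_iff_unit unit_p_intg(2) by blast
  ultimately show "inv\<^bsub>Heis\<^esub> x \<in> Heis_Gamma"
    unfolding Heis_Gamma_def using Gamma_closed(3)[OF A(1)] by auto
next
  fix x y :: "('a, 'b) heis" assume xy: "x \<in> Heis_Gamma" "y \<in> Heis_Gamma"
  obtain X a Y b where e: "x = (X, a)" "y = (Y, b)" by (cases x, cases y)
  have X: "X \<in> GSp_Gamma" "a \<in> \<M>" "Y \<in> GSp_Gamma" "b \<in> \<M>" using xy unfolding e Heis_Gamma_def by auto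
  have "X *v b \<in> \<M>" using X Gamma_iff by blast
  then show "x \<otimes>\<^bsub>Heis\<^esub> y \<in> Heis_Gamma"
    unfolding Heis_Gamma_def e using X Gamma_closed(2)[OF X(1,3)] multiplier_intg[OF Gamma_Delta[OF X(3)]]
    by auto
qed

lemma l_coset_Gamma_lat:
  assumes "g \<in> GSp_Delta" "h \<in> GSp_Delta" "lat g = lat h"
  shows "g <#\<^bsub>GSp\<^esub> GSp_Gamma = h <#\<^bsub>GSp\<^esub> GSp_Gamma"
proof -
  note gG = Delta_GSp[OF assms(1)] Delta_GSp[OF assms(2)]
  have "h = g ** (ginv g ** h)" using ginv(1)[OF gG(1)] by (simp add: matrix_mul_assoc)
  then have "h \<in> g <#\<^bsub>GSp\<^esub> GSp_Gamma"
    using lat_eq_imp[OF gG assms(3)] unfolding l_coset_def by auto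
  then show ?thesis by (rule GSp.l_repr_independence[OF _ gG(1) Gamma_subgroup])
qed

lemma level_double:
  assumes C: "C \<in> GSp_Delta" "level C k" and X: "X \<in> GSp_Gamma" "Y \<in> GSp_Gamma"
  shows "X ** C ** Y \<in> GSp_Delta" "level (X ** C ** Y) k"
proof -
  note 1 = level_Gamma_mult[OF X(1) C]
  show "X ** C ** Y \<in> GSp_Delta" using 1(1) Delta_mult Gamma_Delta[OF X(2)] by blast
  have "level Y 0" using X(2) Gamma_Delta level_0_iff by blast
  then show "level (X ** C ** Y) k"
    using level_mult[of "X ** C" Y k 0] 1 Delta_GSp Gamma_GSp[OF X(2)] by auto
qed

lemma GSp_dc:
  "double_coset GSp GSp_Gamma C = {X ** C ** Y | X Y. X \<in> GSp_Gamma \<and> Y \<in> GSp_Gamma}"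
  unfolding double_coset_eq by simp

text \<open>Finiteness of the left cosets follows from \<open>finite_lattices\<close>: a coset is
  recovered from its lattice by way of any chosen generator \<open>?r N\<close>.\<close>

interpretation GH: hecke_pair "GSp :: ('p::prime_card, 'n::finite) sp_mat monoid" GSp_Gamma GSp_Delta
proof (intro hecke_pair.intro hecke_pair_axioms.intro)
  show "subgroup GSp_Gamma (GSp :: ('p, 'n) sp_mat monoid)" by (rule Gamma_subgroup)
  show "GSp_Gamma \<subseteq> (GSp_Delta :: ('p, 'n) sp_mat set)" using Gamma_Delta by auto
  show "GSp_Delta \<subseteq> carrier (GSp :: ('p, 'n) sp_mat monoid)" using Delta_GSp by auto
  fix C :: "('p, 'n) sp_mat" assume C: "C \<in> GSp_Delta"
  obtain k where k: "level C k" using level_exists[OF C] by blast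
  let ?L = "{lat g | g :: ('p, 'n) sp_mat. g \<in> GSp_Delta \<and> level g k}"
  let ?r = "\<lambda>N. SOME g :: ('p, 'n) sp_mat. g \<in> GSp_Delta \<and> level g k \<and> lat g = N"
  have "left_cosets_in GSp GSp_Gamma (double_coset GSp GSp_Gamma C) \<subseteq> (\<lambda>N. ?r N <#\<^bsub>GSp\<^esub> GSp_Gamma) ` ?L"
  proof
    fix A assume "A \<in> left_cosets_in GSp GSp_Gamma (double_coset GSp GSp_Gamma C)"
    then obtain X Y where XY: "X \<in> GSp_Gamma" "Y \<in> GSp_Gamma" "A = (X ** C ** Y) <#\<^bsub>GSp\<^esub> GSp_Gamma"
      unfolding left_cosets_in_def GSp_dc by auto
    let ?g = "X ** C ** Y"
    note g = level_double[OF C k XY(1,2)]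
    have "?g \<in> GSp_Delta \<and> level ?g k \<and> lat ?g = lat ?g" using g by simp
    then have "?r (lat ?g) \<in> GSp_Delta \<and> level (?r (lat ?g)) k \<and> lat (?r (lat ?g)) = lat ?g"
      by (rule someI[of "\<lambda>h. h \<in> GSp_Delta \<and> level h k \<and> lat h = lat ?g"])
    then have "A = ?r (lat ?g) <#\<^bsub>GSp\<^esub> GSp_Gamma"
      unfolding XY(3) using l_coset_Gamma_lat[OF g(1), of "?r (lat ?g)"] by simp
    then show "A \<in> (\<lambda>N. ?r N <#\<^bsub>GSp\<^esub> GSp_Gamma) ` ?L" using g by blast
  qed
  then show "finite (left_cosets_in GSp GSp_Gamma (double_coset GSp GSp_Gamma C))"
    by (rule finite_subset[OF _ finite_imageI[OF finite_lattices]])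
qed (auto simp: Delta_mult GSp_group)

lemma Heis_Delta_iff: "(C, a) \<in> Heis_Delta \<longleftrightarrow> C \<in> GSp_Delta \<and> a \<in> \<M>"
  unfolding Heis_Delta_def by auto

lemma Heis_Gamma_iff: "(C, a) \<in> Heis_Gamma \<longleftrightarrow> C \<in> GSp_Gamma \<and> a \<in> \<M>"
  unfolding Heis_Gamma_def by auto

text \<open>The vector component matters only modulo \<open>lat D\<close>. The translation on the
  right contributes an element of \<open>XC\<M>\<close>, which is \<open>lat D\<close>, and the one
  on the left is multiplied by the multiplier of \<open>C\<close>, hence lies in
  \<open>p^k \<M>\<close> and again in \<open>lat D\<close>.\<close>

lemma Heis_dc:
  assumes C: "C \<in> GSp_Delta"
  shows "(D, b) \<in> double_coset Heis Heis_Gamma (C, a) \<longleftrightarrow>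
    (\<exists>X\<in>GSp_Gamma. \<exists>Y\<in>GSp_Gamma. D = X ** C ** Y \<and> b - multiplier Y *s (X *v a) \<in> lat D)"
proof
  assume "(D, b) \<in> double_coset Heis Heis_Gamma (C, a)"
  then obtain X x Y y where XY: "X \<in> GSp_Gamma" "x \<in> \<M>" "Y \<in> GSp_Gamma" "y \<in> \<M>"
    "(D, b) = (X, x) \<otimes>\<^bsub>Heis\<^esub> (C, a) \<otimes>\<^bsub>Heis\<^esub> (Y, y)"
    unfolding double_coset_eq Heis_Gamma_def by auto
  then have D: "D = X ** C ** Y" and b: "b = (X ** C) *v y + multiplier Y *s (X *v a + multiplier C *s x)"
    by auto
  obtain k where k: "level C k" using level_exists[OF C] by blast
  note Dk = level_double[OF C k XY(1,3), folded D]
  have "multiplier C *s (multiplier Y *s x) \<in> pM k"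
  proof -
    obtain u where u: "unit_p u" "multiplier C = u * \<pi> ^ k" using k unfolding level_def by auto
    have "multiplier Y *s x \<in> \<M>" using XY multiplier_intg[OF Gamma_Delta] by auto
    then have "\<pi> ^ k *s (u *s (multiplier Y *s x)) \<in> pM k" using pM_simps(7) unit_smult_M[OF u(1)] by blast
    then show ?thesis unfolding u by (simp add: vector_smult_assoc mult_ac)
  qed
  then have 1: "multiplier C *s (multiplier Y *s x) \<in> lat D" using pM_sub_lat[OF Dk] by auto
  have "lat D = lat (X ** C)" unfolding D by (rule lat_mult_Gamma[OF XY(3)])
  then have 2: "(X ** C) *v y \<in> lat D" using XY(4) unfolding lat_def by blast
  have "b - multiplier Y *s (X *v a) = (X ** C) *v y + multiplier C *s (multiplier Y *s x)"
    unfolding b by (simp add: vector_add_ldistrib vector_smult_assoc mult.commute)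
  then have "b - multiplier Y *s (X *v a) \<in> lat D" using lat_closed(2)[OF 2 1] by simp
  then show "\<exists>X\<in>GSp_Gamma. \<exists>Y\<in>GSp_Gamma. D = X ** C ** Y \<and> b - multiplier Y *s (X *v a) \<in> lat D"
    using XY(1,3) D by blast
next
  assume "\<exists>X\<in>GSp_Gamma. \<exists>Y\<in>GSp_Gamma. D = X ** C ** Y \<and> b - multiplier Y *s (X *v a) \<in> lat D"
  then obtain X Y where XY: "X \<in> GSp_Gamma" "Y \<in> GSp_Gamma" "D = X ** C ** Y"
    "b - multiplier Y *s (X *v a) \<in> lat D" by blast
  have "lat D = lat (X ** C)" unfolding XY(3) by (rule lat_mult_Gamma[OF XY(2)])
  then obtain m where m: "m \<in> \<M>" "b - multiplier Y *s (X *v a) = (X ** C) *v m"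
    using XY(4) unfolding lat_def by auto
  have "b = (X ** C) *v m + multiplier Y *s (X *v a)" using m(2) by (simp add: algebra_simps)
  then have "(D, b) = (X, 0) \<otimes>\<^bsub>Heis\<^esub> (C, a) \<otimes>\<^bsub>Heis\<^esub> (Y, m)" using XY(3) by simp
  then show "(D, b) \<in> double_coset Heis Heis_Gamma (C, a)"
    unfolding double_coset_eq using XY(1,2) m(1) Heis_Gamma_iff M_simps(1) by blast
qed

text \<open>Every left coset has a representative \<open>(g, r)\<close> with one \<open>g\<close>
  for each lattice of level \<open>k\<close> and \<open>r\<close> in \<open>Rk k\<close>.\<close>

lemma Heis_l_coset_level:
  fixes k :: nat
  shows "finite {(D, b) <#\<^bsub>Heis\<^esub> Heis_Gamma | D b. (D, b) \<in> (Heis_Delta :: ('p::prime_card, 'n::finite) heis set) \<and> level D k}"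
proof (rule finite_subset)
  let ?L = "{lat g | g :: ('p, 'n) sp_mat. g \<in> GSp_Delta \<and> level g k}"
  let ?r = "\<lambda>N. SOME g :: ('p, 'n) sp_mat. g \<in> GSp_Delta \<and> level g k \<and> lat g = N"
  let ?f = "\<lambda>(N, r). (?r N, r) <#\<^bsub>Heis\<^esub> Heis_Gamma"
  show "finite (?f ` (?L \<times> Rk k))" using finite_lattices card_Rk(1) by blast
  show "{(D, b) <#\<^bsub>Heis\<^esub> Heis_Gamma | D b. (D, b) \<in> (Heis_Delta :: ('p, 'n) heis set) \<and> level D k} \<subseteq> ?f ` (?L \<times> Rk k)"
  proof clarify
    fix D :: "('p, 'n) sp_mat" and b assume Db: "(D, b) \<in> Heis_Delta" "level D k"
    then have D: "D \<in> GSp_Delta" and b: "b \<in> \<M>" by (auto simp: Heis_Delta_iff)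
    define g where "g = ?r (lat D)"
    have g: "g \<in> GSp_Delta" "level g k" "lat g = lat D"
      using someI[of "\<lambda>h. h \<in> GSp_Delta \<and> level h k \<and> lat h = lat D" D] D Db(2) unfolding g_def by auto
    note gG = Delta_GSp[OF g(1)]
    define Y where "Y = ginv g ** D"
    have Y: "Y \<in> GSp_Gamma" unfolding Y_def by (rule lat_eq_imp[OF gG Delta_GSp[OF D] g(3)])
    have gY: "g ** Y = D" unfolding Y_def using ginv(1)[OF gG] by (simp add: matrix_mul_assoc)
    have uY: "unit_p (multiplier Y)" using Y Gamma_iff_unit by blast
    \<comment> \<open>Multiplication on the right by an element over \<open>Y\<close> scales the
      vector component by the multiplier of \<open>Y\<close>; dividing by it in advance lets the
      component be reduced modulo \<open>lat g\<close>.\<close>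
    define c where "c = inverse (multiplier Y) *s b"
    have c: "c \<in> \<M>" unfolding c_def using b unit_p_intg(2)[OF uY] by auto
    have "c - red k c \<in> lat g" using red_cong[OF c] pM_sub_lat[OF g(1,2)] by auto
    then obtain m where m: "m \<in> \<M>" "c - red k c = g *v m" unfolding lat_def by auto
    have cr: "c = g *v m + red k c" using m(2) by (simp add: algebra_simps)
    have "b = multiplier Y *s c" unfolding c_def using unit_p_intg(3)[OF uY] by (simp add: vector_smult_assoc)
    also have "\<dots> = g *v (multiplier Y *s m) + multiplier Y *s red k c"
      by (subst cr) (simp add: vector_add_ldistrib vector_scalar_commute)
    finally have "(D, b) = (g, red k c) \<otimes>\<^bsub>Heis\<^esub> (Y, multiplier Y *s m)" using gY by simp
    moreover have "(Y, multiplier Y *s m) \<in> Heis_Gamma"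
      using Y m(1) unit_p_intg(1)[OF uY] by (auto simp: Heis_Gamma_iff)
    ultimately have "(D, b) \<in> (g, red k c) <#\<^bsub>Heis\<^esub> Heis_Gamma" unfolding l_coset_def by blast
    then have "(g, red k c) <#\<^bsub>Heis\<^esub> Heis_Gamma = (D, b) <#\<^bsub>Heis\<^esub> Heis_Gamma"
      by (rule Heis.l_repr_independence[OF _ _ Heis_Gamma_subgroup]) (simp add: gG)
    then show "(D, b) <#\<^bsub>Heis\<^esub> Heis_Gamma \<in> ?f ` (?L \<times> Rk k)"
      using D Db(2) red_Rk[OF c] unfolding g_def by (intro image_eqI[of _ _ "(lat D, red k c)"]) auto
  qed
qed

lemma Heis_dc_level:
  assumes "(D, b) \<in> double_coset Heis Heis_Gamma (C, a)" "(C, a) \<in> Heis_Delta" "level C k"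
  shows "(D, b) \<in> Heis_Delta" "level D k"
proof -
  obtain X Y where XY: "X \<in> GSp_Gamma" "Y \<in> GSp_Gamma" "D = X ** C ** Y" "b - multiplier Y *s (X *v a) \<in> lat D"
    using assms Heis_dc[of C D b a] by (auto simp: Heis_Delta_iff)
  note D = level_double[OF _ assms(3) XY(1,2), folded XY(3)]
  show "level D k" using D assms(2) by (auto simp: Heis_Delta_iff)
  have DD: "D \<in> GSp_Delta" using D assms(2) by (auto simp: Heis_Delta_iff)
  have "X *v a \<in> \<M>" using XY(1) assms(2) Gamma_iff by (auto simp: Heis_Delta_iff)
  then have "multiplier Y *s (X *v a) \<in> \<M>" using multiplier_intg[OF Gamma_Delta[OF XY(2)]] by auto
  then have "(b - multiplier Y *s (X *v a)) + multiplier Y *s (X *v a) \<in> \<M>"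
    using XY(4) lat_sub_M[OF DD] M_simps(2) by blast
  then show "(D, b) \<in> Heis_Delta" using DD by (simp add: Heis_Delta_iff)
qed

interpretation HH: hecke_pair "Heis :: ('p::prime_card, 'n::finite) heis monoid" Heis_Gamma Heis_Delta
proof (intro hecke_pair.intro hecke_pair_axioms.intro)
  show "group (Heis :: ('p, 'n) heis monoid)" by (rule Heis_group)
  show "subgroup Heis_Gamma (Heis :: ('p, 'n) heis monoid)" by (rule Heis_Gamma_subgroup)
  show "Heis_Gamma \<subseteq> (Heis_Delta :: ('p, 'n) heis set)"
    unfolding Heis_Gamma_def Heis_Delta_def using Gamma_Delta by auto
  show "Heis_Delta \<subseteq> carrier (Heis :: ('p, 'n) heis monoid)"
    unfolding Heis_Delta_def using Delta_GSp by auto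
  show "x \<otimes>\<^bsub>Heis\<^esub> y \<in> Heis_Delta" if "x \<in> Heis_Delta" "y \<in> Heis_Delta" for x y :: "('p, 'n) heis"
  proof -
    obtain C a D b where e: "x = (C, a)" "y = (D, b)" by (cases x, cases y)
    have C: "C \<in> GSp_Delta" "a \<in> \<M>" "D \<in> GSp_Delta" "b \<in> \<M>" using that unfolding e Heis_Delta_def by auto
    have "C *v b \<in> \<M>" using C Delta_iff by blast
    then show ?thesis
      unfolding Heis_Delta_def e using C Delta_mult[OF C(1,3)] multiplier_intg[OF C(3)] by auto
  qed
  fix x :: "('p, 'n) heis" assume x: "x \<in> Heis_Delta"
  obtain C a where e: "x = (C, a)" by (cases x)
  obtain k where k: "level C k" using level_exists x e by (auto simp: Heis_Delta_iff)
  have "left_cosets_in Heis Heis_Gamma (double_coset Heis Heis_Gamma x)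
    \<subseteq> {(D, b) <#\<^bsub>Heis\<^esub> Heis_Gamma | D b. (D, b) \<in> (Heis_Delta :: ('p, 'n) heis set) \<and> level D k}"
    unfolding left_cosets_in_def using Heis_dc_level[OF _ x[unfolded e] k] e by fast
  then show "finite (left_cosets_in Heis Heis_Gamma (double_coset Heis Heis_Gamma x))"
    using Heis_l_coset_level finite_subset by blast
qed

abbreviation hdc :: "('p::prime_card, 'n::finite) heis \<Rightarrow> ('p, 'n) heis set" where
  "hdc \<equiv> double_coset Heis Heis_Gamma"

lemma Delta_Heis: "(C, a) \<in> Heis_Delta \<Longrightarrow> (C, a) \<in> carrier Heis"
  using Delta_GSp by (auto simp: Heis_Delta_iff)

section \<open>Heisenberg double cosets of a given level\<close>

lemma hdc_l_coset:
  assumes "x \<in> carrier Heis"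
  shows "hdc (SOME y. y \<in> x <#\<^bsub>Heis\<^esub> Heis_Gamma) = hdc x"
proof -
  note s = HH.l_coset_some[OF assms]
  obtain k where k: "k \<in> Heis_Gamma" "x = (SOME y. y \<in> x <#\<^bsub>Heis\<^esub> Heis_Gamma) \<otimes>\<^bsub>Heis\<^esub> k"
    using HH.l_coset_eqD[OF assms s(2)] s(3) by metis
  then have "x \<in> hdc (SOME y. y \<in> x <#\<^bsub>Heis\<^esub> Heis_Gamma)"
    using HH.dc_mult_right[OF s(2) HH.dc_self[OF s(2)] k(1)] by metis
  then show ?thesis using HH.dc_eq[OF s(2)] by simp
qed

lemma finite_hdc_level:
  "finite {hdc (C, c) | C c. (C, c) \<in> (Heis_Delta :: ('p::prime_card, 'n::finite) heis set) \<and> level C k}"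
proof (rule finite_subset)
  let ?S = "{(D, b) <#\<^bsub>Heis\<^esub> Heis_Gamma | D b. (D, b) \<in> (Heis_Delta :: ('p, 'n) heis set) \<and> level D k}"
  show "finite ((\<lambda>A. hdc (SOME x. x \<in> A)) ` ?S)" using Heis_l_coset_level by blast
  show "{hdc (C, c) | C c. (C, c) \<in> (Heis_Delta :: ('p, 'n) heis set) \<and> level C k} \<subseteq> (\<lambda>A. hdc (SOME x. x \<in> A)) ` ?S"
  proof clarify
    fix C :: "('p, 'n) sp_mat" and c assume C: "(C, c) \<in> Heis_Delta" "level C k"
    then show "hdc (C, c) \<in> (\<lambda>A. hdc (SOME x. x \<in> A)) ` ?S"
      using hdc_l_coset[OF Delta_Heis[OF C(1)]]
      by (intro image_eqI[of _ _ "(C, c) <#\<^bsub>Heis\<^esub> Heis_Gamma"]) auto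
  qed
qed

lemma Heis_P_eq:
  "Heis_P k = (\<Sum>U \<in> {hdc (C, c) | C c. (C, c) \<in> (Heis_Delta :: ('p::prime_card, 'n::finite) heis set) \<and> level C k}. frag_of U)"
proof -
  have "{hdc (C, c) | C c. (C, c) \<in> (Heis_Delta :: ('p, 'n) heis set) \<and> padic_val (multiplier C) = int k}
    = {hdc (C, c) | C c. (C, c) \<in> Heis_Delta \<and> level C k}"
    using level_iff_val[OF Delta_GSp] by (auto simp: Heis_Delta_iff)
  then show ?thesis unfolding Heis_P_def by simp
qed

lemma Heis_P_carrier: "Heis_P k \<in> carrier (Heis_hecke :: (('p::prime_card, 'n::finite) heis set \<Rightarrow>\<^sub>0 int) ring)"
proof -
  have "Poly_Mapping.keys (Heis_P k) \<subseteq> {hdc (C, c) | C c. (C, c) \<in> (Heis_Delta :: ('p, 'n) heis set) \<and> level C k}"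
    unfolding Heis_P_eq by (intro order.trans[OF keys_sum]) auto
  then show ?thesis unfolding Heis_hecke_def hecke_ring_simps double_cosets_def by blast
qed

lemma lookup_Heis_P:
  fixes C :: "('p::prime_card, 'n::finite) sp_mat"
  assumes "(C, a) \<in> Heis_Delta"
  shows "Poly_Mapping.lookup (Heis_P k) (hdc (C, a)) = (if level C k then 1 else 0)"
proof -
  let ?S = "{hdc (C, c) | C c. (C, c) \<in> (Heis_Delta :: ('p, 'n) heis set) \<and> level C k}"
  have "Poly_Mapping.lookup (Heis_P k) (hdc (C, a)) = (\<Sum>U\<in>?S. if U = hdc (C, a) then 1 else 0)"
    unfolding Heis_P_eq lookup_sum_int by (intro sum.cong) (auto simp: when_def)
  also have "\<dots> = (if hdc (C, a) \<in> ?S then 1 else 0)"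
    by (rule sum.delta[OF finite_hdc_level])
  also have "hdc (C, a) \<in> ?S \<longleftrightarrow> level C k"
  proof
    assume "hdc (C, a) \<in> ?S"
    then obtain D d where D: "hdc (C, a) = hdc (D, d)" "(D, d) \<in> Heis_Delta" "level D k" by blast
    then have "(C, a) \<in> hdc (D, d)" using HH.dc_self[OF Delta_Heis[OF assms]] by simp
    then show "level C k" using Heis_dc_level(2) D by blast
  qed (use assms in blast)
  finally show ?thesis .
qed

subsection \<open>The endomorphism \<open>\<theta>\<close>\<close>

lemma lat_periodic: "x - y \<in> lat C \<Longrightarrow> z - x \<in> lat C \<longleftrightarrow> z - y \<in> lat C" "x - y \<in> lat C \<Longrightarrow> x - z \<in> lat C \<longleftrightarrow> y - z \<in> lat C"
  "x - y \<in> lat C \<Longrightarrow> x \<in> lat C \<longleftrightarrow> y \<in> lat C"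
proof -
  assume d: "x - y \<in> lat C"
  have "z - y = (z - x) + (x - y)" "z - x = (z - y) - (x - y)" "x - z = (x - y) + (y - z)" "y - z = (x - z) - (x - y)"
    "x = (x - y) + y" "y = x - (x - y)" by simp_all
  then show "z - x \<in> lat C \<longleftrightarrow> z - y \<in> lat C" "x - z \<in> lat C \<longleftrightarrow> y - z \<in> lat C" "x \<in> lat C \<longleftrightarrow> y \<in> lat C"
    using lat_closed(2,3) d by metis+
qed

lemma hdc_shift:
  fixes C :: "('p::prime_card, 'n::finite) sp_mat"
  assumes "C \<in> GSp_Delta" "a - b \<in> lat C"
  shows "hdc (C, a) = hdc (C, b)"
proof -
  have "multiplier (mat 1 :: ('p, 'n) sp_mat) = 1" by (rule GSp_one(2))
  then have "(C, a) \<in> hdc (C, b)"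
    unfolding Heis_dc[OF assms(1)] using Gamma_closed(1) assms(2)
    by (intro bexI[of _ "mat 1"]) auto
  then show ?thesis using HH.dc_eq[of "(C, b)" "(C, a)"] Delta_GSp[OF assms(1)] by simp
qed

lemma card_Rk_lat:
  fixes C :: "('p::prime_card, 'n::finite) sp_mat"
  assumes C: "C \<in> GSp_Delta" "level C k" and v: "v \<in> \<M>"
  shows "card {x \<in> Rk k. x - v \<in> lat C} = (CARD('p) ^ k) ^ CARD('n)"
    "card {x \<in> Rk k. v - x \<in> lat C} = (CARD('p) ^ k) ^ CARD('n)"
proof -
  have "card {x \<in> Rk k. x + - v \<in> lat C} = card {x \<in> Rk k. x \<in> lat C}"
    using v pM_sub_lat[OF C] lat_periodic(3) by (intro card_Rk_shift) blast+
  moreover have "card {x \<in> Rk k. x \<in> lat C} * (CARD('p) ^ k) ^ CARD('n) = (CARD('p) ^ k) ^ CARD('n) * (CARD('p) ^ k) ^ CARD('n)"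
    using card_lat[OF C order_refl] by (simp add: mult_2 power_add)
  then have "card {x \<in> Rk k. x \<in> lat C} = (CARD('p) ^ k) ^ CARD('n)"
    by (rule mult_right_cancel[THEN iffD1, rotated]) simp
  ultimately show 1: "card {x \<in> Rk k. x - v \<in> lat C} = (CARD('p) ^ k) ^ CARD('n)" by simp
  have "v - x \<in> lat C \<longleftrightarrow> x - v \<in> lat C" for x using lat_closed(5)[of "v - x" C] lat_closed(5)[of "x - v" C] by auto
  then show "card {x \<in> Rk k. v - x \<in> lat C} = (CARD('p) ^ k) ^ CARD('n)" using 1 by simp
qed

text \<open>Cosets of \<open>lat C\<close> in a periodic set are counted through
  \<open>Rk k\<close>: each coset contains \<open>p^(kn)\<close> of the chosen
  representatives.\<close>

lemma card_cosets:
  fixes C :: "('p::prime_card, 'n::finite) sp_mat"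
  assumes C: "C \<in> GSp_Delta" "level C k" and P: "P \<subseteq> \<M>" "\<And>x y. x \<in> P \<Longrightarrow> y \<in> \<M> \<Longrightarrow> x - y \<in> lat C \<Longrightarrow> y \<in> P"
  shows "finite ((\<lambda>b. {x. x - b \<in> lat C}) ` P)"
    "card ((\<lambda>b. {x. x - b \<in> lat C}) ` P) * (CARD('p) ^ k) ^ CARD('n) = card {x \<in> Rk k. x \<in> P}"
proof -
  let ?c = "\<lambda>b. {x. x - b \<in> lat C}"
  have cc: "?c b = ?c b'" if "b - b' \<in> lat C" for b b' using lat_periodic(1)[OF that] by blast
  have "?c ` P \<subseteq> ?c ` Rk k"
  proof clarify
    fix b assume b: "b \<in> P"
    then have "b \<in> \<M>" using P by auto
    then have "b - red k b \<in> lat C" "red k b \<in> Rk k" using red_cong[of b k] pM_sub_lat[OF C] red_Rk[of b k] by auto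
    then show "?c b \<in> ?c ` Rk k" using cc by blast
  qed
  then show fin: "finite (?c ` P)" using card_Rk(1) finite_subset by blast
  have "card {x \<in> Rk k. x \<in> P} * 1 = card (?c ` P) * (CARD('p) ^ k) ^ CARD('n)"
  proof (rule sum_card_swap[OF _ fin])
    fix x assume x: "x \<in> {x \<in> Rk k. x \<in> P}"
    have "{j \<in> ?c ` P. x \<in> j} = {?c x}"
      using x cc lat_closed(1)[of C] by (auto simp: image_iff)
    then show "card {j \<in> ?c ` P. x \<in> j} = 1" by simp
  next
    fix j assume "j \<in> ?c ` P"
    then obtain b where b: "b \<in> P" "j = ?c b" by auto
    have "x \<in> P" if "x \<in> Rk k" "x - b \<in> lat C" for x
      using P(2)[OF b(1), of x] that Rk_sub_M lat_closed(5)[OF that(2)] by auto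
    then have "{i \<in> {x \<in> Rk k. x \<in> P}. i \<in> j} = {x \<in> Rk k. x - b \<in> lat C}" using b(2) by auto
    then show "card {i \<in> {x \<in> Rk k. x \<in> P}. i \<in> j} = (CARD('p) ^ k) ^ CARD('n)"
      using card_Rk_lat(1)[OF C, of b] b(1) P(1) by auto
  qed (simp add: card_Rk(1))
  then show "card (?c ` P) * (CARD('p) ^ k) ^ CARD('n) = card {x \<in> Rk k. x \<in> P}" by simp
qed

lemma Gamma_conj_iff:
  assumes "C \<in> carrier GSp"
  shows "X \<in> Gamma_conj C \<longleftrightarrow> X \<in> GSp_Gamma \<and> ginv C ** X ** C \<in> GSp_Gamma"
proof -
  have "(C <#\<^bsub>GSp\<^esub> GSp_Gamma) #>\<^bsub>GSp\<^esub> ginv C = {C ** Y ** ginv C | Y. Y \<in> GSp_Gamma}"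
    unfolding l_coset_def r_coset_def by auto
  moreover have "X = C ** Y ** ginv C \<longleftrightarrow> ginv C ** X ** C = Y" for Y
  proof
    assume "X = C ** Y ** ginv C"
    then have "ginv C ** X ** C = (ginv C ** C) ** Y ** (ginv C ** C)" by (simp add: matrix_mul_assoc)
    then show "ginv C ** X ** C = Y" using ginv[OF assms] by simp
  next
    assume "ginv C ** X ** C = Y"
    then have "C ** Y ** ginv C = (C ** ginv C) ** X ** (C ** ginv C)" by (simp add: matrix_mul_assoc flip: \<open>_ = Y\<close>)
    then show "X = C ** Y ** ginv C" using ginv[OF assms] by simp
  qed
  ultimately show ?thesis unfolding Gamma_conj_def by auto
qed

text \<open>An element \<open>X\<close> belongs to \<open>\<Gamma>\<^sup>C\<close> exactly when
  \<open>C = XCY\<close> for some \<open>Y\<close> in \<Gamma>, and comparing multipliers shows that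
  the multiplier of \<open>Y\<close> is inverse to that of \<open>X\<close>. Hence the twisted
  action records which vectors over the same \<open>C\<close> lie in one double coset.\<close>

lemma Gamma_orbit_eq:
  fixes C :: "('p::prime_card, 'n::finite) sp_mat"
  assumes C: "C \<in> GSp_Delta" and a: "a \<in> \<M>"
  shows "Gamma_orbit C a = (\<lambda>b. {x. x - b \<in> lat C}) ` {b \<in> \<M>. (C, b) \<in> hdc (C, a)}"
proof -
  note CG = Delta_GSp[OF C]
  have coset: "{b + C *v m | m. m \<in> \<M>} = {x. x - b \<in> lat C}" for b
    unfolding lat_def by (auto simp: image_iff algebra_simps)
  have iff: "(C, b) \<in> hdc (C, a) \<longleftrightarrow> (\<exists>X\<in>Gamma_conj C. b - inverse (multiplier X) *s (X *v a) \<in> lat C)" for b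
  proof
    assume "(C, b) \<in> hdc (C, a)"
    then obtain X Y where XY: "X \<in> GSp_Gamma" "Y \<in> GSp_Gamma" "C = X ** C ** Y" "b - multiplier Y *s (X *v a) \<in> lat C"
      unfolding Heis_dc[OF C] by blast
    note G = Gamma_GSp[OF XY(1)] Gamma_GSp[OF XY(2)]
    have "multiplier C = multiplier X * multiplier C * multiplier Y"
      using GSp_mult(2)[OF GSp_mult(1)[OF G(1) CG] G(2)] GSp_mult(2)[OF G(1) CG] XY(3) by simp
    then have "multiplier X * multiplier Y = 1" using GSpD(2)[OF CG] by (simp add: field_simps)
    then have mY: "multiplier Y = inverse (multiplier X)" by (metis inverse_unique)
    have "C ** ginv Y = (X ** C ** Y) ** ginv Y" by (rule arg_cong[OF XY(3)])
    also have "\<dots> = X ** C ** (Y ** ginv Y)" by (simp only: matrix_mul_assoc)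
    also have "\<dots> = X ** C" by (simp only: ginv(1)[OF G(2)] matrix_mul_rid)
    finally have CY: "C ** ginv Y = X ** C" .
    have "ginv C ** X ** C = ginv C ** (X ** C)" by (simp only: matrix_mul_assoc)
    also have "\<dots> = (ginv C ** C) ** ginv Y" by (simp only: CY[symmetric] matrix_mul_assoc)
    also have "\<dots> = ginv Y" by (simp only: ginv(2)[OF CG] matrix_mul_lid)
    finally have "X \<in> Gamma_conj C" unfolding Gamma_conj_iff[OF CG] using XY(1,2) Gamma_closed(3) by auto
    then show "\<exists>X\<in>Gamma_conj C. b - inverse (multiplier X) *s (X *v a) \<in> lat C" using XY(4) mY by auto
  next
    assume "\<exists>X\<in>Gamma_conj C. b - inverse (multiplier X) *s (X *v a) \<in> lat C"
    then obtain X where X: "X \<in> GSp_Gamma" "ginv C ** X ** C \<in> GSp_Gamma" "b - inverse (multiplier X) *s (X *v a) \<in> lat C"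
      by (auto simp: Gamma_conj_iff[OF CG])
    define Z where "Z = ginv C ** X ** C"
    have Z: "Z \<in> GSp_Gamma" unfolding Z_def by (rule X(2))
    note G = Gamma_GSp[OF X(1)] Gamma_GSp[OF Z]
    have CZ: "C ** Z = X ** C" unfolding Z_def using ginv(1)[OF CG] by (simp add: matrix_mul_assoc)
    then have "multiplier Z = multiplier X"
      using GSp_mult(2)[OF CG G(2)] GSp_mult(2)[OF G(1) CG] GSpD(2)[OF CG] by simp
    then have "multiplier (ginv Z) = inverse (multiplier X)" using ginv(6)[OF G(2)] by simp
    moreover have "C = X ** C ** ginv Z"
    proof -
      have "X ** C ** ginv Z = C ** (Z ** ginv Z)" by (simp only: CZ[symmetric] matrix_mul_assoc)
      then show ?thesis by (simp only: ginv(1)[OF G(2)] matrix_mul_rid)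
    qed
    ultimately show "(C, b) \<in> hdc (C, a)"
      unfolding Heis_dc[OF C] using X(1,3) Gamma_closed(3)[OF Z] by (intro bexI[of _ X] bexI[of _ "ginv Z"]) auto
  qed
  have M: "inverse (multiplier X) *s (X *v a) \<in> \<M>" if "X \<in> Gamma_conj C" for X
  proof -
    have X: "X \<in> GSp_Gamma" using that Gamma_conj_iff[OF CG] by blast
    then have "X *v a \<in> \<M>" using a Gamma_iff by blast
    then show ?thesis using X Gamma_iff_unit unit_p_intg(2) by blast
  qed
  have cc: "{x. x - b \<in> lat C} = {x. x - b' \<in> lat C}" if "b - b' \<in> lat C" for b b' using lat_periodic(1)[OF that] by blast
  show ?thesis
    unfolding Gamma_orbit_def coset
  proof safe
    fix X assume X: "X \<in> Gamma_conj C"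
    have "(C, inverse (multiplier X) *s (X *v a)) \<in> hdc (C, a)" unfolding iff using X lat_closed(1) by (intro bexI[of _ X]) auto
    then show "{x. x - inverse (multiplier X) *s (X *v a) \<in> lat C} \<in> (\<lambda>b. {x. x - b \<in> lat C}) ` {b \<in> \<M>. (C, b) \<in> hdc (C, a)}"
      using M[OF X] by blast
  next
    fix b assume "b \<in> \<M>" "(C, b) \<in> hdc (C, a)"
    then obtain X where X: "X \<in> Gamma_conj C" "b - inverse (multiplier X) *s (X *v a) \<in> lat C" unfolding iff by blast
    then show "\<exists>X. {x. x - b \<in> lat C} = {x. x - inverse (multiplier X) *s (X *v a) \<in> lat C} \<and> X \<in> Gamma_conj C"
      using cc[OF X(2)] by blast
  qed
qed

lemma hdc_carrier_iff: "C \<in> GSp_Delta \<Longrightarrow> (D, b) \<in> hdc (C, a) \<longleftrightarrow> D \<in> carrier GSp \<and> hdc (D, b) = hdc (C, a)"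
  using HH.dc_eq_iff[of "(C, a)" "(D, b)"] HH.dc_carrier[of "(C, a)" "(D, b)"] Delta_GSp[of C] by auto

lemma hdc_transport:
  fixes C :: "('p::prime_card, 'n::finite) sp_mat"
  assumes C: "C \<in> GSp_Delta" and X: "X \<in> GSp_Gamma" "Y \<in> GSp_Gamma"
  shows "hdc (X ** C ** Y, multiplier Y *s (X *v a)) = hdc (C, a)"
proof -
  have "(X ** C ** Y, multiplier Y *s (X *v a)) \<in> hdc (C, a)"
    unfolding Heis_dc[OF C] using X lat_closed(1) by (intro bexI[of _ X] bexI[of _ Y]) auto
  then show ?thesis using HH.dc_eq[of "(C, a)"] Delta_GSp[OF C] by simp
qed

text \<open>Solutions of \<open>pa \<equiv> b\<close> whose double coset over \<open>C\<close> is
  \<open>U\<close>. Up to a power of \<open>p\<close> this is the coefficient of \<theta> from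
  \<open>U\<close> to the double coset of \<open>(C, b)\<close>.\<close>

definition fibre :: "('p::prime_card, 'n::finite) heis set \<Rightarrow> nat \<Rightarrow> ('p, 'n) sp_mat \<Rightarrow> ('p, 'n) sp_vec \<Rightarrow> nat" where
  "fibre U k C b = card {a \<in> Rk k. \<pi> *s a - b \<in> lat C \<and> hdc (C, a) = U}"

text \<open>The map \<open>a \<mapsto> \<mu>(Y)Xa\<close> permutes the residues, carries
  \<open>lat C\<close> to \<open>lat D\<close> and preserves double cosets.\<close>

lemma fibre_transport:
  fixes C :: "('p::prime_card, 'n::finite) sp_mat"
  assumes C: "C \<in> GSp_Delta" "level C k" and b: "b \<in> \<M>" and D: "(D, d) \<in> hdc (C, b)"
  shows "fibre U k D d = fibre U k C b"
proof -
  obtain X Y where XY: "X \<in> GSp_Gamma" "Y \<in> GSp_Gamma" "D = X ** C ** Y" "d - multiplier Y *s (X *v b) \<in> lat D"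
    using D unfolding Heis_dc[OF C(1)] by blast
  note Dl = level_double[OF C XY(1,2), folded XY(3)]
  have uY: "unit_p (multiplier Y)" using XY(2) Gamma_iff_unit by blast
  note XG = Gamma_GSp[OF XY(1)]
  define h where "h a = multiplier Y *s (X *v a)" for a
  have h_diff: "h x - h y = h (x - y)" for x y
    unfolding h_def by (simp add: matrix_vector_mult_diff_distrib vector_ssub_ldistrib)
  have h_pi: "\<pi> *s h a = h (\<pi> *s a)" for a unfolding h_def by (simp add: vector_scalar_commute vector_smult_assoc mult.commute)
  have h_lat: "h z \<in> lat D \<longleftrightarrow> z \<in> lat C" for z
  proof -
    have "lat D = lat (X ** C)" unfolding XY(3) by (rule lat_mult_Gamma[OF XY(2)])
    moreover have "h z \<in> lat (X ** C) \<longleftrightarrow> X *v z \<in> lat (X ** C)"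
    proof
      assume "h z \<in> lat (X ** C)"
      then have "inverse (multiplier Y) *s h z \<in> lat (X ** C)" by (rule lat_closed(4)[OF unit_p_intg(2)[OF uY]])
      then show "X *v z \<in> lat (X ** C)"
        unfolding h_def using unit_p_intg(3)[OF uY] by (simp add: vector_smult_assoc)
    next
      assume "X *v z \<in> lat (X ** C)"
      then show "h z \<in> lat (X ** C)" unfolding h_def by (rule lat_closed(4)[OF unit_p_intg(1)[OF uY]])
    qed
    ultimately show ?thesis using lat_translate(1)[OF XG] by simp
  qed
  have "card {a \<in> Rk k. \<pi> *s h a - d \<in> lat D \<and> hdc (D, h a) = U} = card {a \<in> Rk k. \<pi> *s a - d \<in> lat D \<and> hdc (D, a) = U}"
  proof (rule card_Rk_reindex)
    show "h x \<in> \<M>" if "x \<in> \<M>" for x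
      unfolding h_def using that unit_smult_M[OF uY] XY(1) Gamma_iff by blast
    show "x - y \<in> pM k" if "h x - h y \<in> pM k" for x y
      using that unfolding h_diff unfolding h_def using unit_smult_pM[OF uY] Gamma_pM[OF XY(1)] by blast
    fix x y :: "('p, 'n) sp_vec" assume xy: "x \<in> \<M>" "y \<in> \<M>" "x - y \<in> pM k"
    have l: "x - y \<in> lat D" using xy(3) pM_sub_lat[OF Dl] by auto
    then have "\<pi> *s x - \<pi> *s y \<in> lat D"
      using lat_closed(4)[of \<pi> "x - y" D] by (simp add: vector_ssub_ldistrib)
    then have "\<pi> *s x - d \<in> lat D \<longleftrightarrow> \<pi> *s y - d \<in> lat D" by (rule lat_periodic(2))
    then show "(\<pi> *s x - d \<in> lat D \<and> hdc (D, x) = U) = (\<pi> *s y - d \<in> lat D \<and> hdc (D, y) = U)"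
      using hdc_shift[OF Dl(1) l] by simp
  qed
  moreover have "\<pi> *s h a - d \<in> lat D \<longleftrightarrow> \<pi> *s a - b \<in> lat C" for a
  proof -
    have "\<pi> *s h a - d \<in> lat D \<longleftrightarrow> \<pi> *s h a - h b \<in> lat D" using XY(4) unfolding h_def by (rule lat_periodic(1))
    then show ?thesis unfolding h_pi h_diff h_lat .
  qed
  moreover have "hdc (D, h a) = hdc (C, a)" for a
    unfolding XY(3) h_def by (rule hdc_transport[OF C(1) XY(1,2)])
  ultimately show ?thesis unfolding fibre_def by simp
qed

lemma card_orbit:
  fixes C :: "('p::prime_card, 'n::finite) sp_mat"
  assumes C: "C \<in> GSp_Delta" "level C k" and a: "a \<in> \<M>"
  shows "card (Gamma_orbit C a) * (CARD('p) ^ k) ^ CARD('n) = card {x \<in> Rk k. hdc (C, x) = hdc (C, a)}"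
    "card (Gamma_orbit C a) > 0"
proof -
  let ?P = "{b \<in> \<M>. (C, b) \<in> hdc (C, a)}"
  have iff: "(C, x) \<in> hdc (C, a) \<longleftrightarrow> hdc (C, x) = hdc (C, a)" for x
    using hdc_carrier_iff[OF C(1)] Delta_GSp[OF C(1)] by blast
  have P: "y \<in> ?P" if "x \<in> ?P" "y \<in> \<M>" "x - y \<in> lat C" for x y
    using that hdc_shift[OF C(1) that(3)] unfolding iff by auto
  have sub: "?P \<subseteq> \<M>" by blast
  have "{x \<in> Rk k. x \<in> ?P} = {x \<in> Rk k. hdc (C, x) = hdc (C, a)}" unfolding iff using Rk_sub_M by blast
  then show "card (Gamma_orbit C a) * (CARD('p) ^ k) ^ CARD('n) = card {x \<in> Rk k. hdc (C, x) = hdc (C, a)}"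
    unfolding Gamma_orbit_eq[OF C(1) a] using card_cosets(2)[OF C sub P] by simp
  have "finite (Gamma_orbit C a)" unfolding Gamma_orbit_eq[OF C(1) a] by (rule card_cosets(1)[OF C sub P])
  moreover have "Gamma_orbit C a \<noteq> {}" unfolding Gamma_orbit_eq[OF C(1) a] using a iff by blast
  ultimately show "card (Gamma_orbit C a) > 0" by (simp add: card_gt_0_iff)
qed

text \<open>Pairs \<open>(x, b)\<close> with \<open>px \<equiv> b\<close> modulo
  \<open>lat C\<close>, \<open>x\<close> in the class of \<open>a\<close> and \<open>b\<close> in
  that of \<open>pa\<close>, are counted in both orders. The fibres over all such \<open>b\<close>
  have equal size by \<open>fibre_transport\<close>, so that size is \<open>p^(kn)\<close> times the
  ratio of the orbit sizes.\<close>

lemma fibre_eq: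
  fixes C :: "('p::prime_card, 'n::finite) sp_mat"
  assumes C: "C \<in> GSp_Delta" "level C k" and a: "a \<in> \<M>" and d: "d \<in> \<M>" and D: "D \<in> GSp_Delta"
  shows "fibre (hdc (C, a)) k D d = (CARD('p) ^ k) ^ CARD('n) *
    (if hdc (D, d) = hdc (C, \<pi> *s a) then card (Gamma_orbit C a) div card (Gamma_orbit C (\<pi> *s a)) else 0)"
proof (cases "hdc (D, d) = hdc (C, \<pi> *s a)")
  case False
  have "\<not> (\<pi> *s x - d \<in> lat D \<and> hdc (D, x) = hdc (C, a))" for x
  proof
    assume x: "\<pi> *s x - d \<in> lat D \<and> hdc (D, x) = hdc (C, a)"
    then have "(D, x) \<in> hdc (C, a)" using hdc_carrier_iff[OF C(1)] Delta_GSp[OF D] by blast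
    then obtain X Y where XY: "X \<in> GSp_Gamma" "Y \<in> GSp_Gamma" "D = X ** C ** Y" "x - multiplier Y *s (X *v a) \<in> lat D"
      unfolding Heis_dc[OF C(1)] by blast
    have "\<pi> *s (x - multiplier Y *s (X *v a)) \<in> lat D" by (rule lat_closed(4)[OF intg_simps(8) XY(4)])
    then have "\<pi> *s x - multiplier Y *s (X *v (\<pi> *s a)) \<in> lat D"
      by (simp add: vector_ssub_ldistrib vector_scalar_commute vector_smult_assoc mult.commute)
    moreover have "(\<pi> *s x - d \<in> lat D)" using x by blast
    ultimately have "d - multiplier Y *s (X *v (\<pi> *s a)) \<in> lat D"
      using lat_periodic(2)[of "\<pi> *s x" d D "multiplier Y *s (X *v (\<pi> *s a))"] by blast
    then have "(D, d) \<in> hdc (C, \<pi> *s a)" unfolding Heis_dc[OF C(1)] using XY by blast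
    then show False using False hdc_carrier_iff[OF C(1)] by blast
  qed
  then have "{x \<in> Rk k. \<pi> *s x - d \<in> lat D \<and> hdc (D, x) = hdc (C, a)} = {}" by blast
  then show ?thesis using False unfolding fibre_def by (simp only: card.empty if_False mult_0_right)
next
  case True
  let ?q = "(CARD('p) ^ k) ^ CARD('n)" and ?U = "hdc (C, a)"
  have pa: "\<pi> *s a \<in> \<M>" using a by auto
  have q: "?q > 0" by simp
  let ?f = "fibre ?U k C (\<pi> *s a)"
  have "(D, d) \<in> hdc (C, \<pi> *s a)" using True hdc_carrier_iff[OF C(1)] Delta_GSp[OF D] by blast
  then have f: "fibre ?U k D d = ?f" by (rule fibre_transport[OF C pa])
  let ?S = "{x \<in> Rk k. hdc (C, x) = ?U}" and ?T = "{b \<in> Rk k. hdc (C, b) = hdc (C, \<pi> *s a)}"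
  have "card ?S * ?q = card ?T * ?f"
  proof (rule sum_card_swap[where R = "\<lambda>x b. \<pi> *s x - b \<in> lat C"])
    fix x assume x: "x \<in> ?S"
    have "hdc (C, b) = hdc (C, \<pi> *s a)" if b: "\<pi> *s x - b \<in> lat C" for b
    proof -
      have "(C, x) \<in> hdc (C, a)" using x hdc_carrier_iff[OF C(1)] Delta_GSp[OF C(1)] by blast
      then obtain X Y where XY: "X \<in> GSp_Gamma" "Y \<in> GSp_Gamma" "C = X ** C ** Y" "x - multiplier Y *s (X *v a) \<in> lat C"
        unfolding Heis_dc[OF C(1)] by blast
      have "\<pi> *s (x - multiplier Y *s (X *v a)) \<in> lat C" by (rule lat_closed(4)[OF intg_simps(8) XY(4)])
      then have "\<pi> *s x - multiplier Y *s (X *v (\<pi> *s a)) \<in> lat C"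
        by (simp add: vector_ssub_ldistrib vector_scalar_commute vector_smult_assoc mult.commute)
      then have "b - multiplier Y *s (X *v (\<pi> *s a)) \<in> lat C"
        using lat_periodic(2)[OF b, of "multiplier Y *s (X *v (\<pi> *s a))"] by blast
      then have "(C, b) \<in> hdc (C, \<pi> *s a)" unfolding Heis_dc[OF C(1)] using XY by blast
      then show ?thesis using hdc_carrier_iff[OF C(1)] by blast
    qed
    then have "{b \<in> ?T. \<pi> *s x - b \<in> lat C} = {b \<in> Rk k. \<pi> *s x - b \<in> lat C}" by blast
    moreover have "\<pi> *s x \<in> \<M>" using x Rk_sub_M by auto
    ultimately show "card {b \<in> ?T. \<pi> *s x - b \<in> lat C} = ?q" using card_Rk_lat(2)[OF C] by simp
  next
    fix b assume b: "b \<in> ?T"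
    then have "(C, b) \<in> hdc (C, \<pi> *s a)" using hdc_carrier_iff[OF C(1)] Delta_GSp[OF C(1)] by blast
    then have "fibre ?U k C b = ?f" by (rule fibre_transport[OF C pa])
    moreover have "{x \<in> ?S. \<pi> *s x - b \<in> lat C} = {x \<in> Rk k. \<pi> *s x - b \<in> lat C \<and> hdc (C, x) = ?U}" by blast
    ultimately show "card {x \<in> ?S. \<pi> *s x - b \<in> lat C} = ?f" unfolding fibre_def by simp
  qed (simp_all add: card_Rk(1))
  then have "(card (Gamma_orbit C a) * ?q) * ?q = (card (Gamma_orbit C (\<pi> *s a)) * ?q) * ?f"
    unfolding card_orbit(1)[OF C a] card_orbit(1)[OF C pa] .
  then have "(card (Gamma_orbit C a) * ?q) * ?q = (card (Gamma_orbit C (\<pi> *s a)) * ?f) * ?q" by (simp only: mult_ac)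
  then have 1: "card (Gamma_orbit C a) * ?q = card (Gamma_orbit C (\<pi> *s a)) * ?f" using q by simp
  \<comment> \<open>The fibre is a union of cosets of \<open>lat C\<close>, so its size is a
    multiple of \<open>p^(kn)\<close>. This makes the ratio of the orbits an integer, as the
    operation \<open>div\<close> requires.\<close>
  let ?P = "{x \<in> \<M>. \<pi> *s x - \<pi> *s a \<in> lat C \<and> hdc (C, x) = ?U}"
  have P: "y \<in> ?P" if xy: "x \<in> ?P" "y \<in> \<M>" "x - y \<in> lat C" for x y
  proof -
    have "\<pi> *s (x - y) \<in> lat C" by (rule lat_closed(4)[OF intg_simps(8) xy(3)])
    then have "\<pi> *s x - \<pi> *s y \<in> lat C" by (simp add: vector_ssub_ldistrib)
    then show ?thesis using xy lat_periodic(2) hdc_shift[OF C(1) xy(3)] by auto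
  qed
  have "{x \<in> Rk k. x \<in> ?P} = {x \<in> Rk k. \<pi> *s x - \<pi> *s a \<in> lat C \<and> hdc (C, x) = ?U}" using Rk_sub_M by blast
  moreover have "card ((\<lambda>b. {x. x - b \<in> lat C}) ` ?P) * ?q = card {x \<in> Rk k. x \<in> ?P}"
    by (rule card_cosets(2)[OF C]) (blast, rule P)
  ultimately have "?f = card ((\<lambda>b. {x. x - b \<in> lat C}) ` ?P) * ?q" unfolding fibre_def by simp
  then obtain t where t: "?f = t * ?q" by blast
  then have "card (Gamma_orbit C a) * ?q = (card (Gamma_orbit C (\<pi> *s a)) * t) * ?q" using 1 by (simp only: mult_ac)
  then have "card (Gamma_orbit C a) = card (Gamma_orbit C (\<pi> *s a)) * t" using q by simp
  then have "card (Gamma_orbit C a) div card (Gamma_orbit C (\<pi> *s a)) = t"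
    using card_orbit(2)[OF C pa] by simp
  then show ?thesis using True f t by simp
qed

lemma Heis_carrierD:
  assumes "\<xi> \<in> carrier Heis_hecke" "U \<in> Poly_Mapping.keys \<xi>"
  obtains C a where "(SOME x. x \<in> U) = (C, a)" "C \<in> GSp_Delta" "a \<in> \<M>" "U = hdc (C, a)"
proof -
  obtain x where x: "x \<in> Heis_Delta" "U = hdc x"
    using assms unfolding Heis_hecke_def hecke_ring_simps double_cosets_def by auto
  have xc: "x \<in> carrier Heis" using x(1) HH.D_sub by auto
  note s = HH.some_dc[OF xc]
  have "(SOME y. y \<in> U) \<in> Heis_Delta" using s(1) HH.dc_sub_D[OF x(1)] x(2) by auto
  then show ?thesis using that[of "fst (SOME y. y \<in> U)" "snd (SOME y. y \<in> U)"] s(3) x(2)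
    by (auto simp: Heis_Delta_def)
qed

lemma theta_carrier:
  assumes "\<xi> \<in> carrier Heis_hecke" shows "hecke_theta \<xi> \<in> carrier Heis_hecke"
proof -
  let ?t = "\<lambda>U. let (C, a) = (SOME x. x \<in> U); pa = \<pi> *s a
     in frag_cmul (int (card (Gamma_orbit C a) div card (Gamma_orbit C pa))) (Heis_T (C, pa))"
  have "Poly_Mapping.keys (?t U) \<subseteq> double_cosets Heis Heis_Gamma Heis_Delta" if U: "U \<in> Poly_Mapping.keys \<xi>" for U
  proof -
    obtain C a where Ca: "(SOME x. x \<in> U) = (C, a)" "C \<in> GSp_Delta" "a \<in> \<M>" using Heis_carrierD[OF assms U] by metis
    have "(C, \<pi> *s a) \<in> Heis_Delta" using Ca by (auto simp: Heis_Delta_iff)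
    then show ?thesis unfolding Ca(1) Heis_T_def double_cosets_def by (auto simp: Let_def)
  qed
  then show ?thesis
    unfolding hecke_theta_def Heis_hecke_def hecke_ring_simps(1) mem_Collect_eq
    using keys_frag_extend[of ?t \<xi>] by blast
qed

text \<open>On functions, \<theta> is summation over the solutions of \<open>px \<equiv> d\<close>
  modulo \<open>lat D\<close>. The orbit ratios in its definition are absorbed by
  \<open>fibre_eq\<close>, and orbits no longer occur from here on.\<close>

lemma lookup_theta:
  fixes D :: "('p::prime_card, 'n::finite) sp_mat"
  assumes \<xi>: "\<xi> \<in> carrier Heis_hecke" and D: "D \<in> GSp_Delta" "level D k" "d \<in> \<M>"
  shows "int ((CARD('p) ^ k) ^ CARD('n)) * Poly_Mapping.lookup (hecke_theta \<xi>) (hdc (D, d))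
    = (\<Sum>x\<in>{x \<in> Rk k. \<pi> *s x - d \<in> lat D}. Poly_Mapping.lookup \<xi> (hdc (D, x)))"
proof -
  let ?q = "(CARD('p) ^ k) ^ CARD('n)"
  let ?K = "Poly_Mapping.keys \<xi>"
  let ?t = "\<lambda>U. let (C, a) = (SOME x. x \<in> U); pa = \<pi> *s a
     in frag_cmul (int (card (Gamma_orbit C a) div card (Gamma_orbit C pa))) (Heis_T (C, pa))"
  let ?S = "{x \<in> Rk k. \<pi> *s x - d \<in> lat D}"
  have t: "int ?q * Poly_Mapping.lookup (?t U) (hdc (D, d)) = int (fibre U k D d)" if U: "U \<in> ?K" for U
  proof -
    obtain C a where Ca: "(SOME x. x \<in> U) = (C, a)" "C \<in> GSp_Delta" "a \<in> \<M>" "U = hdc (C, a)"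
      using Heis_carrierD[OF \<xi> U] by metis
    obtain l where l: "level C l" using level_exists[OF Ca(2)] by blast
    have lv: "l = k" if "hdc (D, x) = hdc (C, y)" "y \<in> \<M>" for x y
    proof -
      have "(D, x) \<in> hdc (C, y)" using that hdc_carrier_iff[OF Ca(2)] Delta_GSp[OF D(1)] by blast
      then have "level D l" using Heis_dc_level(2)[OF _ _ l] Ca(2) that(2) by (simp add: Heis_Delta_iff)
      then show ?thesis using level_unique D(2) by blast
    qed
    show ?thesis
    proof (cases "l = k")
      case True
      then show ?thesis
        unfolding Ca(4) fibre_eq[OF Ca(2) l[unfolded True] Ca(3) D(3,1)] Ca(1)[unfolded Ca(4)]
        by (simp add: Heis_T_def Let_def)
    next
      case False
      then have "hdc (D, d) \<noteq> hdc (C, \<pi> *s a)" using lv[of d "\<pi> *s a"] Ca(3) by auto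
      moreover have "{x \<in> Rk k. \<pi> *s x - d \<in> lat D \<and> hdc (D, x) = U} = {}" using lv Ca(3,4) False by blast
      then have "fibre U k D d = 0" unfolding fibre_def by (simp only: card.empty)
      ultimately show ?thesis unfolding Ca(1) by (simp add: Heis_T_def Let_def)
    qed
  qed
  have "int ?q * Poly_Mapping.lookup (hecke_theta \<xi>) (hdc (D, d))
      = (\<Sum>U\<in>?K. Poly_Mapping.lookup \<xi> U * (int ?q * Poly_Mapping.lookup (?t U) (hdc (D, d))))"
    unfolding hecke_theta_def lookup_frag_extend sum_distrib_left by (intro sum.cong refl) (simp only: mult_ac)
  also have "\<dots> = (\<Sum>U\<in>?K. Poly_Mapping.lookup \<xi> U * int (fibre U k D d))"
    by (intro sum.cong refl) (simp only: t)
  also have "\<dots> = (\<Sum>U\<in>?K. \<Sum>x\<in>?S. if hdc (D, x) = U then Poly_Mapping.lookup \<xi> U else 0)"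
  proof (intro sum.cong refl)
    fix U
    have "fibre U k D d = card {x \<in> ?S. hdc (D, x) = U}" unfolding fibre_def by (simp add: conj_assoc)
    then show "Poly_Mapping.lookup \<xi> U * int (fibre U k D d) = (\<Sum>x\<in>?S. if hdc (D, x) = U then Poly_Mapping.lookup \<xi> U else 0)"
      by (simp add: sum.If_cases card_Rk(1) Int_def)
  qed
  also have "\<dots> = (\<Sum>x\<in>?S. \<Sum>U\<in>?K. if hdc (D, x) = U then Poly_Mapping.lookup \<xi> U else 0)" by (rule sum.swap)
  also have "\<dots> = (\<Sum>x\<in>?S. Poly_Mapping.lookup \<xi> (hdc (D, x)))"
    by (intro sum.cong refl) (auto simp: in_keys_iff)
  finally show ?thesis .
qed

lemma theta_pow_P_carrier: "(hecke_theta ^^ j) (Heis_P k) \<in> carrier Heis_hecke"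
  by (induction j) (simp_all add: Heis_P_carrier theta_carrier)

text \<open>A solution of \<open>p^(j+1) y \<equiv> d\<close> passes through the intermediate
  vectors \<open>x \<equiv> p^j y\<close>. Each \<open>y\<close> has \<open>p^(kn)\<close> of these
  in \<open>Rk k\<close>, which accounts for the normalisation at every step.\<close>

lemma lookup_theta_pow_P:
  fixes D :: "('p::prime_card, 'n::finite) sp_mat"
  assumes D: "D \<in> GSp_Delta" "level D k" "d \<in> \<M>"
  shows "int ((CARD('p) ^ k) ^ CARD('n)) * Poly_Mapping.lookup ((hecke_theta ^^ j) (Heis_P l)) (hdc (D, d))
    = (if k = l then int (card {x \<in> Rk k. \<pi> ^ j *s x - d \<in> lat D}) else 0)"
  using D(3)
proof (induction j arbitrary: d)
  case 0
  have "level D l \<longleftrightarrow> k = l" using D(2) level_unique by blast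
  moreover have "(D, d) \<in> Heis_Delta" using D(1) 0 by (simp add: Heis_Delta_iff)
  ultimately show ?case using lookup_Heis_P[of D d l] card_Rk_lat(1)[OF D(1,2) 0] by auto
next
  case (Suc j)
  let ?q = "(CARD('p) ^ k) ^ CARD('n)"
  let ?v = "\<lambda>x. Poly_Mapping.lookup ((hecke_theta ^^ j) (Heis_P l)) (hdc (D, x))"
  let ?S = "{x \<in> Rk k. \<pi> *s x - d \<in> lat D}"
  have q: "int ?q \<noteq> 0" by simp
  have th: "int ?q * Poly_Mapping.lookup ((hecke_theta ^^ Suc j) (Heis_P l)) (hdc (D, d)) = (\<Sum>x\<in>?S. ?v x)"
    using lookup_theta[OF theta_pow_P_carrier[of j l] D(1,2) Suc.prems] by simp
  have IH: "int ?q * ?v x = (if k = l then int (card {y \<in> Rk k. \<pi> ^ j *s y - x \<in> lat D}) else 0)" if "x \<in> ?S" for x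
    using Suc.IH that Rk_sub_M by blast
  have "int ?q * (\<Sum>x\<in>?S. ?v x) = (\<Sum>x\<in>?S. if k = l then int (card {y \<in> Rk k. \<pi> ^ j *s y - x \<in> lat D}) else 0)"
    unfolding sum_distrib_left by (intro sum.cong refl) (rule IH)
  also have "\<dots> = int ?q * (if k = l then int (card {x \<in> Rk k. \<pi> ^ Suc j *s x - d \<in> lat D}) else 0)"
  proof (cases "k = l")
    case True
    let ?T = "{y \<in> Rk k. \<pi> ^ Suc j *s y - d \<in> lat D}"
    have "(\<Sum>x\<in>?S. card {y \<in> Rk k. \<pi> ^ j *s y - x \<in> lat D}) = (\<Sum>x\<in>?S. card {y \<in> ?T. \<pi> ^ j *s y - x \<in> lat D})"
    proof (intro sum.cong refl arg_cong[of _ _ card])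
      fix x assume x: "x \<in> ?S"
      have "\<pi> ^ Suc j *s y - d \<in> lat D" if y: "\<pi> ^ j *s y - x \<in> lat D" for y
      proof -
        have "\<pi> *s (\<pi> ^ j *s y - x) \<in> lat D" by (rule lat_closed(4)[OF intg_simps(8) y])
        then have "\<pi> ^ Suc j *s y - \<pi> *s x \<in> lat D" by (simp add: vector_ssub_ldistrib vector_smult_assoc)
        then show ?thesis using x lat_periodic(2) by blast
      qed
      then show "{y \<in> Rk k. \<pi> ^ j *s y - x \<in> lat D} = {y \<in> ?T. \<pi> ^ j *s y - x \<in> lat D}" by blast
    qed
    also have "\<dots> = ?q * card ?T"
    proof (rule sum_multicount)
      show "\<forall>y\<in>?T. card {x \<in> ?S. \<pi> ^ j *s y - x \<in> lat D} = ?q"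
      proof
        fix y assume y: "y \<in> ?T"
        have "\<pi> *s x - d \<in> lat D" if x: "\<pi> ^ j *s y - x \<in> lat D" for x
        proof -
          have "\<pi> *s (\<pi> ^ j *s y - x) \<in> lat D" by (rule lat_closed(4)[OF intg_simps(8) x])
          then have "\<pi> ^ Suc j *s y - \<pi> *s x \<in> lat D" by (simp add: vector_ssub_ldistrib vector_smult_assoc)
          then show ?thesis using y lat_periodic(2) by blast
        qed
        then have "{x \<in> ?S. \<pi> ^ j *s y - x \<in> lat D} = {x \<in> Rk k. \<pi> ^ j *s y - x \<in> lat D}" by blast
        moreover have "\<pi> ^ j *s y \<in> \<M>" using y Rk_sub_M by auto
        ultimately show "card {x \<in> ?S. \<pi> ^ j *s y - x \<in> lat D} = ?q" using card_Rk_lat(2)[OF D(1,2)] by simp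
      qed
    qed (simp_all add: card_Rk(1))
    finally have "int (\<Sum>x\<in>?S. card {y \<in> Rk k. \<pi> ^ j *s y - x \<in> lat D}) = int (?q * card ?T)"
      by (rule arg_cong)
    then have "(\<Sum>x\<in>?S. int (card {y \<in> Rk k. \<pi> ^ j *s y - x \<in> lat D})) = int ?q * int (card ?T)"
      by (simp only: of_nat_sum of_nat_mult)
    then show ?thesis using True by simp
  qed simp
  finally show ?case unfolding th using q by simp
qed

subsection \<open>Multiplication by lifted elements\<close>

text \<open>The generator of \<open>N\<close> is chosen in the form \<open>\<gamma>g\<close>, so
  that its lift with vector 0 lies in the double coset of \<open>(g, 0)\<close>.\<close>

definition lat_rep :: "('p::prime_card, 'n::finite) sp_mat \<Rightarrow> ('p, 'n) sp_vec set \<Rightarrow> ('p, 'n) sp_mat" where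
  "lat_rep g N = (SOME \<gamma>. \<gamma> \<in> GSp_Gamma \<and> lat (\<gamma> ** g) = N) ** g"

lemma lat_rep:
  assumes "g \<in> GSp_Delta" "level g j" "N \<in> lats g"
  shows "lat_rep g N \<in> GSp_Delta" "level (lat_rep g N) j" "lat (lat_rep g N) = N" "(lat_rep g N, 0) \<in> hdc (g, 0)"
proof -
  let ?\<gamma> = "SOME \<gamma>. \<gamma> \<in> GSp_Gamma \<and> lat (\<gamma> ** g) = N"
  obtain \<gamma> where "\<gamma> \<in> GSp_Gamma \<and> lat (\<gamma> ** g) = N" using assms(3) unfolding lats_def by blast
  then have g: "?\<gamma> \<in> GSp_Gamma \<and> lat (?\<gamma> ** g) = N" by (rule someI)
  then show "lat_rep g N \<in> GSp_Delta" "level (lat_rep g N) j" "lat (lat_rep g N) = N"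
    unfolding lat_rep_def using level_Gamma_mult[OF _ assms(1,2)] by auto
  show "(lat_rep g N, 0) \<in> hdc (g, 0)"
    unfolding Heis_dc[OF assms(1)] lat_rep_def using g Gamma_closed(1) lat_closed(1)
    by (intro bexI[of _ ?\<gamma>] bexI[of _ "mat 1"]) auto
qed

text \<open>Lifting by \<open>s\<close> adds no left cosets: an element \<open>(D, b)\<close> of the
  double coset of \<open>(g, 0)\<close> has \<open>b\<close> in \<open>lat D\<close>, and such a
  vector is absorbed by \<Gamma>~ on the right. So the lattices of \<open>g\<close> index the
  convolution for \<open>s(T(g))\<close> too.\<close>

lemma bij_left_cosets:
  fixes g :: "('p::prime_card, 'n::finite) sp_mat"
  assumes g: "g \<in> GSp_Delta" "level g j"
  shows "bij_betw (\<lambda>N. (lat_rep g N, 0) <#\<^bsub>Heis\<^esub> Heis_Gamma) (lats g) (left_cosets_in Heis Heis_Gamma (hdc (g, 0)))"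
  unfolding bij_betw_def
proof
  note rep = lat_rep[OF g]
  show "inj_on (\<lambda>N. (lat_rep g N, 0) <#\<^bsub>Heis\<^esub> Heis_Gamma) (lats g)"
  proof (rule inj_onI)
    fix N N' assume N: "N \<in> lats g" "N' \<in> lats g"
      and eq: "(lat_rep g N, 0) <#\<^bsub>Heis\<^esub> Heis_Gamma = (lat_rep g N', 0) <#\<^bsub>Heis\<^esub> Heis_Gamma"
    have c: "(lat_rep g N, 0) \<in> carrier Heis" "(lat_rep g N', 0) \<in> carrier Heis"
      using Delta_GSp[OF rep(1)[OF N(1)]] Delta_GSp[OF rep(1)[OF N(2)]] by simp_all
    obtain k where k: "k \<in> Heis_Gamma" "(lat_rep g N, 0) = (lat_rep g N', 0) \<otimes>\<^bsub>Heis\<^esub> k"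
      using HH.l_coset_eqD[OF c eq] by blast
    obtain Y y where Y: "k = (Y, y)" by (cases k)
    then have "Y \<in> GSp_Gamma" "lat_rep g N = lat_rep g N' ** Y" using k by (auto simp: Heis_Gamma_iff)
    then have "lat (lat_rep g N) = lat (lat_rep g N')" using lat_mult_Gamma by simp
    then show "N = N'" using rep(3) N by simp
  qed
  show "(\<lambda>N. (lat_rep g N, 0) <#\<^bsub>Heis\<^esub> Heis_Gamma) ` lats g = left_cosets_in Heis Heis_Gamma (hdc (g, 0))"
  proof
    show "(\<lambda>N. (lat_rep g N, 0) <#\<^bsub>Heis\<^esub> Heis_Gamma) ` lats g \<subseteq> left_cosets_in Heis Heis_Gamma (hdc (g, 0))"
      unfolding left_cosets_in_def using rep(4) by blast
    show "left_cosets_in Heis Heis_Gamma (hdc (g, 0)) \<subseteq> (\<lambda>N. (lat_rep g N, 0) <#\<^bsub>Heis\<^esub> Heis_Gamma) ` lats g"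
    proof
      fix A assume "A \<in> left_cosets_in Heis Heis_Gamma (hdc (g, 0))"
      then obtain D b where A: "A = (D, b) <#\<^bsub>Heis\<^esub> Heis_Gamma" "(D, b) \<in> hdc (g, 0)"
        unfolding left_cosets_in_def by auto
      then obtain X Y where XY: "X \<in> GSp_Gamma" "Y \<in> GSp_Gamma" "D = X ** g ** Y" "b - multiplier Y *s (X *v 0) \<in> lat D"
        unfolding Heis_dc[OF g(1)] by blast
      have b: "b \<in> lat D" using XY(4) by simp
      note D = level_double[OF g XY(1,2), folded XY(3)]
      have lD: "lat D = lat (X ** g)" unfolding XY(3) by (rule lat_mult_Gamma[OF XY(2)])
      then have N: "lat D \<in> lats g" unfolding lats_def using XY(1) by auto
      let ?r = "lat_rep g (lat D)"
      note rG = Delta_GSp[OF rep(1)[OF N]]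
      define Z where "Z = ginv ?r ** D"
      have Z: "Z \<in> GSp_Gamma" unfolding Z_def by (rule lat_eq_imp[OF rG Delta_GSp[OF D(1)] rep(3)[OF N]])
      have rZ: "?r ** Z = D" unfolding Z_def using ginv(1)[OF rG] by (simp add: matrix_mul_assoc)
      obtain m where m: "m \<in> \<M>" "b = ?r *v m" using b rep(3)[OF N] unfolding lat_def by auto
      have "(D, b) = (?r, 0) \<otimes>\<^bsub>Heis\<^esub> (Z, m)" using rZ m(2) by simp
      then have "(D, b) \<in> (?r, 0) <#\<^bsub>Heis\<^esub> Heis_Gamma"
        unfolding l_coset_def using Z m(1) Heis_Gamma_iff by blast
      then have "(?r, 0) <#\<^bsub>Heis\<^esub> Heis_Gamma = A"
        unfolding A(1) by (rule Heis.l_repr_independence[OF _ _ Heis_Gamma_subgroup]) (simp add: rG)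
      then show "A \<in> (\<lambda>N. (lat_rep g N, 0) <#\<^bsub>Heis\<^esub> Heis_Gamma) ` lats g" using N by blast
    qed
  qed
qed

lemma lookup_lift_mult:
  fixes g :: "('p::prime_card, 'n::finite) sp_mat"
  assumes g: "g \<in> GSp_Delta" "level g j" and \<eta>: "\<eta> \<in> carrier Heis_hecke" and C: "(C, a) \<in> Heis_Delta"
  shows "Poly_Mapping.lookup (Heis_T (g, 0) \<otimes>\<^bsub>Heis_hecke\<^esub> \<eta>) (hdc (C, a))
    = (\<Sum>N\<in>lats g. Poly_Mapping.lookup \<eta> (hdc (ginv (lat_rep g N) ** C, ginv (lat_rep g N) *v a)))"
proof -
  have g0: "(g, 0) \<in> Heis_Delta" using g(1) by (simp add: Heis_Delta_iff)
  have "Poly_Mapping.lookup (Heis_T (g, 0) \<otimes>\<^bsub>Heis_hecke\<^esub> \<eta>) (hdc (C, a))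
    = (\<Sum>A\<in>left_cosets_in Heis Heis_Gamma (hdc (g, 0)).
        Poly_Mapping.lookup \<eta> (hdc (inv\<^bsub>Heis\<^esub> (SOME x. x \<in> A) \<otimes>\<^bsub>Heis\<^esub> (C, a))))"
    unfolding Heis_T_def Heis_hecke_def by (rule HH.lookup_hecke_mult[OF g0 \<eta>[unfolded Heis_hecke_def] C])
  also have "\<dots> = (\<Sum>N\<in>lats g. Poly_Mapping.lookup \<eta>
      (hdc (inv\<^bsub>Heis\<^esub> (SOME x. x \<in> (lat_rep g N, 0) <#\<^bsub>Heis\<^esub> Heis_Gamma) \<otimes>\<^bsub>Heis\<^esub> (C, a))))"
    by (rule sum.reindex_bij_betw[OF bij_left_cosets[OF g], symmetric])
  also have "\<dots> = (\<Sum>N\<in>lats g. Poly_Mapping.lookup \<eta> (hdc (ginv (lat_rep g N) ** C, ginv (lat_rep g N) *v a)))"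
  proof (rule sum.cong[OF refl])
    fix N assume N: "N \<in> lats g"
    note rG = Delta_GSp[OF lat_rep(1)[OF g N]]
    have "(lat_rep g N, 0) \<in> carrier Heis" using rG by simp
    from HH.dc_inv_some[OF this Delta_Heis[OF C]]
    show "Poly_Mapping.lookup \<eta> (hdc (inv\<^bsub>Heis\<^esub> (SOME x. x \<in> (lat_rep g N, 0) <#\<^bsub>Heis\<^esub> Heis_Gamma) \<otimes>\<^bsub>Heis\<^esub> (C, a)))
      = Poly_Mapping.lookup \<eta> (hdc (ginv (lat_rep g N) ** C, ginv (lat_rep g N) *v a))"
      using Heis_inv_0[OF rG] by simp
  qed
  finally show ?thesis .
qed

text \<open>In the convolution over lattices this kills the terms whose translate is not integral,
  whether in the matrix or in the vector.\<close>

lemma lookup_carrier_zero: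
  assumes "\<eta> \<in> carrier Heis_hecke" "x \<in> carrier Heis" "x \<notin> Heis_Delta"
  shows "Poly_Mapping.lookup \<eta> (hdc x) = 0"
  using assms HH.dc_mem_double_cosets_iff[OF assms(2)]
  unfolding Heis_hecke_def hecke_ring_simps by (auto simp: in_keys_iff)

text \<open>The vector adjoined to \<open>C\<M>\<close>, with exponent 4 because \<theta> occurs up
  to the fourth power. It is a quotient of powers since \<open>k\<close> may exceed 4, in which case
  the vector need not be integral.\<close>

definition adj :: "nat \<Rightarrow> ('p::prime_card, 'n::finite) sp_mat \<Rightarrow> ('p, 'n) sp_vec \<Rightarrow> ('p, 'n) sp_vec" where
  "adj k C w = (\<pi> ^ 4 / \<pi> ^ k) *s (C *v w)"

text \<open>The character against which the counts are transformed. It depends only on the double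
  coset representative \<open>(C, a)\<close>, because \<open>D\<inverse>b = C\<inverse>a\<close>
  when \<open>D = \<alpha>\<inverse>C\<close> and \<open>b = \<alpha>\<inverse>a\<close>.\<close>

definition chi :: "nat \<Rightarrow> ('p::prime_card, 'n::finite) heis \<Rightarrow> ('p, 'n) sp_vec \<Rightarrow> complex" where
  "chi k c w = psi k (- om w (\<pi> ^ k *s (ginv (fst c) *v snd c)))"

lemma scaled_inverse_intg:
  assumes "C \<in> GSp_Delta" "level C k" "a \<in> \<M>"
  shows "\<pi> ^ k *s (ginv C *v a) \<in> \<M>"
proof -
  have "\<pi> ^ k *s a \<in> lat C" using pM_sub_lat[OF assms(1,2)] assms(3) pM_simps(7) by blast
  then show ?thesis using lat_iff[OF Delta_GSp[OF assms(1)]] by (simp add: vector_scalar_commute)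
qed

text \<open>The value at the translate by \<open>\<alpha>\<inverse>\<close> is a count of solutions
  modulo a lattice \<open>D\<M>\<close> of level \<open>l = k - j\<close>. Counting them modulo
  \<open>p^k\<close> and transforming yields a sum over \<open>w\<close> in which \<alpha> enters
  only through an inclusion of lattices.\<close>

lemma theta_pow_P_fourier:
  fixes \<alpha> :: "('p::prime_card, 'n::finite) sp_mat"
  assumes \<alpha>: "\<alpha> \<in> GSp_Delta" "level \<alpha> j" "j \<le> 4" and C: "C \<in> GSp_Delta" "level C k" and a: "a \<in> \<M>"
  shows "of_nat ((CARD('p) ^ k) ^ CARD('n)) * of_nat ((CARD('p) ^ j) ^ CARD('n)) *
      of_int (Poly_Mapping.lookup ((hecke_theta ^^ (4 - j)) (Heis_P m)) (hdc (ginv \<alpha> ** C, ginv \<alpha> *v a)))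
    = (if j + m = k then \<Sum>w\<in>Rk k. if insert (adj k C w) (lat C) \<subseteq> lat \<alpha> then chi k (C, a) w else 0 else 0)"
proof -
  define D where "D = ginv \<alpha> ** C"
  define b where "b = ginv \<alpha> *v a"
  let ?lk = "Poly_Mapping.lookup ((hecke_theta ^^ (4 - j)) (Heis_P m)) (hdc (D, b))"
  note \<alpha>G = Delta_GSp[OF \<alpha>(1)] and CG = Delta_GSp[OF C(1)]
  have DG: "D \<in> carrier GSp" unfolding D_def using GSp_mult(1)[OF ginv(5)[OF \<alpha>G] CG] .
  have \<alpha>D: "\<alpha> ** D = C" unfolding D_def using ginv(1)[OF \<alpha>G] by (simp add: matrix_mul_assoc)
  have \<alpha>b: "\<alpha> *v b = a" unfolding b_def by (rule ginv(3)[OF \<alpha>G])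
  show ?thesis
  proof (cases "lat C \<subseteq> lat \<alpha>")
    case False
    then have "D \<notin> GSp_Delta" unfolding D_def using lat_subset_iff[OF \<alpha>G CG] by blast
    then have "(D, b) \<notin> Heis_Delta" by (simp add: Heis_Delta_iff)
    then have "?lk = 0" using lookup_carrier_zero[OF theta_pow_P_carrier, of "(D, b)"] DG by simp
    then show ?thesis using False unfolding D_def b_def by simp
  next
    case True
    then have D: "D \<in> GSp_Delta" unfolding D_def using lat_subset_iff[OF \<alpha>G CG] by blast
    then obtain l where l: "level D l" using level_exists by blast
    have "level C (j + l)" using level_mult[OF \<alpha>G DG \<alpha>(2) l] \<alpha>D by simp
    then have k: "k = j + l" using level_unique C(2) by blast
    have "C *v (ginv D *v b) = a"
      using ginv(3)[OF DG, of b] \<alpha>b unfolding \<alpha>D[symmetric] by (simp add: matrix_vector_mul_assoc[symmetric])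
    then have inv_eq: "ginv D *v b = ginv C *v a" using ginv(4)[OF CG] by metis
    have Eb: "\<pi> ^ k *s (ginv D *v b) \<in> \<M>" unfolding inv_eq by (rule scaled_inverse_intg[OF C a])
    let ?N = "card {x \<in> Rk k. \<pi> ^ (4 - j) *s x - b \<in> lat D}"
    \<comment> \<open>The solutions are counted in \<open>Rk k\<close> and not in
      \<open>Rk l\<close>, so that the range of \<open>w\<close> is the same for every
      \<alpha>.\<close>
    have N_sum: "of_nat ?N = (\<Sum>w\<in>Rk k. if insert (adj k C w) (lat C) \<subseteq> lat \<alpha> then chi k (C, a) w else 0)"
    proof -
      \<comment> \<open>Multiplying by \<alpha> replaces \<open>Dw\<close> by \<open>Cw\<close>, and
        dividing by \<open>p^l\<close> with \<open>l = k - j\<close> turns \<open>p^(4-j)\<close>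
        into \<open>p^(4-k)\<close>. The index \<open>j\<close> disappears.\<close>
      have iff: "\<pi> ^ (4 - j) *s (D *v w) \<in> pM l \<longleftrightarrow> insert (adj k C w) (lat C) \<subseteq> lat \<alpha>" for w
      proof -
        have "ginv \<alpha> *v adj k C w = (\<pi> ^ 4 / \<pi> ^ k) *s (D *v w)"
          unfolding adj_def D_def by (simp add: vector_scalar_commute matrix_vector_mul_assoc[symmetric])
        moreover have "\<pi> ^ l *s ((\<pi> ^ 4 / \<pi> ^ k) *s (D *v w)) = \<pi> ^ (4 - j) *s (D *v w)"
          unfolding k using \<alpha>(3) by (simp add: vector_smult_assoc power_add power_diff)
        moreover have "adj k C w \<in> lat \<alpha> \<longleftrightarrow> \<pi> ^ l *s (ginv \<alpha> *v adj k C w) \<in> pM l"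
          unfolding pM_simps(7) by (rule lat_iff[OF \<alpha>G])
        ultimately have "adj k C w \<in> lat \<alpha> \<longleftrightarrow> \<pi> ^ (4 - j) *s (D *v w) \<in> pM l"
          by (simp only:)
        then show ?thesis using True by simp
      qed
      have "l \<le> k" using k by simp
      then show ?thesis
        using count_fourier[OF D l _ Eb, of "4 - j"] unfolding chi_def inv_eq iff fst_conv snd_conv by blast
    qed
    show ?thesis
    proof (cases "b \<in> \<M>")
      case b: False
      then have "(D, b) \<notin> Heis_Delta" by (simp add: Heis_Delta_iff)
      then have lk: "?lk = 0" using lookup_carrier_zero[OF theta_pow_P_carrier, of "(D, b)"] DG by simp
      \<comment> \<open>For non-integral \<open>b\<close> the coefficient is 0 because the translate
        is outside \<open>Heis_Delta\<close>. The sum over \<open>w\<close> vanishes as well,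
        because it equals an empty count.\<close>
      have "\<pi> ^ (4 - j) *s x - b \<notin> lat D" if x: "x \<in> Rk k" for x
      proof
        assume "\<pi> ^ (4 - j) *s x - b \<in> lat D"
        then have "\<pi> ^ (4 - j) *s x - b \<in> \<M>" using lat_sub_M[OF D] by blast
        moreover have "\<pi> ^ (4 - j) *s x \<in> \<M>" using x Rk_sub_M by auto
        ultimately have "\<pi> ^ (4 - j) *s x - (\<pi> ^ (4 - j) *s x - b) \<in> \<M>" by (rule M_simps(3)[rotated])
        then show False using b by simp
      qed
      then have "{x \<in> Rk k. \<pi> ^ (4 - j) *s x - b \<in> lat D} = {}" by blast
      then have "?N = 0" by (simp only: card.empty)
      then show ?thesis using N_sum lk unfolding D_def b_def by simp
    next
      case b: True
      let ?q = "\<lambda>i. (CARD('p) ^ i) ^ CARD('n)"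
      have lk: "int (?q l) * ?lk = (if l = m then int (card {x \<in> Rk l. \<pi> ^ (4 - j) *s x - b \<in> lat D}) else 0)"
        by (rule lookup_theta_pow_P[OF D l b])
      have q0: "?q i \<noteq> 0" for i by simp
      show ?thesis
      proof (cases "l = m")
        case False
        then have "?lk = 0" using lk q0[of l] by simp
        moreover have "j + m \<noteq> k" using False k by simp
        ultimately show ?thesis unfolding D_def b_def by simp
      next
        case True
        \<comment> \<open>Passing from \<open>Rk l\<close> to \<open>Rk k\<close> costs the ratio
          \<open>p^(2n(k-l))\<close>. Together with the factor \<open>p^(ln)\<close> already
          attached to the coefficient this leaves \<open>p^(kn) p^(jn)\<close>.\<close>
        have "?N * card (Rk l :: ('p, 'n) sp_vec set) = card {x \<in> Rk l. \<pi> ^ (4 - j) *s x - b \<in> lat D} * card (Rk k :: ('p, 'n) sp_vec set)"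
        proof (rule card_fibres)
          show "l \<le> k" using k by simp
          fix x y :: "('p, 'n) sp_vec" assume "x - y \<in> pM l"
          then have "x - y \<in> lat D" using pM_sub_lat[OF D l] by blast
          then have "\<pi> ^ (4 - j) *s (x - y) \<in> lat D" by (rule lat_closed(4)[rotated]) simp
          then have "\<pi> ^ (4 - j) *s x - \<pi> ^ (4 - j) *s y \<in> lat D" by (simp add: vector_ssub_ldistrib)
          then show "(\<pi> ^ (4 - j) *s x - b \<in> lat D) = (\<pi> ^ (4 - j) *s y - b \<in> lat D)" by (rule lat_periodic(2))
        qed
        then have "int ?N * int (card (Rk l :: ('p, 'n) sp_vec set)) = (int (?q l) * ?lk) * int (card (Rk k :: ('p, 'n) sp_vec set))"
          using lk True by (simp only: of_nat_mult[symmetric] if_True refl)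
        moreover have "card (Rk i :: ('p, 'n) sp_vec set) = ?q i * ?q i" for i
          unfolding card_Rk(2) by (simp add: mult_2 power_add)
        moreover have "?q k = ?q j * ?q l" unfolding k by (simp add: power_add power_mult_distrib)
        ultimately have "(int (?q l) * int (?q l)) * int ?N = (int (?q l) * int (?q l)) * (int (?q k) * int (?q j) * ?lk)"
          by (simp add: mult_ac)
        then have "int ?N = int (?q k) * int (?q j) * ?lk" using q0[of l] by simp
        then have "of_int (int ?N) = (of_int (int (?q k) * int (?q j) * ?lk) :: complex)" by simp
        then have "of_nat (?q k) * of_nat (?q j) * of_int ?lk = (of_nat ?N :: complex)"
          by (simp only: of_int_mult of_int_of_nat_eq)
        then show ?thesis using N_sum True k unfolding D_def b_def by simp
      qed
    qed
  qed
qed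

text \<open>Summing over the lattices \<open>N\<close> of \<open>g\<close> turns the indicator of
  the inclusion into \<open>cnt\<close>. All \<open>N\<close> share the same character and the same
  enlarged lattice, so the sums can be exchanged.\<close>

lemma lift_mult_fourier:
  fixes g :: "('p::prime_card, 'n::finite) sp_mat"
  assumes g: "g \<in> GSp_Delta" "level g j" "j \<le> 4" and C: "C \<in> GSp_Delta" "level C k" and a: "a \<in> \<M>"
  shows "of_nat ((CARD('p) ^ k) ^ CARD('n)) * of_nat ((CARD('p) ^ j) ^ CARD('n)) *
      of_int (Poly_Mapping.lookup (Heis_T (g, 0) \<otimes>\<^bsub>Heis_hecke\<^esub> (hecke_theta ^^ (4 - j)) (Heis_P m)) (hdc (C, a)))
    = (if j + m = k then \<Sum>w\<in>Rk k. of_nat (cnt g (insert (adj k C w) (lat C))) * chi k (C, a) w else 0)"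
proof -
  have Ca: "(C, a) \<in> Heis_Delta" using C a by (simp add: Heis_Delta_iff)
  let ?I = "\<lambda>w N. if insert (adj k C w) (lat C) \<subseteq> N then chi k (C, a) w else 0"
  have "of_nat ((CARD('p) ^ k) ^ CARD('n)) * of_nat ((CARD('p) ^ j) ^ CARD('n)) *
      of_int (Poly_Mapping.lookup (Heis_T (g, 0) \<otimes>\<^bsub>Heis_hecke\<^esub> (hecke_theta ^^ (4 - j)) (Heis_P m)) (hdc (C, a)))
    = (\<Sum>N\<in>lats g. if j + m = k then \<Sum>w\<in>Rk k. ?I w N else 0)"
    unfolding lookup_lift_mult[OF g(1,2) theta_pow_P_carrier Ca] of_int_sum sum_distrib_left
  proof (rule sum.cong[OF refl])
    fix N assume N: "N \<in> lats g"
    note r = lat_rep[OF g(1,2) N]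
    show "of_nat ((CARD('p) ^ k) ^ CARD('n)) * of_nat ((CARD('p) ^ j) ^ CARD('n)) *
        of_int (Poly_Mapping.lookup ((hecke_theta ^^ (4 - j)) (Heis_P m)) (hdc (ginv (lat_rep g N) ** C, ginv (lat_rep g N) *v a)))
      = (if j + m = k then \<Sum>w\<in>Rk k. ?I w N else 0)"
      using theta_pow_P_fourier[OF r(1,2) g(3) C a, of m] unfolding r(3) .
  qed
  also have "\<dots> = (if j + m = k then \<Sum>w\<in>Rk k. \<Sum>N\<in>lats g. ?I w N else 0)"
    by (simp add: sum.swap[of _ "Rk k"])
  also have "\<dots> = (if j + m = k then \<Sum>w\<in>Rk k. of_nat (cnt g (insert (adj k C w) (lat C))) * chi k (C, a) w else 0)"
  proof -
    have "(\<Sum>N\<in>lats g. ?I w N) = of_nat (cnt g (insert (adj k C w) (lat C))) * chi k (C, a) w" for w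
      unfolding cnt_def by (simp add: sum.If_cases[OF finite_lats[OF g(1)]] Int_def)
    then show ?thesis by simp
  qed
  finally show ?thesis .
qed

text \<open>An inclusion of lattices makes the level of the smaller one at least that of the larger
  one. This matches the absence of the terms with \<open>j > n\<close> in the power series.\<close>

lemma cnt_low_level:
  assumes g: "g \<in> GSp_Delta" "level g j" and C: "C \<in> GSp_Delta" "level C k" and jk: "k < j"
  shows "cnt g (insert z (lat C)) = 0"
proof -
  have "\<not> lat C \<subseteq> N" if N: "N \<in> lats g" for N
  proof
    assume sub: "lat C \<subseteq> N"
    obtain h where h: "N = lat h" "h \<in> GSp_Delta" "level h j" using lats_cases[OF N g] by blast
    note hG = Delta_GSp[OF h(2)] and CG = Delta_GSp[OF C(1)]
    have D: "ginv h ** C \<in> GSp_Delta" using lat_subset_iff[OF hG CG] sub h(1) by blast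
    then obtain l where l: "level (ginv h ** C) l" using level_exists by blast
    have "h ** (ginv h ** C) = C" using ginv(1)[OF hG] by (simp add: matrix_mul_assoc)
    then have "level C (j + l)" using level_mult[OF hG Delta_GSp[OF D] h(3) l] by simp
    then show False using level_unique[OF C(2)] jk by fastforce
  qed
  then have "{N \<in> lats g. insert z (lat C) \<subseteq> N} = {}" by blast
  then show ?thesis unfolding cnt_def by (simp only: card.empty)
qed

text \<open>Once the count attached to \<open>w\<close> is known to be independent of
  \<open>w\<close>, this orthogonality relation inverts the transform.\<close>

lemma sum_chi:
  fixes C :: "('p::prime_card, 'n::finite) sp_mat"
  assumes C: "C \<in> GSp_Delta" "level C k" and a: "a \<in> \<M>"
  shows "(\<Sum>w\<in>Rk k. chi k (C, a) w) = (if a \<in> lat C then of_nat ((CARD('p) ^ k) ^ CARD('n)) * of_nat ((CARD('p) ^ k) ^ CARD('n)) else 0)"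
proof -
  let ?z = "- (\<pi> ^ k *s (ginv C *v a))"
  have z: "?z \<in> \<M>" using scaled_inverse_intg[OF C a] by auto
  have "chi k (C, a) w = psi k (om w ?z)" for w
  proof -
    have "om w ?z = - om w (\<pi> ^ k *s (ginv C *v a))"
      using om_linear(6)[of w "-1" "\<pi> ^ k *s (ginv C *v a)"] by (simp add: vector_sneg_minus1[symmetric])
    then show ?thesis unfolding chi_def by simp
  qed
  then have "(\<Sum>w\<in>Rk k. chi k (C, a) w) = (if ?z \<in> pM k then of_nat (card (Rk k :: ('p, 'n) sp_vec set)) else 0)"
    using sum_psi_om[OF z] by simp
  moreover have "?z \<in> pM k \<longleftrightarrow> a \<in> lat C"
  proof -
    have "?z \<in> pM k \<longleftrightarrow> \<pi> ^ k *s (ginv C *v a) \<in> pM k" using pM_simps(4)[of ?z k] pM_simps(4)[of "- ?z" k] by auto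
    also have "\<dots> \<longleftrightarrow> a \<in> lat C" unfolding pM_simps(7) lat_iff[OF Delta_GSp[OF C(1)]] ..
    finally show ?thesis .
  qed
  moreover have "card (Rk k :: ('p, 'n) sp_vec set) = (CARD('p) ^ k) ^ CARD('n) * (CARD('p) ^ k) ^ CARD('n)"
    unfolding card_Rk(2) by (simp add: mult_2 power_add)
  ultimately show ?thesis by simp
qed

section \<open>The coefficients of the series as Fourier transforms\<close>

lemma level_scalar_01: "level (mat (\<pi> ^ 0)) 0" "level (mat (\<pi> ^ 1)) 2" "level (mat (\<pi> ^ 2)) 4"
  using scalar_Delta(2)[of 0] scalar_Delta(2)[of 1] scalar_Delta(2)[of 2] by simp_all

lemma pA_Delta: "mat (\<pi> ^ 1) ** matA \<in> GSp_Delta" "level (mat (\<pi> ^ 1) ** matA) 3"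
proof -
  show "mat (\<pi> ^ 1) ** matA \<in> GSp_Delta" by (rule Delta_mult[OF scalar_Delta(1) matA_Delta(1)])
  show "level (mat (\<pi> ^ 1) ** matA) 3"
    using level_mult[OF Delta_GSp[OF scalar_Delta(1)] Delta_GSp[OF matA_Delta(1)] scalar_Delta(2)[of 1] matA_Delta(2)]
    by simp
qed

lemma lat_eq_pM_level:
  fixes C :: "('p::prime_card, 'n::finite) sp_mat"
  assumes "C \<in> GSp_Delta" "level C k" "lat C = pM i"
  shows "k = 2 * i"
proof -
  have c: "(mat (\<pi> ^ i) :: ('p, 'n) sp_mat) \<in> GSp_Delta" by (rule scalar_Delta(1))
  define Y where "Y = ginv (mat (\<pi> ^ i)) ** C"
  have Y: "Y \<in> GSp_Gamma"
    unfolding Y_def by (intro lat_eq_imp Delta_GSp c assms(1)) (simp add: lat_scalar assms(3))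
  have "mat (\<pi> ^ i) ** Y = C" unfolding Y_def using ginv(1)[OF Delta_GSp[OF c]] by (simp add: matrix_mul_assoc)
  moreover have "level Y 0" using Y Gamma_Delta level_0_iff by blast
  ultimately have "level C (2 * i)"
    using level_mult[OF Delta_GSp[OF c] Gamma_GSp[OF Y] scalar_Delta(2)] by force
  then show ?thesis using level_unique assms(2) by blast
qed

lemma hdc_scalar_iff:
  fixes C :: "('p::prime_card, 'n::finite) sp_mat"
  assumes "C \<in> GSp_Delta"
  shows "hdc (C, a) = hdc (mat (\<pi> ^ i), 0) \<longleftrightarrow> lat C = pM i \<and> a \<in> lat C"
proof -
  let ?c = "mat (\<pi> ^ i) :: ('p, 'n) sp_mat"
  have c: "?c \<in> GSp_Delta" by (rule scalar_Delta(1))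
  have "hdc (C, a) = hdc (?c, 0) \<longleftrightarrow> (C, a) \<in> hdc (?c, 0)"
    using hdc_carrier_iff[OF c] Delta_GSp[OF assms] by blast
  also have "\<dots> \<longleftrightarrow> (\<exists>X\<in>GSp_Gamma. \<exists>Y\<in>GSp_Gamma. C = X ** ?c ** Y \<and> a \<in> lat C)"
    unfolding Heis_dc[OF c] by simp
  also have "\<dots> \<longleftrightarrow> lat C = pM i \<and> a \<in> lat C"
  proof
    assume "\<exists>X\<in>GSp_Gamma. \<exists>Y\<in>GSp_Gamma. C = X ** ?c ** Y \<and> a \<in> lat C"
    then obtain X Y where XY: "X \<in> GSp_Gamma" "Y \<in> GSp_Gamma" "C = X ** ?c ** Y" "a \<in> lat C" by blast
    have "lat C = lat (X ** ?c)" unfolding XY(3) by (rule lat_mult_Gamma[OF XY(2)])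
    moreover have "lat (X ** ?c) \<in> lats ?c" unfolding lats_def using XY(1) by blast
    ultimately show "lat C = pM i \<and> a \<in> lat C" using XY(4) unfolding lats_scalar by simp
  next
    assume *: "lat C = pM i \<and> a \<in> lat C"
    define Y where "Y = ginv ?c ** C"
    have Y: "Y \<in> GSp_Gamma"
      unfolding Y_def by (intro lat_eq_imp Delta_GSp c assms) (simp add: lat_scalar *)
    have "?c ** Y = C" unfolding Y_def using ginv(1)[OF Delta_GSp[OF c]] by (simp add: matrix_mul_assoc)
    then have "C = mat 1 ** ?c ** Y" by simp
    then show "\<exists>X\<in>GSp_Gamma. \<exists>Y\<in>GSp_Gamma. C = X ** ?c ** Y \<and> a \<in> lat C"
      using * Y Gamma_closed(1) by blast
  qed
  finally show ?thesis .
qed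

text \<open>The coefficient of \<open>X^n\<close> in the term of index \<open>j\<close>, with the
  lift of a single double coset in place of \<open>q\<^sub>j\<close>. The scalar
  \<open>p^(2j)\<close> comes from \<open>Y^j\<close>, and the case distinction from the shift by
  \<open>X^j\<close>.\<close>

definition hecke_term :: "('p::prime_card, 2) sp_mat \<Rightarrow> nat \<Rightarrow> nat \<Rightarrow> (('p, 2) heis set \<Rightarrow>\<^sub>0 int)" where
  "hecke_term g j n = (if j \<le> n then frag_cmul (int CARD('p) ^ (2 * j))
      (Heis_T (g, 0) \<otimes>\<^bsub>Heis_hecke\<^esub> (hecke_theta ^^ (4 - j)) (Heis_P (n - j))) else 0)"

text \<open>The factor \<open>p^(2j)\<close> of \<open>Y^j\<close> equals the normalisation
  \<open>p^(jn)\<close> of \<open>lift_mult_fourier\<close> for \<open>n = 2\<close>. The remaining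
  factor \<open>p^(2k)\<close> is common to all terms, so they can be added under one sum over
  \<open>w\<close>.\<close>

lemma hecke_term_fourier:
  fixes g :: "('p::prime_card, 2) sp_mat"
  assumes g: "g \<in> GSp_Delta" "level g j" "j \<le> 4" and C: "C \<in> GSp_Delta" "level C k" and a: "a \<in> \<M>"
  shows "of_nat ((CARD('p) ^ k) ^ 2) * of_int (Poly_Mapping.lookup (hecke_term g j n) (hdc (C, a)))
    = (if n = k then \<Sum>w\<in>Rk k. of_nat (cnt g (insert (adj k C w) (lat C))) * chi k (C, a) w else 0)"
proof (cases "j \<le> n")
  case True
  have p: "(of_nat ((CARD('p) ^ j) ^ CARD(2)) :: complex) = of_int (int CARD('p) ^ (2 * j))"
    by (simp add: power_mult[symmetric] mult.commute)
  have "j + (n - j) = k \<longleftrightarrow> n = k" using True by auto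
  then show ?thesis
    using lift_mult_fourier[OF g C a, of "n - j"] True unfolding hecke_term_def p
    by (simp add: mult.assoc)
next
  case False
  then have "(\<Sum>w\<in>Rk k. of_nat (cnt g (insert (adj k C w) (lat C))) * chi k (C, a) w) = 0" if "n = k"
    using cnt_low_level[OF g(1,2) C] that by simp
  then show ?thesis using False unfolding hecke_term_def by auto
qed

text \<open>The coefficient of \<open>X\<^sup>n\<close> of the right-hand side is the Fourier transform of \<open>hecke_sum\<close>.\<close>

lemma coefficient_identity:
  fixes C :: "('p::prime_card, 2) sp_mat" and n :: nat
  assumes C: "C \<in> GSp_Delta" "level C k" and a: "a \<in> \<M>"
  defines "q \<equiv> int CARD('p)" and "c \<equiv> hdc (C, a)"
  shows "Poly_Mapping.lookup ((hecke_theta ^^ 4) (Heis_P n)) c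
      - Poly_Mapping.lookup (hecke_term matA 1 n) c
      + (q * Poly_Mapping.lookup (hecke_term matB 2 n) c + q * (q ^ 2 + 1) * Poly_Mapping.lookup (hecke_term (mat (\<pi> ^ 1)) 2 n) c)
      - q ^ 3 * Poly_Mapping.lookup (hecke_term (mat (\<pi> ^ 1) ** matA) 3 n) c
      + q ^ 6 * Poly_Mapping.lookup (hecke_term (mat (\<pi> ^ 2)) 4 n) c
    = (if n = 0 then Poly_Mapping.lookup (Heis_T (mat (\<pi> ^ 0), 0)) c else 0)
      - (if n = 2 then q ^ 6 * Poly_Mapping.lookup (Heis_T (mat (\<pi> ^ 1), 0)) c else 0)" (is "?L = ?R")
proof -
  let ?N = "of_nat ((CARD('p) ^ k) ^ 2) :: complex"
  let ?I = "\<lambda>w. insert (adj k C w) (lat C)"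
  define F where "F g = (\<Sum>w\<in>Rk k. of_int (int (cnt g (?I w))) * chi k (C, a) w)" for g
  note ft = hecke_term_fourier[OF _ _ _ C a, of _ _ n, folded c_def]
  have N0: "?N \<noteq> 0" by simp
  \<comment> \<open>The term with \<open>q\<^sub>0 = 1\<close> carries no lifted factor; it is the
    transform for \<alpha> = 1.\<close>
  have t0: "?N * of_int (Poly_Mapping.lookup ((hecke_theta ^^ 4) (Heis_P n)) c) = (if n = k then F (mat (\<pi> ^ 0)) else 0)"
  proof -
    let ?e = "mat (\<pi> ^ 0) :: ('p, 2) sp_mat"
    have e: "?e ** C = C" "?e *v a = a" by simp_all
    have ge: "ginv ?e = ?e" using ginv(2)[OF GSp_one(1)] by simp
    have "(if ?I w \<subseteq> lat ?e then chi k (C, a) w else 0) = of_int (int (cnt ?e (?I w))) * chi k (C, a) w" for w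
      unfolding lat_scalar cnt_scalar by simp
    then show ?thesis
      using theta_pow_P_fourier[OF scalar_Delta(1) level_scalar_01(1) _ C a, of n] unfolding F_def c_def ge e by simp
  qed
  have t: "?N * of_int (Poly_Mapping.lookup (hecke_term matA 1 n) c) = (if n = k then F matA else 0)"
    "?N * of_int (Poly_Mapping.lookup (hecke_term matB 2 n) c) = (if n = k then F matB else 0)"
    "?N * of_int (Poly_Mapping.lookup (hecke_term (mat (\<pi> ^ 1)) 2 n) c) = (if n = k then F (mat (\<pi> ^ 1)) else 0)"
    "?N * of_int (Poly_Mapping.lookup (hecke_term (mat (\<pi> ^ 1) ** matA) 3 n) c) = (if n = k then F (mat (\<pi> ^ 1) ** matA) else 0)"
    "?N * of_int (Poly_Mapping.lookup (hecke_term (mat (\<pi> ^ 2)) 4 n) c) = (if n = k then F (mat (\<pi> ^ 2)) else 0)"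
    unfolding F_def of_int_of_nat_eq
    by (intro ft matA_Delta matB_Delta scalar_Delta(1) level_scalar_01 pA_Delta; simp)+
  let ?h = "if k = 0 then 1 else if lat C = pM 1 then - (q ^ 2) else 0"
  have "?N * of_int ?L = (if n = k then F (mat (\<pi> ^ 0)) - F matA
      + (of_int q * F matB + of_int (q * (q ^ 2 + 1)) * F (mat (\<pi> ^ 1)))
      - of_int (q ^ 3) * F (mat (\<pi> ^ 1) ** matA) + of_int (q ^ 6) * F (mat (\<pi> ^ 2)) else 0)"
  proof -
    have "?N * of_int ?L = ?N * of_int (Poly_Mapping.lookup ((hecke_theta ^^ 4) (Heis_P n)) c)
      - ?N * of_int (Poly_Mapping.lookup (hecke_term matA 1 n) c)
      + (of_int q * (?N * of_int (Poly_Mapping.lookup (hecke_term matB 2 n) c))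
        + of_int (q * (q ^ 2 + 1)) * (?N * of_int (Poly_Mapping.lookup (hecke_term (mat (\<pi> ^ 1)) 2 n) c)))
      - of_int (q ^ 3) * (?N * of_int (Poly_Mapping.lookup (hecke_term (mat (\<pi> ^ 1) ** matA) 3 n) c))
      + of_int (q ^ 6) * (?N * of_int (Poly_Mapping.lookup (hecke_term (mat (\<pi> ^ 2)) 4 n) c))"
      unfolding of_int_add of_int_diff of_int_mult by (simp only: algebra_simps)
    then show ?thesis unfolding t0 t by simp
  qed
  also have "F (mat (\<pi> ^ 0)) - F matA
      + (of_int q * F matB + of_int (q * (q ^ 2 + 1)) * F (mat (\<pi> ^ 1)))
      - of_int (q ^ 3) * F (mat (\<pi> ^ 1) ** matA) + of_int (q ^ 6) * F (mat (\<pi> ^ 2))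
    = (\<Sum>w\<in>Rk k. of_int (hecke_sum (?I w)) * chi k (C, a) w)"
    unfolding F_def sum_distrib_left sum.distrib[symmetric] sum_subtractf[symmetric] hecke_sum_def q_def
    by (intro sum.cong refl) (simp only: of_int_add of_int_diff of_int_mult ring_distribs mult.assoc diff_add_eq add.assoc[symmetric])
  \<comment> \<open>By \<open>hecke_sum_adjoin\<close> the alternating sum does not depend on
    \<open>w\<close>, so it factors out and only the plain character sum remains.\<close>
  also have "\<dots> = of_int ?h * (\<Sum>w\<in>Rk k. chi k (C, a) w)"
  proof -
    have "hecke_sum (?I w) = ?h" if "w \<in> Rk k" for w
      using hecke_sum_adjoin[OF C _ adj_def, of w] that Rk_sub_M unfolding q_def by blast
    then show ?thesis unfolding sum_distrib_left by (intro sum.cong refl) simp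
  qed
  also have "\<dots> = of_int ?h * (if a \<in> lat C then ?N * ?N else 0)"
    using sum_chi[OF C a] by simp
  finally have "?N * of_int ?L = ?N * of_int (if n = k \<and> a \<in> lat C then ?h * q ^ (2 * k) else 0)"
    unfolding q_def by (auto simp: power_mult[symmetric] mult.commute)
  \<comment> \<open>Complex numbers served only for the characters; the identity returns to the
    integers by injectivity.\<close>
  then have "(of_int ?L :: complex) = of_int (if n = k \<and> a \<in> lat C then ?h * q ^ (2 * k) else 0)"
    by (rule mult_left_cancel[OF N0, THEN iffD1])
  then have "?L = (if n = k \<and> a \<in> lat C then ?h * q ^ (2 * k) else 0)"
    by (simp only: of_int_eq_iff)
  also have "\<dots> = ?R"
  proof -
    have T: "Poly_Mapping.lookup (Heis_T (mat (\<pi> ^ i), 0)) c = (if lat C = pM i \<and> a \<in> lat C then 1 else 0)" for i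
      using hdc_scalar_iff[OF C(1), of a i] unfolding Heis_T_def c_def by simp
    have 0: "k = 0 \<longleftrightarrow> lat C = pM 0"
      using level_0_iff[OF C(1)] level_unique[OF C(2)] C(2) lat_eq_M_iff[OF Delta_GSp[OF C(1)]] unfolding pM_simps by blast
    have 1: "lat C = pM 1 \<Longrightarrow> k = 2" using lat_eq_pM_level[OF C, of 1] by simp
    show ?thesis
    proof (cases "n = k")
      case False
      then show ?thesis unfolding T using 0 1 by auto
    next
      case nk: True
      consider "k = 0" | "k \<noteq> 0" "lat C = pM 1" | "k \<noteq> 0" "lat C \<noteq> pM 1" by blast
      then show ?thesis
      proof cases
        case 1
        then show ?thesis unfolding T nk using 0 by simp
      next
        case 2
        \<comment> \<open>Here \<open>k = 2\<close>, and \<open>-p^2\<close> times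
          \<open>p^(2k)\<close> is the required \<open>-p^6\<close>.\<close>
        then show ?thesis unfolding T nk using \<open>lat C = pM 1 \<Longrightarrow> k = 2\<close> by (simp flip: power_add)
      next
        case 3
        then show ?thesis unfolding T nk by simp
      qed
    qed
  qed
  finally show ?thesis .
qed

subsection \<open>Power series over Hecke rings\<close>

lemma ps_ring_simps:
  "carrier (ps_ring R) = UNIV \<rightarrow> carrier R" "f \<oplus>\<^bsub>ps_ring R\<^esub> g = (\<lambda>n. f n \<oplus>\<^bsub>R\<^esub> g n)"
  "\<zero>\<^bsub>ps_ring R\<^esub> = (\<lambda>_. \<zero>\<^bsub>R\<^esub>)" "\<one>\<^bsub>ps_ring R\<^esub> = (\<lambda>n. if n = 0 then \<one>\<^bsub>R\<^esub> else \<zero>\<^bsub>R\<^esub>)"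
  by (simp_all add: ps_ring_def)

text \<open>This is the structure needed to expand the \<open>finsum\<close> in the evaluation of
  the polynomial \<open>g\<close>.\<close>

lemma ps_abelian_monoid: "abelian_monoid (ps_ring (hecke_ring G K D))"
proof (rule abelian_monoidI)
  interpret abelian_group "hecke_ring G K D" by (rule hecke_ring_abelian_group)
  let ?S = "ps_ring (hecke_ring G K D)"
  fix f g h :: "nat \<Rightarrow> 'a set \<Rightarrow>\<^sub>0 int"
  show "\<zero>\<^bsub>?S\<^esub> \<in> carrier ?S" unfolding ps_ring_simps by auto
  assume fg: "f \<in> carrier ?S" "g \<in> carrier ?S"
  then show "f \<oplus>\<^bsub>?S\<^esub> g \<in> carrier ?S" unfolding ps_ring_simps by auto
  show "f \<oplus>\<^bsub>?S\<^esub> g = g \<oplus>\<^bsub>?S\<^esub> f" unfolding ps_ring_simps hecke_ring_simps by (simp add: add.commute)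
  show "f \<oplus>\<^bsub>?S\<^esub> g \<oplus>\<^bsub>?S\<^esub> h = f \<oplus>\<^bsub>?S\<^esub> (g \<oplus>\<^bsub>?S\<^esub> h)"
    unfolding ps_ring_simps hecke_ring_simps by (simp add: add.assoc)
next
  let ?S = "ps_ring (hecke_ring G K D)"
  show "\<zero>\<^bsub>?S\<^esub> \<oplus>\<^bsub>?S\<^esub> f = f" for f unfolding ps_ring_simps hecke_ring_simps by simp
qed

lemma ps_finsum:
  assumes "finite A" "\<And>a n. a \<in> A \<Longrightarrow> f a n \<in> carrier (hecke_ring G K D)"
  shows "finsum (ps_ring (hecke_ring G K D)) f A = (\<lambda>n. \<Sum>a\<in>A. f a n)"
proof -
  interpret abelian_monoid "ps_ring (hecke_ring G K D)" by (rule ps_abelian_monoid)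
  show ?thesis
    using assms
  proof (induction A rule: finite_induct)
    case (insert a A)
    then have "f \<in> insert a A \<rightarrow> carrier (ps_ring (hecke_ring G K D))" unfolding ps_ring_simps by blast
    then show ?case
      using insert by (subst finsum_insert) (auto simp: ps_ring_simps(2) hecke_ring_simps(4))
  qed (simp add: ps_ring_simps hecke_ring_simps)
qed

lemma ps_mult:
  "(f \<otimes>\<^bsub>ps_ring (hecke_ring G K D)\<^esub> g) n = (\<Sum>i\<le>n. f i \<otimes>\<^bsub>hecke_ring G K D\<^esub> g (n - i))"
proof -
  have "(f \<otimes>\<^bsub>ps_ring (hecke_ring G K D)\<^esub> g) n
      = finsum (hecke_ring G K D) (\<lambda>i. f i \<otimes>\<^bsub>hecke_ring G K D\<^esub> g (n - i)) {..n}"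
    by (simp add: ps_ring_def)
  then show ?thesis by (simp only: hecke_ring_finsum[OF finite_atMost hecke_mult_closed])
qed

lemma ps_add_pow:
  "[(m::nat)] \<cdot>\<^bsub>ps_ring (hecke_ring G K D)\<^esub> f = (\<lambda>n. frag_cmul (int m) (f n))"
proof (induction m)
  case 0
  then show ?case by (simp add: add_pow_def ps_ring_simps hecke_ring_simps)
next
  case (Suc m)
  then show ?case
    by (simp add: add_pow_def ps_ring_simps hecke_ring_simps frag_cmul_distrib add.commute)
qed

definition ps_monom :: "nat \<Rightarrow> ('a \<Rightarrow>\<^sub>0 int) \<Rightarrow> nat \<Rightarrow> ('a \<Rightarrow>\<^sub>0 int)" where
  "ps_monom j x = (\<lambda>n. if n = j then x else 0)"

lemma ps_monom_mult:
  "(ps_monom j x \<otimes>\<^bsub>ps_ring (hecke_ring G K D)\<^esub> f) n = (if j \<le> n then x \<otimes>\<^bsub>hecke_ring G K D\<^esub> f (n - j) else 0)"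
proof -
  have "(ps_monom j x \<otimes>\<^bsub>ps_ring (hecke_ring G K D)\<^esub> f) n
      = (\<Sum>i\<le>n. if i = j then x \<otimes>\<^bsub>hecke_ring G K D\<^esub> f (n - j) else 0)"
    unfolding ps_mult ps_monom_def by (intro sum.cong) (auto simp: hecke_mult_0)
  then show ?thesis by simp
qed

lemma ps_const_eq: "ps_const (hecke_ring G K D) x = ps_monom 0 x"
  unfolding ps_const_def ps_monom_def hecke_ring_simps ..

lemma ps_X_eq: "[c] \<cdot>\<^bsub>ps_ring (hecke_ring G K D)\<^esub> ps_X (hecke_ring G K D) = ps_monom 1 (frag_cmul (int c) \<one>\<^bsub>hecke_ring G K D\<^esub>)"
  unfolding ps_add_pow ps_X_def ps_monom_def by (auto simp: hecke_ring_simps(2))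

lemma (in hecke_pair) one_closed_hecke: "\<one>\<^bsub>hecke_ring G K D\<^esub> \<in> carrier (hecke_ring G K D)"
  using subsetD[OF K_sub_D K_closed(2)] by (simp add: hecke_ring_simps double_cosets_def)

lemma (in hecke_pair) ps_monom_mult_monom:
  assumes "x \<in> carrier (hecke_ring G K D)"
  shows "ps_monom i x \<otimes>\<^bsub>ps_ring (hecke_ring G K D)\<^esub> ps_monom j (frag_cmul c \<one>\<^bsub>hecke_ring G K D\<^esub>)
    = ps_monom (i + j) (frag_cmul c x)"
proof
  fix n
  show "(ps_monom i x \<otimes>\<^bsub>ps_ring (hecke_ring G K D)\<^esub> ps_monom j (frag_cmul c \<one>\<^bsub>hecke_ring G K D\<^esub>)) n
    = ps_monom (i + j) (frag_cmul c x) n"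
    unfolding ps_monom_mult
    using hecke_mult_one_right[OF assms] unfolding ps_monom_def
    by (auto simp: hecke_mult_0 hecke_mult_cmul_right)
qed

lemma (in hecke_pair) ps_Y_pow:
  fixes j :: nat
  defines "H \<equiv> hecke_ring G K D"
  assumes Y: "Y = ps_monom 1 (frag_cmul c \<one>\<^bsub>H\<^esub>)"
  shows "Y [^]\<^bsub>ps_ring H\<^esub> j = ps_monom j (frag_cmul (c ^ j) \<one>\<^bsub>H\<^esub>)"
proof (induction j)
  case 0
  then show ?case by (auto simp: ps_monom_def ps_ring_simps H_def hecke_ring_simps)
next
  case (Suc j)
  have "frag_cmul (c ^ j) \<one>\<^bsub>H\<^esub> \<in> carrier H"
    using one_closed_hecke unfolding H_def hecke_ring_simps(1) by auto
  then show ?case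
    using Suc ps_monom_mult_monom[of "frag_cmul (c ^ j) \<one>\<^bsub>H\<^esub>" j 1 c] unfolding H_def Y by (simp flip: Suc_eq_plus1)
qed

text \<open>The Hecke ring has been shown above to be an abelian group, not a ring, so the additive
  inverse in \<open>UP H\<close> is determined directly from its definition.\<close>

lemma UP_hecke_minus:
  fixes G :: "('g, 'm) monoid_scheme" and K D :: "'g set"
  defines "H \<equiv> hecke_ring G K D"
  assumes f: "f \<in> up H"
  shows "\<ominus>\<^bsub>UP H\<^esub> f = (\<lambda>i. - f i)" "(\<lambda>i. - f i) \<in> up H"
proof -
  show up: "(\<lambda>i. - f i) \<in> up H"
    using f unfolding up_def H_def hecke_ring_simps bound_def by fastforce
  have simps: "carrier (UP H) = up H" "\<zero>\<^bsub>UP H\<^esub> = (\<lambda>_. 0)"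
    "\<And>a b. a \<in> up H \<Longrightarrow> b \<in> up H \<Longrightarrow> a \<oplus>\<^bsub>UP H\<^esub> b = (\<lambda>i. a i + b i)"
    unfolding UP_def H_def hecke_ring_simps by simp_all
  show "\<ominus>\<^bsub>UP H\<^esub> f = (\<lambda>i. - f i)"
    unfolding a_inv_def m_inv_def
  proof (rule the_equality)
    show "(\<lambda>i. - f i) \<in> carrier (add_monoid (UP H)) \<and> f \<otimes>\<^bsub>add_monoid (UP H)\<^esub> (\<lambda>i. - f i) = \<one>\<^bsub>add_monoid (UP H)\<^esub> \<and>
        (\<lambda>i. - f i) \<otimes>\<^bsub>add_monoid (UP H)\<^esub> f = \<one>\<^bsub>add_monoid (UP H)\<^esub>"
      using simps f up by auto
    fix y assume y: "y \<in> carrier (add_monoid (UP H)) \<and> f \<otimes>\<^bsub>add_monoid (UP H)\<^esub> y = \<one>\<^bsub>add_monoid (UP H)\<^esub> \<and>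
        y \<otimes>\<^bsub>add_monoid (UP H)\<^esub> f = \<one>\<^bsub>add_monoid (UP H)\<^esub>"
    then have "(\<lambda>i. y i + f i) = (\<lambda>_. 0)" using simps f by auto
    then show "y = (\<lambda>i. - f i)" by (metis add_eq_0_iff2)
  qed
qed

text \<open>The evaluation of a polynomial sums up to its degree, so the degree is needed along with
  the coefficients; \<open>c \<noteq> 0\<close> makes it exactly 2.\<close>

lemma UP_hecke_quadratic:
  fixes G :: "('g, 'm) monoid_scheme" and K D :: "'g set"
  defines "H \<equiv> hecke_ring G K D"
  assumes c: "c \<in> carrier H" "c \<noteq> 0" and one: "\<one>\<^bsub>H\<^esub> \<in> carrier H"
  defines "g \<equiv> \<one>\<^bsub>UP H\<^esub> \<ominus>\<^bsub>UP H\<^esub> monom (UP H) c 2"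
  shows "g \<in> carrier (UP H)" "deg H g = 2"
    "coeff (UP H) g = (\<lambda>i. if i = 0 then \<one>\<^bsub>H\<^esub> else if i = 2 then - c else 0)"
proof -
  let ?g = "\<lambda>i. if i = 0 then \<one>\<^bsub>H\<^esub> else if i = (2::nat) then - c else 0"
  let ?m = "\<lambda>i. if i = (2::nat) then c else 0"
  let ?o = "\<lambda>i. if i = (0::nat) then \<one>\<^bsub>H\<^esub> else 0"
  have zero: "\<zero>\<^bsub>H\<^esub> = 0" "(0 :: 'g set \<Rightarrow>\<^sub>0 int) \<in> carrier H" unfolding H_def hecke_ring_simps by auto
  have m: "monom (UP H) c 2 = ?m" and o: "\<one>\<^bsub>UP H\<^esub> = ?o"
    unfolding UP_def using c(1) zero by auto
  have mup: "?m \<in> up H" unfolding up_def using c zero by (auto intro!: exI[of _ 2] bound.intro)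
  have oup: "?o \<in> up H" unfolding up_def using one zero by (auto intro!: exI[of _ 0] bound.intro)
  note minus = UP_hecke_minus[OF mup[unfolded H_def], folded H_def]
  have g: "g = ?g"
  proof -
    have "g = ?o \<oplus>\<^bsub>UP H\<^esub> (\<lambda>i. - ?m i)" unfolding g_def a_minus_def m o minus(1) ..
    also have "\<dots> = (\<lambda>i. ?o i + - ?m i)"
      unfolding UP_def using oup minus(2) by (simp add: H_def hecke_ring_simps)
    finally show ?thesis by (auto simp: fun_eq_iff)
  qed
  have cm: "- c \<in> carrier H" using c(1) unfolding H_def hecke_ring_simps by simp
  have gup: "?g \<in> up H" unfolding up_def using cm one zero by (auto intro!: exI[of _ 2] bound.intro)
  show "g \<in> carrier (UP H)" unfolding g UP_def using gup by simp
  show co: "coeff (UP H) g = ?g" unfolding g UP_def using gup by simp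
  show "deg H g = 2"
    unfolding deg_def co
  proof (rule Least_equality)
    show "bound \<zero>\<^bsub>H\<^esub> 2 ?g" using zero by (auto intro!: bound.intro)
    fix n assume b: "bound \<zero>\<^bsub>H\<^esub> n ?g"
    show "2 \<le> n"
    proof (rule ccontr)
      assume "\<not> 2 \<le> n"
      then show False using bound.bound[OF b, of 2] zero c(2) by simp
    qed
  qed
qed

subsection \<open>The power series identity\<close>

lemma hecke_s_T: "C \<in> GSp_Delta \<Longrightarrow> hecke_s (GSp_T C) = Heis_T (C, 0)"
proof -
  assume C: "C \<in> GSp_Delta"
  have "(SOME D. D \<in> double_coset GSp GSp_Gamma C) \<in> double_coset GSp GSp_Gamma C"
    by (rule GH.some_dc(1)[OF Delta_GSp[OF C]])
  then obtain X Y where XY: "X \<in> GSp_Gamma" "Y \<in> GSp_Gamma" "(SOME D. D \<in> double_coset GSp GSp_Gamma C) = X ** C ** Y"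
    unfolding GSp_dc by blast
  then show ?thesis
    unfolding hecke_s_def GSp_T_def frag_extend_of Heis_T_def
    using hdc_transport[OF C XY(1,2), of 0] by simp
qed

lemma Heis_T_closed: "C \<in> GSp_Delta \<Longrightarrow> Heis_T (C, 0) \<in> carrier Heis_hecke"
  unfolding Heis_T_def Heis_hecke_def hecke_ring_simps double_cosets_def by (auto simp: Heis_Delta_iff)

lemma GSp_T_closed: "C \<in> GSp_Delta \<Longrightarrow> GSp_T C \<in> carrier GSp_hecke"
  unfolding GSp_T_def GSp_hecke_def hecke_ring_simps double_cosets_def by auto

text \<open>A scalar matrix is central, so its double coset is a single left coset and the
  convolution has only one term. This turns \<open>\<langle>p\<rangle>T(A)\<close> in
  \<open>q\<^sub>3\<close> into the double coset of \<open>pA\<close>.\<close>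

lemma GSp_T_scalar_mult:
  fixes C :: "('p::prime_card, 'n::finite) sp_mat"
  assumes C: "C \<in> GSp_Delta"
  shows "GSp_T (mat (\<pi> ^ k)) \<otimes>\<^bsub>GSp_hecke\<^esub> GSp_T C = GSp_T (mat (\<pi> ^ k) ** C)" (is "?l = ?r")
proof (rule poly_mapping_eqI)
  fix W
  let ?c = "mat (\<pi> ^ k) :: ('p, 'n) sp_mat"
  let ?dc = "double_coset GSp GSp_Gamma"
  have c: "?c \<in> GSp_Delta" by (rule scalar_Delta(1))
  have cC: "?c ** C \<in> GSp_Delta" by (rule Delta_mult[OF c C])
  note cG = Delta_GSp[OF c] and CG = Delta_GSp[OF C]
  show "Poly_Mapping.lookup ?l W = Poly_Mapping.lookup ?r W"
  proof (cases "W \<in> double_cosets GSp GSp_Gamma GSp_Delta")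
    case False
    have "?l \<in> carrier GSp_hecke" unfolding GSp_hecke_def by (rule hecke_mult_closed)
    then have "W \<notin> Poly_Mapping.keys ?l" "W \<notin> Poly_Mapping.keys ?r"
      using False GSp_T_closed[OF cC] unfolding GSp_hecke_def hecke_ring_simps(1) mem_Collect_eq by blast+
    then show ?thesis by (simp only: in_keys_iff not_not)
  next
    case True
    then obtain E where E: "E \<in> GSp_Delta" "W = ?dc E" unfolding double_cosets_def by auto
    note EG = Delta_GSp[OF E(1)]
    have "left_cosets_in GSp GSp_Gamma (?dc ?c) = {?c <#\<^bsub>GSp\<^esub> GSp_Gamma}"
    proof -
      have "A = ?c <#\<^bsub>GSp\<^esub> GSp_Gamma" if A: "A \<in> left_cosets_in GSp GSp_Gamma (?dc ?c)" for A
      proof -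
        obtain X Y where XY: "X \<in> GSp_Gamma" "Y \<in> GSp_Gamma" "A = (X ** ?c ** Y) <#\<^bsub>GSp\<^esub> GSp_Gamma"
          using A unfolding left_cosets_in_def GSp_dc by auto
        have "X ** ?c ** Y = ?c ** (X ** Y)" by (simp only: mat_comm[symmetric] matrix_mul_assoc)
        then show ?thesis
          using GH.l_coset_mem[OF cG Gamma_closed(2)[OF XY(1,2)]] XY(3) by simp
      qed
      moreover have "?c <#\<^bsub>GSp\<^esub> GSp_Gamma \<in> left_cosets_in GSp GSp_Gamma (?dc ?c)"
        unfolding left_cosets_in_def using GH.dc_self[OF cG] by blast
      ultimately show ?thesis by blast
    qed
    then have "Poly_Mapping.lookup ?l W = Poly_Mapping.lookup (GSp_T C) (?dc (ginv ?c ** E))"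
      using GH.lookup_hecke_mult[OF c GSp_T_closed[OF C, unfolded GSp_hecke_def] E(1)] GH.dc_inv_some[OF cG EG]
      unfolding E(2) GSp_T_def GSp_hecke_def by simp
    moreover have "?dc (ginv ?c ** E) = ?dc C \<longleftrightarrow> ?dc E = ?dc (?c ** C)"
    proof -
      have iE: "ginv ?c ** E \<in> carrier GSp" by (rule GSp_mult(1)[OF ginv(5)[OF cG] EG])
      have e: "ginv ?c ** E = X ** C ** Y \<longleftrightarrow> E = X ** (?c ** C) ** Y" for X Y
      proof -
        have "ginv ?c ** E = X ** C ** Y \<longleftrightarrow> E = ?c ** (X ** C ** Y)"
        proof
          assume "ginv ?c ** E = X ** C ** Y"
          then have "?c ** (X ** C ** Y) = (?c ** ginv ?c) ** E" by (metis matrix_mul_assoc)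
          then show "E = ?c ** (X ** C ** Y)" by (simp only: ginv(1)[OF cG] matrix_mul_lid)
        next
          assume "E = ?c ** (X ** C ** Y)"
          then have "ginv ?c ** E = (ginv ?c ** ?c) ** (X ** C ** Y)" by (metis matrix_mul_assoc)
          then show "ginv ?c ** E = X ** C ** Y" by (simp only: ginv(2)[OF cG] matrix_mul_lid)
        qed
        moreover have "?c ** (X ** C ** Y) = X ** (?c ** C) ** Y"
        proof -
          have "?c ** (X ** C ** Y) = (?c ** X) ** C ** Y" by (simp only: matrix_mul_assoc)
          also have "\<dots> = (X ** ?c) ** C ** Y" by (simp only: mat_comm)
          also have "\<dots> = X ** (?c ** C) ** Y" by (simp only: matrix_mul_assoc)
          finally show ?thesis .
        qed
        ultimately show ?thesis by simp
      qed
      have "?dc (ginv ?c ** E) = ?dc C \<longleftrightarrow> ginv ?c ** E \<in> ?dc C" by (rule GH.dc_eq_iff[OF CG iE])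
      also have "\<dots> \<longleftrightarrow> E \<in> ?dc (?c ** C)" unfolding GSp_dc mem_Collect_eq e ..
      also have "\<dots> \<longleftrightarrow> ?dc E = ?dc (?c ** C)" by (rule GH.dc_eq_iff[OF Delta_GSp[OF cC] EG, symmetric])
      finally show ?thesis .
    qed
    ultimately show ?thesis unfolding GSp_T_def E(2) by simp
  qed
qed

lemma hecke_term_closed: "hecke_term g j n \<in> carrier Heis_hecke"
proof -
  have "Heis_T (g, 0) \<otimes>\<^bsub>Heis_hecke\<^esub> (hecke_theta ^^ (4 - j)) (Heis_P (n - j)) \<in> carrier Heis_hecke"
    unfolding Heis_hecke_def by (rule hecke_mult_closed)
  then show ?thesis unfolding hecke_term_def Heis_hecke_def hecke_ring_simps(1) by auto
qed

text \<open>The evaluation \<open>eval\<close> through \<kappa> renders \<open>g^s(Y)\<close>, and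
  composing \<open>P\<close> with a power of \<theta> applies it to each coefficient. Both sides are
  expanded into coefficients of \<open>X^n\<close>, which are then compared at every double coset by
  \<open>coefficient_identity\<close>.\<close>

theorem theorem5p14:
  fixes p :: nat
    and A B :: "('p::prime_card, 2) sp_mat"
    and R :: "(('p, 2) sp_mat set \<Rightarrow>\<^sub>0 int) ring"
    and R' :: "(('p, 2) heis set \<Rightarrow>\<^sub>0 int) ring"
    and s :: "(('p, 2) sp_mat set \<Rightarrow>\<^sub>0 int) \<Rightarrow> (('p, 2) heis set \<Rightarrow>\<^sub>0 int)"
    and \<theta> :: "(('p, 2) heis set \<Rightarrow>\<^sub>0 int) \<Rightarrow> (('p, 2) heis set \<Rightarrow>\<^sub>0 int)"
    and P :: "nat \<Rightarrow> (('p, 2) heis set \<Rightarrow>\<^sub>0 int)"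
  assumes "p = CARD('p)"
    and "R = GSp_hecke" and "R' = Heis_hecke" and "s = hecke_s" and "\<theta> = hecke_theta"
    and "P = Heis_P"
    and "A = block_diag (vector [1, 1]) (vector [of_nat p, of_nat p])"
    and "B = block_diag (vector [1, of_nat p]) (vector [of_nat p ^ 2, of_nat p])"
    and "\<pi>1 = GSp_T (mat (of_nat p))" and "\<pi>2 = GSp_T (mat (of_nat p ^ 2))"
    and "q1 = \<ominus>\<^bsub>R\<^esub> GSp_T A"
    and "q2 = [p] \<cdot>\<^bsub>R\<^esub> GSp_T B \<oplus>\<^bsub>R\<^esub> [(p * (p ^ 2 + 1))] \<cdot>\<^bsub>R\<^esub> \<pi>1"
    and "q3 = \<ominus>\<^bsub>R\<^esub> ([(p ^ 3)] \<cdot>\<^bsub>R\<^esub> (\<pi>1 \<otimes>\<^bsub>R\<^esub> GSp_T A))"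
    and "q4 = [(p ^ 6)] \<cdot>\<^bsub>R\<^esub> \<pi>2"
    and "g = \<one>\<^bsub>UP R\<^esub> \<ominus>\<^bsub>UP R\<^esub> monom (UP R) ([(p ^ 2)] \<cdot>\<^bsub>R\<^esub> \<pi>1) 2"
    and "S = ps_ring R'"
    and "Y = [(p ^ 2)] \<cdot>\<^bsub>S\<^esub> ps_X R'"
    and "\<And>q. \<kappa> q = ps_const R' (s q)"
  shows "eval R S \<kappa> Y g =
      ((\<theta> ^^ 4) \<circ> P)
      \<oplus>\<^bsub>S\<^esub> \<kappa> q1 \<otimes>\<^bsub>S\<^esub> Y \<otimes>\<^bsub>S\<^esub> ((\<theta> ^^ 3) \<circ> P)
      \<oplus>\<^bsub>S\<^esub> \<kappa> q2 \<otimes>\<^bsub>S\<^esub> Y [^]\<^bsub>S\<^esub> (2::nat) \<otimes>\<^bsub>S\<^esub> ((\<theta> ^^ 2) \<circ> P)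
      \<oplus>\<^bsub>S\<^esub> \<kappa> q3 \<otimes>\<^bsub>S\<^esub> Y [^]\<^bsub>S\<^esub> (3::nat) \<otimes>\<^bsub>S\<^esub> (\<theta> \<circ> P)
      \<oplus>\<^bsub>S\<^esub> \<kappa> q4 \<otimes>\<^bsub>S\<^esub> Y [^]\<^bsub>S\<^esub> (4::nat) \<otimes>\<^bsub>S\<^esub> P"
proof -
  let ?c = "\<lambda>k. mat (\<pi> ^ k) :: ('p, 2) sp_mat"
  let ?T = "\<lambda>g :: ('p, 2) sp_mat. Heis_T (g, 0)"
  let ?q = "int CARD('p)"
  note R = assms(2)[unfolded GSp_hecke_def] and R' = assms(3)[unfolded Heis_hecke_def]
  have A: "A = matA" and B: "B = matB"
    using assms(1,7,8) unfolding matA_def matB_def by simp_all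
  have \<pi>: "\<pi>1 = GSp_T (?c 1)" "\<pi>2 = GSp_T (?c 2)" using assms(1,9,10) by simp_all
  have TA: "GSp_T A \<in> carrier R" "GSp_T (?c 1 ** A) \<in> carrier R"
    unfolding assms(2) A by (intro GSp_T_closed matA_Delta pA_Delta)+
  have \<pi>A: "\<pi>1 \<otimes>\<^bsub>R\<^esub> GSp_T A = GSp_T (?c 1 ** A)"
    unfolding assms(2) \<pi> by (rule GSp_T_scalar_mult) (simp add: A matA_Delta)
  have q: "q1 = - GSp_T A" "q2 = frag_cmul ?q (GSp_T B) + frag_cmul (?q * (?q ^ 2 + 1)) (GSp_T (?c 1))"
    "q3 = frag_cmul (- (?q ^ 3)) (GSp_T (?c 1 ** A))" "q4 = frag_cmul (?q ^ 6) (GSp_T (?c 2))"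
  proof -
    show "q1 = - GSp_T A" unfolding assms(11) using TA(1) unfolding R by (rule hecke_ring_a_inv)
    show "q2 = frag_cmul ?q (GSp_T B) + frag_cmul (?q * (?q ^ 2 + 1)) (GSp_T (?c 1))"
      unfolding assms(12) \<pi> R hecke_ring_add_pow hecke_ring_simps assms(1) by simp
    have "frag_cmul (int (p ^ 3)) (GSp_T (?c 1 ** A)) \<in> carrier R"
      using TA(2) unfolding R hecke_ring_simps(1) by auto
    then have "\<ominus>\<^bsub>R\<^esub> frag_cmul (int (p ^ 3)) (GSp_T (?c 1 ** A)) = - frag_cmul (int (p ^ 3)) (GSp_T (?c 1 ** A))"
      unfolding R by (rule hecke_ring_a_inv)
    then show "q3 = frag_cmul (- (?q ^ 3)) (GSp_T (?c 1 ** A))"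
      unfolding assms(13) \<pi>A unfolding R hecke_ring_add_pow unfolding assms(1) by simp
    show "q4 = frag_cmul (?q ^ 6) (GSp_T (?c 2))"
      unfolding assms(14) \<pi> R hecke_ring_add_pow assms(1) by simp
  qed
  have s: "s q1 = - ?T matA" "s q2 = frag_cmul ?q (?T matB) + frag_cmul (?q * (?q ^ 2 + 1)) (?T (?c 1))"
    "s q3 = frag_cmul (- (?q ^ 3)) (?T (?c 1 ** matA))" "s q4 = frag_cmul (?q ^ 6) (?T (?c 2))"
  proof -
    have lin: "s (x + y) = s x + s y" "s (- x) = - s x" "s (frag_cmul c x) = frag_cmul c (s x)" for x y c
      unfolding assms(4) hecke_s_def by (simp_all add: frag_extend_add frag_extend_minus frag_extend_cmul)
    have T: "s (GSp_T C) = ?T C" if "C \<in> GSp_Delta" for C unfolding assms(4) by (rule hecke_s_T[OF that])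
    show "s q1 = - ?T matA" "s q2 = frag_cmul ?q (?T matB) + frag_cmul (?q * (?q ^ 2 + 1)) (?T (?c 1))"
      "s q3 = frag_cmul (- (?q ^ 3)) (?T (?c 1 ** matA))" "s q4 = frag_cmul (?q ^ 6) (?T (?c 2))"
      unfolding q A B lin using T[OF matA_Delta(1)] T[OF matB_Delta(1)] T[OF scalar_Delta(1)[of 1]]
        T[OF scalar_Delta(1)[of 2]] T[OF pA_Delta(1)] by (simp_all only:)
  qed
  have closed: "?T C \<in> carrier R'" if "C \<in> GSp_Delta" for C
    unfolding assms(3) by (rule Heis_T_closed[OF that])
  have lin_closed: "x \<in> carrier R' \<Longrightarrow> y \<in> carrier R' \<Longrightarrow> x + y \<in> carrier R'"
    "x \<in> carrier R' \<Longrightarrow> - x \<in> carrier R'" "x \<in> carrier R' \<Longrightarrow> frag_cmul c x \<in> carrier R'" for x y c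
    using keys_add[of x y] unfolding R' hecke_ring_simps(1) by auto
  have s_closed: "s q1 \<in> carrier R'" "s q2 \<in> carrier R'" "s q3 \<in> carrier R'" "s q4 \<in> carrier R'"
    unfolding s by (intro lin_closed closed matA_Delta matB_Delta scalar_Delta pA_Delta)+
  have Y: "Y = ps_monom 1 (frag_cmul (?q ^ 2) \<one>\<^bsub>R'\<^esub>)"
    unfolding assms(17,16) R' ps_X_eq unfolding assms(1) by simp
  have Ypow: "Y [^]\<^bsub>S\<^esub> j = ps_monom j (frag_cmul (?q ^ (2 * j)) \<one>\<^bsub>R'\<^esub>)" for j :: nat
    using HH.ps_Y_pow[OF Y[unfolded R'], of j] unfolding assms(16) R' by (simp only: power_mult)
  \<comment> \<open>A constant series times a power of Y is a monomial, because the only coefficient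
    of that power is a multiple of the unit.\<close>
  have kappa: "\<kappa> x \<otimes>\<^bsub>S\<^esub> Y [^]\<^bsub>S\<^esub> j = ps_monom j (frag_cmul (?q ^ (2 * j)) (s x))" if "s x \<in> carrier R'" for x and j :: nat
    unfolding assms(18) Ypow using HH.ps_monom_mult_monom[OF that[unfolded R'], of 0 j "?q ^ (2 * j)"]
    unfolding assms(16) R' ps_const_eq by simp
  have kappa1: "\<kappa> q1 \<otimes>\<^bsub>S\<^esub> Y = ps_monom 1 (frag_cmul (?q ^ (2 * 1)) (s q1))"
    using HH.ps_monom_mult_monom[OF s_closed(1)[unfolded R'], of 0 1 "?q ^ 2"]
    unfolding assms(18) assms(16) Y R' ps_const_eq by simp
  have c0: "frag_cmul (?q ^ 2) (GSp_T (?c 1)) \<in> carrier R" "frag_cmul (?q ^ 2) (GSp_T (?c 1)) \<noteq> 0"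
    using GSp_T_closed[OF scalar_Delta(1)[of 1]] unfolding assms(2) GSp_hecke_def hecke_ring_simps(1)
    by (auto simp: GSp_T_def)
  have g: "g = \<one>\<^bsub>UP R\<^esub> \<ominus>\<^bsub>UP R\<^esub> monom (UP R) (frag_cmul (?q ^ 2) (GSp_T (?c 1))) 2"
    unfolding assms(15) \<pi> R hecke_ring_add_pow unfolding assms(1) by simp
  have one: "\<one>\<^bsub>R\<^esub> = GSp_T (?c 0)" unfolding R hecke_ring_simps GSp_T_def by simp
  have gq: "g \<in> carrier (UP R)" "deg R g = 2"
    "coeff (UP R) g = (\<lambda>i. if i = 0 then \<one>\<^bsub>R\<^esub> else if i = 2 then - frag_cmul (?q ^ 2) (GSp_T (?c 1)) else 0)"
    unfolding g R by (rule UP_hecke_quadratic[OF c0[unfolded R] GH.one_closed_hecke])+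
  have s_one: "s \<one>\<^bsub>R\<^esub> = ?T (?c 0)" unfolding one assms(4) by (rule hecke_s_T[OF scalar_Delta(1)])
  have s_c: "s (- frag_cmul (?q ^ 2) (GSp_T (?c 1))) = - frag_cmul (?q ^ 2) (?T (?c 1))"
  proof -
    have "hecke_s (GSp_T (?c 1)) = ?T (?c 1)" by (rule hecke_s_T[OF scalar_Delta(1)])
    then show ?thesis
      unfolding assms(4) hecke_s_def frag_extend_minus frag_extend_cmul by simp
  qed
  have coeff_closed: "s (coeff (UP R) g i) \<in> carrier R'" for i
  proof -
    have 0: "s 0 = 0" "(0 :: ('p, 2) heis set \<Rightarrow>\<^sub>0 int) \<in> carrier R'" unfolding assms(4) hecke_s_def R' hecke_ring_simps by auto
    have "s \<one>\<^bsub>R\<^esub> \<in> carrier R'" "s (- frag_cmul (?q ^ 2) (GSp_T (?c 1))) \<in> carrier R'"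
      unfolding s_one s_c by (intro lin_closed closed scalar_Delta)+
    then show ?thesis unfolding gq(3) using 0 by (simp del: minus_frag_cmul)
  qed
  have lhs: "eval R S \<kappa> Y g n = (if n = 0 then ?T (?c 0) else 0) - (if n = 2 then frag_cmul (?q ^ 6) (?T (?c 1)) else 0)" for n
  proof -
    have "eval R S \<kappa> Y g = finsum S (\<lambda>i. \<kappa> (coeff (UP R) g i) \<otimes>\<^bsub>S\<^esub> Y [^]\<^bsub>S\<^esub> i) {..2}"
      unfolding eval_def using gq(1,2) by simp
    also have "\<dots> = finsum S (\<lambda>i. ps_monom i (frag_cmul (?q ^ (2 * i)) (s (coeff (UP R) g i)))) {..2}"
      by (simp only: kappa[OF coeff_closed])
    also have "\<dots> = (\<lambda>n. \<Sum>i\<le>2. ps_monom i (frag_cmul (?q ^ (2 * i)) (s (coeff (UP R) g i))) n)"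
      unfolding assms(16) R'
    proof (rule ps_finsum)
      fix i n
      have "frag_cmul (?q ^ (2 * i)) (s (coeff (UP R) g i)) \<in> carrier R'" "(0 :: ('p, 2) heis set \<Rightarrow>\<^sub>0 int) \<in> carrier R'"
        using lin_closed(3)[OF coeff_closed] unfolding R' hecke_ring_simps by auto
      then show "ps_monom i (frag_cmul (?q ^ (2 * i)) (s (coeff (UP R) g i))) n \<in> carrier (hecke_ring Heis Heis_Gamma Heis_Delta)"
        unfolding ps_monom_def R' by simp
    qed simp
    finally have "eval R S \<kappa> Y g n = (\<Sum>i\<in>{0, 1, 2}. ps_monom i (frag_cmul (?q ^ (2 * i)) (s (coeff (UP R) g i))) n)"
      by (simp add: atMost_nat_numeral numeral_2_eq_2 atMost_Suc insert_commute One_nat_def)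
    \<comment> \<open>The \<open>p^4\<close> of \<open>Y^2\<close> and the \<open>p^2\<close> in
      \<open>g\<close> combine to the \<open>p^6\<close> on the left-hand side.\<close>
    moreover have "frag_cmul (?q ^ 4) (- frag_cmul (?q ^ 2) x) = - frag_cmul (?q ^ 6) x" for x :: "('p, 2) heis set \<Rightarrow>\<^sub>0 int"
      by (simp flip: power_add)
    moreover have "s 0 = 0" unfolding assms(4) hecke_s_def by simp
    ultimately show ?thesis
      unfolding gq(3) ps_monom_def using s_one s_c
      by (simp del: minus_frag_cmul)
  qed
  have T_term: "(ps_monom j (frag_cmul (?q ^ (2 * j)) (?T C)) \<otimes>\<^bsub>S\<^esub> ((\<theta> ^^ (4 - j)) \<circ> P)) n = hecke_term C j n" for j n C
    unfolding assms(16) R' ps_monom_mult hecke_term_def Heis_hecke_def assms(5,6) hecke_mult_cmul_left by simp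
  have monom_lin: "(ps_monom j (x + y) \<otimes>\<^bsub>S\<^esub> F) n = (ps_monom j x \<otimes>\<^bsub>S\<^esub> F) n + (ps_monom j y \<otimes>\<^bsub>S\<^esub> F) n"
    "(ps_monom j (frag_cmul c x) \<otimes>\<^bsub>S\<^esub> F) n = frag_cmul c ((ps_monom j x \<otimes>\<^bsub>S\<^esub> F) n)"
    "(ps_monom j (- x) \<otimes>\<^bsub>S\<^esub> F) n = - (ps_monom j x \<otimes>\<^bsub>S\<^esub> F) n" for j x y c F n
    unfolding assms(16) R' ps_monom_mult by (simp_all add: hecke_mult_add_left hecke_mult_cmul_left hecke_mult_minus_left)
  have cmul_swap: "frag_cmul a (frag_cmul b x) = frag_cmul b (frag_cmul a x)" for a b and x :: "('p, 2) heis set \<Rightarrow>\<^sub>0 int"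
    by (simp add: mult.commute)
  have cmul_minus: "frag_cmul a (- x) = - frag_cmul a x" for a and x :: "('p, 2) heis set \<Rightarrow>\<^sub>0 int"
    by (rule poly_mapping_eqI) simp
  have rhs1: "(\<kappa> q1 \<otimes>\<^bsub>S\<^esub> Y \<otimes>\<^bsub>S\<^esub> ((\<theta> ^^ 3) \<circ> P)) n = - hecke_term matA 1 n" for n
    using T_term[of 1 matA n] unfolding kappa1 s monom_lin cmul_minus by simp
  have rhs2: "(\<kappa> q2 \<otimes>\<^bsub>S\<^esub> Y [^]\<^bsub>S\<^esub> (2::nat) \<otimes>\<^bsub>S\<^esub> ((\<theta> ^^ 2) \<circ> P)) n
      = frag_cmul ?q (hecke_term matB 2 n) + frag_cmul (?q * (?q ^ 2 + 1)) (hecke_term (?c 1) 2 n)" for n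
    using T_term[of 2 matB n] T_term[of 2 "?c 1" n]
    unfolding kappa[OF s_closed(2)] s frag_cmul_distrib2 cmul_swap[of "?q ^ (2 * 2)"] monom_lin by simp
  have rhs3: "(\<kappa> q3 \<otimes>\<^bsub>S\<^esub> Y [^]\<^bsub>S\<^esub> (3::nat) \<otimes>\<^bsub>S\<^esub> (\<theta> \<circ> P)) n
      = frag_cmul (- (?q ^ 3)) (hecke_term (?c 1 ** matA) 3 n)" for n
    using T_term[of 3 "?c 1 ** matA" n]
    unfolding kappa[OF s_closed(3)] s cmul_swap[of "?q ^ (2 * 3)"] monom_lin by simp
  have rhs4: "(\<kappa> q4 \<otimes>\<^bsub>S\<^esub> Y [^]\<^bsub>S\<^esub> (4::nat) \<otimes>\<^bsub>S\<^esub> P) n = frag_cmul (?q ^ 6) (hecke_term (?c 2) 4 n)" for n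
    using T_term[of 4 "?c 2" n]
    unfolding kappa[OF s_closed(4)] s cmul_swap[of "?q ^ (2 * 4)"] monom_lin by simp
  show ?thesis
  proof
    fix n
    let ?rhs = "(hecke_theta ^^ 4) (Heis_P n) + - hecke_term matA 1 n
        + (frag_cmul ?q (hecke_term matB 2 n) + frag_cmul (?q * (?q ^ 2 + 1)) (hecke_term (?c 1) 2 n))
        + frag_cmul (- (?q ^ 3)) (hecke_term (?c 1 ** matA) 3 n) + frag_cmul (?q ^ 6) (hecke_term (?c 2) 4 n)"
    let ?lhs = "(if n = 0 then ?T (?c 0) else 0) - (if n = 2 then frag_cmul (?q ^ 6) (?T (?c 1)) else 0)"
    have "?lhs = ?rhs"
    proof (rule poly_mapping_eqI)
      fix U
      show "Poly_Mapping.lookup ?lhs U = Poly_Mapping.lookup ?rhs U"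
      proof (cases "U \<in> double_cosets Heis Heis_Gamma Heis_Delta")
        case True
        then obtain C a where U: "U = hdc (C, a)" "C \<in> GSp_Delta" "a \<in> \<M>"
          unfolding double_cosets_def by (auto simp: Heis_Delta_def)
        obtain k where k: "level C k" using level_exists[OF U(2)] by blast
        have "Poly_Mapping.lookup ?lhs U = (if n = 0 then Poly_Mapping.lookup (?T (?c 0)) U else 0)
            - (if n = 2 then ?q ^ 6 * Poly_Mapping.lookup (?T (?c 1)) U else 0)"
          by (simp add: lookup_minus)
        also have "\<dots> = Poly_Mapping.lookup ?rhs U"
          unfolding coefficient_identity[OF U(2) k U(3), of n, folded U(1), symmetric]
          by (simp add: lookup_add lookup_minus lookup_uminus)
        finally show ?thesis .
      next
        case False
        \<comment> \<open>Elements of the Hecke ring are supported on the double cosets of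
          \<open>Heis_Delta\<close>, so elsewhere both sides are 0.\<close>
        then have z: "Poly_Mapping.lookup x U = 0" if "x \<in> carrier Heis_hecke" for x
          using that unfolding Heis_hecke_def hecke_ring_simps(1) by (auto simp: in_keys_iff)
        then show ?thesis
          by (simp add: lookup_add lookup_minus lookup_uminus hecke_term_closed theta_pow_P_carrier
              Heis_T_closed scalar_Delta(1) del: power_0 power_one_right)
      qed
    qed
    then show "eval R S \<kappa> Y g n = (((\<theta> ^^ 4) \<circ> P)
      \<oplus>\<^bsub>S\<^esub> \<kappa> q1 \<otimes>\<^bsub>S\<^esub> Y \<otimes>\<^bsub>S\<^esub> ((\<theta> ^^ 3) \<circ> P)
      \<oplus>\<^bsub>S\<^esub> \<kappa> q2 \<otimes>\<^bsub>S\<^esub> Y [^]\<^bsub>S\<^esub> (2::nat) \<otimes>\<^bsub>S\<^esub> ((\<theta> ^^ 2) \<circ> P)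
      \<oplus>\<^bsub>S\<^esub> \<kappa> q3 \<otimes>\<^bsub>S\<^esub> Y [^]\<^bsub>S\<^esub> (3::nat) \<otimes>\<^bsub>S\<^esub> (\<theta> \<circ> P)
      \<oplus>\<^bsub>S\<^esub> \<kappa> q4 \<otimes>\<^bsub>S\<^esub> Y [^]\<^bsub>S\<^esub> (4::nat) \<otimes>\<^bsub>S\<^esub> P) n"
      unfolding lhs
      using rhs1[of n] rhs2[of n] rhs3[of n] rhs4[of n] unfolding assms(16) ps_ring_simps(2)
      by (simp add: R' hecke_ring_simps(4) assms(5,6))
  qed
qed

end
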